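(* Let $d \geq 1$, let $\Phi \in C(\mathbb{R}^d) \cap L^1(\mathbb{R}^d)$ be a real-valued positive-definite function and let $H(\mathbb{R}^d)$ be the reproducing kernel Hilbert space of the translation-invariant kernel $K(x,y) = \Phi(x-y)$ on $\mathbb{R}^d$. If there is a radial Lipschitz function $\omega \colon \mathbb{R}^d \to [0,\infty)$ and a constant $c > 0$ such that $$e^{-\omega(\xi)} \leq c \cdot \mathcal{F}\Phi(\xi) \quad \text{for all } \xi \in \mathbb{R}^d$$ and $$\int_{\mathbb{R}^d} \frac{\omega(\xi)}{(1+\lVert\xi\rVert^2)^{(d+1)/2}}\, d\xi < \infty,$$ then for every closed ball $B(x,\varepsilon)$ (with $x \in \mathbb{R}^d$, $\varepsilon > 0$) there is $\psi \in H(\mathbb{R}^d)$ such that $\operatorname{supp}(\psi) \subseteq B(x,\varepsilon)$, $\psi(x) = 1$, and $\int_{\mathbb{R}^d} \psi(y)\, dy \neq 0$.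
   Context: A function $\Phi \colon \mathbb{R}^d \to \mathbb{R}$ is positive-definite if the kernel $K(x,y)=\Phi(x-y)$ is symmetric and $\sum_{i,j=1}^n c_i c_j \Phi(y_i-y_j) > 0$ for all $n$, all distinct $y_1,\ldots,y_n \in \mathbb{R}^d$ and all $(c_1,\ldots,c_n) \in \mathbb{R}^n \setminus \{0\}$. The reproducing kernel Hilbert space of $K$ is the unique Hilbert space of functions $f \colon \mathbb{R}^d \to \mathbb{R}$ containing every $K(\cdot,x)$ and satisfying $\langle f, K(\cdot,x)\rangle = f(x)$ for all $f$ and $x$. The Fourier transform is $\mathcal{F}\Phi(\xi) = (2\pi)^{-d/2}\int_{\mathbb{R}^d} \Phi(x) e^{-\mathrm{i}x\cdot\xi}\,dx$ (real and non-negative for such $\Phi$; called the spectral density). It is a known result that $H(\mathbb{R}^d) = \{ f \in C(\mathbb{R}^d) \cap L^2(\mathbb{R}^d) : \int_{\mathbb{R}^d} |\mathcal{F}f(\xi)|^2 / \mathcal{F}\Phi(\xi)\, d\xi < \infty \}$. A function $\omega$ is radial if $\omega(\xi)$ depends only on the Euclidean norm $\lVert\xi\rVert$. $B(x,\varepsilon)$ is the closed ball of radius $\varepsilon$ centered at $x$, and $\operatorname{supp}(\psi)$ is the closure of $\{\psi \neq 0\}$. *)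

theory Defs
  imports "HOL-Analysis.Analysis"
begin

definition positive_definite :: "('a::ab_group_add \<Rightarrow> real) \<Rightarrow> bool" where
  "positive_definite \<Phi> \<longleftrightarrow>
     (\<forall>x y. \<Phi> (x - y) = \<Phi> (y - x)) \<and>
     (\<forall>n y c. inj_on y {1..n::nat} \<longrightarrow> (\<exists>i\<in>{1..n}. c i \<noteq> 0) \<longrightarrow>
        (\<Sum>i=1..n. \<Sum>j=1..n. c i * c j * \<Phi> (y i - y j)) > 0)"

text \<open>
  A real Hilbert space of functions is given by its set of elements \<open>H\<close> (with the pointwise
  operations) and its inner product \<open>ip\<close>, whose values outside \<open>H\<close> are irrelevant. For a
  symmetric positive-definite kernel \<open>K\<close> such a pair exists and is unique on \<open>H\<close>
  (Moore--Aronszajn theorem), so ``the'' reproducing kernel Hilbert space of \<open>K\<close> is any pair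
  satisfying this predicate.
\<close>

locale reproducing_kernel_Hilbert_space =
  fixes K :: "'x \<Rightarrow> 'x \<Rightarrow> real"
    and H :: "('x \<Rightarrow> real) set"
    and ip :: "('x \<Rightarrow> real) \<Rightarrow> ('x \<Rightarrow> real) \<Rightarrow> real"
  assumes zero_mem: "(\<lambda>_. 0) \<in> H"
    and add_mem: "f \<in> H \<Longrightarrow> g \<in> H \<Longrightarrow> (\<lambda>x. f x + g x) \<in> H"
    and scale_mem: "f \<in> H \<Longrightarrow> (\<lambda>x. a * f x) \<in> H"
    and ip_commute: "f \<in> H \<Longrightarrow> g \<in> H \<Longrightarrow> ip f g = ip g f"
    and ip_add_left:
      "f \<in> H \<Longrightarrow> g \<in> H \<Longrightarrow> h \<in> H \<Longrightarrow> ip (\<lambda>x. f x + g x) h = ip f h + ip g h"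
    and ip_scale_left: "f \<in> H \<Longrightarrow> g \<in> H \<Longrightarrow> ip (\<lambda>x. a * f x) g = a * ip f g"
    and ip_pos: "f \<in> H \<Longrightarrow> f \<noteq> (\<lambda>_. 0) \<Longrightarrow> ip f f > 0"
    and complete:
      "(\<And>n. s n \<in> H) \<Longrightarrow>
       (\<And>e. e > 0 \<Longrightarrow>
          \<exists>N. \<forall>m\<ge>N. \<forall>n\<ge>N. sqrt (ip (\<lambda>x. s m x - s n x) (\<lambda>x. s m x - s n x)) < e) \<Longrightarrow>
       \<exists>f\<in>H. (\<lambda>n. sqrt (ip (\<lambda>x. s n x - f x) (\<lambda>x. s n x - f x))) \<longlonglongrightarrow> 0"
    and kernel_mem: "(\<lambda>y. K y x) \<in> H"
    and reproducing: "f \<in> H \<Longrightarrow> ip f (\<lambda>y. K y x) = f x"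

definition fourier :: "(real ^ 'n \<Rightarrow> real) \<Rightarrow> real ^ 'n \<Rightarrow> complex" where
  "fourier \<Phi> \<xi> =
     complex_of_real ((2 * pi) powr (- real CARD('n) / 2)) *
     (LINT x|lborel. complex_of_real (\<Phi> x) * exp (- \<i> * complex_of_real (x \<bullet> \<xi>)))"

text \<open>
  The Fourier transform of a real, even, integrable function is real-valued, so for a
  positive-definite \<open>\<Phi>\<close> taking the real part only changes the type.
\<close>

definition spectral_density :: "(real ^ 'n \<Rightarrow> real) \<Rightarrow> real ^ 'n \<Rightarrow> real" where
  "spectral_density \<Phi> \<xi> = Re (fourier \<Phi> \<xi>)"

definition radial :: "('a::real_normed_vector \<Rightarrow> 'b) \<Rightarrow> bool" where
  "radial \<omega> \<longleftrightarrow> (\<forall>\<xi> \<eta>. norm \<xi> = norm \<eta> \<longrightarrow> \<omega> \<xi> = \<omega> \<eta>)"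

definition supp :: "('a::topological_space \<Rightarrow> real) \<Rightarrow> 'a set" where
  "supp \<psi> = closure {x. \<psi> x \<noteq> 0}"

end

theory Submission
  imports Defs "HOL-Probability.Probability" "HOL-Complex_Analysis.Complex_Analysis" "HOL-Real_Asymp.Real_Asymp"
begin

text \<open>
  The function \<open>\<psi>\<close> is the Fourier transform of \<open>h \<xi> = (f (\<xi> \<bullet> \<xi>))\<^sup>2\<close>, where \<open>f\<close> is entire,
  \<open>f (z\<^sup>2)\<close> has small exponential type, and \<open>\<bar>f (x\<^sup>2)\<bar>\<close> is dominated by \<open>exp (- W x)\<close> for the
  radial profile \<open>W\<close> of \<open>\<omega>\<close>. Such an \<open>f\<close> is a Beurling--Malliavin multiplier. The
  condition on \<open>\<omega>\<close> says that \<open>\<integral>W x / (1 + x\<^sup>2) < \<infinity>\<close>. On each dyadic scale one solves an obstacle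
  problem for the Poisson average \<open>P\<close> at height one, and the sum of the solutions is an even majorant
  \<open>\<Omega>\<close> of a multiple of \<open>W\<close> near infinity with \<open>P \<Omega> - e \<le> \<Omega>\<close> and finite logarithmic integral.
  Hence \<open>\<rho> = 2 * e + \<Omega> - P \<Omega>\<close> is a positive density, and \<open>f (z\<^sup>2)\<close> is the canonical product
  with zeros at plus and minus the quantiles of \<open>\<rho>\<close>. The logarithmic potential of \<open>2 * e\<close> gives the exponential type
  and that of \<open>\<Omega> - P \<Omega>\<close> gives the decay. The sum over the zeros is compared with the integral against
  \<open>\<rho>\<close> by unimodality of the logarithmic factors on the half-line, at the cost of a polynomial factor,
  which is absorbed by deleting finitely many zeros.

  Shifting the contour in the direction of \<open>x\<close> shows that \<open>\<psi>\<close> vanishes off a small ball. Moreover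
  \<open>\<psi> 0 = \<integral>h > 0\<close>, and \<open>\<integral>\<psi>\<close> is a positive multiple of \<open>h 0 \<noteq> 0\<close> by Fourier inversion. Finally
  \<open>\<integral>h\<^sup>2 / \<F>\<Phi>\<close> is finite, so Cauchy--Schwarz on the Fourier side bounds \<open>(\<Sum>c\<^sub>x \<psi> x)\<^sup>2\<close> by a constant
  times \<open>\<Sum>c\<^sub>x c\<^sub>y \<Phi> (x - y)\<close>, and such a bound characterises membership in \<open>H\<close>.
\<close>

section \<open>Poisson averages and an obstacle problem\<close>

text \<open>The type must be arbitrarily small while the Lipschitz constant L of the weight is
  fixed. Taking \<Omega> to be a multiple of \<open>W\<close> itself fails, because nothing keeps
  its Poisson average within a small e of it, and then the density of zeros may be negative. The
  obstacle problem repairs this at the cost of a factor 1 + L / e in the integral, so the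
  logarithmic integral stays finite. Its energy argument needs integrable data; hence it is solved
  on each dyadic scale separately, and distant scales interact only through their shares of the
  logarithmic integral.

  Averages at height one replace derivatives of conjugate functions: averaging ln |z - t| moves z to
  z + i, so the logarithmic potential of \<Omega> minus its average is, up to bounded terms, minus
  the integral of \<Omega> against a nonnegative gap that is bounded below near Re z. A Lipschitz
  weight varies by at most a constant on this unit scale, so a fixed multiple of \<open>W\<close>
  below \<Omega> suffices for decay like exp (- W).\<close>

definition poisson_kernel :: "real \<Rightarrow> real \<Rightarrow> real" where
  "poisson_kernel r x = r / (pi * (r\<^sup>2 + x\<^sup>2))"

lemma poisson_kernel_nonneg: "r > 0 \<Longrightarrow> poisson_kernel r x \<ge> 0"
  by (auto simp: poisson_kernel_def)

lemma poisson_kernel_even: "poisson_kernel r (- x) = poisson_kernel r x"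
  by (simp add: poisson_kernel_def)

lemma poisson_kernel_diff_commute: "poisson_kernel r (x - y) = poisson_kernel r (y - x)"
  by (simp add: poisson_kernel_def power2_commute)

lemma poisson_kernel_1: "poisson_kernel 1 x = 1 / (pi * (1 + x\<^sup>2))"
  by (simp add: poisson_kernel_def)

lemma measurable_poisson_kernel [measurable]: "poisson_kernel r \<in> borel_measurable borel"
  unfolding poisson_kernel_def by measurable

lemma
  assumes "r > 0"
  shows integrable_poisson_kernel: "integrable lborel (poisson_kernel r)"
    and integral_poisson_kernel: "(LBINT x. poisson_kernel r x) = 1"
proof -
  have i1: "integrable lborel (\<lambda>x::real. inverse (1 + x\<^sup>2))"
    using integrable_inverse_1_plus_square by (simp add: set_integrable_def einterval_def)
  have v1: "(LBINT x::real. inverse (1 + x\<^sup>2)) = pi"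
    using LBINT_inverse_1_plus_square
    by (simp add: interval_lebesgue_integral_def set_lebesgue_integral_def einterval_def)
  have eq: "poisson_kernel r = (\<lambda>x. (1 / (pi * r)) * inverse (1 + (0 + (1/r) * x)\<^sup>2))"
    using assms by (auto simp: poisson_kernel_def fun_eq_iff field_simps power2_eq_square)
  have i2: "integrable lborel (\<lambda>x::real. inverse (1 + (0 + (1/r) * x)\<^sup>2))"
    using assms by (intro lborel_integrable_real_affine[OF i1]) auto
  show "integrable lborel (poisson_kernel r)"
    unfolding eq by (intro integrable_mult_right i2)
  have "pi = \<bar>1/r\<bar> *\<^sub>R (LBINT x::real. inverse (1 + (0 + (1/r) * x)\<^sup>2))"
    using assms by (subst lborel_integral_real_affine[symmetric]) (auto simp: v1)
  then have "(LBINT x::real. inverse (1 + (0 + (1/r) * x)\<^sup>2)) = pi * r"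
    using assms by (auto simp: field_simps)
  then show "(LBINT x. poisson_kernel r x) = 1"
    unfolding eq by (subst integral_mult_right_zero) (use assms in auto)
qed

lemma
  assumes "r > 0"
  shows integrable_poisson_kernel_shift: "integrable lborel (\<lambda>y. poisson_kernel r (x - y))"
    and integral_poisson_kernel_shift: "(LBINT y. poisson_kernel r (x - y)) = 1"
proof -
  show "integrable lborel (\<lambda>y. poisson_kernel r (x - y))"
    using lborel_integrable_real_affine[OF integrable_poisson_kernel[OF assms], of "-1" x] by simp
  show "(LBINT y. poisson_kernel r (x - y)) = 1"
    using lborel_integral_real_affine[of "-1" "poisson_kernel r" x] integral_poisson_kernel[OF assms] by simp
qed

lemma poisson_kernel_1_le_1: "poisson_kernel 1 x \<le> 1"
proof -
  have "1 * 1 \<le> pi * (1 + x\<^sup>2)" by (intro mult_mono) (use pi_ge_two in auto)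
  then show ?thesis by (simp add: poisson_kernel_1)
qed

section \<open>The averaging operator at height one and its quadratic form\<close>

definition poisson :: "(real \<Rightarrow> real) \<Rightarrow> real \<Rightarrow> real" where
  "poisson f x = (LBINT y. poisson_kernel 1 (x - y) * f y)"

lemma measurable_poisson [measurable (raw)]:
  assumes [measurable]: "f \<in> borel_measurable borel"
  shows "poisson f \<in> borel_measurable borel"
  unfolding poisson_def by measurable

lemma poisson_mono:
  assumes "integrable lborel (\<lambda>y. poisson_kernel 1 (x - y) * f y)"
    and "integrable lborel (\<lambda>y. poisson_kernel 1 (x - y) * g y)"
    and "\<And>y. f y \<le> g y"
  shows "poisson f x \<le> poisson g x"
  unfolding poisson_def using assms
  by (intro integral_mono mult_left_mono) (auto simp: poisson_kernel_nonneg)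

lemma integrable_poisson_kernel_mult:
  assumes "integrable lborel f"
  shows "integrable lborel (\<lambda>y. poisson_kernel 1 (x - y) * f y)"
proof (rule Bochner_Integration.integrable_bound[OF assms])
  show "AE y in lborel. norm (poisson_kernel 1 (x - y) * f y) \<le> norm (f y)"
    using mult_right_mono[OF poisson_kernel_1_le_1 abs_ge_zero]
    by (auto simp: abs_mult poisson_kernel_nonneg)
qed (use assms in measurable)

lemma integrable_cpt_support:
  fixes f :: "real \<Rightarrow> real"
  assumes [measurable]: "f \<in> borel_measurable borel"
    and "\<And>x. \<bar>f x\<bar> \<le> M" and "\<And>x. x \<notin> {a..b} \<Longrightarrow> f x = 0"
  shows "integrable lborel f"
proof (rule Bochner_Integration.integrable_bound)
  show "integrable lborel (\<lambda>x. M * indicator {a..b} x)"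
    by (intro integrable_mult_right integrable_real_indicator)
       (auto simp: emeasure_lborel_Icc_eq)
  show "AE x in lborel. norm (f x) \<le> norm (M * indicator {a..b} x)"
  proof (intro AE_I2)
    fix x show "norm (f x) \<le> norm (M * indicator {a..b} x)"
      using assms(2)[of x] assms(3)[of x] by (auto simp: indicator_def)
  qed
qed auto

lemma integrable_poisson_pair:
  assumes "integrable lborel f" "integrable lborel g"
  shows "integrable (lborel \<Otimes>\<^sub>M lborel) (\<lambda>(x, y). poisson_kernel 1 (x - y) * (f x * g y))"
proof (rule Bochner_Integration.integrable_bound)
  have m[measurable]: "f \<in> borel_measurable borel" "g \<in> borel_measurable borel"
    using assms by auto
  show "integrable (lborel \<Otimes>\<^sub>M lborel) (\<lambda>(x, y). f x * g y)"
  proof (rule lborel_pair.Fubini_integrable)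
    show "integrable lborel (\<lambda>x. LBINT y. norm (case (x, y) of (x, y) \<Rightarrow> f x * g y))"
      using assms by (auto simp: abs_mult)
  qed (use assms in auto)
  show "AE p in lborel \<Otimes>\<^sub>M lborel. norm (case p of (x, y) \<Rightarrow> poisson_kernel 1 (x - y) * (f x * g y))
        \<le> norm (case p of (x, y) \<Rightarrow> f x * g y)"
    by (intro AE_I2) (auto simp: abs_mult poisson_kernel_nonneg split: prod.splits
        intro: order_trans[OF mult_right_mono[OF poisson_kernel_1_le_1]])
  show "(\<lambda>(x, y). poisson_kernel 1 (x - y) * (f x * g y)) \<in> borel_measurable (lborel \<Otimes>\<^sub>M lborel)"
    by measurable
qed

lemma
  assumes "integrable lborel f" "integrable lborel g"
  shows integrable_mult_poisson: "integrable lborel (\<lambda>x. f x * poisson g x)"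
    and integral_mult_poisson: "(LBINT x. f x * poisson g x)
      = (LINT (x, y)|(lborel \<Otimes>\<^sub>M lborel). poisson_kernel 1 (x - y) * (f x * g y))"
proof -
  have eq: "(LBINT y. poisson_kernel 1 (x - y) * (f x * g y)) = f x * poisson g x" for x
    unfolding poisson_def
    by (subst integral_mult_right_zero[symmetric]) (simp add: mult_ac)
  show "integrable lborel (\<lambda>x. f x * poisson g x)"
    using lborel_pair.integrable_fst[OF integrable_poisson_pair[OF assms]] by (simp add: eq)
  show "(LBINT x. f x * poisson g x)
      = (LINT (x, y)|(lborel \<Otimes>\<^sub>M lborel). poisson_kernel 1 (x - y) * (f x * g y))"
    using lborel_pair.integral_fst'[OF integrable_poisson_pair[OF assms]] by (simp add: eq)
qed

lemma integral_mult_poisson_commute: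
  assumes "integrable lborel f" "integrable lborel g"
  shows "(LBINT x. f x * poisson g x) = (LBINT x. g x * poisson f x)"
proof -
  have "(LINT (x, y)|(lborel \<Otimes>\<^sub>M lborel). poisson_kernel 1 (x - y) * (f x * g y))
     = (LINT (x, y)|(lborel \<Otimes>\<^sub>M lborel). (\<lambda>(x, y). poisson_kernel 1 (x - y) * (f x * g y)) (y, x))"
    using integrable_poisson_pair[OF assms]
    by (subst lborel_pair.integral_product_swap) (auto simp: case_prod_unfold)
  then show ?thesis
    by (simp add: integral_mult_poisson assms poisson_kernel_diff_commute mult_ac)
qed

lemma
  fixes f :: "real \<Rightarrow> real"
  assumes f: "integrable lborel f"
  shows integrable_poisson_pair_fst:
      "integrable (lborel \<Otimes>\<^sub>M lborel) (\<lambda>(x, y). poisson_kernel 1 (x - y) * f x)"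
    and integral_poisson_pair_fst:
      "(LINT (x, y)|(lborel \<Otimes>\<^sub>M lborel). poisson_kernel 1 (x - y) * f x) = (LBINT x. f x)"
    and integrable_poisson_pair_snd:
      "integrable (lborel \<Otimes>\<^sub>M lborel) (\<lambda>(x, y). poisson_kernel 1 (x - y) * f y)"
    and integral_poisson_pair_snd:
      "(LINT (x, y)|(lborel \<Otimes>\<^sub>M lborel). poisson_kernel 1 (x - y) * f y) = (LBINT x. f x)"
proof -
  have m[measurable]: "f \<in> borel_measurable borel" using f by auto
  show i: "integrable (lborel \<Otimes>\<^sub>M lborel) (\<lambda>(x, y). poisson_kernel 1 (x - y) * f x)"
  proof (rule lborel_pair.Fubini_integrable)
    show "integrable lborel (\<lambda>x. LBINT y. norm (case (x, y) of (x, y) \<Rightarrow> poisson_kernel 1 (x - y) * f x))"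
      using f by (auto simp: abs_mult integral_poisson_kernel_shift poisson_kernel_nonneg)
  qed (auto intro!: integrable_mult_left integrable_poisson_kernel_shift)
  show e: "(LINT (x, y)|(lborel \<Otimes>\<^sub>M lborel). poisson_kernel 1 (x - y) * f x) = (LBINT x. f x)"
    using lborel_pair.integral_fst'[OF i] by (simp add: integral_poisson_kernel_shift)
  have s: "(\<lambda>(x, y). poisson_kernel 1 (x - y) * f y)
      = (\<lambda>(x, y). (case (y, x) of (x, y) \<Rightarrow> poisson_kernel 1 (x - y) * f x))"
    by (auto simp: fun_eq_iff poisson_kernel_diff_commute)
  show "integrable (lborel \<Otimes>\<^sub>M lborel) (\<lambda>(x, y). poisson_kernel 1 (x - y) * f y)"
    unfolding s lborel_pair.integrable_product_swap_iff by (rule i)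
  show "(LINT (x, y)|(lborel \<Otimes>\<^sub>M lborel). poisson_kernel 1 (x - y) * f y) = (LBINT x. f x)"
    unfolding s by (subst lborel_pair.integral_product_swap) (use e i in auto)
qed

text \<open>Expanding the square leaves two diagonal terms and a cross term. The kernel is symmetric
  of mass one, so each diagonal term integrates to the integral of \<open>f\<close> squared.
  Identity minus average is thus a Dirichlet form, which gives positivity and local estimates at
  once.\<close>

lemma
  assumes f: "integrable lborel f" and f2: "integrable lborel (\<lambda>x. (f x)\<^sup>2)"
  shows integrable_poisson_energy:
      "integrable (lborel \<Otimes>\<^sub>M lborel) (\<lambda>(x, y). poisson_kernel 1 (x - y) * (f x - f y)\<^sup>2)"
    and integral_poisson_energy:
      "(LBINT x. (f x)\<^sup>2) - (LBINT x. f x * poisson f x)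
        = (LINT (x, y)|(lborel \<Otimes>\<^sub>M lborel). poisson_kernel 1 (x - y) * (f x - f y)\<^sup>2) / 2"
proof -
  define A where "A = (\<lambda>(x, y). poisson_kernel 1 (x - y) * (f x)\<^sup>2)"
  define B where "B = (\<lambda>(x, y). poisson_kernel 1 (x - y) * (f y)\<^sup>2)"
  define C where "C = (\<lambda>(x, y). poisson_kernel 1 (x - y) * (f x * f y))"
  have eq: "(\<lambda>(x, y). poisson_kernel 1 (x - y) * (f x - f y)\<^sup>2) = (\<lambda>p. A p + B p - 2 * C p)"
    by (auto simp: A_def B_def C_def fun_eq_iff power2_eq_square algebra_simps)
  have i: "integrable (lborel \<Otimes>\<^sub>M lborel) A" "integrable (lborel \<Otimes>\<^sub>M lborel) B"
    "integrable (lborel \<Otimes>\<^sub>M lborel) C"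
    unfolding A_def B_def C_def
    using f f2 integrable_poisson_pair integrable_poisson_pair_fst integrable_poisson_pair_snd by auto
  have v: "integral\<^sup>L (lborel \<Otimes>\<^sub>M lborel) A = (LBINT x. (f x)\<^sup>2)"
    "integral\<^sup>L (lborel \<Otimes>\<^sub>M lborel) B = (LBINT x. (f x)\<^sup>2)"
    "integral\<^sup>L (lborel \<Otimes>\<^sub>M lborel) C = (LBINT x. f x * poisson f x)"
    unfolding A_def B_def C_def
    using f f2 integral_mult_poisson integral_poisson_pair_fst integral_poisson_pair_snd by auto
  show "integrable (lborel \<Otimes>\<^sub>M lborel) (\<lambda>(x, y). poisson_kernel 1 (x - y) * (f x - f y)\<^sup>2)"
    unfolding eq using i by auto
  show "(LBINT x. (f x)\<^sup>2) - (LBINT x. f x * poisson f x)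
        = (LINT (x, y)|(lborel \<Otimes>\<^sub>M lborel). poisson_kernel 1 (x - y) * (f x - f y)\<^sup>2) / 2"
    unfolding eq using i by (simp add: v)
qed

lemma integral_mult_poisson_self_le:
  assumes f: "integrable lborel f" and f2: "integrable lborel (\<lambda>x. (f x)\<^sup>2)"
  shows "(LBINT x. f x * poisson f x) \<le> (LBINT x. (f x)\<^sup>2)"
proof -
  have "0 \<le> (LINT (x, y)|(lborel \<Otimes>\<^sub>M lborel). poisson_kernel 1 (x - y) * (f x - f y)\<^sup>2)"
    by (intro integral_nonneg_AE AE_I2) (auto simp: poisson_kernel_nonneg)
  then show ?thesis using integral_poisson_energy[OF assms] by simp
qed

text \<open>If a >= b >= 0, then (a - b)^2 is at most a^2 and at most (L h)^2, hence at most 2 a^2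
  (L h)^2 / (a^2 + (L h)^2). Dividing by 1 + h^2 disposes of h^2, and what remains is a multiple of
  the Poisson kernel of height a / L. Its mass is one, so integrating over h leaves a bound linear
  in a.\<close>

lemma poisson_energy_pointwise:
  assumes "a \<ge> 0" "b \<ge> 0" "L > 0" "\<bar>a - b\<bar> \<le> L * \<bar>h\<bar>"
  shows "poisson_kernel 1 h * (a - b)\<^sup>2
    \<le> 2 * L * (a * poisson_kernel (a / L) h) + 2 * L * (b * poisson_kernel (b / L) h)"
proof -
  have *: "poisson_kernel 1 h * (a - b)\<^sup>2 \<le> 2 * L * (a * poisson_kernel (a / L) h)"
    if "a \<ge> b" "b \<ge> 0" "\<bar>a - b\<bar> \<le> L * \<bar>h\<bar>" for a b
  proof (cases "a = b")
    case True
    then show ?thesis using that assms(3) by (cases "a = 0") (auto simp: poisson_kernel_def)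
  next
    case False
    then have h: "h \<noteq> 0" using that by auto
    have a: "a > 0" using that False by auto
    have "(a - b)\<^sup>2 \<le> (L * h)\<^sup>2" using that by (metis abs_le_square_iff abs_mult abs_of_pos assms(3))
    then have 1: "(a - b)\<^sup>2 * a\<^sup>2 \<le> (L * h)\<^sup>2 * a\<^sup>2" by (intro mult_right_mono) auto
    have "(a - b)\<^sup>2 \<le> a\<^sup>2" using that by (intro power_mono) auto
    then have 2: "(a - b)\<^sup>2 * (L * h)\<^sup>2 \<le> a\<^sup>2 * (L * h)\<^sup>2" by (intro mult_right_mono) auto
    have pos: "(a\<^sup>2 + (L * h)\<^sup>2) > 0" using a by (simp add: add_pos_nonneg)
    have "(a - b)\<^sup>2 * (a\<^sup>2 + (L * h)\<^sup>2) \<le> 2 * a\<^sup>2 * L\<^sup>2 * h\<^sup>2"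
      using 1 2 by (simp add: algebra_simps power_mult_distrib)
    also have "\<dots> \<le> 2 * a\<^sup>2 * L\<^sup>2 * (1 + h\<^sup>2)" by (intro mult_left_mono) auto
    finally have "(a - b)\<^sup>2 / (1 + h\<^sup>2) \<le> 2 * a\<^sup>2 * L\<^sup>2 / (a\<^sup>2 + (L * h)\<^sup>2)"
      using pos by (simp add: divide_simps add_pos_nonneg mult_ac)
    moreover have "2 * L * (a * poisson_kernel (a / L) h) = 2 * a\<^sup>2 * L\<^sup>2 / (a\<^sup>2 + (L * h)\<^sup>2) / pi"
      using a assms(3) pos by (simp add: poisson_kernel_def divide_simps) (simp add: power2_eq_square algebra_simps)
    moreover have "poisson_kernel 1 h * (a - b)\<^sup>2 = (a - b)\<^sup>2 / (1 + h\<^sup>2) / pi"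
      by (simp add: poisson_kernel_1)
    ultimately show ?thesis by (simp only:) (intro divide_right_mono, auto)
  qed
  have nn: "0 \<le> 2 * L * (a * poisson_kernel (a / L) h)" if "a \<ge> 0" for a
    using that assms(3) by (auto simp: poisson_kernel_def)
  show ?thesis
  proof (cases "a \<ge> b")
    case True
    then show ?thesis using *[of b a] nn[of b] assms by linarith
  next
    case False
    then show ?thesis using *[of a b] nn[of a] assms by (simp add: power2_commute abs_minus_commute)
  qed
qed

text \<open>The height of each majorant depends on one variable only, so integrating out the other
  leaves 2 L times the integral of \<open>w\<close>, and the form is half of the double integral.
  The bound is linear in \<open>w\<close> although the form is quadratic; this lets the obstacle
  problem compare an integral with an integral.\<close>

lemma poisson_energy_lipschitz_le:
  fixes w :: "real \<Rightarrow> real"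
  assumes w: "integrable lborel w" and w2: "integrable lborel (\<lambda>x. (w x)\<^sup>2)"
    and nn: "\<And>x. w x \<ge> 0" and L: "L > 0" and lip: "\<And>x y. \<bar>w x - w y\<bar> \<le> L * \<bar>x - y\<bar>"
  shows "(LBINT x. (w x)\<^sup>2) - (LBINT x. w x * poisson w x) \<le> 2 * L * (LBINT x. w x)"
proof -
  have m[measurable]: "w \<in> borel_measurable borel" using w by auto
  define A where "A = (\<lambda>(x, y). 2 * L * (w x * poisson_kernel (w x / L) (x - y)))"
  define B where "B = (\<lambda>(x, y). 2 * L * (w y * poisson_kernel (w y / L) (x - y)))"
  \<comment> \<open>The case \<open>w x = 0\<close> is separate: a kernel of height zero has no
    mass, but the factor \<open>w x\<close> removes the term.\<close>
  have int1: "(LBINT y. 2 * L * (w x * poisson_kernel (w x / L) (x - y))) = 2 * L * w x"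
    and int2: "integrable lborel (\<lambda>y. 2 * L * (w x * poisson_kernel (w x / L) (x - y)))" for x
    using nn[of x] L integral_poisson_kernel_shift[of "w x / L" x] integrable_poisson_kernel_shift[of "w x / L" x]
    by (cases "w x = 0"; auto)+
  have [measurable]: "A \<in> borel_measurable (lborel \<Otimes>\<^sub>M lborel)"
    unfolding A_def poisson_kernel_def by measurable
  have nnA: "A p \<ge> 0" for p
    using L nn by (auto simp: A_def poisson_kernel_def split: prod.splits)
  have iA: "integrable (lborel \<Otimes>\<^sub>M lborel) A"
  proof (rule lborel_pair.Fubini_integrable)
    have "(LBINT y. norm (A (x, y))) = (LBINT y. A (x, y))" for x
      using nnA by (intro Bochner_Integration.integral_cong) auto
    then have "(LBINT y. norm (A (x, y))) = 2 * L * w x" for x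
      using int1[of x] by (simp add: A_def)
    then show "integrable lborel (\<lambda>x. LBINT y. norm (A (x, y)))"
      using w by simp
    show "AE x in lborel. integrable lborel (\<lambda>y. A (x, y))"
      using int2 by (simp add: A_def)
  qed measurable
  have vA: "integral\<^sup>L (lborel \<Otimes>\<^sub>M lborel) A = 2 * L * (LBINT x. w x)"
  proof -
    have "(LBINT y. A (x, y)) = 2 * L * w x" for x
      using int1[of x] by (simp add: A_def)
    then show ?thesis
      using lborel_pair.integral_fst'[OF iA] by simp
  qed
  have s: "B = (\<lambda>(x, y). A (y, x))"
    by (auto simp: A_def B_def poisson_kernel_diff_commute)
  have iB: "integrable (lborel \<Otimes>\<^sub>M lborel) B"
    unfolding s lborel_pair.integrable_product_swap_iff by (rule iA)
  have vB: "integral\<^sup>L (lborel \<Otimes>\<^sub>M lborel) B = 2 * L * (LBINT x. w x)"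
    unfolding s by (subst lborel_pair.integral_product_swap) (use vA in auto)
  have "(LINT (x, y)|(lborel \<Otimes>\<^sub>M lborel). poisson_kernel 1 (x - y) * (w x - w y)\<^sup>2)
    \<le> (LINT p|(lborel \<Otimes>\<^sub>M lborel). A p + B p)"
    using poisson_energy_pointwise[OF nn nn L lip] integrable_poisson_energy[OF w w2] iA iB
    by (intro integral_mono) (auto simp: A_def B_def)
  also have "\<dots> = 4 * L * (LBINT x. w x)"
    using iA iB by (simp add: vA vB)
  finally show ?thesis using integral_poisson_energy[OF w w2] by simp
qed

text \<open>\<open>\<Theta>\<close> is the least solution of \<open>\<Theta> x = max (w x) (poisson \<Theta> x - e)\<close>. Integrating the resulting
  complementarity relation and using that the quadratic form \<open>\<integral>f (f - poisson f)\<close> is nonnegative at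
  \<open>\<Theta> - w\<close> bounds \<open>\<integral>\<Theta>\<close> by the energy of \<open>w\<close>, which the Lipschitz condition controls.\<close>

lemma obstacle_problem:
  fixes w B :: "real \<Rightarrow> real"
  assumes B [measurable]: "B \<in> borel_measurable borel"
    and bound: "\<And>x. \<bar>B x\<bar> \<le> M" and supp: "\<And>x. x \<notin> {a..b} \<Longrightarrow> B x = 0"
    and nn: "\<And>x. w x \<ge> 0" and wB: "\<And>x. w x \<le> B x"
    and L: "L > 0" and lip: "\<And>x y. \<bar>w x - w y\<bar> \<le> L * \<bar>x - y\<bar>"
    and e: "e > 0" and super: "\<And>x. poisson B x - e \<le> B x"
  obtains \<Theta> where "\<Theta> \<in> borel_measurable borel" "\<And>x. w x \<le> \<Theta> x" "\<And>x. \<Theta> x \<le> B x"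
    "\<And>x. poisson \<Theta> x - e \<le> \<Theta> x" "(LBINT x. \<Theta> x) \<le> (1 + L / e) * (LBINT x. w x)"
proof -
  have [measurable]: "w \<in> borel_measurable borel"
  proof (rule borel_measurable_continuous_onI, rule continuous_at_imp_continuous_on, rule ballI)
    fix x have "(\<lambda>y. L * \<bar>y - x\<bar>) \<midarrow>x\<rightarrow> L * \<bar>x - x\<bar>" by (intro tendsto_intros)
    then have "(\<lambda>y. L * \<bar>y - x\<bar>) \<midarrow>x\<rightarrow> 0" by simp
    then have "((\<lambda>y. w y - w x) \<longlongrightarrow> 0) (at x)"
      by (rule Lim_null_comparison[rotated]) (use lip in auto)
    then show "isCont w x" by (simp add: isCont_def LIM_zero_iff)
  qed
  \<comment> \<open>Monotone iteration from \<open>w\<close>. As \<open>w\<close> and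
    \<open>poisson B - e\<close> both lie below \<open>B\<close>, every iterate stays below
    \<open>B\<close>, which bounds the sequence and dominates its Poisson averages.\<close>
  define T where "T i = ((\<lambda>f x. max (w x) (poisson f x - e)) ^^ i) w" for i
  have T0: "T 0 = w" and TS: "T (Suc i) = (\<lambda>x. max (w x) (poisson (T i) x - e))" for i
    by (auto simp: T_def)
  have Tm[measurable]: "T i \<in> borel_measurable borel" for i
    by (induction i) (auto simp: T0 TS)
  have iI: "integrable lborel f" if [measurable]: "f \<in> borel_measurable borel"
    and "\<And>x. 0 \<le> f x" "\<And>x. f x \<le> B x" for f
  proof (rule integrable_cpt_support[where M=M and a=a and b=b])
    show "\<bar>f x\<bar> \<le> M" for x using that(2,3)[of x] bound[of x] by linarith
    show "f x = 0" if "x \<notin> {a..b}" for x using \<open>0 \<le> f x\<close> \<open>f x \<le> B x\<close> supp[OF that] by simp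
  qed fact
  have iB: "integrable lborel B"
    using bound supp by (intro integrable_cpt_support[where M=M and a=a and b=b]) auto
  have wT: "w x \<le> T i x" for i x by (cases i) (auto simp: T0 TS)
  have TB: "T i x \<le> B x" for i x
  proof (induction i arbitrary: x)
    case (Suc i)
    have "integrable lborel (T i)" using Suc wT nn order_trans by (intro iI) (auto, blast)
    then have "poisson (T i) x \<le> poisson B x"
      using Suc by (intro poisson_mono integrable_poisson_kernel_mult iB)
    then show ?case using super[of x] wB[of x] by (simp add: TS)
  qed (auto simp: T0 wB)
  have iT: "integrable lborel (T i)" for i
    using TB wT nn order_trans by (intro iI) (auto, blast)
  have Tinc: "T i x \<le> T (Suc i) x" for i x
  proof (induction i arbitrary: x)
    case (Suc i)
    have "poisson (T i) x \<le> poisson (T (Suc i)) x"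
      using Suc by (intro poisson_mono integrable_poisson_kernel_mult iT)
    then have "max (w x) (poisson (T i) x - e) \<le> max (w x) (poisson (T (Suc i)) x - e)"
      by (intro max.mono) auto
    then show ?case by (simp add: TS[of "Suc i"] TS[of i])
  qed (auto simp: T0 TS)
  define \<Theta> where "\<Theta> x = lim (\<lambda>i. T i x)" for x
  have lim: "(\<lambda>i. T i x) \<longlonglongrightarrow> \<Theta> x" for x
  proof -
    have "incseq (\<lambda>i. T i x)" using Tinc by (intro incseq_SucI)
    then have "convergent (\<lambda>i. T i x)"
      using TB by (metis incseq_convergent convergentI)
    then show ?thesis by (simp add: \<Theta>_def convergent_LIMSEQ_iff)
  qed
  have m[measurable]: "\<Theta> \<in> borel_measurable borel"
    using lim by (rule borel_measurable_LIMSEQ_real) simp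
  have w\<Theta>: "w x \<le> \<Theta> x" for x by (rule LIMSEQ_le_const[OF lim]) (use wT in auto)
  have \<Theta>B: "\<Theta> x \<le> B x" for x by (rule LIMSEQ_le_const2[OF lim]) (use TB in auto)
  have i\<Theta>: "integrable lborel \<Theta>" using \<Theta>B w\<Theta> nn order_trans by (intro iI) (auto, blast)
  have Plim: "(\<lambda>i. poisson (T i) x) \<longlonglongrightarrow> poisson \<Theta> x" for x
    unfolding poisson_def
  proof (rule integral_dominated_convergence)
    show "integrable lborel (\<lambda>y. poisson_kernel 1 (x - y) * B y)"
      by (intro integrable_poisson_kernel_mult iB)
    show "AE y in lborel. (\<lambda>i. poisson_kernel 1 (x - y) * T i y) \<longlonglongrightarrow> poisson_kernel 1 (x - y) * \<Theta> y"
      by (intro AE_I2 tendsto_intros lim)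
    show "AE y in lborel. norm (poisson_kernel 1 (x - y) * T i y) \<le> poisson_kernel 1 (x - y) * B y" for i
    proof (intro AE_I2)
      fix y have "0 \<le> T i y" using wT nn order_trans by blast
      then show "norm (poisson_kernel 1 (x - y) * T i y) \<le> poisson_kernel 1 (x - y) * B y"
        using TB[of i y] by (auto simp: abs_mult poisson_kernel_nonneg intro!: mult_left_mono)
    qed
  qed measurable
  have fix_eq: "\<Theta> x = max (w x) (poisson \<Theta> x - e)" for x
  proof (rule LIMSEQ_unique)
    show "(\<lambda>i. T (Suc i) x) \<longlonglongrightarrow> \<Theta> x" by (rule LIMSEQ_Suc[OF lim])
    show "(\<lambda>i. T (Suc i) x) \<longlonglongrightarrow> max (w x) (poisson \<Theta> x - e)"
      unfolding TS by (intro tendsto_intros Plim)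
  qed
  have i2: "integrable lborel (\<lambda>x. f x * g x)"
    if [measurable]: "f \<in> borel_measurable borel" "g \<in> borel_measurable borel"
      and "\<And>x. 0 \<le> f x" "\<And>x. f x \<le> B x" "\<And>x. 0 \<le> g x" "\<And>x. g x \<le> B x" for f g
  proof (rule integrable_cpt_support[where M="M * M" and a=a and b=b])
    show "\<bar>f x * g x\<bar> \<le> M * M" for x
      using that(3-6)[of x] bound[of x] unfolding abs_mult by (intro mult_mono) auto
    show "f x * g x = 0" if "x \<notin> {a..b}" for x using \<open>0 \<le> f x\<close> \<open>f x \<le> B x\<close> supp[OF that] by simp
  qed measurable
  have nn\<Theta>: "0 \<le> \<Theta> x" for x using w\<Theta> nn order_trans by blast
  define I where "I = (LBINT x. \<Theta> x)"
  define J where "J = (LBINT x. w x)"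
  have iw: "integrable lborel w" using wB nn by (intro iI) auto
  have iww: "integrable lborel (\<lambda>x. (w x)\<^sup>2)"
    unfolding power2_eq_square by (rule i2) (use nn wB in auto)
  have i\<Theta>\<Theta>: "integrable lborel (\<lambda>x. (\<Theta> x)\<^sup>2)"
    unfolding power2_eq_square by (rule i2) (use nn\<Theta> \<Theta>B in auto)
  have iw\<Theta>: "integrable lborel (\<lambda>x. w x * \<Theta> x)"
    by (rule i2) (use nn nn\<Theta> wB \<Theta>B in auto)
  note ip = integrable_mult_poisson[OF i\<Theta> i\<Theta>] integrable_mult_poisson[OF iw i\<Theta>]
    integrable_mult_poisson[OF i\<Theta> iw] integrable_mult_poisson[OF iw iw]
  have "(\<Theta> x)\<^sup>2 - \<Theta> x * poisson \<Theta> x + e * \<Theta> x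
      - w x * \<Theta> x + w x * poisson \<Theta> x - e * w x = 0" for x
  proof -
    have "(\<Theta> x - w x) * (\<Theta> x - (poisson \<Theta> x - e)) = 0"
      using fix_eq[of x] by (auto simp: max_def split: if_splits)
    then show ?thesis by (simp add: power2_eq_square algebra_simps)
  qed
  then have "(LBINT x. (\<Theta> x)\<^sup>2 - \<Theta> x * poisson \<Theta> x + e * \<Theta> x
      - w x * \<Theta> x + w x * poisson \<Theta> x - e * w x) = 0" by simp
  then have E: "(LBINT x. (\<Theta> x)\<^sup>2) - (LBINT x. \<Theta> x * poisson \<Theta> x) + e * I
     - (LBINT x. w x * \<Theta> x) + (LBINT x. w x * poisson \<Theta> x) - e * J = 0"
    using i\<Theta> iw iww i\<Theta>\<Theta> iw\<Theta> ip by (simp add: I_def J_def)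
  have id: "integrable lborel (\<lambda>x. \<Theta> x - w x)" using i\<Theta> iw by simp
  have eq2: "(\<lambda>x. (\<Theta> x - w x)\<^sup>2) = (\<lambda>x. (\<Theta> x)\<^sup>2 + (w x)\<^sup>2 - 2 * (w x * \<Theta> x))"
    by (auto simp: fun_eq_iff power2_eq_square algebra_simps)
  have pd: "poisson (\<lambda>x. \<Theta> x - w x) x = poisson \<Theta> x - poisson w x" for x
    unfolding poisson_def using integrable_poisson_kernel_mult[OF i\<Theta>] integrable_poisson_kernel_mult[OF iw]
    by (subst Bochner_Integration.integral_diff[symmetric]) (auto simp: algebra_simps)
  have id2: "integrable lborel (\<lambda>x. (\<Theta> x - w x)\<^sup>2)"
    unfolding eq2 using i\<Theta>\<Theta> iww iw\<Theta> by auto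
  have "(LBINT x. (\<Theta> x - w x) * poisson (\<lambda>x. \<Theta> x - w x) x)
      = (LBINT x. \<Theta> x * poisson \<Theta> x - \<Theta> x * poisson w x - w x * poisson \<Theta> x + w x * poisson w x)"
    by (intro Bochner_Integration.integral_cong) (auto simp: pd algebra_simps)
  also have "\<dots> = (LBINT x. \<Theta> x * poisson \<Theta> x) - 2 * (LBINT x. w x * poisson \<Theta> x) + (LBINT x. w x * poisson w x)"
    using ip integral_mult_poisson_commute[OF i\<Theta> iw] by simp
  finally have "(LBINT x. \<Theta> x * poisson \<Theta> x) - 2 * (LBINT x. w x * poisson \<Theta> x) + (LBINT x. w x * poisson w x)
      \<le> (LBINT x. (\<Theta> x)\<^sup>2) + (LBINT x. (w x)\<^sup>2) - 2 * (LBINT x. w x * \<Theta> x)"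
    using integral_mult_poisson_self_le[OF id id2] i\<Theta>\<Theta> iww iw\<Theta> by (simp add: eq2)
  moreover have "(LBINT x. (w x)\<^sup>2) - (LBINT x. w x * poisson w x) \<le> 2 * L * J"
    unfolding J_def by (rule poisson_energy_lipschitz_le[OF iw iww nn L lip])
  moreover have "(LBINT x. \<Theta> x * poisson \<Theta> x) \<le> (LBINT x. (\<Theta> x)\<^sup>2)"
    by (rule integral_mult_poisson_self_le[OF i\<Theta> i\<Theta>\<Theta>])
  \<comment> \<open>Write Q for the form f (f - poisson f) integrated and b for its bilinear form.
    Then \<open>E\<close> reads Q(\<Theta>) - b(w, \<Theta>) + e (I - J) = 0, and Q(\<Theta> - w) >=
    0 gives b(w, \<Theta>) <= (Q(\<Theta>) + Q(w)) / 2. Hence e (I - J) <= (Q(w) - Q(\<Theta>)) / 2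
    <= Q(w) / 2 <= L J.\<close>
  ultimately have "e * I \<le> (e + L) * J" using E by (simp add: algebra_simps)
  then have "I \<le> (1 + L / e) * J" using e by (simp add: field_simps)
  moreover have "poisson \<Theta> x - e \<le> \<Theta> x" for x using fix_eq[of x] by simp
  ultimately show thesis using that[OF m w\<Theta> \<Theta>B] by (simp add: I_def J_def)
qed

section \<open>Dyadic majorants\<close>

text \<open>A supersolution needs only an upper bound on second differences. The kink at the centre
  is concave and lowers them; squaring smooths the convex kinks at the two ends.\<close>

definition quad_bump :: "real \<Rightarrow> real \<Rightarrow> real \<Rightarrow> real" where
  "quad_bump c r x = (max 0 (1 - \<bar>(x - c) / r\<bar>))\<^sup>2"

lemma measurable_quad_bump [measurable]: "quad_bump c r \<in> borel_measurable borel"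
  unfolding quad_bump_def by measurable

lemma quad_bump_bounds: "0 \<le> quad_bump c r x" "quad_bump c r x \<le> 1"
  unfolding quad_bump_def by (auto intro!: power_le_one)

lemma quad_bump_eq_0: "r > 0 \<Longrightarrow> x \<notin> {c - r..c + r} \<Longrightarrow> quad_bump c r x = 0"
  unfolding quad_bump_def by (auto simp: field_simps abs_if)

lemma quad_bump_second_difference:
  assumes "r > 0"
  shows "quad_bump c r (x + h) + quad_bump c r (x - h) - 2 * quad_bump c r x \<le> 2 * (h / r)\<^sup>2"
proof -
  define p where "p t = (max 0 (1 - t))\<^sup>2" for t :: real
  have mono: "p s \<le> p t" if "t \<le> s" for s t
    unfolding p_def using that by (intro power_mono) auto
  have pp: "p (t + k) + p (t - k) - 2 * p t \<le> 2 * k\<^sup>2" for t k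
  proof -
    have *: "(max 0 (v + k))\<^sup>2 + (max 0 (v - k))\<^sup>2 - 2 * (max 0 v)\<^sup>2 \<le> 2 * k\<^sup>2" for v :: real
    proof -
      have 1: "(max 0 (v + k))\<^sup>2 \<le> (max 0 v)\<^sup>2 + 2 * max 0 v * k + k\<^sup>2" for v k :: real
      proof (cases "v \<ge> 0")
        case True
        have "(max 0 (v + k))\<^sup>2 \<le> (v + k)\<^sup>2" by (simp add: max_def)
        then show ?thesis using True by (simp add: power2_eq_square algebra_simps)
      next
        case False
        have "(max 0 (v + k))\<^sup>2 \<le> k\<^sup>2"
          using False unfolding abs_le_square_iff[symmetric] by (auto simp: max_def)
        then show ?thesis using False by simp
      qed
      from 1[of v k] 1[of v "-k"] show ?thesis by simp
    qed
    show ?thesis using *[of "1 - t"] by (simp add: p_def algebra_simps)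
  qed
  \<comment> \<open>As p is decreasing, passing to absolute values can only lower the two shifted
    terms. This is the concave kink at the centre.\<close>
  have *: "p \<bar>t + k\<bar> + p \<bar>t - k\<bar> - 2 * p \<bar>t\<bar> \<le> 2 * k\<^sup>2" for t k
  proof (cases "t \<ge> 0")
    case True
    then show ?thesis
      using pp[of t k] mono[OF abs_ge_self[of "t + k"]] mono[OF abs_ge_self[of "t - k"]]
      by (simp add: algebra_simps)
  next
    case False
    show ?thesis
    proof -
      have "- t + k = - (t - k)" "- t - k = - (t + k)" "\<bar>t\<bar> = - t" using False by auto
      then show ?thesis
        using pp[of "-t" k] mono[OF abs_ge_minus_self[of "t + k"]] mono[OF abs_ge_minus_self[of "t - k"]]
        by simp
    qed
  qed
  have q: "quad_bump c r y = p \<bar>(y - c) / r\<bar>" for y by (simp add: quad_bump_def p_def)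
  have "(x + h - c) / r = (x - c) / r + h / r" "(x - h - c) / r = (x - c) / r - h / r"
    using assms by (auto simp: field_simps)
  then show ?thesis using *[of "(x - c) / r" "h / r"] by (simp add: q)
qed

lemma integral_poisson_shift:
  assumes f: "integrable lborel f"
  shows "poisson f x = (LBINT h. poisson_kernel 1 h * f (x + h))"
    and "integrable lborel (\<lambda>h. poisson_kernel 1 h * f (x + h))"
proof -
  show "poisson f x = (LBINT h. poisson_kernel 1 h * f (x + h))"
    unfolding poisson_def
    by (subst lborel_integral_real_affine[where c=1 and t=x]) (simp_all add: poisson_kernel_even)
  show "integrable lborel (\<lambda>h. poisson_kernel 1 h * f (x + h))"
    using lborel_integrable_real_affine[OF integrable_poisson_kernel_mult[OF f, of x], of 1 x]
    by (simp add: poisson_kernel_even)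
qed

lemma integral_poisson_shift':
  assumes f: "integrable lborel f"
  shows "poisson f x = (LBINT h. poisson_kernel 1 h * f (x - h))"
    and "integrable lborel (\<lambda>h. poisson_kernel 1 h * f (x - h))"
proof -
  show "poisson f x = (LBINT h. poisson_kernel 1 h * f (x - h))"
    unfolding poisson_def
    by (subst lborel_integral_real_affine[where c="-1" and t=x]) (simp_all add: poisson_kernel_even)
  show "integrable lborel (\<lambda>h. poisson_kernel 1 h * f (x - h))"
    using lborel_integrable_real_affine[OF integrable_poisson_kernel_mult[OF f, of x], of "-1" x]
    by (simp add: poisson_kernel_even)
qed

text \<open>Averaging the two shifted forms of the integral turns twice the difference into an
  integral of second differences d. From d <= 2 (h / r)^2 and d <= 2 follows d (r^2 + h^2) <= 4 h^2,
  so d / (1 + h^2) <= 4 / (r^2 + h^2). This is a multiple of the Poisson kernel of height r, which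
  has mass one.\<close>

lemma poisson_quad_bump_le:
  assumes r: "r > 0"
  shows "poisson (quad_bump c r) x - quad_bump c r x \<le> 2 / r"
proof -
  let ?b = "quad_bump c r"
  have i: "integrable lborel ?b"
    using quad_bump_bounds quad_bump_eq_0[OF r]
    by (intro integrable_cpt_support[where M=1 and a="c-r" and b="c+r"]) auto
  note s = integral_poisson_shift[OF i, of x] integral_poisson_shift'[OF i, of x]
  have ik: "integrable lborel (poisson_kernel 1)" "(LBINT h. poisson_kernel 1 h) = 1"
    using integrable_poisson_kernel[of 1] integral_poisson_kernel[of 1] by auto
  have "2 * (poisson ?b x - ?b x) = (LBINT h. poisson_kernel 1 h * ?b (x + h))
      + (LBINT h. poisson_kernel 1 h * ?b (x - h)) - 2 * ?b x * (LBINT h. poisson_kernel 1 h)"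
    using s ik by simp
  also have "\<dots> = (LBINT h. poisson_kernel 1 h * ?b (x + h) + poisson_kernel 1 h * ?b (x - h)
      - 2 * ?b x * poisson_kernel 1 h)"
    using s(2,4) ik(1) by simp
  also have "\<dots> \<le> (LBINT h. (4 / r) * poisson_kernel r h)"
  proof (rule integral_mono)
    show "integrable lborel (\<lambda>h. poisson_kernel 1 h * ?b (x + h) + poisson_kernel 1 h * ?b (x - h)
      - 2 * ?b x * poisson_kernel 1 h)" using s(2,4) ik(1) by simp
    show "integrable lborel (\<lambda>h. (4 / r) * poisson_kernel r h)"
      using integrable_poisson_kernel[OF r] by simp
    fix h
    let ?d = "?b (x + h) + ?b (x - h) - 2 * ?b x"
    have d1: "?d \<le> 2 * (h / r)\<^sup>2" by (rule quad_bump_second_difference[OF r])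
    have d2: "?d \<le> 2"
      using quad_bump_bounds[of c r x] quad_bump_bounds[of c r "x + h"] quad_bump_bounds[of c r "x - h"] by linarith
    have "?d * (r\<^sup>2 + h\<^sup>2) \<le> 4 * h\<^sup>2"
    proof -
      have "?d * r\<^sup>2 \<le> 2 * (h / r)\<^sup>2 * r\<^sup>2" by (intro mult_right_mono d1) auto
      also have "\<dots> = 2 * h\<^sup>2" using r by (simp add: field_simps)
      finally have 1: "?d * r\<^sup>2 \<le> 2 * h\<^sup>2" .
      have 2: "?d * h\<^sup>2 \<le> 2 * h\<^sup>2" by (intro mult_right_mono d2) auto
      show ?thesis using 1 2 unfolding distrib_left by linarith
    qed
    also have "\<dots> \<le> 4 * (1 + h\<^sup>2)" by simp
    finally have "?d / (1 + h\<^sup>2) \<le> 4 / (r\<^sup>2 + h\<^sup>2)"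
      using r by (simp add: divide_simps add_pos_nonneg mult_ac)
    then have "?d / (1 + h\<^sup>2) / pi \<le> 4 / (r\<^sup>2 + h\<^sup>2) / pi" by (rule divide_right_mono) simp
    moreover have "poisson_kernel 1 h * ?b (x + h) + poisson_kernel 1 h * ?b (x - h)
      - 2 * ?b x * poisson_kernel 1 h = ?d / (1 + h\<^sup>2) / pi"
      by (simp add: poisson_kernel_1 diff_divide_distrib add_divide_distrib mult.commute)
    moreover have "(4 / r) * poisson_kernel r h = 4 / (r\<^sup>2 + h\<^sup>2) / pi"
      using r by (simp add: poisson_kernel_def)
    ultimately show "poisson_kernel 1 h * ?b (x + h) + poisson_kernel 1 h * ?b (x - h)
      - 2 * ?b x * poisson_kernel 1 h \<le> (4 / r) * poisson_kernel r h" by simp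
  qed
  also have "\<dots> = 4 / r" using integral_poisson_kernel[OF r] by simp
  finally show ?thesis by simp
qed

text \<open>By \<open>poisson_quad_bump_le\<close> the average of a bump of height
  \<open>e * X\<close> and radius \<open>2 * X\<close> exceeds the bump by at most \<open>e\<close>.
  Such a bump is the supersolution that \<open>obstacle_problem\<close> asks for.\<close>

lemma one_scale_majorant:
  fixes w :: "real \<Rightarrow> real"
  assumes X: "X > 0" and nn: "\<And>x. w x \<ge> 0" and supp: "\<And>x. x \<notin> {X/2..4*X} \<Longrightarrow> w x = 0"
    and small: "\<And>x. w x \<le> e * X / 64"
    and L: "L > 0" and lip: "\<And>x y. \<bar>w x - w y\<bar> \<le> L * \<bar>x - y\<bar>" and e: "e > 0"
  obtains \<Theta> where "\<Theta> \<in> borel_measurable borel" "\<And>x. w x \<le> \<Theta> x" "\<And>x. \<Theta> x \<le> e * X"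
    "\<And>x. x \<notin> {X/4..17*X/4} \<Longrightarrow> \<Theta> x = 0"
    "\<And>x. poisson \<Theta> x - e \<le> \<Theta> x" "(LBINT x. \<Theta> x) \<le> (1 + L / e) * (LBINT x. w x)"
proof -
  define B where "B x = e * X * quad_bump (9*X/4) (2*X) x" for x
  have [measurable]: "B \<in> borel_measurable borel" unfolding B_def by measurable
  have B0: "0 \<le> B x" for x using quad_bump_bounds e X by (auto simp: B_def)
  have B1: "B x \<le> e * X" for x
    using mult_left_mono[OF quad_bump_bounds(2), of "e * X"] e X by (auto simp: B_def)
  have Bs: "B x = 0" if "x \<notin> {X/4..17*X/4}" for x
    using that X quad_bump_eq_0[of "2*X" x "9*X/4"] by (auto simp: B_def)
  have wB: "w x \<le> B x" for x
  proof (cases "x \<in> {X/2..4*X}")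
    case True
    \<comment> \<open>The centre 9 X / 4 is the midpoint of the interval from X / 2 to 4 X, whose
      half-length 7 X / 4 is 7/8 of the radius. Squaring the remaining 1/8 produces the 64 in the
      smallness assumption.\<close>
    have "1/8 \<le> 1 - \<bar>(x - 9*X/4) / (2*X)\<bar>" using True X by (auto simp: abs_if field_simps)
    then have "(1/8)\<^sup>2 \<le> quad_bump (9*X/4) (2*X) x"
      unfolding quad_bump_def by (intro power_mono) auto
    then have "e * X * (1/64) \<le> B x"
      unfolding B_def using e X by (intro mult_left_mono) (auto simp: power2_eq_square)
    then show ?thesis using small[of x] by simp
  qed (use supp B0 in auto)
  have super: "poisson B x - e \<le> B x" for x
  proof -
    have "poisson B x = e * X * poisson (quad_bump (9*X/4) (2*X)) x"
      unfolding poisson_def B_def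
      by (subst integral_mult_right_zero[symmetric]) (simp add: mult_ac)
    then have "poisson B x - B x = e * X * (poisson (quad_bump (9*X/4) (2*X)) x - quad_bump (9*X/4) (2*X) x)"
      by (simp add: B_def right_diff_distrib)
    also have "\<dots> \<le> e * X * (2 / (2 * X))"
      using e X by (intro mult_left_mono poisson_quad_bump_le) auto
    also have "\<dots> = e" using X by simp
    finally show ?thesis by simp
  qed
  have Bb: "\<bar>B x\<bar> \<le> e * X" for x using B0 B1 by simp
  obtain \<Theta> where \<Theta>: "\<Theta> \<in> borel_measurable borel" "\<And>x. w x \<le> \<Theta> x" "\<And>x. \<Theta> x \<le> B x"
    "\<And>x. poisson \<Theta> x - e \<le> \<Theta> x" "(LBINT x. \<Theta> x) \<le> (1 + L / e) * (LBINT x. w x)"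
    using obstacle_problem[OF \<open>B \<in> borel_measurable borel\<close> Bb Bs nn wB L lip e super] by metis
  show thesis
  proof (rule that[OF \<Theta>(1,2) _ _ \<Theta>(4,5)])
    show "\<Theta> x \<le> e * X" for x using \<Theta>(3) B1 order_trans by blast
    show "\<Theta> x = 0" if "x \<notin> {X/4..17*X/4}" for x
      using \<Theta>(2)[of x] \<Theta>(3)[of x] nn[of x] Bs[OF that] by simp
  qed
qed

text \<open>If W x > d x for a large x, the Lipschitz condition keeps W above d x / 2 on an interval
  of length \<eta> x to the right of x. With weight 1 / (1 + u^2) this contributes at least d \<eta>
  / 10, whatever x is, whereas the tail of the integral tends to zero. The choice of \<eta> ensures
  u <= 2 x and L \<eta> <= d / 2.\<close>

lemma lipschitz_integrable_sublinear:
  fixes W :: "real \<Rightarrow> real"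
  assumes nn: "\<And>x. W x \<ge> 0" and L: "L > 0" and lip: "\<And>x y. \<bar>W x - W y\<bar> \<le> L * \<bar>x - y\<bar>"
    and int: "integrable lborel (\<lambda>x. W x / (1 + x\<^sup>2))" and d: "d > 0"
  obtains X0 where "X0 \<ge> 1" "\<And>x. x \<ge> X0 \<Longrightarrow> W x \<le> d * x"
proof -
  let ?V = "\<lambda>x. W x / (1 + x\<^sup>2)"
  define \<eta> where "\<eta> = min 1 (d / (2 * L))"
  have \<eta>: "\<eta> > 0" "\<eta> \<le> 1" "L * \<eta> \<le> d / 2" using d L by (auto simp: \<eta>_def min_def field_simps)
  have "(\<lambda>n. LBINT x. indicator {real n..} x * ?V x) \<longlonglongrightarrow> (LBINT x::real. 0)"
  proof (rule integral_dominated_convergence[OF _ _ int])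
    show "AE x in lborel. (\<lambda>n. indicator {real n..} x * ?V x) \<longlonglongrightarrow> 0"
    proof (intro AE_I2 tendsto_eventually)
      fix x :: real
      obtain N :: nat where "x < N" using reals_Archimedean2 by blast
      then show "\<forall>\<^sub>F n in sequentially. indicator {real n..} x * ?V x = 0"
        by (intro eventually_sequentiallyI[of N]) (auto simp: indicator_def)
    qed
    show "AE x in lborel. norm (indicator {real n..} x * ?V x) \<le> ?V x" for n
      using nn by (auto simp: indicator_def)
    have m: "(\<lambda>x. W x / (1 + x\<^sup>2)) \<in> borel_measurable borel" using int by auto
    show "(\<lambda>x. indicator {real n..} x * ?V x) \<in> borel_measurable lborel" for n
      using m by (intro borel_measurable_times) auto
  qed auto
  then have "\<forall>\<^sub>F n in sequentially. (LBINT x. indicator {real n..} x * ?V x) < d * \<eta> / 10"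
    using d \<eta> by (intro order_tendstoD(2)) auto
  then obtain n where n: "(LBINT x. indicator {real n..} x * ?V x) < d * \<eta> / 10"
    by (auto simp: eventually_sequentially)
  show thesis
  proof (rule that[of "max 1 (real n)"])
    fix x assume x: "max 1 (real n) \<le> x"
    show "W x \<le> d * x"
    proof (rule ccontr)
      assume "\<not> ?thesis"
      then have Wx: "W x > d * x" by simp
      have pt: "d / (10 * x) \<le> ?V u" if u: "x \<le> u" "u \<le> x + \<eta> * x" for u
      proof -
        have ux: "u \<le> 2 * x" using u \<eta> x mult_right_mono[of \<eta> 1 x] by linarith
        have "L * \<bar>x - u\<bar> \<le> L * (\<eta> * x)" using u L by (intro mult_left_mono) auto
        also have "\<dots> \<le> d / 2 * x" using \<eta> x mult_right_mono[of "L * \<eta>" "d/2" x] by (simp add: mult_ac)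
        finally have Wu: "d * x / 2 \<le> W u" using lip[of x u] Wx by (simp add: abs_if split: if_splits)
        have "u\<^sup>2 \<le> (2 * x)\<^sup>2" using u ux x by (intro power_mono) auto
        moreover have "1 \<le> x\<^sup>2" using x by (intro one_le_power) auto
        ultimately have "1 + u\<^sup>2 \<le> 5 * x\<^sup>2" by (simp add: power_mult_distrib)
        then have "(d * x / 2) / (5 * x\<^sup>2) \<le> W u / (1 + u\<^sup>2)"
          using Wu x d nn[of u] by (intro frac_le) (auto simp: add_pos_nonneg)
        moreover have "(d * x / 2) / (5 * x\<^sup>2) = d / (10 * x)" using x by (simp add: power2_eq_square)
        ultimately show ?thesis by simp
      qed
      have Vnn: "0 \<le> ?V u" for u using nn[of u] by simp
      have "d * \<eta> / 10 = (d / (10 * x)) * (\<eta> * x)" using x by simp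
      also have "\<dots> = (LBINT u. (d / (10 * x)) * indicator {x..x + \<eta> * x} u)"
        using \<eta> x by (subst integral_mult_right_zero) (auto simp: measure_def)
      also have "\<dots> \<le> (LBINT u. indicator {real n..} u * ?V u)"
      proof (rule integral_mono)
        show "integrable lborel (\<lambda>u. (d / (10 * x)) * indicator {x..x + \<eta> * x} u)"
          by (intro integrable_mult_right integrable_real_indicator) (auto simp: emeasure_lborel_Icc_eq)
        show "integrable lborel (\<lambda>u. indicator {real n..} u * ?V u)"
          using integrable_real_mult_indicator[OF _ int, of "{real n..}"]
          by (simp add: mult.commute[of "indicator _ _"])
        show "(d / (10 * x)) * indicator {x..x + \<eta> * x} u \<le> indicator {real n..} u * ?V u" for u
          using pt[of u] Vnn[of u] x by (simp add: indicator_def)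
      qed
      finally show False using n by simp
    qed
  qed auto
qed

section \<open>Estimates for adding up dyadic scales\<close>

lemma poisson_kernel_1_le_weight: "poisson_kernel 1 (x - y) \<le> (1 + x\<^sup>2) / (1 + y\<^sup>2)"
proof -
  have "(1 + y\<^sup>2) \<le> 2 * ((1 + x\<^sup>2) * (1 + (x - y)\<^sup>2))"
  proof -
    have "2 * ((1 + x\<^sup>2) * (1 + (x - y)\<^sup>2)) - (1 + y\<^sup>2)
       = 1 + (y - 2 * x)\<^sup>2 + 2 * (x * (x - y))\<^sup>2"
      by (simp add: power2_eq_square algebra_simps)
    also have "\<dots> \<ge> 0" by (intro add_nonneg_nonneg) auto
    finally show ?thesis by simp
  qed
  also have "\<dots> \<le> pi * ((1 + x\<^sup>2) * (1 + (x - y)\<^sup>2))"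
    using pi_ge_two by (intro mult_right_mono) auto
  finally show ?thesis
    by (simp add: poisson_kernel_1 divide_simps add_pos_nonneg mult_ac)
qed

lemma integrable_poisson_kernel_weight:
  assumes [measurable]: "f \<in> borel_measurable borel"
    and int: "integrable lborel (\<lambda>y. f y / (1 + y\<^sup>2))"
  shows "integrable lborel (\<lambda>y. poisson_kernel 1 (x - y) * f y)"
proof (rule Bochner_Integration.integrable_bound)
  show "integrable lborel (\<lambda>y. (1 + x\<^sup>2) * (f y / (1 + y\<^sup>2)))" by (intro integrable_mult_right int)
  show "AE y in lborel. norm (poisson_kernel 1 (x - y) * f y) \<le> norm ((1 + x\<^sup>2) * (f y / (1 + y\<^sup>2)))"
  proof (intro AE_I2)
    fix y
    have "poisson_kernel 1 (x - y) * \<bar>f y\<bar> \<le> (1 + x\<^sup>2) / (1 + y\<^sup>2) * \<bar>f y\<bar>"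
      by (intro mult_right_mono poisson_kernel_1_le_weight) auto
    then show "norm (poisson_kernel 1 (x - y) * f y) \<le> norm ((1 + x\<^sup>2) * (f y / (1 + y\<^sup>2)))"
      by (simp add: abs_mult poisson_kernel_nonneg add_nonneg_nonneg)
  qed
qed measurable

lemma poisson_reflect: "poisson (\<lambda>x. f (- x)) x = poisson f (- x)"
proof -
  have "poisson_kernel 1 (x - - t) = poisson_kernel 1 (- x - t)" for t
    by (simp add: poisson_kernel_def power2_eq_square algebra_simps)
  then show ?thesis
    unfolding poisson_def by (subst lborel_integral_real_affine[where c="-1" and t=0]) simp_all
qed

lemma sum_dyadic_le:
  fixes y :: real
  assumes "y \<ge> 0"
  shows "(\<Sum>j<n. if 2 ^ (m + j) \<le> y then 2 ^ (m + j) else 0) \<le> 2 * y"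
proof -
  \<comment> \<open>The bound \<open>2 ^ (m + n)\<close> strengthens the induction: if the next term
    is present, the old sum is at most that term, so the new sum is at most twice it, and the term
    is at most \<open>y\<close>.\<close>
  have "(\<Sum>j<n. if 2 ^ (m + j) \<le> y then 2 ^ (m + j) else 0) \<le> min (2 ^ (m + n)) (2 * y)"
  proof (induction n)
    case (Suc n)
    then show ?case using assms by (auto simp: min_def split: if_splits)
  qed (use assms in auto)
  then show ?thesis by simp
qed

lemma card_dyadic_le:
  fixes y z :: real
  assumes "z < 2 ^ m * y"
  shows "finite {j::nat. y \<le> 2 ^ (k + j) \<and> 2 ^ (k + j) \<le> z}"
    and "card {j::nat. y \<le> 2 ^ (k + j) \<and> 2 ^ (k + j) \<le> z} \<le> m"
proof -
  let ?A = "{j::nat. y \<le> 2 ^ (k + j) \<and> 2 ^ (k + j) \<le> z}"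
  have *: "finite ?A \<and> card ?A \<le> m"
  proof (cases "?A = {}")
    case False
    define i where "i = (LEAST j. j \<in> ?A)"
    obtain i0 where "i0 \<in> ?A" using False by blast
    then have i: "i \<in> ?A" unfolding i_def by (rule LeastI)
    have sub: "?A \<subseteq> {i..<i+m}"
    proof
      fix j assume j: "j \<in> ?A"
      have "i \<le> j" unfolding i_def using j by (rule Least_le)
      moreover have "(2::real) ^ (k + j) < 2 ^ (k + i + m)"
      proof -
        have "(2::real) ^ (k + j) < 2 ^ m * y" using j assms by simp
        also have "\<dots> \<le> 2 ^ m * 2 ^ (k + i)" using i by (intro mult_left_mono) auto
        finally show ?thesis by (simp add: power_add mult.commute)
      qed
      ultimately show "j \<in> {i..<i+m}" by simp
    qed
    have "card ?A \<le> card {i..<i+m}" by (rule card_mono[OF _ sub]) (rule finite_atLeastLessThan)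
    moreover have "finite ?A" by (rule finite_subset[OF sub]) (rule finite_atLeastLessThan)
    ultimately show ?thesis unfolding card_atLeastLessThan by (metis add_diff_cancel_left')
  next
    case True
    show ?thesis unfolding True by (intro conjI finite.emptyI) (simp only: card.empty zero_le)
  qed
  show "finite ?A" by (rule conjunct1[OF *])
  show "card ?A \<le> m" by (rule conjunct2[OF *])
qed

text \<open>Away from the scale of the support, |x - u| >= u / 2, so the kernel is at most 2 / u^2.
  A distant scale therefore costs only twice its share of the logarithmic integral, and these shares
  are summable.\<close>

lemma poisson_far_le:
  assumes X: "X > 0" and m[measurable]: "\<Theta> \<in> borel_measurable borel" and nn: "\<And>x. \<Theta> x \<ge> 0"
    and supp: "\<And>u. u \<notin> {X/4..17*X/4} \<Longrightarrow> \<Theta> u = 0" and int: "integrable lborel (\<lambda>u. \<Theta> u / u\<^sup>2)"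
    and far: "x < X / 8 \<or> x > 9 * X"
  shows "poisson \<Theta> x \<le> 2 * (LBINT u. \<Theta> u / u\<^sup>2)"
proof -
  have "poisson \<Theta> x \<le> (LBINT u. 2 * (\<Theta> u / u\<^sup>2))"
    unfolding poisson_def
  proof (rule Bochner_Integration.integral_mono')
    show "integrable lborel (\<lambda>u. 2 * (\<Theta> u / u\<^sup>2))" by (intro integrable_mult_right int)
    show "poisson_kernel 1 (x - u) * \<Theta> u \<le> 2 * (\<Theta> u / u\<^sup>2)" for u
    proof (cases "u \<in> {X/4..17*X/4}")
      case True
      then have u1: "X / 4 \<le> u" "u \<le> 17 * X / 4" by simp_all
      have u: "u > 0" using u1 X by linarith
      have u2: "u / 2 \<le> \<bar>x - u\<bar>" using far
      proof
        assume "x < X / 8"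
        then have "u / 2 \<le> u - x" using u1 by linarith
        then show ?thesis by linarith
      next
        assume "9 * X < x"
        then have "u / 2 \<le> x - u" using u1 X by linarith
        then show ?thesis by linarith
      qed
      have "(u / 2)\<^sup>2 \<le> \<bar>x - u\<bar>\<^sup>2" using u u2 by (intro power_mono) simp_all
      then have "u\<^sup>2 \<le> 4 * (x - u)\<^sup>2" by (simp add: power_divide)
      then have 1: "u\<^sup>2 \<le> 4 * (1 + (x - u)\<^sup>2)" by simp
      have 2: "4 * (1 + (x - u)\<^sup>2) \<le> 2 * pi * (1 + (x - u)\<^sup>2)"
        using pi_ge_two by (intro mult_right_mono) auto
      have "u\<^sup>2 \<le> 2 * (pi * (1 + (x - u)\<^sup>2))" using 1 2 by simp
      moreover have "pi * (1 + (x - u)\<^sup>2) > 0" "u\<^sup>2 > 0" using u by (auto simp: add_pos_nonneg)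
      moreover have "1 / p \<le> 2 / q" if "q \<le> 2 * p" "p > 0" "q > 0" for p q :: real
        using that by (simp add: field_simps)
      ultimately have "poisson_kernel 1 (x - u) \<le> 2 / u\<^sup>2"
        unfolding poisson_kernel_1 by blast
      then have "poisson_kernel 1 (x - u) * \<Theta> u \<le> 2 / u\<^sup>2 * \<Theta> u" by (intro mult_right_mono nn)
      then show ?thesis by simp
    qed (use supp in auto)
    show "0 \<le> 2 * (\<Theta> u / u\<^sup>2)" for u using nn by simp
  qed
  also have "\<dots> = 2 * (LBINT u. \<Theta> u / u\<^sup>2)" by (rule integral_mult_right_zero)
  finally show ?thesis .
qed

text \<open>On each scale \<open>W\<close> is cut off by steep linear flanks and the obstacle
  problem is solved for the truncation \<open>w j\<close>. Its cost \<open>c j\<close> is a constant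
  times the part \<open>v j\<close> of the logarithmic integral near that scale, and these parts
  overlap boundedly, so the costs are summable.\<close>

lemma dyadic_pieces:
  fixes W :: "real \<Rightarrow> real"
  assumes nn: "\<And>x. W x \<ge> 0" and L: "L > 0" and lip: "\<And>x y. \<bar>W x - W y\<bar> \<le> L * \<bar>x - y\<bar>"
    and int: "integrable lborel (\<lambda>x. W x / (1 + x\<^sup>2))" and a: "a > 0"
  obtains m :: nat and \<Theta> :: "nat \<Rightarrow> real \<Rightarrow> real" where
    "\<And>j. \<Theta> j \<in> borel_measurable borel" "\<And>j x. 0 \<le> \<Theta> j x" "\<And>j x. \<Theta> j x \<le> a * 2 ^ (m + j)"
    "\<And>j x. x \<notin> {2 ^ (m + j) / 4..17 * 2 ^ (m + j) / 4} \<Longrightarrow> \<Theta> j x = 0"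
    "\<And>j x. poisson (\<Theta> j) x - a \<le> \<Theta> j x"
    "\<And>j x. x \<in> {2 ^ (m + j)..2 * 2 ^ (m + j)} \<Longrightarrow> W x \<le> \<Theta> j x"
    "summable (\<lambda>j. LBINT u. \<Theta> j u / u\<^sup>2)" "(\<Sum>j. LBINT u. \<Theta> j u / u\<^sup>2) \<le> a"
    "\<And>j. integrable lborel (\<lambda>u. \<Theta> j u / u\<^sup>2)"
proof -
  \<comment> \<open>On the interval from X / 2 to 4 X this gives W <= 4 d X = a X / 64, the
    smallness required by \<open>one_scale_majorant\<close>.\<close>
  define d where "d = a / 256"
  have d: "d > 0" using a by (simp add: d_def)
  obtain Y0 where Y0: "Y0 \<ge> 1" "\<And>x. x \<ge> Y0 \<Longrightarrow> W x \<le> d * x"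
    by (rule lipschitz_integrable_sublinear[OF nn L lip int d]) (rule that)
  obtain J :: nat where J: "2 * Y0 < 2 ^ J" using real_arch_pow[of 2 "2 * Y0"] by auto
  define X :: "nat \<Rightarrow> real" where "X j = 2 ^ (J + j)" for j
  have XY: "2 * Y0 \<le> X j" for j
  proof -
    have "(2::real) ^ J \<le> 2 ^ (J + j)" by (intro power_increasing) auto
    then show ?thesis using J unfolding X_def by linarith
  qed
  have X1: "X j \<ge> 1" "X j > 0" for j using XY[of j] Y0 by auto
  \<comment> \<open>Slope at least 4 d makes each flank at least 2 d X between X and 2 X. There W <=
    2 d X, so the truncation agrees with \<open>W\<close>.\<close>
  define L' where "L' = L + 4 * d"
  have L': "L' > 0" "L \<le> L'" "4 * d \<le> L'" using L d by (auto simp: L'_def)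
  define w where "w j x = max 0 (min (W x) (min (L' * (x - X j / 2)) (L' * (4 * X j - x))))" for j x
  have wW: "w j x \<le> W x" and w0: "0 \<le> w j x" for j x using nn[of x] by (auto simp: w_def)
  have wsupp: "w j x = 0" if "x \<notin> {X j / 2..4 * X j}" for j x
  proof -
    have "L' * (x - X j / 2) \<le> 0 \<or> L' * (4 * X j - x) \<le> 0"
      using that L' by (auto simp: mult_le_0_iff)
    then show ?thesis by (auto simp: w_def)
  qed
  have Wd: "W x \<le> d * x" if "x \<in> {X j / 2..4 * X j}" for j x
    using that XY[of j] by (intro Y0) auto
  have wsmall: "w j x \<le> a * X j / 64" for j x
  proof (cases "x \<in> {X j / 2..4 * X j}")
    case True
    then have "d * x \<le> d * (4 * X j)" using d by (intro mult_left_mono) auto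
    then have "W x \<le> d * (4 * X j)" using Wd[OF True] by linarith
    then show ?thesis using wW[of j x] by (simp add: d_def)
  qed (use wsupp a X1 in \<open>simp add: less_imp_le\<close>)
  have wlip: "\<bar>w j x - w j y\<bar> \<le> L' * \<bar>x - y\<bar>" for j x y
  proof -
    have mm: "\<bar>min p q - min r s\<bar> \<le> t" if "\<bar>p - r\<bar> \<le> t" "\<bar>q - s\<bar> \<le> t" for p q r s t :: real
      using that by (auto simp: min_def)
    have m0: "\<bar>max 0 p - max 0 q\<bar> \<le> t" if "\<bar>p - q\<bar> \<le> t" for p q t :: real
      using that by (auto simp: max_def)
    have 1: "\<bar>W x - W y\<bar> \<le> L' * \<bar>x - y\<bar>"
      using lip[of x y] L' mult_right_mono[of L L' "\<bar>x - y\<bar>"] by simp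
    have 2: "\<bar>L' * (x - X j / 2) - L' * (y - X j / 2)\<bar> \<le> L' * \<bar>x - y\<bar>"
      using L' by (simp add: right_diff_distrib[symmetric] abs_mult)
    have 3: "\<bar>L' * (4 * X j - x) - L' * (4 * X j - y)\<bar> \<le> L' * \<bar>x - y\<bar>"
      using L' by (simp add: right_diff_distrib[symmetric] abs_mult abs_minus_commute)
    show ?thesis unfolding w_def by (intro m0 mm 1 2 3)
  qed
  have weq: "w j x = W x" if "x \<in> {X j..2 * X j}" for j x
  proof -
    have "W x \<le> d * (2 * X j)"
    proof -
      have "d * x \<le> d * (2 * X j)" using d that by (intro mult_left_mono) auto
      moreover have "W x \<le> d * x" using that X1(2)[of j] by (intro Wd[of x j]) auto
      ultimately show ?thesis by linarith
    qed
    moreover have "4 * d * (X j / 2) \<le> L' * (x - X j / 2)"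
      using that L' d X1[of j] by (intro mult_mono) auto
    moreover have "4 * d * (X j) \<le> L' * (4 * X j - x)"
      using that L' d X1[of j] by (intro mult_mono) auto
    moreover have "d * X j > 0" using d X1 by simp
    ultimately show ?thesis using nn[of x] by (simp add: w_def min_def max_def)
  qed
  have "\<exists>\<Theta>. \<Theta> \<in> borel_measurable borel \<and> (\<forall>x. w j x \<le> \<Theta> x) \<and> (\<forall>x. \<Theta> x \<le> a * X j) \<and>
    (\<forall>x. x \<notin> {X j/4..17*X j/4} \<longrightarrow> \<Theta> x = 0) \<and>
    (\<forall>x. poisson \<Theta> x - a \<le> \<Theta> x) \<and> (LBINT x. \<Theta> x) \<le> (1 + L' / a) * (LBINT x. w j x)" for j
    using one_scale_majorant[OF X1(2)[of j] w0[of j] wsupp[of _ j] wsmall[of j] L'(1) wlip[of j] a]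
    by metis
  then obtain \<Theta> where \<Theta>: "\<And>j. \<Theta> j \<in> borel_measurable borel" "\<And>j x. w j x \<le> \<Theta> j x"
    "\<And>j x. \<Theta> j x \<le> a * X j" "\<And>j x. x \<notin> {X j/4..17*X j/4} \<Longrightarrow> \<Theta> j x = 0"
    "\<And>j x. poisson (\<Theta> j) x - a \<le> \<Theta> j x" "\<And>j. (LBINT x. \<Theta> j x) \<le> (1 + L' / a) * (LBINT x. w j x)"
    by metis
  have [measurable]: "\<Theta> j \<in> borel_measurable borel" for j by (rule \<Theta>)
  have \<Theta>0: "0 \<le> \<Theta> j x" for j x using w0[of j x] \<Theta>(2)[of j x] by simp
  have i\<Theta>: "integrable lborel (\<Theta> j)" for j
    using \<Theta>(3,4) \<Theta>0 by (intro integrable_cpt_support[where M="a * X j" and a="X j/4" and b="17*X j/4"]) auto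
  have quot: "\<Theta> j u / u\<^sup>2 \<le> 16 / (X j)\<^sup>2 * \<Theta> j u" for j u
  proof (cases "u \<in> {X j/4..17*X j/4}")
    case True
    have "(X j / 4)\<^sup>2 \<le> u\<^sup>2" using True X1[of j] by (intro power_mono) auto
    then have "1 / u\<^sup>2 \<le> 16 / (X j)\<^sup>2" using True X1[of j] by (simp add: divide_simps power2_eq_square split: if_splits)
    from mult_right_mono[OF this \<Theta>0[of j u]] show ?thesis by simp
  qed (use \<Theta>(4) in simp)
  have i\<Theta>2: "integrable lborel (\<lambda>u. \<Theta> j u / u\<^sup>2)" for j
  proof (rule Bochner_Integration.integrable_bound)
    show "integrable lborel (\<lambda>u. 16 / (X j)\<^sup>2 * \<Theta> j u)" using i\<Theta> by simp
    show "AE u in lborel. norm (\<Theta> j u / u\<^sup>2) \<le> norm (16 / (X j)\<^sup>2 * \<Theta> j u)"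
      using quot[of j] \<Theta>0[of j] by (intro AE_I2) (simp add: abs_mult)
  qed measurable
  define c where "c j = (LBINT u. \<Theta> j u / u\<^sup>2)" for j
  let ?V = "\<lambda>x. W x / (1 + x\<^sup>2)"
  define v where "v j = (LBINT u. indicator {X j / 2..4 * X j} u * ?V u)" for j
  have Vnn: "0 \<le> ?V u" for u using nn[of u] by simp
  have iv: "integrable lborel (\<lambda>u. indicator {X j / 2..4 * X j} u * ?V u)" for j
    using integrable_real_mult_indicator[OF _ int, of "{X j / 2..4 * X j}"]
    by (simp add: mult.commute[of "indicator _ _"])
  have iw: "integrable lborel (w j)" for j
  proof (rule integrable_cpt_support[where M="a * X j / 64" and a="X j / 2" and b="4 * X j"])
    have [measurable]: "W \<in> borel_measurable borel"
    proof -
      have "(\<lambda>x. W x / (1 + x\<^sup>2) * (1 + x\<^sup>2)) \<in> borel_measurable borel"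
        using int by (intro borel_measurable_times) auto
      moreover have "W x / (1 + x\<^sup>2) * (1 + x\<^sup>2) = W x" for x
        by (simp add: add_nonneg_eq_0_iff)
      ultimately show ?thesis by simp
    qed
    show "w j \<in> borel_measurable borel" unfolding w_def by measurable
  qed (use wsmall[of j] w0[of j] wsupp[of _ j] in auto)
  have wv: "(LBINT u. w j u) \<le> 17 * (X j)\<^sup>2 * v j" for j
  proof -
    have "(LBINT u. w j u) \<le> (LBINT u. 17 * (X j)\<^sup>2 * (indicator {X j / 2..4 * X j} u * ?V u))"
    proof (rule integral_mono)
      show "integrable lborel (\<lambda>u. 17 * (X j)\<^sup>2 * (indicator {X j / 2..4 * X j} u * ?V u))"
        by (intro integrable_mult_right iv)
      show "w j u \<le> 17 * (X j)\<^sup>2 * (indicator {X j / 2..4 * X j} u * ?V u)" for u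
      proof (cases "u \<in> {X j / 2..4 * X j}")
        case True
        have "u\<^sup>2 \<le> (4 * X j)\<^sup>2" using True X1[of j] by (intro power_mono) auto
        moreover have "1 \<le> (X j)\<^sup>2" using X1[of j] by simp
        ultimately have "1 + u\<^sup>2 \<le> 17 * (X j)\<^sup>2" by (simp add: power_mult_distrib)
        then have "(1 + u\<^sup>2) * ?V u \<le> 17 * (X j)\<^sup>2 * ?V u" by (intro mult_right_mono Vnn)
        moreover have "(1 + u\<^sup>2) * ?V u = W u" by (simp add: add_nonneg_eq_0_iff)
        ultimately show ?thesis using wW[of j u] True by simp
      next
        case False
        have "0 \<le> 17 * (X j)\<^sup>2 * (indicator {X j / 2..4 * X j} u * ?V u)"
          by (intro mult_nonneg_nonneg Vnn) auto
        then show ?thesis using wsupp[OF False] by simp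
      qed
    qed (rule iw)
    also have "\<dots> = 17 * (X j)\<^sup>2 * v j" unfolding v_def by (rule integral_mult_right_zero)
    finally show ?thesis .
  qed
  \<comment> \<open>Here 272 = 16 * 17: on the support of \<Theta> the weight 1 / u^2 is at most 16
    / X^2, and on the support of the truncation 1 + u^2 is at most 17 X^2.\<close>
  define K where "K = 272 * (1 + L' / a)"
  have K: "K \<ge> 0" using L' a by (simp add: K_def)
  have cv: "c j \<le> K * v j" for j
  proof -
    have "c j \<le> (LBINT u. 16 / (X j)\<^sup>2 * \<Theta> j u)"
      unfolding c_def using quot i\<Theta> i\<Theta>2 by (intro integral_mono) auto
    also have "\<dots> = 16 / (X j)\<^sup>2 * (LBINT u. \<Theta> j u)" by simp
    also have "\<dots> \<le> 16 / (X j)\<^sup>2 * ((1 + L' / a) * (17 * (X j)\<^sup>2 * v j))"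
      using \<Theta>(6)[of j] wv[of j] L' a
      by (intro mult_left_mono order_trans[OF \<Theta>(6)[of j]]) auto
    also have "\<dots> = K * v j" using X1[of j] by (simp add: K_def)
    finally show ?thesis .
  qed
  have c0: "0 \<le> c j" for j unfolding c_def using \<Theta>0 by (intro integral_nonneg_AE AE_I2) simp
  have sv: "summable v"
  proof (rule summableI_nonneg_bounded)
    show "0 \<le> v j" for j unfolding v_def using Vnn by (intro integral_nonneg_AE AE_I2 mult_nonneg_nonneg) auto
    show "(\<Sum>j<n. v j) \<le> 4 * (LBINT u. ?V u)" for n
    proof -
      have "(\<Sum>j<n. v j) = (LBINT u. (\<Sum>j<n. indicator {X j / 2..4 * X j} u * ?V u))"
        unfolding v_def using iv by (simp add: Bochner_Integration.integral_sum)
      also have "\<dots> \<le> (LBINT u. 4 * ?V u)"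
      proof (rule integral_mono)
        fix u
        \<comment> \<open>Only scales between u / 4 and 2 u reach u, and the ratio 8 of these bounds
          is less than 2^4.\<close>
        have "(\<Sum>j<n. indicator {X j / 2..4 * X j} u :: real) \<le> 4"
        proof (cases "u > 0")
          case True
          have "(\<Sum>j<n. indicator {X j / 2..4 * X j} u :: real) = card {j. j < n \<and> u \<in> {X j / 2..4 * X j}}"
            by (simp add: indicator_def sum.If_cases Int_def)
          also have "\<dots> \<le> card {j::nat. u / 4 \<le> 2 ^ (J + j) \<and> 2 ^ (J + j) \<le> 2 * u}"
            using True by (intro of_nat_mono card_mono card_dyadic_le[where m = 4]) (auto simp: X_def)
          also have "\<dots> \<le> real 4"
            using True by (intro of_nat_mono card_dyadic_le) auto
          finally show ?thesis by simp
        next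
          case False
          then have "indicator {X j / 2..4 * X j} u = (0::real)" for j
            using X1(2)[of j] by (auto simp: indicator_def)
          then show ?thesis by simp
        qed
        then show "(\<Sum>j<n. indicator {X j / 2..4 * X j} u * ?V u) \<le> 4 * ?V u"
          unfolding sum_distrib_right[symmetric] by (intro mult_right_mono Vnn)
      qed (intro Bochner_Integration.integrable_sum iv integrable_mult_right int)+
      also have "\<dots> = 4 * (LBINT u. ?V u)" by (rule integral_mult_right_zero)
      finally show ?thesis .
    qed
  qed
  have sc: "summable c"
    by (rule summable_comparison_test'[where g="\<lambda>j. K * v j" and N=0])
       (use sv cv c0 in \<open>auto intro: summable_mult\<close>)
  \<comment> \<open>Dropping the first scales brings the total cost below \<open>a\<close>. The
    price is that the majorant is valid only near infinity.\<close>
  obtain N where N: "\<And>n. n \<ge> N \<Longrightarrow> norm (\<Sum>i. c (i + n)) < a"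
    using suminf_exist_split[OF a sc] by blast
  show thesis
  proof (rule that[of "\<lambda>j. \<Theta> (j + N)" "J + N"])
    have XX: "2 ^ (J + N + j) = X (j + N)" for j by (simp add: X_def add_ac)
    show "0 \<le> \<Theta> (j + N) x" for j x by (rule \<Theta>0)
    show "\<Theta> (j + N) x \<le> a * 2 ^ (J + N + j)" for j x unfolding XX by (rule \<Theta>)
    show "\<Theta> (j + N) x = 0" if "x \<notin> {2 ^ (J + N + j) / 4..17 * 2 ^ (J + N + j) / 4}" for j x
      using that unfolding XX by (rule \<Theta>)
    show "W x \<le> \<Theta> (j + N) x" if "x \<in> {2 ^ (J + N + j)..2 * 2 ^ (J + N + j)}" for j x
      using that \<Theta>(2)[of "j + N" x] unfolding XX by (simp add: weq)
    show "summable (\<lambda>j. LBINT u. \<Theta> (j + N) u / u\<^sup>2)"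
      using summable_ignore_initial_segment[OF sc, of N] by (simp add: c_def)
    show "(\<Sum>j. LBINT u. \<Theta> (j + N) u / u\<^sup>2) \<le> a" using N[of N] by (simp add: c_def)
  qed (use \<Theta> i\<Theta>2 in auto)
qed

lemma global_majorant:
  fixes W :: "real \<Rightarrow> real"
  assumes nn: "\<And>x. W x \<ge> 0" and even: "\<And>x. W (- x) = W x"
    and L: "L > 0" and lip: "\<And>x y. \<bar>W x - W y\<bar> \<le> L * \<bar>x - y\<bar>"
    and int: "integrable lborel (\<lambda>x. W x / (1 + x\<^sup>2))" and e: "e > 0"
  obtains \<Omega> :: "real \<Rightarrow> real" and X0 K where
    "\<Omega> \<in> borel_measurable borel" "\<And>x. 0 \<le> \<Omega> x" "\<And>x. \<Omega> (- x) = \<Omega> x" "\<And>x. \<Omega> x \<le> K * \<bar>x\<bar>"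
    "integrable lborel (\<lambda>x. \<Omega> x / (1 + x\<^sup>2))" "\<And>x. X0 \<le> \<bar>x\<bar> \<Longrightarrow> W x \<le> \<Omega> x"
    "\<And>x. poisson \<Omega> x - e \<le> \<Omega> x"
proof -
  \<comment> \<open>At any point at most 7 scales are near on each side, costing \<open>a\<close>
    each, and the distant ones cost at most 4 a in total. This is 18 a, which is at most e.\<close>
  define a where "a = e / 22"
  have a: "a > 0" using e by (simp add: a_def)
  obtain m :: nat and \<Theta> :: "nat \<Rightarrow> real \<Rightarrow> real" where
    \<Theta>m[measurable]: "\<And>j. \<Theta> j \<in> borel_measurable borel" and \<Theta>0: "\<And>j x. 0 \<le> \<Theta> j x"
    and \<Theta>le: "\<And>j x. \<Theta> j x \<le> a * 2 ^ (m + j)"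
    and supp: "\<And>j x. x \<notin> {2 ^ (m + j) / 4..17 * 2 ^ (m + j) / 4} \<Longrightarrow> \<Theta> j x = 0"
    and super: "\<And>j x. poisson (\<Theta> j) x - a \<le> \<Theta> j x"
    and maj: "\<And>j x. x \<in> {2 ^ (m + j)..2 * 2 ^ (m + j)} \<Longrightarrow> W x \<le> \<Theta> j x"
    and sc: "summable (\<lambda>j. LBINT u. \<Theta> j u / u\<^sup>2)" and cle: "(\<Sum>j. LBINT u. \<Theta> j u / u\<^sup>2) \<le> a"
    and i2: "\<And>j. integrable lborel (\<lambda>u. \<Theta> j u / u\<^sup>2)"
    by (rule dyadic_pieces[OF nn L lip int a]) (rule that)
  define c where "c j = (LBINT u. \<Theta> j u / u\<^sup>2)" for j
  have c0: "0 \<le> c j" for j unfolding c_def using \<Theta>0 by (intro integral_nonneg_AE AE_I2) simp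
  define S where "S j x = \<Theta> j x + \<Theta> j (- x)" for j x
  have [measurable]: "S j \<in> borel_measurable borel" for j unfolding S_def by measurable
  have S0: "0 \<le> S j x" for j x using \<Theta>0 by (simp add: S_def)
  define \<Omega> where "\<Omega> x = (\<Sum>j. S j x)" for x
  have \<Theta>b: "\<Theta> j x \<le> a * (if 2 ^ (m + j) \<le> 4 * \<bar>x\<bar> then 2 ^ (m + j) else 0)" for j x
  proof (cases "2 ^ (m + j) \<le> 4 * \<bar>x\<bar>")
    case False
    then have "x \<notin> {2 ^ (m + j) / 4..17 * 2 ^ (m + j) / 4}" by auto
    from supp[OF this] show ?thesis using False by simp
  qed (use \<Theta>le[of j x] in simp)
  have part: "(\<Sum>j<n. S j x) \<le> 16 * a * \<bar>x\<bar>" for n x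
  proof -
    \<comment> \<open>A piece present at x has height at most \<open>a\<close> times its scale, and
      that scale is at most 4 |x|. The scales form a geometric sequence, so their sum is at most
      twice the largest one.\<close>
    have *: "(\<Sum>j<n. \<Theta> j x) \<le> 8 * a * \<bar>x\<bar>" for x
    proof -
      have "(\<Sum>j<n. \<Theta> j x) \<le> (\<Sum>j<n. a * (if 2 ^ (m + j) \<le> 4 * \<bar>x\<bar> then 2 ^ (m + j) else 0))"
        by (intro sum_mono \<Theta>b)
      also have "\<dots> = a * (\<Sum>j<n. if 2 ^ (m + j) \<le> 4 * \<bar>x\<bar> then 2 ^ (m + j) else 0)"
        by (simp add: sum_distrib_left)
      also have "\<dots> \<le> a * (2 * (4 * \<bar>x\<bar>))" using a by (intro mult_left_mono sum_dyadic_le) auto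
      finally show ?thesis by simp
    qed
    show ?thesis using *[of x] *[of "-x"] by (simp add: S_def sum.distrib)
  qed
  have sS: "summable (\<lambda>j. S j x)" for x
    by (rule summableI_nonneg_bounded[OF S0 part])
  have \<Omega>m[measurable]: "\<Omega> \<in> borel_measurable borel" unfolding \<Omega>_def by measurable
  have \<Omega>0: "0 \<le> \<Omega> x" for x unfolding \<Omega>_def by (rule suminf_nonneg[OF sS S0])
  have \<Omega>even: "\<Omega> (- x) = \<Omega> x" for x by (simp add: \<Omega>_def S_def add.commute)
  have \<Omega>le: "\<Omega> x \<le> 16 * a * \<bar>x\<bar>" for x unfolding \<Omega>_def
    by (rule suminf_le_const[OF sS part])
  have weight: "\<Theta> j x / (1 + x\<^sup>2) \<le> \<Theta> j x / x\<^sup>2" for j x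
  proof (cases "x = 0")
    case True
    have "0 \<notin> {2 ^ (m + j) / 4..17 * 2 ^ (m + j) / 4 :: real}" by (simp add: not_le)
    from supp[OF this] show ?thesis using True by simp
  next
    case False
    then show ?thesis using \<Theta>0[of j x] by (intro divide_left_mono) (auto simp: add_pos_nonneg)
  qed
  have i1: "integrable lborel (\<lambda>x. \<Theta> j x / (1 + x\<^sup>2))" for j
    by (rule Bochner_Integration.integrable_bound[OF i2[of j]])
       (use weight[of j] \<Theta>0[of j] in \<open>auto simp: add_nonneg_nonneg\<close>)
  have i1': "integrable lborel (\<lambda>x. \<Theta> j (- x) / (1 + x\<^sup>2))" for j
    using lborel_integrable_real_affine[OF i1[of j], of "-1" 0] by simp
  have v1: "(LBINT x. \<Theta> j x / (1 + x\<^sup>2)) \<le> c j" for j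
    unfolding c_def using weight by (intro integral_mono i1 i2)
  have v1': "(LBINT x. \<Theta> j (- x) / (1 + x\<^sup>2)) \<le> c j" for j
  proof -
    have "(LBINT x. \<Theta> j x / (1 + x\<^sup>2)) = (LBINT x. \<Theta> j (- x) / (1 + x\<^sup>2))"
      by (subst lborel_integral_real_affine[where c="-1" and t=0]) simp_all
    then show ?thesis using v1[of j] by simp
  qed
  have Sdiv: "S j x / (1 + x\<^sup>2) = \<Theta> j x / (1 + x\<^sup>2) + \<Theta> j (- x) / (1 + x\<^sup>2)" for j x
    by (simp add: S_def add_divide_distrib)
  have iS: "integrable lborel (\<lambda>x. S j x / (1 + x\<^sup>2))" for j
    unfolding Sdiv by (intro Bochner_Integration.integrable_add i1 i1')
  have vS: "(LBINT x. S j x / (1 + x\<^sup>2)) \<le> 2 * c j" for j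
    unfolding Sdiv using i1[of j] i1'[of j] v1[of j] v1'[of j] by simp
  have vS0: "0 \<le> (LBINT x. S j x / (1 + x\<^sup>2))" for j
    using S0 by (intro integral_nonneg_AE AE_I2) simp
  have sc': "summable c" using sc by (simp add: c_def[abs_def])
  have i\<Omega>: "integrable lborel (\<lambda>x. \<Omega> x / (1 + x\<^sup>2))"
  proof -
    have "integrable lborel (\<lambda>x. \<Sum>j. S j x / (1 + x\<^sup>2))"
    proof (rule integrable_suminf[OF iS])
      show "AE x in lborel. summable (\<lambda>j. norm (S j x / (1 + x\<^sup>2)))"
        using sS S0 by (auto intro!: AE_I2 summable_divide simp: abs_of_nonneg add_nonneg_nonneg)
      have "norm (LBINT x. norm (S j x / (1 + x\<^sup>2))) \<le> 2 * c j" for j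
        using vS[of j] vS0[of j] S0[of j] by (simp add: abs_of_nonneg add_nonneg_nonneg)
      then show "summable (\<lambda>j. LBINT x. norm (S j x / (1 + x\<^sup>2)))"
        by (rule summable_comparison_test'[OF summable_mult[OF sc', of 2]])
    qed
    moreover have "(\<Sum>j. S j x / (1 + x\<^sup>2)) = \<Omega> x / (1 + x\<^sup>2)" for x
      unfolding \<Omega>_def by (rule suminf_divide[OF sS])
    ultimately show ?thesis by simp
  qed
  have i\<Theta>: "integrable lborel (\<Theta> j)" for j
    using \<Theta>le[of j] supp[of _ j] \<Theta>0[of j]
    by (intro integrable_cpt_support[where M="a * 2 ^ (m + j)" and a="2 ^ (m + j)/4" and b="17*2 ^ (m + j)/4"]) auto
  have i\<Theta>': "integrable lborel (\<lambda>x. \<Theta> j (- x))" for j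
    using lborel_integrable_real_affine[OF i\<Theta>[of j], of "-1" 0] by simp
  have iPS: "integrable lborel (\<lambda>y. poisson_kernel 1 (x - y) * S j y)" for x j
    by (rule integrable_poisson_kernel_weight[OF _ iS]) simp
  have PS: "poisson (S j) x = poisson (\<Theta> j) x + poisson (\<Theta> j) (- x)" for j x
  proof -
    have "poisson (S j) x = poisson (\<Theta> j) x + poisson (\<lambda>x. \<Theta> j (- x)) x"
      unfolding poisson_def S_def distrib_left
      by (intro Bochner_Integration.integral_add integrable_poisson_kernel_mult i\<Theta> i\<Theta>')
    then show ?thesis by (simp only: poisson_reflect)
  qed
  have PS0: "0 \<le> poisson (S j) x" for j x
    unfolding poisson_def using S0 by (intro integral_nonneg_AE AE_I2) (simp add: poisson_kernel_nonneg)
  have PSle: "poisson (S j) x \<le> (1 + x\<^sup>2) * (2 * c j)" for j x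
  proof -
    have "poisson (S j) x \<le> (LBINT y. (1 + x\<^sup>2) * (S j y / (1 + y\<^sup>2)))"
      unfolding poisson_def
    proof (rule integral_mono[OF iPS])
      show "integrable lborel (\<lambda>y. (1 + x\<^sup>2) * (S j y / (1 + y\<^sup>2)))"
        by (rule integrable_mult_right[OF iS])
      show "poisson_kernel 1 (x - y) * S j y \<le> (1 + x\<^sup>2) * (S j y / (1 + y\<^sup>2))" for y
        using mult_right_mono[OF poisson_kernel_1_le_weight S0] by simp
    qed
    also have "\<dots> = (1 + x\<^sup>2) * (LBINT y. S j y / (1 + y\<^sup>2))" by (rule integral_mult_right_zero)
    also have "\<dots> \<le> (1 + x\<^sup>2) * (2 * c j)" by (intro mult_left_mono vS) simp
    finally show ?thesis .
  qed
  have sPS: "summable (\<lambda>j. poisson (S j) x)" for x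
    by (rule summable_comparison_test'[where g="\<lambda>j. (1 + x\<^sup>2) * (2 * c j)" and N=0])
       (use PS0 PSle sc' in \<open>auto intro!: summable_mult simp: abs_of_nonneg\<close>)
  have P\<Omega>: "poisson \<Omega> x = (\<Sum>j. poisson (S j) x)" for x
  proof -
    have "poisson \<Omega> x = (LBINT y. (\<Sum>j. poisson_kernel 1 (x - y) * S j y))"
      unfolding poisson_def \<Omega>_def by (simp add: suminf_mult[OF sS])
    also have "\<dots> = (\<Sum>j. LBINT y. poisson_kernel 1 (x - y) * S j y)"
    proof (rule integral_suminf[OF iPS])
      have n: "norm (poisson_kernel 1 (x - y) * S j y) = poisson_kernel 1 (x - y) * S j y" for j y
        using S0 by (simp add: poisson_kernel_nonneg)
      show "AE y in lborel. summable (\<lambda>j. norm (poisson_kernel 1 (x - y) * S j y))"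
        unfolding n by (intro AE_I2 summable_mult sS)
      show "summable (\<lambda>j. LBINT y. norm (poisson_kernel 1 (x - y) * S j y))"
        unfolding n using sPS[of x] by (simp add: poisson_def)
    qed
    finally show ?thesis by (simp add: poisson_def)
  qed
  \<comment> \<open>The scales that are not far from x in the sense of
    \<open>poisson_far_le\<close>. Their window has ratio 72, which is less than 2^7.\<close>
  define N where "N x = {j::nat. x / 9 \<le> 2 ^ (m + j) \<and> 2 ^ (m + j) \<le> 8 * x}" for x :: real
  have N: "finite (N x)" "card (N x) \<le> 7" for x
  proof -
    have "finite (N x) \<and> card (N x) \<le> 7"
    proof (cases "x > 0")
      case True
      then have "8 * x < 2 ^ 7 * (x / 9)" by simp
      from card_dyadic_le[OF this] show ?thesis unfolding N_def by blast
    next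
      case False
      have "N x = {}"
      proof -
        have "\<not> 2 ^ (m + j) \<le> 8 * x" for j
        proof -
          have "(0::real) < 2 ^ (m + j)" by simp
          then show ?thesis using False by linarith
        qed
        then show ?thesis by (simp add: N_def)
      qed
      then show ?thesis by simp
    qed
    then show "finite (N x)" "card (N x) \<le> 7" by blast+
  qed
  have D: "- (a * of_bool (j \<in> N x) + 2 * c j) \<le> \<Theta> j x - poisson (\<Theta> j) x" for j x
  proof (cases "j \<in> N x")
    case True
    then show ?thesis using super[of j x] c0[of j] by simp
  next
    case False
    have "poisson (\<Theta> j) x \<le> 2 * c j"
      unfolding c_def
    proof (rule poisson_far_le[OF _ \<Theta>m \<Theta>0 supp i2])
      show "x < 2 ^ (m + j) / 8 \<or> 9 * 2 ^ (m + j) < x" using False by (auto simp: N_def)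
    qed auto
    then show ?thesis using False \<Theta>0[of j x] by simp
  qed
  have sN: "(\<lambda>j. a * of_bool (j \<in> N x)) sums (a * card (N x))" for x
  proof -
    have "(\<lambda>j. of_bool (j \<in> N x) :: real) sums (\<Sum>j\<in>N x. of_bool (j \<in> N x))"
      by (rule sums_finite) (use N in auto)
    then have "(\<lambda>j. a * of_bool (j \<in> N x)) sums (a * (\<Sum>j\<in>N x. of_bool (j \<in> N x)))" by (rule sums_mult)
    moreover have "(\<Sum>j\<in>N x. of_bool (j \<in> N x)) = (\<Sum>j\<in>N x. 1 :: real)" by (intro sum.cong) auto
    ultimately show ?thesis by simp
  qed
  have main: "poisson \<Omega> x - e \<le> \<Omega> x" for x
  proof -
    have "- (a * card (N x) + a * card (N (- x)) + 4 * suminf c) \<le> (\<Sum>j. S j x - poisson (S j) x)"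
    proof (rule sums_le)
      have "(\<lambda>j. - (a * of_bool (j \<in> N x) + a * of_bool (j \<in> N (- x)) + 4 * c j)) sums
        - (a * card (N x) + a * card (N (- x)) + 4 * suminf c)"
        by (rule sums_minus[OF sums_add[OF sums_add[OF sN sN] sums_mult[OF summable_sums[OF sc']]]])
      then show "(\<lambda>j. - (a * of_bool (j \<in> N x) + a * of_bool (j \<in> N (- x)) + 4 * c j)) sums
        - (a * card (N x) + a * card (N (- x)) + 4 * suminf c)" .
      show "(\<lambda>j. S j x - poisson (S j) x) sums (\<Sum>j. S j x - poisson (S j) x)"
        by (rule summable_sums[OF summable_diff[OF sS sPS]])
      show "- (a * of_bool (j \<in> N x) + a * of_bool (j \<in> N (- x)) + 4 * c j) \<le> S j x - poisson (S j) x" for j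
        using D[of j x] D[of j "-x"] unfolding PS S_def by simp
    qed
    also have "\<dots> = \<Omega> x - poisson \<Omega> x"
      unfolding P\<Omega> \<Omega>_def by (rule suminf_diff[OF sS sPS, symmetric])
    finally have "poisson \<Omega> x - (a * card (N x) + a * card (N (- x)) + 4 * suminf c) \<le> \<Omega> x" by simp
    moreover have 7: "a * card (N y) \<le> a * 7" for y using N[of y] a by (intro mult_left_mono) simp_all
    moreover have "suminf c \<le> a" using cle by (simp add: c_def[abs_def])
    ultimately have "poisson \<Omega> x - 18 * a \<le> \<Omega> x" using 7[of x] 7[of "- x"] by linarith
    moreover have "18 * a \<le> e" using e by (simp add: a_def)
    ultimately show ?thesis by linarith
  qed
  have W\<Omega>: "W x \<le> \<Omega> x" if x: "2 ^ m \<le> \<bar>x\<bar>" for x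
  proof -
    have "\<exists>j. \<bar>x\<bar> < 2 ^ (m + j)"
    proof -
      obtain n where "\<bar>x\<bar> < 2 ^ n" using real_arch_pow[of 2 "\<bar>x\<bar>"] by auto
      also have "(2::real) ^ n \<le> 2 ^ (m + n)" by (intro power_increasing) auto
      finally show ?thesis by blast
    qed
    then obtain n where n: "\<bar>x\<bar> < 2 ^ (m + n)" by blast
    have "\<exists>i. 2 ^ (m + i) \<le> \<bar>x\<bar> \<and> \<bar>x\<bar> < 2 * 2 ^ (m + i)"
      using n
    proof (induction n)
      case 0
      then show ?case using x by simp
    next
      case (Suc n)
      then show ?case by (cases "\<bar>x\<bar> < 2 ^ (m + n)") (auto simp: not_less)
    qed
    then obtain i where "2 ^ (m + i) \<le> \<bar>x\<bar>" "\<bar>x\<bar> < 2 * 2 ^ (m + i)" by blast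
    then have "\<bar>x\<bar> \<in> {2 ^ (m + i)..2 * 2 ^ (m + i)}" by simp
    then have "W \<bar>x\<bar> \<le> \<Theta> i \<bar>x\<bar>" by (rule maj)
    also have "\<dots> \<le> S i x" using \<Theta>0 by (auto simp: S_def abs_if)
    also have "\<dots> \<le> \<Omega> x"
      unfolding \<Omega>_def using sum_le_suminf[OF sS, of "{i}" x] S0 by simp
    finally show ?thesis using even[of x] by (simp add: abs_if split: if_splits)
  qed
  show thesis by (rule that[OF \<Omega>m \<Omega>0 \<Omega>even \<Omega>le i\<Omega> W\<Omega> main])
qed

section \<open>Logarithmic integrals\<close>

text \<open>Since 1 - q w has positive real part on the closed disc, its principal logarithm is
  holomorphic there. The claim is the mean value property at 0, where the logarithm
  vanishes.\<close>

lemma integral_ln_cmod_circle: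
  assumes q: "cmod q < 1"
  shows "((\<lambda>t. ln (cmod (1 - q * cis t))) has_integral 0) {0..2*pi}"
proof -
  have pos: "Re (1 - q * w) > 0" if "cmod w \<le> 1" for w
  proof -
    have "Re (q * w) \<le> cmod (q * w)" by (rule complex_Re_le_cmod)
    also have "\<dots> \<le> cmod q * 1" unfolding norm_mult using that by (intro mult_left_mono) auto
    finally show ?thesis using q by simp
  qed
  have hol: "(\<lambda>w. Ln (1 - q * w)) holomorphic_on cball 0 1"
    by (intro holomorphic_intros) (use pos in \<open>auto simp: complex_nonpos_Reals_iff dest!: pos\<close>)
  have "((\<lambda>w. Ln (1 - q * w) / (w - 0)) has_contour_integral (2 * of_real pi * \<i> * Ln (1 - q * 0))) (circlepath 0 1)"
    by (rule Cauchy_integral_circlepath_simple[OF hol]) simp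
  then have "((\<lambda>w. Ln (1 - q * w) / w) has_contour_integral 0) (part_circlepath 0 1 0 (2 * pi))"
    by (simp add: circlepath_def)
  then have "((\<lambda>t. Ln (1 - q * (0 + 1 * cis t)) / (0 + 1 * cis t) * 1 * \<i> * cis t) has_integral 0) {0..2*pi}"
    by (subst (asm) has_contour_integral_part_circlepath_iff) simp_all
  then have "((\<lambda>t. \<i> * Ln (1 - q * cis t)) has_integral 0) {0..2*pi}"
    by (simp add: mult_ac)
  from has_integral_linear[OF this bounded_linear_Im]
  have "((\<lambda>t. Re (Ln (1 - q * cis t))) has_integral 0) {0..2*pi}" by (simp add: o_def)
  moreover have "Re (Ln (1 - q * cis t)) = ln (cmod (1 - q * cis t))" for t
  proof (rule Re_Ln)
    have "Re (1 - q * cis t) > 0" by (rule pos) simp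
    then show "1 - q * cis t \<noteq> 0" by (metis less_irrefl zero_complex.sel(1))
  qed
  ultimately show ?thesis by simp
qed

text \<open>The doubled angle is what the tangent substitution produces: the real line corresponds
  to \<theta> in an interval of length pi, hence to the full circle in 2 \<theta>.\<close>

lemma integral_ln_cmod_circle':
  assumes q: "cmod q < 1"
  shows "((\<lambda>t. ln (cmod (1 + q * cis (2 * t)))) has_integral 0) {-(pi/2)..pi/2}"
proof -
  have "((\<lambda>t. ln (cmod (1 - q * cis (2 *\<^sub>R t + pi)))) has_integral (1 / \<bar>2\<bar> ^ DIM(real)) *\<^sub>R 0)
      ((\<lambda>x. (1 / 2) *\<^sub>R x + - ((1 / 2) *\<^sub>R pi)) ` cbox 0 (2 * pi))"
    by (rule has_integral_affinity) (use integral_ln_cmod_circle[OF q] in auto)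
  moreover have "(\<lambda>x. (1 / 2) *\<^sub>R x + - ((1 / 2) *\<^sub>R pi)) ` cbox 0 (2 * pi) = {-(pi/2)..pi/2}"
    using image_affinity_atLeastAtMost[of "1/2" "-(pi/2)" 0 "2*pi"] by (simp add: field_simps)
  moreover have "cis (2 * t + pi) = - cis (2 * t)" for t by (simp add: complex_eq_iff)
  ultimately show ?thesis by simp
qed

lemma cmod_diff_of_real_ratio_le:
  assumes "Im w > 0"
  shows "cmod (z - of_real t) / cmod (w - of_real t) \<le> 1 + cmod (z - w) / Im w"
proof -
  have "Im w \<le> cmod (w - of_real t)" using abs_Im_le_cmod[of "w - of_real t"] by simp
  moreover from this have "cmod (w - of_real t) > 0" using assms by linarith
  ultimately have p: "cmod (w - of_real t) > 0" "cmod (z - w) / cmod (w - of_real t) \<le> cmod (z - w) / Im w"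
    using assms by (auto intro!: divide_left_mono mult_pos_pos)
  have "cmod (z - of_real t) \<le> cmod (z - w) + cmod (w - of_real t)"
    using norm_triangle_ineq[of "z - w" "w - of_real t"] by simp
  then have "cmod (z - of_real t) / cmod (w - of_real t) \<le> (cmod (z - w) + cmod (w - of_real t)) / cmod (w - of_real t)"
    using p by (intro divide_right_mono) auto
  also have "\<dots> = 1 + cmod (z - w) / cmod (w - of_real t)" using p by (simp add: add_divide_distrib)
  finally show ?thesis using p by simp
qed

lemma of_real_neq: "Im z > 0 \<Longrightarrow> z \<noteq> of_real t"
  by auto

lemma abs_ln_cmod_ratio_le:
  assumes "Im z > 0" "Im w > 0"
  shows "\<bar>ln (cmod (z - of_real t)) - ln (cmod (w - of_real t))\<bar> \<le> cmod (z - w) / Im w + cmod (z - w) / Im z"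
proof -
  have n: "cmod (z - of_real t) > 0" "cmod (w - of_real t) > 0"
    using of_real_neq[OF assms(1)] of_real_neq[OF assms(2)] by auto
  have 1: "ln (cmod (z - of_real t)) - ln (cmod (w - of_real t)) \<le> cmod (z - w) / Im w"
    if "Im w > 0" "cmod (z - of_real t) > 0" "cmod (w - of_real t) > 0" for z w
    using cmod_diff_of_real_ratio_le[OF that(1), of z t] that
      ln_le_minus_one[of "cmod (z - of_real t) / cmod (w - of_real t)"]
    by (simp add: ln_div)
  have "cmod (z - w) / Im w \<ge> 0" "cmod (z - w) / Im z \<ge> 0" using assms by auto
  then show ?thesis
    using 1[OF assms(2) n] 1[OF assms(1) n(2,1)] by (simp add: norm_minus_commute abs_le_iff)
qed

text \<open>Under t = tan \<theta> the Poisson measure of height one becomes the uniform measure.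
  The modulus of z - tan \<theta> is |z + i| / 2 times |1 + q cis (2 \<theta>)| divided by cos
  \<theta>, and 1 / cos \<theta> is |i - tan \<theta>|, so the subtracted logarithm cancels it. The
  factor involving q has logarithmic mean zero on the circle.\<close>

lemma
  assumes z: "Im z > 0"
  shows integral_poisson_ln_1:
    "(LBINT t. (ln (cmod (z - of_real t)) - ln (cmod (\<i> - of_real t))) * poisson_kernel 1 t) = ln (cmod (z + \<i>) / 2)"
    (is ?v)
    and integrable_poisson_ln_1:
    "integrable lborel (\<lambda>t. (ln (cmod (z - of_real t)) - ln (cmod (\<i> - of_real t))) * poisson_kernel 1 t)"
    (is ?i)
proof -
  let ?\<phi> = "\<lambda>t. ln (cmod (z - of_real t)) - ln (cmod (\<i> - of_real t))"
  show i: ?i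
  proof (rule Bochner_Integration.integrable_bound)
    show "integrable lborel (\<lambda>t. (cmod (z - \<i>) / Im \<i> + cmod (z - \<i>) / Im z) * poisson_kernel 1 t)"
      using integrable_poisson_kernel[of 1] by simp
    show "AE t in lborel. norm (?\<phi> t * poisson_kernel 1 t)
      \<le> norm ((cmod (z - \<i>) / Im \<i> + cmod (z - \<i>) / Im z) * poisson_kernel 1 t)"
    proof (rule AE_I2)
      fix t
      have "\<bar>?\<phi> t\<bar> \<le> \<bar>cmod (z - \<i>) / Im \<i> + cmod (z - \<i>) / Im z\<bar>"
        using abs_ln_cmod_ratio_le[OF z, of \<i> t] by simp
      then show "norm (?\<phi> t * poisson_kernel 1 t)
      \<le> norm ((cmod (z - \<i>) / Im \<i> + cmod (z - \<i>) / Im z) * poisson_kernel 1 t)"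
        unfolding real_norm_def abs_mult by (intro mult_right_mono) auto
    qed
  qed measurable
  \<comment> \<open>The Cayley transform maps z into the unit disc. The conjugate turns the angle -
    2 \<theta> of the factorisation into 2 \<theta>.\<close>
  define q where "q = cnj ((z - \<i>) / (z + \<i>))"
  have zi: "cmod (z - \<i>) < cmod (z + \<i>)" 
  proof (rule power2_less_imp_less)
    show "(cmod (z - \<i>))\<^sup>2 < (cmod (z + \<i>))\<^sup>2"
      unfolding cmod_power2 using z by (simp add: power2_eq_square algebra_simps)
  qed simp
  then have q2: "cmod (z + \<i>) > 0" using norm_ge_zero[of "z - \<i>"] by linarith
  have "cmod q = cmod (z - \<i>) / cmod (z + \<i>)"
    unfolding q_def by (simp only: complex_mod_cnj norm_divide)
  then have q: "cmod q < 1" "cmod (z + \<i>) > 0"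
    using zi q2 by simp_all
  have eq: "?\<phi> (tan \<theta>) = ln (cmod (z + \<i>) / 2) + ln (cmod (1 + q * cis (2 * \<theta>)))"
    if \<theta>: "- (pi/2) < \<theta>" "\<theta> < pi/2" for \<theta>
  proof -
    have c: "cos \<theta> > 0" using \<theta> by (intro cos_gt_zero_pi) auto
    have *: "cmod (w - of_real (tan \<theta>)) = cmod (w * cos \<theta> - sin \<theta>) / cos \<theta>" for w
    proof -
      have "w - of_real (tan \<theta>) = (w * cos \<theta> - sin \<theta>) / of_real (cos \<theta>)"
        using c by (simp add: tan_def field_simps)
      then show ?thesis using c by (simp add: norm_divide)
    qed
    have i1: "cmod (\<i> * cos \<theta> - sin \<theta>) = 1"
    proof -
      have "\<i> * cos \<theta> - sin \<theta> = \<i> * cis \<theta>" by (simp add: complex_eq_iff)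
      then show ?thesis by (simp add: norm_mult)
    qed
    have "z * cos \<theta> - sin \<theta> = cis \<theta> * ((z + \<i>) / 2) * (1 + (z - \<i>) / (z + \<i>) * cis (- 2 * \<theta>))"
    proof -
      have "z + \<i> \<noteq> 0" using q by auto
      then have "(z + \<i>) * (1 + (z - \<i>) / (z + \<i>) * c) = (z + \<i>) + (z - \<i>) * c" for c
        by (simp add: distrib_left)
      then have "cis \<theta> * ((z + \<i>) / 2) * (1 + (z - \<i>) / (z + \<i>) * cis (- 2 * \<theta>))
        = cis \<theta> * ((z + \<i>) + (z - \<i>) * cis (- 2 * \<theta>)) / 2"
        by (metis (no_types, lifting) mult.assoc times_divide_eq_left times_divide_eq_right)
      also have "\<dots> = (cis \<theta> * (z + \<i>) + (cis \<theta> * cis (- 2 * \<theta>)) * (z - \<i>)) / 2"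
        by (simp add: algebra_simps)
      also have "cis \<theta> * cis (- 2 * \<theta>) = cis (- \<theta>)" by (simp add: cis_mult)
      also have "(cis \<theta> * (z + \<i>) + cis (- \<theta>) * (z - \<i>)) / 2 = z * cos \<theta> - sin \<theta>"
        by (simp add: complex_eq_iff field_simps)
      finally show ?thesis by simp
    qed
    then have "cmod (z * cos \<theta> - sin \<theta>) = cmod (z + \<i>) / 2 * cmod (1 + (z - \<i>) / (z + \<i>) * cis (- 2 * \<theta>))"
      by (simp only: norm_mult norm_divide norm_cis) simp
    also have "cmod (1 + (z - \<i>) / (z + \<i>) * cis (- 2 * \<theta>)) = cmod (cnj (1 + (z - \<i>) / (z + \<i>) * cis (- 2 * \<theta>)))"
      by (simp only: complex_mod_cnj)
    also have "cnj (1 + (z - \<i>) / (z + \<i>) * cis (- 2 * \<theta>)) = 1 + q * cis (2 * \<theta>)"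
      by (simp add: q_def cis_cnj)
    finally have m: "cmod (z * cos \<theta> - sin \<theta>) = cmod (z + \<i>) / 2 * cmod (1 + q * cis (2 * \<theta>))" .
    have "cmod (z - tan \<theta>) > 0" using of_real_neq[OF z] by simp
    then have p: "cmod (z * cos \<theta> - sin \<theta>) > 0" using c by (simp add: * zero_less_divide_iff)
    then have p': "cmod (1 + q * cis (2 * \<theta>)) > 0" using q(2) by (simp add: m zero_less_mult_iff)
    have "?\<phi> (tan \<theta>) = ln (cmod (z * cos \<theta> - sin \<theta>))"
      using p c by (simp add: * i1 ln_div)
    also have "\<dots> = ln (cmod (z + \<i>) / 2) + ln (cmod (1 + q * cis (2 * \<theta>)))"
      unfolding m using q(2) p' by (intro ln_mult_pos) auto
    finally show ?thesis .
  qed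
  define G where "G \<theta> = ln (cmod (z + \<i>) / 2) + ln (cmod (1 + q * cis (2 * \<theta>)))" for \<theta>
  have nz: "1 + q * cis \<theta> \<noteq> 0" for \<theta>
  proof
    assume "1 + q * cis \<theta> = 0"
    then have "q * cis \<theta> = -1" by (simp add: add_eq_0_iff)
    then have "cmod (q * cis \<theta>) = 1" by simp
    then show False using q(1) by (simp add: norm_mult)
  qed
  have contG: "continuous_on A G" for A
    unfolding G_def by (intro continuous_intros) (use nz in auto)
  have hG: "(G has_integral pi * ln (cmod (z + \<i>) / 2)) {-(pi/2)..pi/2}"
  proof -
    have "((\<lambda>\<theta>. ln (cmod (z + \<i>) / 2)) has_integral pi * ln (cmod (z + \<i>) / 2)) {-(pi/2)..pi/2}"
      using has_integral_const_real[of "ln (cmod (z + \<i>) / 2)" "-(pi/2)" "pi/2"] by simp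
    from has_integral_add[OF this integral_ln_cmod_circle'[OF q(1)]]
    show ?thesis unfolding G_def by simp
  qed
  have iG: "set_integrable lborel {-(pi/2)..pi/2} G"
    unfolding set_integrable_def by (intro borel_integrable_compact contG) simp_all
  have iG': "set_integrable lborel (einterval (ereal (-(pi/2))) (ereal (pi/2))) G"
    by (rule set_integrable_subset[OF iG]) (auto simp: einterval_def)
  have "(LBINT x=-\<infinity>..\<infinity>. ?\<phi> x * inverse (1 + x\<^sup>2))
     = (LBINT \<theta>=ereal (-(pi/2))..ereal (pi/2). (1 + (tan \<theta>)\<^sup>2) *\<^sub>R (?\<phi> (tan \<theta>) * inverse (1 + (tan \<theta>)\<^sup>2)))"
  proof (rule interval_integral_substitution_integrable)
    fix x assume x: "ereal (-(pi/2)) < ereal x" "ereal x < ereal (pi/2)"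
    then have c: "cos x > 0" by (intro cos_gt_zero_pi) auto
    show "(tan has_real_derivative 1 + (tan x)\<^sup>2) (at x)"
      using c by (subst tan_sec) (auto intro!: DERIV_tan simp: power_inverse)
    show "isCont (\<lambda>x. ?\<phi> x * inverse (1 + x\<^sup>2)) (tan x)"
      by (intro continuous_intros) (use of_real_neq[OF z] of_real_neq[of \<i>] in \<open>auto simp: add_nonneg_eq_0_iff\<close>)
    show "isCont (\<lambda>x. 1 + (tan x)\<^sup>2) x" using c by (intro continuous_intros) auto
  next
    show "((ereal \<circ> tan \<circ> real_of_ereal) \<longlongrightarrow> -\<infinity>) (at_right (ereal (-(pi/2))))"
      by (simp add: ereal_tendsto_simps filterlim_tan_at_right)
    show "((ereal \<circ> tan \<circ> real_of_ereal) \<longlongrightarrow> \<infinity>) (at_left (ereal (pi/2)))"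
      by (simp add: ereal_tendsto_simps filterlim_tan_at_left)
    have "(1 + (tan x)\<^sup>2) *\<^sub>R (?\<phi> (tan x) * inverse (1 + (tan x)\<^sup>2)) = G x"
      if "x \<in> einterval (ereal (-(pi/2))) (ereal (pi/2))" for x
      using that by (subst eq) (auto simp: einterval_def G_def add_nonneg_eq_0_iff)
    then show "set_integrable lborel (einterval (ereal (-(pi/2))) (ereal (pi/2)))
       (\<lambda>x. (1 + (tan x)\<^sup>2) *\<^sub>R (?\<phi> (tan x) * inverse (1 + (tan x)\<^sup>2)))"
      using iG' by (subst set_integrable_cong[OF refl refl, of _ _ G]) auto
    have "integrable lborel (\<lambda>t. pi * (?\<phi> t * poisson_kernel 1 t))" by (rule integrable_mult_right[OF i])
    moreover have "pi * (?\<phi> t * poisson_kernel 1 t) = ?\<phi> t * inverse (1 + t\<^sup>2)" for t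
      by (simp add: poisson_kernel_1 divide_inverse inverse_mult_distrib)
    ultimately show "set_integrable lborel (einterval (-\<infinity>) \<infinity>) (\<lambda>x. ?\<phi> x * inverse (1 + x\<^sup>2))"
      by (simp add: set_integrable_def einterval_def)
  qed auto
  also have "\<dots> = (LBINT \<theta>=ereal (-(pi/2))..ereal (pi/2). G \<theta>)"
    by (intro interval_integral_cong) (auto simp: einterval_def eq G_def add_nonneg_eq_0_iff)
  also have "\<dots> = integral {-(pi/2)..pi/2} G"
    using iG by (intro interval_integral_eq_integral) auto
  also have "\<dots> = pi * ln (cmod (z + \<i>) / 2)" using hG by (rule integral_unique)
  finally have "(LBINT x. ?\<phi> x * inverse (1 + x\<^sup>2)) = pi * ln (cmod (z + \<i>) / 2)"
    by (simp add: interval_lebesgue_integral_def set_lebesgue_integral_def einterval_def)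
  moreover have "?\<phi> t * poisson_kernel 1 t = (1 / pi) * (?\<phi> t * inverse (1 + t\<^sup>2))" for t
    by (simp add: poisson_kernel_1 field_simps)
  ultimately show ?v by simp
qed

text \<open>Averaging at height r moves z to z + i r. Substituting u + r t reduces this to height
  one at the origin; z and the normalising point i are both transformed, so the result is a
  difference of two instances of the previous lemma, in which the powers of r cancel.\<close>

lemma
  assumes z: "Im z > 0" and r: "r > 0"
  shows integral_poisson_ln:
    "(LBINT t. (ln (cmod (z - of_real t)) - ln (cmod (\<i> - of_real t))) * poisson_kernel r (t - u))
      = ln (cmod (z - u + \<i> * r)) - ln (cmod (\<i> - u + \<i> * r))" (is ?v)
    and integrable_poisson_ln:
    "integrable lborel (\<lambda>t. (ln (cmod (z - of_real t)) - ln (cmod (\<i> - of_real t))) * poisson_kernel r (t - u))"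
    (is ?i)
proof -
  let ?\<phi> = "\<lambda>w t. ln (cmod (w - of_real t)) - ln (cmod (\<i> - of_real t))"
  let ?f = "\<lambda>t. ?\<phi> z t * poisson_kernel r (t - u)"
  let ?w1 = "(z - u) / r" and ?w2 = "(\<i> - u) / r"
  have im: "Im ?w1 > 0" "Im ?w2 > 0" using z r by auto
  have k: "poisson_kernel r (r * t) = poisson_kernel 1 t / r" for t
  proof -
    have "r\<^sup>2 + (r * t)\<^sup>2 = r * (r * (1\<^sup>2 + t\<^sup>2))" by (simp add: power2_eq_square algebra_simps)
    then show ?thesis using r by (simp add: poisson_kernel_def)
  qed
  have \<phi>: "?\<phi> z (u + r * t) = ?\<phi> ?w1 t - ?\<phi> ?w2 t" for t
  proof -
    have *: "ln (cmod (w - of_real (u + r * t))) = ln r + ln (cmod ((w - u) / r - of_real t))" if "Im w > 0" for w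
    proof -
      have "w - of_real (u + r * t) = of_real r * ((w - u) / r - of_real t)" using r by (simp add: field_simps)
      then have "cmod (w - of_real (u + r * t)) = r * cmod ((w - u) / r - of_real t)"
        using r by (simp only: norm_mult norm_of_real abs_of_pos)
      moreover have "cmod ((w - u) / r - of_real t) > 0"
        using of_real_neq[of "(w - u) / r" t] that r by simp
      ultimately show ?thesis using r by (simp add: ln_mult_pos)
    qed
    show ?thesis using *[OF z] *[of \<i>] by simp
  qed
  have eq: "?f (u + r * t) = (?\<phi> ?w1 t * poisson_kernel 1 t - ?\<phi> ?w2 t * poisson_kernel 1 t) / r" for t
    unfolding \<phi> using k[of t] by (simp add: left_diff_distrib diff_divide_distrib)
  have "integrable lborel (\<lambda>t. ?f (u + r * t))"
    unfolding eq using integrable_poisson_ln_1[OF im(1)] integrable_poisson_ln_1[OF im(2)] by auto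
  then show ?i using lborel_integrable_real_affine_iff[of r ?f u] r by blast
  have "(LBINT t. ?f t) = r * (LBINT t. ?f (u + r * t))"
    using lborel_integral_real_affine[of r ?f u] r by simp
  also have "\<dots> = ln (cmod (?w1 + \<i>) / 2) - ln (cmod (?w2 + \<i>) / 2)"
    unfolding eq using integrable_poisson_ln_1[OF im(1)] integrable_poisson_ln_1[OF im(2)] r
    by (simp only: integral_divide_zero Bochner_Integration.integral_diff integral_poisson_ln_1[OF im(1)] integral_poisson_ln_1[OF im(2)]) simp
  also have "\<dots> = ln (cmod (z - u + \<i> * r)) - ln (cmod (\<i> - u + \<i> * r))"
  proof -
    have *: "ln (cmod ((w - u) / r + \<i>) / 2) = ln (cmod (w - u + \<i> * r)) - ln (r * 2)" if "Im w > 0" for w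
    proof -
      have "(w - u) / r + \<i> = (w - u + \<i> * r) / r" using r by (simp add: field_simps)
      then have "cmod ((w - u) / r + \<i>) / 2 = cmod (w - u + \<i> * r) / (r * 2)"
        using r by (simp only: norm_divide norm_of_real) simp
      moreover have "w - u + \<i> * r \<noteq> 0"
        using that r by (auto simp: complex_eq_iff)
      ultimately show ?thesis using r by (simp add: ln_div)
    qed
    show ?thesis using *[OF z] *[of \<i>] by simp
  qed
  finally show ?v .
qed

text \<open>The logarithmic modulus of the factor 1 - (1 + z^2) / (1 + t^2), whose zeros in z are t
  and - t. Normalising factors to be 1 at z = i, rather than at 0, keeps them regular at t = 0 and
  makes the logarithm decay like 1 / t^2.\<close>

definition log_factor :: "complex \<Rightarrow> real \<Rightarrow> real" where
  "log_factor z t = ln (cmod ((of_real t)\<^sup>2 - z\<^sup>2) / (t\<^sup>2 + 1))"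

lemma measurable_log_factor [measurable]: "log_factor z \<in> borel_measurable borel"
  unfolding log_factor_def by measurable

text \<open>The point - z lies in the lower half-plane. Its mirror image - cnj z has the same
  distance to every real t and lies in the upper half-plane, where the formulas for a single
  logarithm apply.\<close>

lemma log_factor_eq:
  assumes z: "Im z > 0"
  shows "log_factor z t = (ln (cmod (z - of_real t)) - ln (cmod (\<i> - of_real t)))
    + (ln (cmod (- cnj z - of_real t)) - ln (cmod (\<i> - of_real t)))"
proof -
  have "(of_real t)\<^sup>2 - z\<^sup>2 = - (z - of_real t) * (z + of_real t)" by (simp add: power2_eq_square algebra_simps)
  then have "cmod ((of_real t)\<^sup>2 - z\<^sup>2) = cmod (z - of_real t) * cmod (z + of_real t)"
    by (simp add: norm_mult norm_minus_commute)
  also have "cmod (z + of_real t) = cmod (cnj (z + of_real t))" by (simp only: complex_mod_cnj)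
  also have "\<dots> = cmod (- cnj z - of_real t)" by (subst norm_minus_cancel[symmetric]) simp
  finally have 1: "cmod ((of_real t)\<^sup>2 - z\<^sup>2) = cmod (z - of_real t) * cmod (- cnj z - of_real t)" .
  have 2: "t\<^sup>2 + 1 = cmod (\<i> - of_real t) * cmod (\<i> - of_real t)"
    by (simp add: cmod_def power2_eq_square[symmetric] real_sqrt_pow2)
  have "cmod (z - of_real t) > 0" "cmod (- cnj z - of_real t) > 0" "cmod (\<i> - of_real t) > 0"
    using of_real_neq[OF z, of t] of_real_neq[of "- cnj z" t] of_real_neq[of \<i> t] z by auto
  then show ?thesis unfolding log_factor_def 1 2 by (simp add: ln_div ln_mult_pos)
qed

lemma log_factor_even: "log_factor z (- t) = log_factor z t"
  by (simp add: log_factor_def)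

lemma integral_poisson_log_factor:
  assumes z: "Im z > 0" and r: "r > 0"
  shows "(LBINT t. log_factor z t * poisson_kernel r (t - u))
    = ln (cmod ((of_real u)\<^sup>2 - (z + \<i> * r)\<^sup>2)) - ln (u\<^sup>2 + (1 + r)\<^sup>2)"
proof -
  have z': "Im (- cnj z) > 0" using z by simp
  note i = integrable_poisson_ln[OF z r, of u] integrable_poisson_ln[OF z' r, of u]
  have "(LBINT t. log_factor z t * poisson_kernel r (t - u)) =
     (ln (cmod (z - u + \<i> * r)) - ln (cmod (\<i> - u + \<i> * r)))
    + (ln (cmod (- cnj z - u + \<i> * r)) - ln (cmod (\<i> - u + \<i> * r)))"
    unfolding log_factor_eq[OF z] distrib_right
    by (subst Bochner_Integration.integral_add[OF i]) (simp only: integral_poisson_ln[OF z r] integral_poisson_ln[OF z' r])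
  also have "\<dots> = log_factor (z + \<i> * r) u - log_factor (\<i> + \<i> * r) u"
    using z r by (subst log_factor_eq, simp)+ (simp add: algebra_simps)
  also have "\<dots> = ln (cmod ((of_real u)\<^sup>2 - (z + \<i> * r)\<^sup>2)) - ln (u\<^sup>2 + (1 + r)\<^sup>2)"
  proof -
    have p: "u\<^sup>2 + 1 > 0" "u\<^sup>2 + (1 + r)\<^sup>2 > 0" using r by (simp_all add: add_nonneg_pos)
    have "(of_real u)\<^sup>2 - (\<i> + \<i> * r)\<^sup>2 = of_real (u\<^sup>2 + (1 + r)\<^sup>2)"
      by (simp add: power2_eq_square algebra_simps)
    then have "cmod ((of_real u)\<^sup>2 - (\<i> + \<i> * r)\<^sup>2) = u\<^sup>2 + (1 + r)\<^sup>2"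
      using p by (simp only: norm_of_real abs_of_pos)
    moreover have "cmod ((of_real u)\<^sup>2 - (z + \<i> * r)\<^sup>2) > 0"
    proof -
      have "(of_real u)\<^sup>2 - (z + \<i> * r)\<^sup>2 = (of_real u - (z + \<i> * r)) * (of_real u + (z + \<i> * r))"
        by (simp add: power2_eq_square algebra_simps)
      moreover have "of_real u - (z + \<i> * r) \<noteq> 0" "of_real u + (z + \<i> * r) \<noteq> 0"
        using z r by (auto simp: complex_eq_iff)
      ultimately show ?thesis by simp
    qed
    ultimately show ?thesis unfolding log_factor_def using p by (simp add: ln_div)
  qed
  finally show ?thesis .
qed

text \<open>The modulus r inside the logarithm differs from 1 by at most v = |z^2 + 1| / (t^2 + 1),
  so ln r <= v. For the lower bound, - ln r <= (1 - r) / r, and 1 / r is bounded by M^2 because Im z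
  > 0.\<close>

lemma log_factor_bound:
  assumes z: "Im z > 0"
  obtains C where "C \<ge> 0" "\<And>t. \<bar>log_factor z t\<bar> \<le> C / (1 + t\<^sup>2)"
proof -
  define M where "M = 1 + cmod (z - \<i>) / Im z"
  have M: "M \<ge> 1" using z by (simp add: M_def)
  have b: "\<bar>log_factor z t\<bar> \<le> M\<^sup>2 * cmod (z\<^sup>2 + 1) / (1 + t\<^sup>2)" for t
  proof -
    define r where "r = cmod ((of_real t)\<^sup>2 - z\<^sup>2) / (t\<^sup>2 + 1)"
    define v where "v = cmod (z\<^sup>2 + 1) / (t\<^sup>2 + 1)"
    have p: "t\<^sup>2 + 1 > 0" by (simp add: add_nonneg_pos)
    have v0: "v \<ge> 0" by (simp add: v_def)
    have f: "(of_real t)\<^sup>2 - z\<^sup>2 = - (z - of_real t) * (z + of_real t)" for z :: complex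
      by (simp add: power2_eq_square algebra_simps)
    have n: "cmod ((of_real t)\<^sup>2 - z\<^sup>2) > 0"
      unfolding f using z by (auto simp: complex_eq_iff)
    then have r0: "r > 0" using p by (simp add: r_def)
    have t1: "cmod (of_real (t\<^sup>2 + 1)) = t\<^sup>2 + 1" using p by (simp only: norm_of_real abs_of_pos)
    have "cmod ((of_real t)\<^sup>2 - z\<^sup>2) \<le> cmod (of_real (t\<^sup>2 + 1)) + cmod (z\<^sup>2 + 1)"
      using norm_triangle_ineq4[of "of_real (t\<^sup>2 + 1)" "z\<^sup>2 + 1"] by simp
    then have "r \<le> (t\<^sup>2 + 1 + cmod (z\<^sup>2 + 1)) / (t\<^sup>2 + 1)"
      unfolding r_def t1 using p by (intro divide_right_mono) auto
    then have r1: "r \<le> 1 + v" using p by (simp add: v_def add_divide_distrib[of "t\<^sup>2 + 1"])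
    have "cmod (of_real (t\<^sup>2 + 1)) \<le> cmod ((of_real t)\<^sup>2 - z\<^sup>2) + cmod (z\<^sup>2 + 1)"
      using norm_triangle_ineq[of "(of_real t)\<^sup>2 - z\<^sup>2" "z\<^sup>2 + 1"] by simp
    then have "(t\<^sup>2 + 1 - cmod (z\<^sup>2 + 1)) / (t\<^sup>2 + 1) \<le> r"
      unfolding r_def t1 using p by (intro divide_right_mono) auto
    then have r2: "1 - v \<le> r" using p by (simp add: v_def diff_divide_distrib[of "t\<^sup>2 + 1"])
    have "(t\<^sup>2 + 1) / cmod ((of_real t)\<^sup>2 - z\<^sup>2)
      = cmod (\<i> - of_real t) / cmod (z - of_real t) * (cmod (\<i> - of_real (- t)) / cmod (z - of_real (- t)))"
    proof -
      have "(of_real t)\<^sup>2 - \<i>\<^sup>2 = of_real (t\<^sup>2 + 1)" by simp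
      then have "t\<^sup>2 + 1 = cmod ((of_real t)\<^sup>2 - \<i>\<^sup>2)" using t1 by (simp only:)
      then show ?thesis unfolding f by (simp add: norm_mult norm_minus_commute)
    qed
    also have "\<dots> \<le> M * M"
      unfolding M_def norm_minus_commute[of z \<i>]
      by (intro mult_mono cmod_diff_of_real_ratio_le[OF z]) (use z in auto)
    finally have rM: "1 / r \<le> M\<^sup>2" by (simp add: r_def power2_eq_square)
    have "ln r \<le> r - 1" by (rule ln_le_minus_one[OF r0])
    then have up: "ln r \<le> v" using r1 by linarith
    have "- ln r = ln (1 / r)" using r0 by (simp add: ln_div)
    also have "\<dots> \<le> 1 / r - 1" using r0 by (intro ln_le_minus_one) simp
    also have "\<dots> = (1 - r) * (1 / r)" using r0 by (simp add: field_simps)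
    also have "\<dots> \<le> v * (1 / r)" using r0 r2 by (intro mult_right_mono) auto
    also have "\<dots> \<le> v * M\<^sup>2" by (intro mult_left_mono rM v0)
    finally have lo: "- ln r \<le> M\<^sup>2 * v" by (simp add: mult.commute)
    have "1 * v \<le> M\<^sup>2 * v" using M by (intro mult_right_mono v0) (simp add: one_le_power)
    then have "\<bar>ln r\<bar> \<le> M\<^sup>2 * v" using up lo by simp
    then show ?thesis by (simp add: log_factor_def r_def v_def add.commute)
  qed
  show thesis by (rule that[of "M\<^sup>2 * cmod (z\<^sup>2 + 1)"]) (use b in auto)
qed

lemma integrable_weight: "integrable lborel (\<lambda>t::real. C / (1 + t\<^sup>2))"
  using integrable_mult_right[OF integrable_poisson_kernel[of 1], of "C * pi"]
  by (simp add: poisson_kernel_1)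

text \<open>As r grows, pi r times the Poisson kernel of height r increases to 1, so the integral is
  the limit of pi r ln (|z + i r|^2 / (1 + r)^2). Its linear dependence on Im z is the source of the
  exponential type of the product.\<close>

lemma
  assumes z: "Im z > 0"
  shows integrable_log_factor: "integrable lborel (log_factor z)"
    and integral_log_factor: "(LBINT t. log_factor z t) = 2 * pi * (Im z - 1)"
proof -
  obtain C where C: "C \<ge> 0" "\<And>t. \<bar>log_factor z t\<bar> \<le> C / (1 + t\<^sup>2)"
    using log_factor_bound[OF z] by blast
  show i: "integrable lborel (log_factor z)"
    by (rule Bochner_Integration.integrable_bound[OF integrable_weight[of C]])
       (use C in \<open>auto intro: order_trans\<close>)
  let ?r = "\<lambda>n::nat. real n + 1"
  have "(\<lambda>n. LBINT t. pi * ?r n * (log_factor z t * poisson_kernel (?r n) (t - 0))) \<longlonglongrightarrow> (LBINT t. log_factor z t)"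
  proof (rule integral_dominated_convergence[OF _ _ integrable_weight[of C]])
    have k: "pi * ?r n * (log_factor z t * poisson_kernel (?r n) (t - 0)) = log_factor z t * ((?r n)\<^sup>2 / ((?r n)\<^sup>2 + t\<^sup>2))" for n t
      by (simp add: poisson_kernel_def power2_eq_square)
    show "AE t in lborel. (\<lambda>n. pi * ?r n * (log_factor z t * poisson_kernel (?r n) (t - 0))) \<longlonglongrightarrow> log_factor z t"
    proof (rule AE_I2)
      fix t
      have "(\<lambda>n. (?r n)\<^sup>2 / ((?r n)\<^sup>2 + t\<^sup>2)) \<longlonglongrightarrow> 1" by real_asymp
      from tendsto_mult[OF tendsto_const this, of "log_factor z t"]
      show "(\<lambda>n. pi * ?r n * (log_factor z t * poisson_kernel (?r n) (t - 0))) \<longlonglongrightarrow> log_factor z t"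
        unfolding k by simp
    qed
    show "AE t in lborel. norm (pi * ?r n * (log_factor z t * poisson_kernel (?r n) (t - 0))) \<le> C / (1 + t\<^sup>2)" for n
    proof (rule AE_I2)
      fix t
      have q: "\<bar>(?r n)\<^sup>2 / ((?r n)\<^sup>2 + t\<^sup>2)\<bar> \<le> 1" by (simp add: divide_le_eq add_pos_nonneg)
      have "\<bar>log_factor z t\<bar> * \<bar>(?r n)\<^sup>2 / ((?r n)\<^sup>2 + t\<^sup>2)\<bar> \<le> \<bar>log_factor z t\<bar> * 1"
        by (intro mult_left_mono q) simp
      then show "norm (pi * ?r n * (log_factor z t * poisson_kernel (?r n) (t - 0))) \<le> C / (1 + t\<^sup>2)"
        unfolding k real_norm_def abs_mult using C(2)[of t] by simp
    qed
  qed measurable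
  moreover have "(\<lambda>n. LBINT t. pi * ?r n * (log_factor z t * poisson_kernel (?r n) (t - 0))) \<longlonglongrightarrow> 2 * pi * (Im z - 1)"
  proof -
    have e: "(LBINT t. pi * ?r n * (log_factor z t * poisson_kernel (?r n) (t - 0)))
       = pi * ?r n * ln (((Re z)\<^sup>2 + (Im z + ?r n)\<^sup>2) / (1 + ?r n)\<^sup>2)" for n
    proof -
      have "(LBINT t. pi * ?r n * (log_factor z t * poisson_kernel (?r n) (t - 0)))
        = pi * ?r n * (ln (cmod ((z + \<i> * ?r n)\<^sup>2)) - ln ((1 + ?r n)\<^sup>2))"
        using integral_poisson_log_factor[OF z, of "?r n" 0]
        by (subst integral_mult_right_zero) simp
      also have "cmod ((z + \<i> * ?r n)\<^sup>2) = (Re z)\<^sup>2 + (Im z + ?r n)\<^sup>2"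
        by (simp add: norm_power cmod_power2)
      also have "ln ((Re z)\<^sup>2 + (Im z + ?r n)\<^sup>2) - ln ((1 + ?r n)\<^sup>2) = ln (((Re z)\<^sup>2 + (Im z + ?r n)\<^sup>2) / (1 + ?r n)\<^sup>2)"
        using z by (subst ln_div) (auto simp: add_nonneg_pos)
      finally show ?thesis .
    qed
    show ?thesis unfolding e by real_asymp
  qed
  ultimately show "(LBINT t. log_factor z t) = 2 * pi * (Im z - 1)"
    by (rule LIMSEQ_unique)
qed

lemma integrable_le_nonneg:
  fixes f g :: "'a \<Rightarrow> real"
  assumes "integrable M g" "f \<in> borel_measurable M" "\<And>x. 0 \<le> f x" "\<And>x. f x \<le> g x"
  shows "integrable M f"
proof (rule Bochner_Integration.integrable_bound[OF assms(1,2)], rule AE_I2)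
  fix x show "norm (f x) \<le> norm (g x)" using assms(3,4)[of x] by simp
qed

text \<open>Since u is the difference of t and t - u, 1 + u^2 is at most twice the sum of 1 + t^2
  and 1 + (t - u)^2. This splits the product of two such reciprocals into a sum, at a gain of 1 / (1
  + u^2).\<close>

lemma poisson_weight_le:
  "integrable lborel (\<lambda>t. 1 / (1 + t\<^sup>2) * poisson_kernel 1 (t - u))"
  "(LBINT t. 1 / (1 + t\<^sup>2) * poisson_kernel 1 (t - u)) \<le> 4 / (1 + u\<^sup>2)"
proof -
  have i: "integrable lborel (\<lambda>t. 2 / (1 + u\<^sup>2) * (poisson_kernel 1 (u - t) + poisson_kernel 1 t))"
    using integrable_poisson_kernel_shift[of 1 u] integrable_poisson_kernel[of 1] by simp
  have le: "1 / (1 + t\<^sup>2) * poisson_kernel 1 (t - u)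
      \<le> 2 / (1 + u\<^sup>2) * (poisson_kernel 1 (u - t) + poisson_kernel 1 t)" for t
  proof -
    have p: "1 + t\<^sup>2 > 0" "1 + (t - u)\<^sup>2 > 0" "1 + u\<^sup>2 > 0" by (simp_all add: add_pos_nonneg)
    have *: "1 / (a * b) \<le> 2 / c * (1 / b + 1 / a)" if "c \<le> 2 * (a + b)" "a > 0" "b > 0" "c > 0" for a b c :: real
    proof -
      have "1 / b + 1 / a = (a + b) / (a * b)" using that by (simp add: field_simps)
      then show ?thesis using that by (simp add: divide_simps mult_ac)
    qed
    have "1 + u\<^sup>2 \<le> 2 * ((1 + t\<^sup>2) + (1 + (t - u)\<^sup>2))"
    proof -
      have "0 \<le> (2 * t - u)\<^sup>2" by simp
      then show ?thesis by (simp add: power2_eq_square algebra_simps)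
    qed
    from *[OF this p]
    have "1 / ((1 + t\<^sup>2) * (1 + (t - u)\<^sup>2)) / pi \<le> 2 / (1 + u\<^sup>2) * (1 / (1 + (t - u)\<^sup>2) + 1 / (1 + t\<^sup>2)) / pi"
      by (rule divide_right_mono) simp
    moreover have k: "poisson_kernel 1 x = 1 / (1 + x\<^sup>2) / pi" for x
      by (simp add: poisson_kernel_1 mult.commute)
    have "2 / (1 + u\<^sup>2) * (poisson_kernel 1 (u - t) + poisson_kernel 1 t)
       = 2 / (1 + u\<^sup>2) * (1 / (1 + (t - u)\<^sup>2) + 1 / (1 + t\<^sup>2)) / pi"
      unfolding k power2_commute[of u t] add_divide_distrib[symmetric] by simp
    moreover have "1 / (1 + t\<^sup>2) * poisson_kernel 1 (t - u) = 1 / ((1 + t\<^sup>2) * (1 + (t - u)\<^sup>2)) / pi"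
      unfolding k by simp
    ultimately show ?thesis by simp
  qed
  show i': "integrable lborel (\<lambda>t. 1 / (1 + t\<^sup>2) * poisson_kernel 1 (t - u))"
    by (rule integrable_le_nonneg[OF i _ _ le]) (auto simp: poisson_kernel_nonneg)
  have "(LBINT t. 1 / (1 + t\<^sup>2) * poisson_kernel 1 (t - u))
     \<le> (LBINT t. 2 / (1 + u\<^sup>2) * (poisson_kernel 1 (u - t) + poisson_kernel 1 t))"
    by (rule integral_mono[OF i' i le])
  also have "\<dots> = 2 / (1 + u\<^sup>2) * ((LBINT t. poisson_kernel 1 (u - t)) + (LBINT t. poisson_kernel 1 t))"
    using integrable_poisson_kernel_shift[of 1 u] integrable_poisson_kernel[of 1]
    by (subst integral_mult_right_zero) simp
  also have "\<dots> = 4 / (1 + u\<^sup>2)"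
    using integral_poisson_kernel_shift[of 1 u] integral_poisson_kernel[of 1] by simp
  finally show "(LBINT t. 1 / (1 + t\<^sup>2) * poisson_kernel 1 (t - u)) \<le> 4 / (1 + u\<^sup>2)" .
qed

text \<open>By \<open>poisson_weight_le\<close> the averaging operator preserves decay like 1 / (1 +
  t^2), which is the integrability that Fubini requires for moving it from \<Omega> to
  \<open>g\<close>.\<close>

lemma
  assumes m[measurable]: "g \<in> borel_measurable borel" "\<Omega> \<in> borel_measurable borel"
    and g: "\<And>t. \<bar>g t\<bar> \<le> C / (1 + t\<^sup>2)"
    and nn: "\<And>x. 0 \<le> \<Omega> x" and int: "integrable lborel (\<lambda>x. \<Omega> x / (1 + x\<^sup>2))"
  shows integrable_weight_mult_poisson: "integrable lborel (\<lambda>t. g t * poisson \<Omega> t)"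
    and integral_weight_mult_poisson:
      "(LBINT t. g t * poisson \<Omega> t) = (LBINT u. \<Omega> u * (LBINT t. g t * poisson_kernel 1 (t - u)))"
    and integrable_weight_mult_poisson':
      "integrable lborel (\<lambda>u. \<Omega> u * (LBINT t. g t * poisson_kernel 1 (t - u)))"
proof -
  have C: "C \<ge> 0" using g[of 0] by simp
  let ?F = "\<lambda>(u, t). \<Omega> u * (g t * poisson_kernel 1 (t - u))"
  have ib: "integrable lborel (\<lambda>t. \<bar>g t\<bar> * poisson_kernel 1 (t - u))"
    and lb: "(LBINT t. \<bar>g t\<bar> * poisson_kernel 1 (t - u)) \<le> 4 * C / (1 + u\<^sup>2)" for u
  proof -
    have le: "\<bar>g t\<bar> * poisson_kernel 1 (t - u) \<le> C * (1 / (1 + t\<^sup>2) * poisson_kernel 1 (t - u))" for t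
      using mult_right_mono[OF g[of t] poisson_kernel_nonneg[of 1 "t - u"]] by simp
    have i: "integrable lborel (\<lambda>t. C * (1 / (1 + t\<^sup>2) * poisson_kernel 1 (t - u)))"
      by (rule integrable_mult_right[OF poisson_weight_le(1)])
    show i': "integrable lborel (\<lambda>t. \<bar>g t\<bar> * poisson_kernel 1 (t - u))"
      by (rule integrable_le_nonneg[OF i _ _ le]) (auto simp: poisson_kernel_nonneg)
    have "(LBINT t. \<bar>g t\<bar> * poisson_kernel 1 (t - u)) \<le> (LBINT t. C * (1 / (1 + t\<^sup>2) * poisson_kernel 1 (t - u)))"
      by (rule integral_mono[OF i' i le])
    also have "\<dots> = C * (LBINT t. 1 / (1 + t\<^sup>2) * poisson_kernel 1 (t - u))" by (rule integral_mult_right_zero)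
    also have "\<dots> \<le> C * (4 / (1 + u\<^sup>2))" by (intro mult_left_mono poisson_weight_le C)
    finally show "(LBINT t. \<bar>g t\<bar> * poisson_kernel 1 (t - u)) \<le> 4 * C / (1 + u\<^sup>2)" by (simp add: mult.commute)
  qed
  have iF: "integrable (lborel \<Otimes>\<^sub>M lborel) ?F"
  proof (rule lborel_pair.Fubini_integrable)
    have eq: "(LBINT t. norm (?F (u, t))) = \<Omega> u * (LBINT t. \<bar>g t\<bar> * poisson_kernel 1 (t - u))" for u
      using nn[of u] by (simp add: abs_mult poisson_kernel_nonneg)
    show "integrable lborel (\<lambda>u. LBINT t. norm (?F (u, t)))"
    proof (rule Bochner_Integration.integrable_bound)
      show "integrable lborel (\<lambda>u. 4 * C * (\<Omega> u / (1 + u\<^sup>2)))" by (rule integrable_mult_right[OF int])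
      show "AE u in lborel. norm (LBINT t. norm (?F (u, t))) \<le> norm (4 * C * (\<Omega> u / (1 + u\<^sup>2)))"
      proof (rule AE_I2)
        fix u
        have "0 \<le> (LBINT t. \<bar>g t\<bar> * poisson_kernel 1 (t - u))"
          by (intro integral_nonneg_AE AE_I2) (simp add: poisson_kernel_nonneg)
        moreover have "\<Omega> u * (LBINT t. \<bar>g t\<bar> * poisson_kernel 1 (t - u)) \<le> \<Omega> u * (4 * C / (1 + u\<^sup>2))"
          by (intro mult_left_mono lb nn)
        ultimately show "norm (LBINT t. norm (?F (u, t))) \<le> norm (4 * C * (\<Omega> u / (1 + u\<^sup>2)))"
          unfolding eq using nn[of u] C by (simp add: abs_mult mult_ac)
      qed
    qed measurable
    have "integrable lborel (\<lambda>t. g t * poisson_kernel 1 (t - u))" for u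
      by (rule Bochner_Integration.integrable_bound[OF ib[of u]]) (auto simp: abs_mult)
    then show "AE u in lborel. integrable lborel (\<lambda>t. ?F (u, t))" by simp
  qed measurable
  have e1: "(LBINT t. ?F (u, t)) = \<Omega> u * (LBINT t. g t * poisson_kernel 1 (t - u))" for u
    by simp
  have e2: "(LBINT u. ?F (u, t)) = g t * poisson \<Omega> t" for t
    unfolding poisson_def by (subst integral_mult_right_zero[symmetric]) (simp add: mult_ac)
  show "integrable lborel (\<lambda>u. \<Omega> u * (LBINT t. g t * poisson_kernel 1 (t - u)))"
    using lborel_pair.integrable_fst'[OF iF] unfolding e1 .
  show "integrable lborel (\<lambda>t. g t * poisson \<Omega> t)"
    using lborel_pair.integrable_snd[OF iF] e2 by simp
  show "(LBINT t. g t * poisson \<Omega> t) = (LBINT u. \<Omega> u * (LBINT t. g t * poisson_kernel 1 (t - u)))"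
    using lborel_pair.Fubini_integral[OF iF] e1 e2 by simp
qed

text \<open>Since \<open>poisson\<close> is self-adjoint and shifts the logarithm from \<open>z\<close> to \<open>z + \<i>\<close>, integrating
  \<open>log_factor z\<close> against \<open>\<Omega> - poisson \<Omega>\<close> amounts, up to bounded terms, to integrating \<open>- log_gap z\<close>
  against \<open>\<Omega>\<close>.\<close>

definition log_gap :: "complex \<Rightarrow> real \<Rightarrow> real" where
  "log_gap z u = ln (cmod ((of_real u)\<^sup>2 - (z + \<i>)\<^sup>2)) - ln (cmod ((of_real u)\<^sup>2 - z\<^sup>2))"

lemma log_gap_eq:
  assumes z: "Im z > 0"
  shows "log_gap z u = (ln (cmod (z + \<i> - u)) - ln (cmod (z - u))) + (ln (cmod (z + \<i> + u)) - ln (cmod (z + u)))"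
proof -
  have f: "(of_real u)\<^sup>2 - w\<^sup>2 = - ((w - u) * (w + u))" for w :: complex
    by (simp add: power2_eq_square algebra_simps)
  have "z - u \<noteq> 0" "z + u \<noteq> 0" "z + \<i> - u \<noteq> 0" "z + \<i> + u \<noteq> 0"
    using z by (auto simp: complex_eq_iff)
  then show ?thesis unfolding log_gap_def f norm_minus_cancel norm_mult by (simp add: ln_mult_pos)
qed

lemma cmod_shift_ge:
  assumes "Im z > 0"
  shows "cmod (z + of_real v) \<le> cmod (z + \<i> + of_real v)"
  unfolding cmod_def using assms by (intro real_sqrt_le_mono add_left_mono power_mono) auto

lemma log_gap_nonneg:
  assumes z: "Im z > 0"
  shows "log_gap z u \<ge> 0"
proof -
  have "z - u \<noteq> 0" "z + u \<noteq> 0" using z by (auto simp: complex_eq_iff)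
  then have "ln (cmod (z - u)) \<le> ln (cmod (z + \<i> - u))" "ln (cmod (z + u)) \<le> ln (cmod (z + \<i> + u))"
    using cmod_shift_ge[OF z, of u] cmod_shift_ge[OF z, of "-u"] by (auto intro!: ln_mono)
  then show ?thesis unfolding log_gap_eq[OF z] by linarith
qed

text \<open>Here |z - u|^2 <= 2, and moving z up by i adds 1 + 2 Im z to it, hence at least half of
  itself. The factor with z + u does not decrease.\<close>

lemma log_gap_ge:
  assumes z: "Im z > 0" "Im z \<le> 1" and u: "\<bar>u - Re z\<bar> \<le> 1"
  shows "log_gap z u \<ge> ln (3/2) / 2"
proof -
  have n: "z - u \<noteq> 0" "z + u \<noteq> 0" using z by (auto simp: complex_eq_iff)
  have 1: "ln (cmod (z + u)) \<le> ln (cmod (z + \<i> + u))"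
    using n cmod_shift_ge[OF z(1), of u] by (auto intro!: ln_mono)
  have c1: "(cmod (z - u))\<^sup>2 = (u - Re z)\<^sup>2 + (Im z)\<^sup>2"
    unfolding cmod_power2 by (simp add: power2_commute)
  have c2: "(cmod (z + \<i> - u))\<^sup>2 = (u - Re z)\<^sup>2 + (Im z)\<^sup>2 + 1 + 2 * Im z"
    unfolding cmod_power2 by (simp add: power2_eq_square algebra_simps)
  have "(u - Re z)\<^sup>2 \<le> 1" using power_mono[OF u, of 2] by simp
  moreover have "(Im z)\<^sup>2 \<le> 1" using z by (simp add: power_le_one)
  ultimately have "(3/2) * (cmod (z - u))\<^sup>2 \<le> (cmod (z + \<i> - u))\<^sup>2" unfolding c1 c2 using z by simp
  moreover have p: "cmod (z - u) > 0" using n by simp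
  ultimately have "ln ((3/2) * (cmod (z - u))\<^sup>2) \<le> ln ((cmod (z + \<i> - u))\<^sup>2)"
    by (intro ln_mono) auto
  moreover have "cmod (z + \<i> - u) > 0" using z by (auto simp: complex_eq_iff)
  moreover have "ln ((3/2) * (cmod (z - u))\<^sup>2) = ln (3/2) + 2 * ln (cmod (z - u))"
    using p by (subst ln_mult_pos) (auto simp: ln_realpow)
  ultimately have "ln (3/2) + 2 * ln (cmod (z - u)) \<le> 2 * ln (cmod (z + \<i> - u))"
    by (simp add: ln_realpow)
  then show ?thesis using 1 unfolding log_gap_eq[OF z(1)] by simp
qed

lemma poisson_even:
  assumes "\<And>x. \<Omega> (- x) = \<Omega> x"
  shows "poisson \<Omega> (- x) = poisson \<Omega> x"
  using poisson_reflect[of \<Omega> x] assms by simp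

text \<open>The constant \<open>e\<close> contributes 2 pi e (Im z - 1) exactly. In the remainder,
  moving the average to the logarithm replaces z by z + i, and the normalising point i by 2 i. The
  second change is \<open>?l\<close>, at most 3 / (1 + u^2), and causes the error term with factor
  3.\<close>

lemma
  fixes \<Omega> :: "real \<Rightarrow> real"
  assumes m[measurable]: "\<Omega> \<in> borel_measurable borel"
    and nn: "\<And>x. 0 \<le> \<Omega> x" and int: "integrable lborel (\<lambda>x. \<Omega> x / (1 + x\<^sup>2))" and z: "Im z > 0"
  shows integrable_log_factor_density:
      "integrable lborel (\<lambda>t. log_factor z t * (e + \<Omega> t - poisson \<Omega> t))"
    and integrable_log_gap: "integrable lborel (\<lambda>u. \<Omega> u * log_gap z u)"
    and integral_log_factor_density_le:
      "(LBINT t. log_factor z t * (e + \<Omega> t - poisson \<Omega> t))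
        \<le> 2 * pi * e * (Im z - 1) + 3 * (LBINT x. \<Omega> x / (1 + x\<^sup>2)) - (LBINT u. \<Omega> u * log_gap z u)"
proof -
  let ?g = "log_factor z"
  obtain C where C: "C \<ge> 0" "\<And>t. \<bar>?g t\<bar> \<le> C / (1 + t\<^sup>2)" using log_factor_bound[OF z] by blast
  have ig: "integrable lborel (\<lambda>t. e * ?g t)" by (rule integrable_mult_right[OF integrable_log_factor[OF z]])
  have i\<Omega>: "integrable lborel (\<lambda>t. ?g t * \<Omega> t)"
  proof (rule Bochner_Integration.integrable_bound)
    show "integrable lborel (\<lambda>u. C * (\<Omega> u / (1 + u\<^sup>2)))" by (rule integrable_mult_right[OF int])
    show "AE t in lborel. norm (?g t * \<Omega> t) \<le> norm (C * (\<Omega> t / (1 + t\<^sup>2)))"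
    proof (rule AE_I2)
      fix t
      have "\<bar>?g t\<bar> * \<Omega> t \<le> C / (1 + t\<^sup>2) * \<Omega> t" by (intro mult_right_mono C nn)
      then show "norm (?g t * \<Omega> t) \<le> norm (C * (\<Omega> t / (1 + t\<^sup>2)))"
        using nn[of t] C(1) by (simp add: abs_mult)
    qed
  qed measurable
  note p = integrable_weight_mult_poisson[OF measurable_log_factor m C(2) nn int]
    integral_weight_mult_poisson[OF measurable_log_factor m C(2) nn int]
    integrable_weight_mult_poisson'[OF measurable_log_factor m C(2) nn int]
  have split: "?g t * (e + \<Omega> t - poisson \<Omega> t) = e * ?g t + ?g t * \<Omega> t - ?g t * poisson \<Omega> t" for t
    by (simp add: algebra_simps)
  show "integrable lborel (\<lambda>t. ?g t * (e + \<Omega> t - poisson \<Omega> t))"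
    unfolding split using ig i\<Omega> p(1) by auto
  let ?h = "\<lambda>u. LBINT t. ?g t * poisson_kernel 1 (t - u)"
  let ?l = "\<lambda>u::real. ln (u\<^sup>2 + 4) - ln (u\<^sup>2 + 1)"
  have pos: "cmod ((of_real u)\<^sup>2 - z\<^sup>2) > 0" for u
  proof -
    have "(of_real u)\<^sup>2 - z\<^sup>2 = - ((z - u) * (z + u))" by (simp add: power2_eq_square algebra_simps)
    moreover have "z - u \<noteq> 0" "z + u \<noteq> 0" using z by (auto simp: complex_eq_iff)
    ultimately show ?thesis by simp
  qed
  have gh: "?g u - ?h u = ?l u - log_gap z u" for u
  proof -
    have "u\<^sup>2 + 1 > 0" by (simp add: add_nonneg_pos)
    then have "?g u = ln (cmod ((of_real u)\<^sup>2 - z\<^sup>2)) - ln (u\<^sup>2 + 1)"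
      unfolding log_factor_def using pos[of u] by (intro ln_divide_pos)
    then show ?thesis using integral_poisson_log_factor[OF z, of 1 u] by (simp add: log_gap_def)
  qed
  have lle: "0 \<le> ?l u" "?l u \<le> 3 / (1 + u\<^sup>2)" for u
  proof -
    have a: "u\<^sup>2 + 1 > 0" "u\<^sup>2 + 4 > 0" by (simp_all add: add_nonneg_pos)
    have "?l u = ln ((u\<^sup>2 + 4) / (u\<^sup>2 + 1))" using a by (simp add: ln_div)
    also have "\<dots> \<le> (u\<^sup>2 + 4) / (u\<^sup>2 + 1) - 1" using a by (intro ln_le_minus_one) simp
    also have "\<dots> = 3 / (1 + u\<^sup>2)" using a by (simp add: field_simps)
    finally show "?l u \<le> 3 / (1 + u\<^sup>2)" .
    show "0 \<le> ?l u" using a by simp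
  qed
  have i3: "integrable lborel (\<lambda>u. 3 * (\<Omega> u / (1 + u\<^sup>2)))" by (rule integrable_mult_right[OF int])
  have le3: "\<Omega> u * ?l u \<le> 3 * (\<Omega> u / (1 + u\<^sup>2))" for u
    using mult_left_mono[OF lle(2)[of u] nn[of u]] by (simp add: mult_ac)
  have il: "integrable lborel (\<lambda>u. \<Omega> u * ?l u)"
    by (rule integrable_le_nonneg[OF i3 _ mult_nonneg_nonneg[OF nn lle(1)] le3]) measurable
  have eq: "\<Omega> u * log_gap z u = \<Omega> u * ?l u - ?g u * \<Omega> u + \<Omega> u * ?h u" for u
  proof -
    have "log_gap z u = ?l u - ?g u + ?h u" using gh[of u] by simp
    have *: "w * (l - g + h) = w * l - g * w + w * h" for w l g h :: real
      by (simp add: algebra_simps)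
    show ?thesis unfolding \<open>log_gap z u = ?l u - ?g u + ?h u\<close> by (rule *)
  qed
  show ig': "integrable lborel (\<lambda>u. \<Omega> u * log_gap z u)"
    unfolding eq using il i\<Omega> p(3) by auto
  have "(LBINT u. \<Omega> u * log_gap z u) = (LBINT u. \<Omega> u * ?l u) - (LBINT u. ?g u * \<Omega> u) + (LBINT u. \<Omega> u * ?h u)"
    unfolding eq using il i\<Omega> p(3) by simp
  moreover have "(LBINT u. \<Omega> u * ?l u) \<le> 3 * (LBINT x. \<Omega> x / (1 + x\<^sup>2))"
  proof -
    have "(LBINT u. \<Omega> u * ?l u) \<le> (LBINT u. 3 * (\<Omega> u / (1 + u\<^sup>2)))" by (rule integral_mono[OF il i3 le3])
    also have "\<dots> = 3 * (LBINT x. \<Omega> x / (1 + x\<^sup>2))" by (rule integral_mult_right_zero)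
    finally show ?thesis .
  qed
  moreover have "(LBINT t. ?g t * (e + \<Omega> t - poisson \<Omega> t))
     = e * (LBINT t. ?g t) + (LBINT t. ?g t * \<Omega> t) - (LBINT t. ?g t * poisson \<Omega> t)"
    unfolding split using ig i\<Omega> p(1) by simp
  moreover have "e * (LBINT t. ?g t) = 2 * pi * e * (Im z - 1)"
    unfolding integral_log_factor[OF z] by simp
  ultimately show "(LBINT t. ?g t * (e + \<Omega> t - poisson \<Omega> t))
      \<le> 2 * pi * e * (Im z - 1) + 3 * (LBINT x. \<Omega> x / (1 + x\<^sup>2)) - (LBINT u. \<Omega> u * log_gap z u)"
    using p(2) by linarith
qed

lemma integral_log_gap_ge:
  fixes \<Omega> :: "real \<Rightarrow> real"
  assumes m[measurable]: "\<Omega> \<in> borel_measurable borel"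
    and nn: "\<And>x. 0 \<le> \<Omega> x" and int: "integrable lborel (\<lambda>x. \<Omega> x / (1 + x\<^sup>2))"
    and z: "Im z > 0" "Im z \<le> 1" and c: "c \<ge> 0" "\<And>u. \<bar>u - Re z\<bar> \<le> 1 \<Longrightarrow> c \<le> \<Omega> u"
  shows "c * ln (3/2) \<le> (LBINT u. \<Omega> u * log_gap z u)"
proof -
  let ?I = "{Re z - 1..Re z + 1}"
  \<comment> \<open>The window has length two, which makes up for the half in
    \<open>log_gap_ge\<close>.\<close>
  have "c * ln (3/2) = (LBINT u. (c * (ln (3/2) / 2)) * indicator ?I u)"
    by (subst integral_mult_right_zero) (simp add: measure_def)
  also have "\<dots> \<le> (LBINT u. \<Omega> u * log_gap z u)"
  proof (rule integral_mono[OF _ integrable_log_gap[OF m nn int z(1)]])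
    show "integrable lborel (\<lambda>u. (c * (ln (3/2) / 2)) * indicator ?I u)"
      by (intro integrable_mult_right integrable_real_indicator) (auto simp: emeasure_lborel_Icc_eq)
    show "(c * (ln (3/2) / 2)) * indicator ?I u \<le> \<Omega> u * log_gap z u" for u
    proof (cases "u \<in> ?I")
      case True
      then have u: "\<bar>u - Re z\<bar> \<le> 1" by auto
      have "c * (ln (3/2) / 2) \<le> \<Omega> u * log_gap z u"
        using c(2)[OF u] log_gap_ge[OF z u] nn[of u] by (intro mult_mono) auto
      then show ?thesis using True by simp
    next
      case False
      then show ?thesis using mult_nonneg_nonneg[OF nn[of u] log_gap_nonneg[OF z(1), of u]] by simp
    qed
  qed
  finally show ?thesis .
qed

section \<open>Entire functions with prescribed decay\<close>

text \<open>For b = 1 / (t^2 + 1) a factor vanishes at z = t^2 and equals 1 at z = -1, so after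
  substituting z^2 it is the factor measured by \<open>log_factor\<close>. At 0 the factors 1 - b k
  are positive, so their convergent product does not vanish.\<close>

lemma entire_product:
  fixes b :: "nat \<Rightarrow> real"
  assumes sb: "summable b" and b: "\<And>k. 0 \<le> b k" "\<And>k. b k < 1"
  obtains f where "f holomorphic_on UNIV" "f 0 \<noteq> 0" "\<And>z. f (cnj z) = cnj (f z)"
    "\<And>z. (\<lambda>N. \<Prod>k<N. 1 - (1 + z) * of_real (b k)) \<longlonglongrightarrow> f z"
proof -
  define p where "p N z = (\<Prod>k<N. 1 + - ((1 + z) * of_real (b k)))" for N and z :: complex
  define f where "f z = lim (\<lambda>N. p N z)" for z
  have unif: "uniform_limit (cball z 1) p f sequentially" for z
  proof -
    have "uniformly_convergent_on (cball z 1) (\<lambda>N w. \<Prod>k<N. 1 + - ((1 + w) * of_real (b k)))"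
    proof (rule uniformly_convergent_on_prod)
      show "uniformly_convergent_on (cball z 1) (\<lambda>N w. \<Sum>n<N. norm (- ((1 + w) * complex_of_real (b n))))"
      proof (rule Weierstrass_m_test'_ev)
        show "summable (\<lambda>n. (2 + cmod z) * b n)" by (rule summable_mult[OF sb])
        show "\<forall>\<^sub>F n in sequentially. \<forall>w\<in>cball z 1. norm (norm (- ((1 + w) * complex_of_real (b n)))) \<le> (2 + cmod z) * b n"
        proof (intro always_eventually allI ballI)
          fix n w assume "w \<in> cball z 1"
          then have "cmod (w - z) \<le> 1" by (simp add: dist_norm norm_minus_commute)
          then have "cmod (1 + w) \<le> 2 + cmod z"
            using norm_triangle_ineq[of "1 + z" "w - z"] norm_triangle_ineq[of 1 z] by simp
          then show "norm (norm (- ((1 + w) * complex_of_real (b n)))) \<le> (2 + cmod z) * b n"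
            using b(1)[of n] by (simp add: norm_mult mult_right_mono)
        qed
      qed
    qed (auto intro!: continuous_intros)
    then have "uniformly_convergent_on (cball z 1) p" by (simp add: p_def[abs_def])
    then show ?thesis unfolding f_def by (simp add: uniformly_convergent_uniform_limit_iff)
  qed
  have lim: "(\<lambda>N. p N z) \<longlonglongrightarrow> f z" for z
    by (rule tendsto_uniform_limitI[OF unif[of z]]) simp
  show thesis
  proof (rule that)
    show "f holomorphic_on UNIV"
    proof (rule holomorphic_uniform_sequence)
      show "p n holomorphic_on UNIV" for n unfolding p_def by (intro holomorphic_intros)
      show "\<exists>d>0. cball z d \<subseteq> UNIV \<and> uniform_limit (cball z d) p f sequentially" for z
        using unif[of z] zero_less_one by blast
    qed simp
    show "f (cnj z) = cnj (f z)" for z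
    proof (rule LIMSEQ_unique[OF lim])
      have "p N (cnj z) = cnj (p N z)" for N by (simp add: p_def)
      then show "(\<lambda>N. p N (cnj z)) \<longlonglongrightarrow> cnj (f z)" using tendsto_cnj[OF lim[of z]] by simp
    qed
    show "f 0 \<noteq> 0"
    proof
      assume "f 0 = 0"
      have "abs_convergent_prod (\<lambda>k. 1 - b k)"
        by (rule summable_imp_abs_convergent_prod) (use sb b in simp)
      then have "convergent_prod (\<lambda>k. 1 - b k)" by (rule abs_convergent_prod_imp_convergent_prod)
      moreover have "(\<lambda>N. complex_of_real (\<Prod>k<N. 1 - b k)) \<longlonglongrightarrow> of_real 0"
        using lim[of 0] \<open>f 0 = 0\<close> by (simp add: p_def)
      then have "(\<lambda>N. \<Prod>k<N. 1 - b k) \<longlonglongrightarrow> 0" by (simp only: tendsto_of_real_iff)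
      then have "(\<lambda>N. \<Prod>k\<le>N. 1 - b k) \<longlonglongrightarrow> 0" by (simp only: LIMSEQ_lessThan_iff_atMost)
      ultimately have "\<exists>k. 1 - b k = 0" by (simp only: convergent_prod_to_zero_iff)
      then show False using b(2) by (metis eq_iff_diff_eq_0 less_irrefl)
    qed
    show "(\<lambda>N. \<Prod>k<N. 1 - (1 + z) * complex_of_real (b k)) \<longlonglongrightarrow> f z" for z
      using lim[of z] by (simp add: p_def)
  qed
qed

section \<open>Logarithmic singularities\<close>

definition log_minus :: "real \<Rightarrow> real" where
  "log_minus v = max 0 (- ln \<bar>v\<bar>)"

lemma measurable_log_minus [measurable]: "log_minus \<in> borel_measurable borel"
  unfolding log_minus_def by measurable

lemma log_minus_nonneg: "0 \<le> log_minus v" by (simp add: log_minus_def)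

lemma log_minus_le: "v \<noteq> 0 \<Longrightarrow> - ln \<bar>v\<bar> \<le> log_minus v" by (simp add: log_minus_def)

text \<open>Paying ln M shrinks the singularity to width 1 / M. Its integral is then at most 8 / M,
  which compensates a density as large as a multiple of M.\<close>

lemma log_minus_scale:
  assumes "M \<ge> 1"
  shows "log_minus v \<le> ln M + log_minus (M * v)"
proof (cases "v = 0")
  case False
  then have "ln \<bar>M * v\<bar> = ln M + ln \<bar>v\<bar>" using assms by (simp add: abs_mult ln_mult_pos)
  then show ?thesis using assms by (auto simp: log_minus_def max_def)
qed (use assms in \<open>simp add: log_minus_def\<close>)

text \<open>On the unit interval - ln v = 2 ln (v powr (-1/2)) is at most 2 v powr (-1/2), whose
  integral is 4. The two signs of v give 8.\<close>

lemma
  shows integrable_log_minus: "integrable lborel log_minus"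
    and integral_log_minus_le: "(LBINT v. log_minus v) \<le> 8"
proof -
  let ?p = "\<lambda>v::real. 2 * v powr (- 1/2)"
  define q where "q v = indicator {0..1} v * ?p v" for v
  have hi: "(?p has_integral 4) {0..1}"
    using has_integral_mult_right[OF has_integral_powr_from_0[of "-1/2" 1], of 2] by simp
  have "integrable lebesgue (\<lambda>v. indicator {0..1} v *\<^sub>R ?p v)"
    using nonnegative_absolutely_integrable_1[OF has_integral_integrable[OF hi]]
    by (simp add: set_integrable_def)
  then have iq: "integrable lborel q"
    unfolding q_def by (subst (asm) integrable_completion) auto
  have vq: "(LBINT v. q v) = 4"
  proof -
    have "set_integrable lborel {0..1} ?p" using iq by (simp add: set_integrable_def q_def[abs_def])
    then have "(LINT v:{0..1}|lborel. ?p v) = integral {0..1} ?p" by (rule set_borel_integral_eq_integral)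
    moreover have "(LBINT v. q v) = (LINT v:{0..1}|lborel. ?p v)"
      by (simp only: set_lebesgue_integral_def q_def real_scaleR_def)
    ultimately show ?thesis using integral_unique[OF hi] by simp
  qed
  have iq': "integrable lborel (\<lambda>v. q (- v))" using lborel_integrable_real_affine[OF iq, of "-1" 0] by simp
  have vq': "(LBINT v. q (- v)) = 4" using lborel_integral_real_affine[of "-1" q 0] vq by simp
  have le: "log_minus v \<le> q v + q (- v)" for v
  proof -
    have q0: "q v \<ge> 0" for v by (simp add: q_def)
    have *: "- ln v \<le> q v" if "0 < v" "v \<le> 1" for v
    proof -
      have "- ln v = 2 * ln (v powr (-1/2))" using that by (simp add: ln_powr)
      also have "\<dots> \<le> 2 * (v powr (-1/2) - 1)" using that by (intro mult_left_mono ln_le_minus_one) auto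
      also have "\<dots> \<le> q v" using that by (simp add: q_def)
      finally show ?thesis .
    qed
    consider "v = 0" | "\<bar>v\<bar> > 1" | "v \<noteq> 0" "\<bar>v\<bar> \<le> 1" by linarith
    then show ?thesis
    proof cases
      case 2
      then have "log_minus v = 0" by (simp add: log_minus_def)
      then show ?thesis using q0[of v] q0[of "-v"] by simp
    next
      case 3
      show ?thesis using *[of v] *[of "-v"] 3 q0[of v] q0[of "-v"]
        by (cases "v > 0") (auto simp: log_minus_def)
    qed (use q0[of 0] in \<open>simp add: log_minus_def\<close>)
  qed
  have i2: "integrable lborel (\<lambda>v. q v + q (- v))" using iq iq' by simp
  show i: "integrable lborel log_minus"
    by (rule integrable_le_nonneg[OF i2 _ log_minus_nonneg le]) simp
  have "(LBINT v. log_minus v) \<le> (LBINT v. q v + q (- v))" by (rule integral_mono[OF i i2 le])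
  then show "(LBINT v. log_minus v) \<le> 8" using iq iq' vq vq' by simp
qed

lemma
  assumes "M > 0"
  shows integrable_log_minus_affine: "integrable lborel (\<lambda>t. log_minus (M * (t - x)))"
    and integral_log_minus_affine_le: "(LBINT t. log_minus (M * (t - x))) \<le> 8 / M"
proof -
  have e: "M * (t - x) = - M * x + M * t" for t by (simp add: algebra_simps)
  show "integrable lborel (\<lambda>t. log_minus (M * (t - x)))"
    unfolding e using assms by (intro lborel_integrable_real_affine integrable_log_minus) simp
  have "(LBINT v. log_minus v) = M * (LBINT t. log_minus (M * (t - x)))"
    unfolding e using lborel_integral_real_affine[of M log_minus "- M * x"] assms by simp
  then show "(LBINT t. log_minus (M * (t - x))) \<le> 8 / M"
    using integral_log_minus_le assms by (simp add: field_simps)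
qed

section \<open>Unimodality of the logarithmic factors\<close>

lemma log_factor_alt:
  "cmod ((of_real t)\<^sup>2 - z\<^sup>2) / (t\<^sup>2 + 1) = cmod (1 - of_real (1 / (t\<^sup>2 + 1)) * (1 + z\<^sup>2))"
proof -
  have p: "t\<^sup>2 + 1 > 0" by (simp add: add_nonneg_pos)
  have nz: "of_real (t\<^sup>2 + 1) \<noteq> (0::complex)" using p by (simp only: of_real_eq_0_iff)
  have "1 - of_real (1 / (t\<^sup>2 + 1)) * (1 + z\<^sup>2) = (of_real (t\<^sup>2 + 1) - (1 + z\<^sup>2)) / of_real (t\<^sup>2 + 1)"
    using nz by (simp only: of_real_divide diff_divide_distrib divide_self) simp
  also have "cmod \<dots> = cmod (of_real (t\<^sup>2 + 1) - (1 + z\<^sup>2)) / (t\<^sup>2 + 1)"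
    using p by (simp only: norm_divide norm_of_real abs_of_pos)
  also have "of_real (t\<^sup>2 + 1) - (1 + z\<^sup>2) = (of_real t)\<^sup>2 - z\<^sup>2" by simp
  finally show ?thesis by simp
qed

lemma cmod_one_minus_scaled:
  "(cmod (1 - of_real s * w))\<^sup>2 = 1 - 2 * s * Re w + s\<^sup>2 * (cmod w)\<^sup>2"
  unfolding cmod_power2 by (simp add: power2_eq_square algebra_simps)

lemma log_factor_le_of_norm_le:
  assumes z: "Im z > 0"
    and le: "(cmod (1 - of_real (1 / (s\<^sup>2 + 1)) * (1 + z\<^sup>2)))\<^sup>2 \<le> (cmod (1 - of_real (1 / (t\<^sup>2 + 1)) * (1 + z\<^sup>2)))\<^sup>2"
  shows "log_factor z s \<le> log_factor z t"
proof -
  have "(of_real s)\<^sup>2 - z\<^sup>2 = - ((z - s) * (z + s))" by (simp add: power2_eq_square algebra_simps)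
  moreover have "z - s \<noteq> 0" "z + s \<noteq> 0" using z by (auto simp: complex_eq_iff)
  ultimately have "cmod ((of_real s)\<^sup>2 - z\<^sup>2) > 0" by simp
  moreover have "s\<^sup>2 + 1 > 0" by (simp add: add_nonneg_pos)
  ultimately have "0 < cmod ((of_real s)\<^sup>2 - z\<^sup>2) / (s\<^sup>2 + 1)" by simp
  moreover have "cmod ((of_real s)\<^sup>2 - z\<^sup>2) / (s\<^sup>2 + 1) \<le> cmod ((of_real t)\<^sup>2 - z\<^sup>2) / (t\<^sup>2 + 1)"
    unfolding log_factor_alt using le by (rule power2_le_imp_le) simp
  ultimately show ?thesis unfolding log_factor_def by (intro ln_mono) auto
qed

text \<open>In terms of \<open>s = 1 / (t\<^sup>2 + 1)\<close> the squared modulus inside the logarithm is a convex quadratic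
  polynomial, so for \<open>t \<ge> 0\<close> the function \<open>log_factor z\<close> first decreases and then increases.\<close>

lemma log_factor_antimono:
  assumes z: "Im z > 0" and D: "Re (1 + z\<^sup>2) * (s\<^sup>2 + 1) \<le> (cmod (1 + z\<^sup>2))\<^sup>2" and t: "0 \<le> t" "t \<le> s"
  shows "log_factor z s \<le> log_factor z t"
proof (rule log_factor_le_of_norm_le[OF z])
  define \<sigma> \<tau> where "\<sigma> = 1 / (s\<^sup>2 + 1)" and "\<tau> = 1 / (t\<^sup>2 + 1)"
  have p: "s\<^sup>2 + 1 > 0" "t\<^sup>2 + 1 > 0" by (simp_all add: add_nonneg_pos)
  have "t\<^sup>2 \<le> s\<^sup>2" using t by (intro power_mono)
  then have st: "\<sigma> \<le> \<tau>" "\<sigma> > 0" using p by (auto simp: \<sigma>_def \<tau>_def intro!: divide_left_mono)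
  let ?w = "1 + z\<^sup>2"
  have "Re ?w \<le> \<sigma> * (cmod ?w)\<^sup>2" using D p by (simp add: \<sigma>_def field_simps)
  moreover have "\<sigma> * (cmod ?w)\<^sup>2 \<le> \<tau> * (cmod ?w)\<^sup>2" using st by (intro mult_right_mono) auto
  ultimately have "0 \<le> (\<tau> - \<sigma>) * ((\<tau> + \<sigma>) * (cmod ?w)\<^sup>2 - 2 * Re ?w)"
    using st by (intro mult_nonneg_nonneg) (auto simp: algebra_simps)
  then show "(cmod (1 - of_real \<sigma> * ?w))\<^sup>2 \<le> (cmod (1 - of_real \<tau> * ?w))\<^sup>2"
    unfolding cmod_one_minus_scaled by (simp add: power2_eq_square algebra_simps)
qed

lemma log_factor_mono:
  assumes z: "Im z > 0" and D: "Re (1 + z\<^sup>2) * (s\<^sup>2 + 1) > (cmod (1 + z\<^sup>2))\<^sup>2" and t: "0 \<le> s" "s \<le> t"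
  shows "log_factor z s \<le> log_factor z t"
proof (rule log_factor_le_of_norm_le[OF z])
  define \<sigma> \<tau> where "\<sigma> = 1 / (s\<^sup>2 + 1)" and "\<tau> = 1 / (t\<^sup>2 + 1)"
  have p: "s\<^sup>2 + 1 > 0" "t\<^sup>2 + 1 > 0" by (simp_all add: add_nonneg_pos)
  have "s\<^sup>2 \<le> t\<^sup>2" using t by (intro power_mono)
  then have st: "\<tau> \<le> \<sigma>" "\<tau> > 0" using p by (auto simp: \<sigma>_def \<tau>_def intro!: divide_left_mono)
  let ?w = "1 + z\<^sup>2"
  have "\<sigma> * (cmod ?w)\<^sup>2 \<le> Re ?w" using D p by (simp add: \<sigma>_def field_simps)
  moreover have "\<tau> * (cmod ?w)\<^sup>2 \<le> \<sigma> * (cmod ?w)\<^sup>2" using st by (intro mult_right_mono) auto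
  ultimately have "0 \<le> (\<sigma> - \<tau>) * (2 * Re ?w - (\<tau> + \<sigma>) * (cmod ?w)\<^sup>2)"
    using st by (intro mult_nonneg_nonneg) (auto simp: algebra_simps)
  then show "(cmod (1 - of_real \<sigma> * ?w))\<^sup>2 \<le> (cmod (1 - of_real \<tau> * ?w))\<^sup>2"
    unfolding cmod_one_minus_scaled by (simp add: power2_eq_square algebra_simps)
qed

text \<open>Here g holds the values at the zeros and I the averages over the cells between them. Up
  to J each cell is matched with the zero at its right end, beyond J with the zero at its left end.
  Cell J remains unmatched, and \<open>E\<close> bounds its possible negative contribution.\<close>

lemma sum_shift_le:
  fixes g I :: "nat \<Rightarrow> real"
  assumes J: "J \<le> N" and dec: "\<And>k. k < J \<Longrightarrow> g (Suc k) \<le> I k"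
    and inc: "\<And>k. J < k \<Longrightarrow> k \<le> N \<Longrightarrow> g k \<le> I k" and low: "- E \<le> I J"
  shows "(\<Sum>k=1..N. g k) \<le> (\<Sum>k<Suc N. I k) + E"
proof -
  have 1: "n \<le> J \<Longrightarrow> (\<Sum>k=1..n. g k) \<le> (\<Sum>k<n. I k)" for n
  proof (induction n)
    case (Suc n)
    then show ?case using dec[of n] by simp
  qed simp
  have 2: "J + n \<le> N \<Longrightarrow> (\<Sum>k=1..J + n. g k) \<le> (\<Sum>k<Suc (J + n). I k) - I J" for n
  proof (induction n)
    case 0
    then show ?case using 1[of J] by simp
  next
    case (Suc n)
    then show ?case using inc[of "J + Suc n"] by simp
  qed
  from 2[of "N - J"] J low show ?thesis by simp
qed

lemma integral_half_line_even:
  fixes h :: "real \<Rightarrow> real"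
  assumes i: "integrable lborel h" and even: "\<And>t. h (- t) = h t"
  shows "(LBINT t. indicator {0..} t * h t) = (LBINT t. h t) / 2"
proof -
  have m[measurable]: "h \<in> borel_measurable borel" using i by simp
  have i1: "integrable lborel (\<lambda>t. indicator {0..} t * h t)"
    using integrable_real_mult_indicator[OF _ i, of "{0..}"] by (simp add: mult.commute)
  have i2: "integrable lborel (\<lambda>t. indicator {0..} (- t) * h t)"
    using lborel_integrable_real_affine[OF i1, of "-1" 0] by (simp add: even)
  have "(LBINT t. h t) = (LBINT t. indicator {0..} t * h t + indicator {0..} (- t) * h t)"
  proof (rule integral_cong_AE)
    have "AE u in lborel. u \<noteq> (0::real)" by (rule AE_lborel_singleton)
    then show "AE t in lborel. h t = indicator {0..} t * h t + indicator {0..} (- t) * h t"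
      by eventually_elim (auto simp: indicator_def)
  qed measurable
  also have "\<dots> = (LBINT t. indicator {0..} t * h t) + (LBINT t. indicator {0..} (- t) * h t)"
    by (rule Bochner_Integration.integral_add[OF i1 i2])
  also have "(LBINT t. indicator {0..} t * h t) = (LBINT t. indicator {0..} (- t) * h t)"
    using lborel_integral_real_affine[of "-1" "\<lambda>t. indicator {0..} t * h t" 0] by (simp add: even)
  finally show ?thesis
    using lborel_integral_real_affine[of "-1" "\<lambda>t. indicator {0..} t * h t" 0] by (simp add: even)
qed

text \<open>The lower bound makes the mass of the half-line infinite, so all quantiles exist. The
  linear upper bound controls a logarithmic singularity inside a single cell, and the weighted
  integral makes the product over the zeros converge.\<close>

locale zero_density =
  fixes \<rho> :: "real \<Rightarrow> real" and \<delta> K :: real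
  assumes measurable_density [measurable]: "\<rho> \<in> borel_measurable borel"
    and \<delta>: "\<delta> > 0" and density_ge: "\<And>t. \<delta> \<le> \<rho> t" and density_le: "\<And>t. \<rho> t \<le> K * (1 + \<bar>t\<bar>)"
    and integrable_density: "integrable lborel (\<lambda>t. \<rho> t / (1 + t\<^sup>2))"
begin

lemma density_pos: "\<rho> t > 0" using density_ge[of t] \<delta> by linarith

lemma K_pos: "K > 0" using density_le[of 0] density_pos[of 0] by simp

section \<open>Quantiles of the density and the cells between them\<close>

definition mass :: "real \<Rightarrow> real" where
  "mass t = (LBINT u. indicator {0..t} u * \<rho> u)"

lemma integrable_density_Icc: "integrable lborel (\<lambda>u. indicator {a..b} u * \<rho> u)"
proof (rule integrable_cpt_support[where M="K * (1 + (\<bar>a\<bar> + \<bar>b\<bar>))" and a=a and b=b])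
  show "\<bar>indicator {a..b} u * \<rho> u\<bar> \<le> K * (1 + (\<bar>a\<bar> + \<bar>b\<bar>))" for u
  proof (cases "u \<in> {a..b}")
    case True
    then have "\<bar>u\<bar> \<le> \<bar>a\<bar> + \<bar>b\<bar>" by auto
    then have "K * (1 + \<bar>u\<bar>) \<le> K * (1 + (\<bar>a\<bar> + \<bar>b\<bar>))" using K_pos by (intro mult_left_mono) auto
    then show ?thesis using True density_le[of u] density_pos[of u] by simp
  next
    case False
    then show ?thesis using K_pos by (auto simp: indicator_def)
  qed
qed auto

lemma mass_diff:
  assumes "0 \<le> a" "a \<le> b"
  shows "mass b - mass a = (LBINT u. indicator {a..b} u * \<rho> u)"
proof -
  have "mass b - mass a = (LBINT u. indicator {0..b} u * \<rho> u - indicator {0..a} u * \<rho> u)"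
    unfolding mass_def by (rule Bochner_Integration.integral_diff[symmetric]) (rule integrable_density_Icc)+
  also have "\<dots> = (LBINT u. indicator {a..b} u * \<rho> u)"
  proof (rule integral_cong_AE)
    have "AE u in lborel. u \<noteq> a" by (rule AE_lborel_singleton)
    then show "AE u in lborel. indicator {0..b} u * \<rho> u - indicator {0..a} u * \<rho> u = indicator {a..b} u * \<rho> u"
      by eventually_elim (use assms in \<open>auto simp: indicator_def\<close>)
  qed measurable
  finally show ?thesis .
qed

lemma mass_0: "mass 0 = 0"
  using mass_diff[of 0 0] mass_def[of 0] by (simp add: mass_def)

lemma mass_diff_bounds:
  assumes "0 \<le> a" "a \<le> b"
  shows "\<delta> * (b - a) \<le> mass b - mass a" "mass b - mass a \<le> K * (1 + b) * (b - a)"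
proof -
  have c: "(LBINT u. c * indicator {a..b} u) = c * (b - a)" for c :: real
    using assms by (subst integral_mult_right_zero) simp
  have i: "integrable lborel (\<lambda>u. c * indicator {a..b} u)" for c :: real
    by (intro integrable_mult_right integrable_real_indicator) (auto simp: emeasure_lborel_Icc_eq)
  have "(LBINT u. \<delta> * indicator {a..b} u) \<le> (LBINT u. indicator {a..b} u * \<rho> u)"
    by (rule integral_mono[OF i integrable_density_Icc]) (use density_ge in \<open>auto simp: indicator_def\<close>)
  then show "\<delta> * (b - a) \<le> mass b - mass a" unfolding mass_diff[OF assms] c .
  have "(LBINT u. indicator {a..b} u * \<rho> u) \<le> (LBINT u. (K * (1 + b)) * indicator {a..b} u)"
  proof (rule integral_mono[OF integrable_density_Icc i])
    fix u
    show "indicator {a..b} u * \<rho> u \<le> (K * (1 + b)) * indicator {a..b} u"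
    proof (cases "u \<in> {a..b}")
      case True
      then have "K * (1 + \<bar>u\<bar>) \<le> K * (1 + b)" using K_pos assms by (intro mult_left_mono) auto
      then show ?thesis using True density_le[of u] by simp
    qed (auto simp: indicator_def)
  qed
  then show "mass b - mass a \<le> K * (1 + b) * (b - a)" unfolding mass_diff[OF assms] c .
qed

lemma ex_mass_eq: "\<exists>t\<ge>0. mass t = real k"
proof -
  let ?b = "real k / \<delta>"
  have b: "?b \<ge> 0" using \<delta> by simp
  have up: "real k \<le> mass ?b" using mass_diff_bounds(1)[of 0 ?b] b \<delta> by (simp add: mass_0)
  have "continuous_on {0..?b} mass"
  proof (rule lipschitz_on_continuous_on)
    show "(K * (1 + ?b))-lipschitz_on {0..?b} mass"
    proof (rule lipschitz_onI)
      have *: "\<bar>mass y - mass x\<bar> \<le> K * (1 + ?b) * \<bar>y - x\<bar>" if "0 \<le> x" "x \<le> y" "y \<le> ?b" for x y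
      proof -
        have "K * (1 + y) * (y - x) \<le> K * (1 + ?b) * (y - x)"
          using that K_pos by (intro mult_right_mono mult_left_mono) auto
        moreover have "0 \<le> \<delta> * (y - x)" using \<delta> that by simp
        ultimately show ?thesis using mass_diff_bounds[OF that(1,2)] that by simp
      qed
      show "dist (mass x) (mass y) \<le> K * (1 + ?b) * dist x y" if "x \<in> {0..?b}" "y \<in> {0..?b}" for x y
        using *[of x y] *[of y x] that
        by (cases "x \<le> y") (auto simp: dist_real_def abs_minus_commute)
      show "0 \<le> K * (1 + ?b)" using K_pos b by simp
    qed
  qed
  then show ?thesis
    using IVT'[of mass 0 "real k" ?b] up b by (auto simp: mass_0)
qed

text \<open>The \<open>k\<close>-th zero is the \<open>k\<close>-th quantile of the density, so between consecutive zeros the density has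
  mass one.\<close>

definition zero :: "nat \<Rightarrow> real" where
  "zero k = (SOME t. t \<ge> 0 \<and> mass t = real k)"

lemma zero_nonneg: "0 \<le> zero k" and mass_zero: "mass (zero k) = real k"
proof -
  have "zero k \<ge> 0 \<and> mass (zero k) = real k"
    unfolding zero_def by (rule someI_ex) (use ex_mass_eq in blast)
  then show "0 \<le> zero k" "mass (zero k) = real k" by auto
qed

lemma zero_strict_mono: "j < k \<Longrightarrow> zero j < zero k"
proof (rule ccontr)
  assume "j < k" "\<not> zero j < zero k"
  then have "zero k \<le> zero j" by simp
  then have "0 \<le> \<delta> * (zero j - zero k)" using \<delta> by simp
  then show False
    using mass_diff_bounds(1)[OF zero_nonneg \<open>zero k \<le> zero j\<close>] \<open>j < k\<close> by (simp add: mass_zero)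
qed

lemma zero_mono: "j \<le> k \<Longrightarrow> zero j \<le> zero k"
  using zero_strict_mono[of j k] by (cases "j = k") auto

lemma zero_0: "zero 0 = 0"
proof (rule ccontr)
  assume "zero 0 \<noteq> 0"
  then have "0 < \<delta> * (zero 0 - 0)" using zero_nonneg[of 0] \<delta> by simp
  then show False using mass_diff_bounds(1)[of 0 "zero 0"] zero_nonneg[of 0] by (simp add: mass_0 mass_zero)
qed

lemma zero_pos: "k > 0 \<Longrightarrow> zero k > 0"
  using zero_strict_mono[of 0 k] by (simp add: zero_0)

lemma less_zero: "0 \<le> t \<Longrightarrow> mass t < real k \<Longrightarrow> t < zero k"
proof (rule ccontr)
  assume *: "0 \<le> t" "mass t < real k" "\<not> t < zero k"
  then have "zero k \<le> t" by simp
  then have "0 \<le> \<delta> * (t - zero k)" using \<delta> by simp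
  then show False using mass_diff_bounds(1)[OF zero_nonneg \<open>zero k \<le> t\<close>] * by (simp add: mass_zero)
qed

definition cell :: "nat \<Rightarrow> real \<Rightarrow> real" where
  "cell k t = indicator {zero k..zero (Suc k)} t * \<rho> t"

lemma cell_nonneg: "0 \<le> cell k t" using density_pos[of t] by (simp add: cell_def)

lemma measurable_cell [measurable]: "cell k \<in> borel_measurable borel"
  unfolding cell_def by measurable

lemma integrable_cell: "integrable lborel (cell k)"
  unfolding cell_def by (rule integrable_density_Icc)

lemma integral_cell: "(LBINT t. cell k t) = 1"
  unfolding cell_def using mass_diff[OF zero_nonneg zero_mono[of k "Suc k"]] by (simp add: mass_zero)

lemma integrable_cell_mult:
  assumes "integrable lborel (\<lambda>t. g t * \<rho> t)"
  shows "integrable lborel (\<lambda>t. g t * cell k t)"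
proof -
  have "integrable lborel (\<lambda>t. g t * \<rho> t * indicator {zero k..zero (Suc k)} t)"
    by (rule integrable_real_mult_indicator[OF _ assms]) simp
  then show ?thesis by (simp add: cell_def mult_ac)
qed

lemma cell_integral_ge:
  assumes i: "integrable lborel (\<lambda>t. g t * \<rho> t)" and le: "\<And>t. t \<in> {zero k..zero (Suc k)} \<Longrightarrow> c \<le> g t"
  shows "c \<le> (LBINT t. g t * cell k t)"
proof -
  have "c = (LBINT t. c * cell k t)" using integral_mult_right_zero[of lborel c "cell k"] by (simp add: integral_cell)
  also have "\<dots> \<le> (LBINT t. g t * cell k t)"
  proof (rule integral_mono)
    show "integrable lborel (\<lambda>t. c * cell k t)" by (rule integrable_mult_right[OF integrable_cell])
    show "c * cell k t \<le> g t * cell k t" for t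
    proof (cases "t \<in> {zero k..zero (Suc k)}")
      case True
      then show ?thesis by (intro mult_right_mono le cell_nonneg)
    qed (auto simp: cell_def indicator_def)
  qed (rule integrable_cell_mult[OF i])
  finally show ?thesis .
qed

lemma sum_cell_integral:
  assumes i: "integrable lborel (\<lambda>t. g t * \<rho> t)"
  shows "(\<Sum>k<N. LBINT t. g t * cell k t) = (LBINT t. indicator {0..zero N} t * (g t * \<rho> t))"
proof (induction N)
  case 0
  have "(LBINT t. indicator {0..0} t * (g t * \<rho> t)) = (LBINT t::real. 0)"
  proof (rule integral_cong_AE)
    have "AE u in lborel. u \<noteq> (0::real)" by (rule AE_lborel_singleton)
    then show "AE t in lborel. indicator {0..0} t * (g t * \<rho> t) = 0"
      by eventually_elim (auto simp: indicator_def)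
    show "(\<lambda>t. indicator {0..0} t * (g t * \<rho> t)) \<in> borel_measurable lborel"
      using i by (intro borel_measurable_times[OF borel_measurable_indicator]) simp_all
  qed simp
  then show ?case by (simp add: zero_0)
next
  case (Suc N)
  have m: "(\<lambda>t. g t * \<rho> t) \<in> borel_measurable lborel" using i by auto
  have ii: "integrable lborel (\<lambda>t. indicator {0..zero N} t * (g t * \<rho> t))"
    using integrable_real_mult_indicator[OF _ i, of "{0..zero N}"] by (simp add: mult_ac)
  have "(\<Sum>k<Suc N. LBINT t. g t * cell k t)
     = (LBINT t. indicator {0..zero N} t * (g t * \<rho> t) + g t * cell N t)"
    using Suc ii integrable_cell_mult[OF i, of N] by simp
  also have "\<dots> = (LBINT t. indicator {0..zero (Suc N)} t * (g t * \<rho> t))"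
  proof (rule integral_cong_AE)
    have "AE u in lborel. u \<noteq> zero N" by (rule AE_lborel_singleton)
    then show "AE t in lborel. indicator {0..zero N} t * (g t * \<rho> t) + g t * cell N t
      = indicator {0..zero (Suc N)} t * (g t * \<rho> t)"
      by eventually_elim
         (use zero_nonneg[of N] zero_mono[of N "Suc N"] in \<open>auto simp: indicator_def cell_def\<close>)
    show "(\<lambda>t. indicator {0..zero N} t * (g t * \<rho> t) + g t * cell N t) \<in> borel_measurable lborel"
      using ii integrable_cell_mult[OF i, of N] by (intro borel_measurable_add) auto
    show "(\<lambda>t. indicator {0..zero (Suc N)} t * (g t * \<rho> t)) \<in> borel_measurable lborel"
      by (rule borel_measurable_times[OF borel_measurable_indicator m]) simp
  qed
  finally show ?case .
qed

text \<open>Each term is at most the average of 1 / (1 + t^2) over the cell that ends at that zero.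
  The cells have unit mass and do not overlap, so the integral of the weighted density bounds all
  partial sums.\<close>

lemma summable_zero: "summable (\<lambda>k. 1 / ((zero (Suc k))\<^sup>2 + 1))"
proof (rule summableI_nonneg_bounded)
  show "0 \<le> 1 / ((zero (Suc k))\<^sup>2 + 1)" for k by simp
  have i: "integrable lborel (\<lambda>t. 1 / (1 + t\<^sup>2) * \<rho> t)" using integrable_density by simp
  show "(\<Sum>k<N. 1 / ((zero (Suc k))\<^sup>2 + 1)) \<le> (LBINT t. \<rho> t / (1 + t\<^sup>2))" for N
  proof -
    have "(\<Sum>k<N. 1 / ((zero (Suc k))\<^sup>2 + 1)) \<le> (\<Sum>k<N. LBINT t. 1 / (1 + t\<^sup>2) * cell k t)"
    proof (rule sum_mono, rule cell_integral_ge[OF i])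
      fix k t assume "t \<in> {zero k..zero (Suc k)}"
      then have "t\<^sup>2 \<le> (zero (Suc k))\<^sup>2" using zero_nonneg[of k] by (intro power_mono) auto
      then show "1 / ((zero (Suc k))\<^sup>2 + 1) \<le> 1 / (1 + t\<^sup>2)"
        by (intro divide_left_mono) (auto simp: add_nonneg_pos add_pos_nonneg)
    qed
    also have "\<dots> = (LBINT t. indicator {0..zero N} t * (1 / (1 + t\<^sup>2) * \<rho> t))"
      by (rule sum_cell_integral[OF i])
    also have "\<dots> \<le> (LBINT t. \<rho> t / (1 + t\<^sup>2))"
    proof (rule integral_mono[OF _ integrable_density])
      show "integrable lborel (\<lambda>t. indicator {0..zero N} t * (1 / (1 + t\<^sup>2) * \<rho> t))"
        using integrable_real_mult_indicator[OF _ i, of "{0..zero N}"] by (simp add: mult_ac)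
      show "indicator {0..zero N} t * (1 / (1 + t\<^sup>2) * \<rho> t) \<le> \<rho> t / (1 + t\<^sup>2)" for t
        using density_pos[of t] by (auto simp: indicator_def)
    qed
    finally show ?thesis .
  qed
qed

text \<open>The possible loss on one cell: 1 + ln (1 + T^2) with T = 2 |z| + 2 covers the
  denominators and the part beyond T, and each of the singularities near Re z and - Re z costs ln (1
  + T) + 8 K.\<close>

definition cell_error :: "complex \<Rightarrow> real" where
  "cell_error z = 1 + ln (1 + (2 * cmod z + 2)\<^sup>2) + 2 * ln (1 + (2 * cmod z + 2)) + 16 * K"

text \<open>Up to T the density is at most K (1 + T). Rescaling the singularity by 1 + T cancels
  this factor, so T enters only through its logarithm.\<close>

lemma cell_log_minus_le:
  assumes "T \<ge> 0"
  shows "integrable lborel (\<lambda>t. indicator {0..T} t * log_minus (t - x) * cell k t)"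
    and "(LBINT t. indicator {0..T} t * log_minus (t - x) * cell k t) \<le> ln (1 + T) + 8 * K"
proof -
  let ?M = "1 + T"
  have M: "?M > 0" "?M \<ge> 1" using assms by auto
  have i: "integrable lborel (\<lambda>t. ln ?M * cell k t + K * ?M * log_minus (?M * (t - x)))"
    using integrable_cell integrable_log_minus_affine[OF M(1)] by auto
  have le: "indicator {0..T} t * log_minus (t - x) * cell k t
      \<le> ln ?M * cell k t + K * ?M * log_minus (?M * (t - x))" for t
  proof (cases "t \<in> {0..T}")
    case True
    have "cell k t \<le> \<rho> t" using density_pos[of t] by (auto simp: cell_def indicator_def)
    also have "\<dots> \<le> K * (1 + \<bar>t\<bar>)" by (rule density_le)
    also have "\<dots> \<le> K * ?M" using True K_pos by (intro mult_left_mono) auto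
    finally have c: "log_minus (?M * (t - x)) * cell k t \<le> log_minus (?M * (t - x)) * (K * ?M)"
      by (intro mult_left_mono log_minus_nonneg)
    have "log_minus (t - x) * cell k t \<le> (ln ?M + log_minus (?M * (t - x))) * cell k t"
      by (intro mult_right_mono log_minus_scale cell_nonneg M)
    then show ?thesis using c True by (simp add: algebra_simps)
  next
    case False
    have "0 \<le> ln ?M * cell k t + K * ?M * log_minus (?M * (t - x))"
      using M K_pos cell_nonneg log_minus_nonneg by (intro add_nonneg_nonneg mult_nonneg_nonneg) auto
    then show ?thesis using False by simp
  qed
  show i': "integrable lborel (\<lambda>t. indicator {0..T} t * log_minus (t - x) * cell k t)"
    by (rule integrable_le_nonneg[OF i _ _ le])
       (auto intro!: mult_nonneg_nonneg cell_nonneg log_minus_nonneg)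
  have "(LBINT t. indicator {0..T} t * log_minus (t - x) * cell k t)
      \<le> (LBINT t. ln ?M * cell k t + K * ?M * log_minus (?M * (t - x)))"
    by (rule integral_mono[OF i' i le])
  also have "\<dots> = ln ?M + K * ?M * (LBINT t. log_minus (?M * (t - x)))"
    using integrable_cell integrable_log_minus_affine[OF M(1)] by (simp add: integral_cell)
  also have "\<dots> \<le> ln ?M + K * ?M * (8 / ?M)"
    using M K_pos by (intro add_left_mono mult_left_mono integral_log_minus_affine_le) auto
  also have "\<dots> = ln ?M + 8 * K" using M by simp
  finally show "(LBINT t. indicator {0..T} t * log_minus (t - x) * cell k t) \<le> ln (1 + T) + 8 * K" .
qed

text \<open>Distances from z and - z are bounded below by distances from their real parts, so the
  bound stays uniform as Im z tends to 0. This uniformity is needed to reach the real axis.\<close>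

lemma cell_log_factor_ge:
  assumes z: "Im z > 0" and i: "integrable lborel (\<lambda>t. log_factor z t * \<rho> t)"
  shows "- cell_error z \<le> (LBINT t. log_factor z t * cell k t)"
proof -
  \<comment> \<open>For t > T we have |z| <= t / 2 and t > 2, so |t^2 - z^2| >= 3 t^2 / 4 >= (t^2 +
    1) / 2. Beyond T the factor thus has modulus at least 1/2.\<close>
  define T where "T = 2 * cmod z + 2"
  have T: "T \<ge> 2" by (simp add: T_def)
  let ?x = "Re z"
  let ?f = "\<lambda>t. (1 + ln (1 + T\<^sup>2)) * cell k t + indicator {0..T} t * log_minus (t - ?x) * cell k t
    + indicator {0..T} t * log_minus (t - (- ?x)) * cell k t"
  have T0: "T \<ge> 0" using T by simp
  note c = cell_log_minus_le[OF T0, of ?x k] cell_log_minus_le[OF T0, of "- ?x" k]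
  have "- (LBINT t. log_factor z t * cell k t) = (LBINT t. - (log_factor z t * cell k t))" by simp
  also have "\<dots> \<le> (LBINT t. ?f t)"
  proof (rule integral_mono_AE)
    show "integrable lborel (\<lambda>t. - (log_factor z t * cell k t))" using integrable_cell_mult[OF i] by simp
    show "integrable lborel ?f" using c integrable_cell by auto
    have "AE t in lborel. t \<noteq> ?x" "AE t in lborel. t \<noteq> - ?x" by (rule AE_lborel_singleton)+
    then show "AE t in lborel. - (log_factor z t * cell k t) \<le> ?f t"
    proof eventually_elim
      case (elim t)
      have p: "t\<^sup>2 + 1 > 0" by (simp add: add_nonneg_pos)
      have f: "(of_real t)\<^sup>2 - z\<^sup>2 = - ((z - t) * (z + t))" by (simp add: power2_eq_square algebra_simps)
      have n: "cmod (z - t) > 0" "cmod (z + t) > 0" using z by (auto simp: complex_eq_iff)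
      have g: "log_factor z t = ln (cmod (z - t)) + ln (cmod (z + t)) - ln (t\<^sup>2 + 1)"
        unfolding log_factor_def f norm_minus_cancel norm_mult using n p by (simp add: ln_divide_pos ln_mult_pos)
      show ?case
      proof (cases "t \<in> {zero k..zero (Suc k)}")
        case True
        then have t0: "t \<ge> 0" using zero_nonneg[of k] by auto
        have "- log_factor z t \<le> (1 + ln (1 + T\<^sup>2)) + indicator {0..T} t * log_minus (t - ?x)
          + indicator {0..T} t * log_minus (t - (- ?x))"
        proof (cases "t \<le> T")
          case True
          have "\<bar>t - ?x\<bar> \<le> cmod (z - t)" using abs_Re_le_cmod[of "z - t"] by (simp add: abs_minus_commute)
          then have "ln \<bar>t - ?x\<bar> \<le> ln (cmod (z - t))" using elim by (intro ln_mono) auto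
          then have 1: "- ln (cmod (z - t)) \<le> log_minus (t - ?x)" using log_minus_le[of "t - ?x"] elim by simp
          have "\<bar>t - (- ?x)\<bar> \<le> cmod (z + t)" using abs_Re_le_cmod[of "z + t"] by (simp add: add.commute)
          then have "ln \<bar>t - (- ?x)\<bar> \<le> ln (cmod (z + t))" using elim by (intro ln_mono) auto
          then have 2: "- ln (cmod (z + t)) \<le> log_minus (t - (- ?x))" using log_minus_le[of "t - (- ?x)"] elim by simp
          have "t\<^sup>2 \<le> T\<^sup>2" using True t0 by (intro power_mono)
          then have 3: "ln (t\<^sup>2 + 1) \<le> ln (1 + T\<^sup>2)" using p by (intro ln_mono) auto
          show ?thesis using 1 2 3 True t0 unfolding g by simp
        next
          case False
          have tz: "cmod z \<le> t / 2" "t > 2" using False T norm_ge_zero[of z] unfolding T_def by linarith+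
          have "t / 2 \<le> cmod (z - t)"
            using norm_triangle_ineq2[of "of_real t" z] tz t0 by (simp add: norm_minus_commute)
          moreover have "t / 2 \<le> cmod (z + t)"
            using norm_triangle_ineq2[of "of_real t" "- z"] tz t0 by (simp add: add.commute)
          moreover have "cmod (of_real t - z) \<ge> t - cmod z" using norm_triangle_ineq2[of "of_real t" z] t0 by simp
          have "cmod ((of_real t)\<^sup>2 - z\<^sup>2) \<ge> t\<^sup>2 - (cmod z)\<^sup>2"
            using norm_triangle_ineq2[of "(of_real t)\<^sup>2" "z\<^sup>2"] by (simp add: norm_power)
          moreover have "(cmod z)\<^sup>2 \<le> (t / 2)\<^sup>2" using tz by (intro power_mono) auto
          moreover have "4 \<le> t\<^sup>2" using tz power_mono[of 2 t 2] by simp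
          ultimately have "(t\<^sup>2 + 1) / 2 \<le> cmod ((of_real t)\<^sup>2 - z\<^sup>2)" by (simp add: power_divide)
          then have "1 / 2 \<le> cmod ((of_real t)\<^sup>2 - z\<^sup>2) / (t\<^sup>2 + 1)" using p by (simp add: field_simps)
          then have "ln (1 / 2) \<le> log_factor z t" unfolding log_factor_def by (intro ln_mono) auto
          then have "- log_factor z t \<le> ln 2" by (simp add: ln_div)
          also have "\<dots> \<le> 1" using ln_2_less_1 by simp
          also have "\<dots> \<le> 1 + ln (1 + T\<^sup>2)" by simp
          finally have "- log_factor z t \<le> 1 + ln (1 + T\<^sup>2)" .
          then show ?thesis using False by simp
        qed
        then have "- log_factor z t * cell k t \<le> ((1 + ln (1 + T\<^sup>2)) + indicator {0..T} t * log_minus (t - ?x)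
          + indicator {0..T} t * log_minus (t - (- ?x))) * cell k t"
          by (intro mult_right_mono cell_nonneg)
        then show ?thesis by (simp add: distrib_right)
      next
        case False
        then have "cell k t = 0" by (auto simp: cell_def indicator_def)
        then show ?thesis by simp
      qed
    qed
  qed
  also have "(LBINT t. ?f t) = (1 + ln (1 + T\<^sup>2)) + (LBINT t. indicator {0..T} t * log_minus (t - ?x) * cell k t)
    + (LBINT t. indicator {0..T} t * log_minus (t - (- ?x)) * cell k t)"
    using c integrable_cell by (simp add: integral_cell)
  finally show ?thesis using c unfolding cell_error_def T_def[symmetric] by linarith
qed

text \<open>On the decreasing branch of \<open>log_factor\<close> the value at the right end of a
  cell is at most the average over the cell; on the increasing branch this holds for the left end.
  Only the cell at the turning point is left over, and \<open>cell_log_factor_ge\<close> bounds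
  it.\<close>

lemma sum_log_factor_zero_le:
  assumes z: "Im z > 0" and i: "integrable lborel (\<lambda>t. log_factor z t * \<rho> t)"
  shows "(\<Sum>k=1..N. log_factor z (zero k))
    \<le> (LBINT t. indicator {0..zero (Suc N)} t * (log_factor z t * \<rho> t)) + cell_error z"
proof -
  \<comment> \<open>D k says that the k-th zero is on the decreasing branch, in the form required by
    \<open>log_factor_antimono\<close>. If Re (1 + z^2) is negative, all zeros are on it.\<close>
  define D where "D k \<longleftrightarrow> Re (1 + z\<^sup>2) * ((zero k)\<^sup>2 + 1) \<le> (cmod (1 + z\<^sup>2))\<^sup>2" for k
  have Ddown: "D j" if "D k" "j \<le> k" for j k
  proof (cases "Re (1 + z\<^sup>2) \<ge> 0")
    case True
    have "(zero j)\<^sup>2 \<le> (zero k)\<^sup>2" using zero_mono[OF that(2)] zero_nonneg[of j] by (intro power_mono)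
    then have "Re (1 + z\<^sup>2) * ((zero j)\<^sup>2 + 1) \<le> Re (1 + z\<^sup>2) * ((zero k)\<^sup>2 + 1)"
      using True by (intro mult_left_mono) auto
    then show ?thesis using that unfolding D_def by linarith
  next
    case False
    then have "Re (1 + z\<^sup>2) * ((zero j)\<^sup>2 + 1) \<le> 0" by (intro mult_nonpos_nonneg) auto
    then show ?thesis unfolding D_def using zero_le_power2[of "cmod (1 + z\<^sup>2)"] by linarith
  qed
  \<comment> \<open>If D already fails at 0, all zeros are on the increasing branch and cell 0 is
    the unmatched one.\<close>
  define J where "J = (if D 0 then Max {k. k \<le> N \<and> D k} else 0)"
  have fin: "finite {k. k \<le> N \<and> D k}" by simp
  have J: "J \<le> N" "\<And>k. 0 < k \<Longrightarrow> k \<le> J \<Longrightarrow> D k" "\<And>k. J < k \<Longrightarrow> k \<le> N \<Longrightarrow> \<not> D k"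
  proof -
    have "J \<le> N \<and> (\<forall>k. 0 < k \<longrightarrow> k \<le> J \<longrightarrow> D k) \<and> (\<forall>k. J < k \<longrightarrow> k \<le> N \<longrightarrow> \<not> D k)"
    proof (cases "D 0")
      case True
      then have "0 \<in> {k. k \<le> N \<and> D k}" by simp
      then have "Max {k. k \<le> N \<and> D k} \<in> {k. k \<le> N \<and> D k}" using Max_in[OF fin] by blast
      then have "J \<in> {k. k \<le> N \<and> D k}" unfolding J_def using True by simp
      moreover have "k \<le> J" if "k \<le> N" "D k" for k unfolding J_def using True Max_ge[OF fin, of k] that by simp
      ultimately have "J \<le> N" "D J" "\<And>k. k \<le> N \<Longrightarrow> D k \<Longrightarrow> k \<le> J" by simp_all
      then show ?thesis using Ddown[of J] by (meson not_le)
    next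
      case False
      then have "\<not> D k" for k using Ddown[of k 0] by blast
      then show ?thesis using False by (simp add: J_def)
    qed
    then show "J \<le> N" "\<And>k. 0 < k \<Longrightarrow> k \<le> J \<Longrightarrow> D k" "\<And>k. J < k \<Longrightarrow> k \<le> N \<Longrightarrow> \<not> D k" by blast+
  qed
  have "(\<Sum>k=1..N. log_factor z (zero k)) \<le> (\<Sum>k<Suc N. LBINT t. log_factor z t * cell k t) + cell_error z"
  proof (rule sum_shift_le[OF J(1)])
    fix k assume "k < J"
    then have D: "D (Suc k)" using J(2)[of "Suc k"] by simp
    show "log_factor z (zero (Suc k)) \<le> (LBINT t. log_factor z t * cell k t)"
      by (rule cell_integral_ge[OF i], rule log_factor_antimono[OF z D[unfolded D_def]])
         (use zero_nonneg[of k] in auto)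
  next
    fix k assume "J < k" "k \<le> N"
    then have D: "\<not> D k" using J(3) by simp
    show "log_factor z (zero k) \<le> (LBINT t. log_factor z t * cell k t)"
      by (rule cell_integral_ge[OF i], rule log_factor_mono[OF z D[unfolded D_def not_le]])
         (use zero_nonneg[of k] in auto)
  qed (rule cell_log_factor_ge[OF z i])
  then show ?thesis unfolding sum_cell_integral[OF i] .
qed

text \<open>The cells cover only the half-line t >= 0, because each factor accounts for the zeros t
  and - t together. For an even integrand this is half of the full integral.\<close>

lemma tendsto_integral_zero:
  assumes i: "integrable lborel (\<lambda>t. g t * \<rho> t)" and even: "\<And>t. g (- t) * \<rho> (- t) = g t * \<rho> t"
  shows "(\<lambda>N. LBINT t. indicator {0..zero N} t * (g t * \<rho> t)) \<longlonglongrightarrow> (LBINT t. g t * \<rho> t) / 2"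
proof -
  let ?h = "\<lambda>t. g t * \<rho> t"
  have m': "?h \<in> borel_measurable lborel" by (rule borel_measurable_integrable[OF i])
  have "(\<lambda>N. LBINT t. indicator {0..zero N} t * ?h t) \<longlonglongrightarrow> (LBINT t. indicator {0..} t * ?h t)"
  proof (rule integral_dominated_convergence)
    show "integrable lborel (\<lambda>t. \<bar>?h t\<bar>)" using i by simp
    show "AE t in lborel. (\<lambda>N. indicator {0..zero N} t * ?h t) \<longlonglongrightarrow> indicator {0..} t * ?h t"
    proof (rule AE_I2, rule tendsto_eventually)
      fix t :: real
      obtain n :: nat where n: "mass t < real n" using reals_Archimedean2[of "mass t"] by auto
      have "t \<le> zero N" if "0 \<le> t" "n \<le> N" for N
        using less_zero[OF that(1), of N] n that by simp
      then show "\<forall>\<^sub>F N in sequentially. indicator {0..zero N} t * ?h t = indicator {0..} t * ?h t"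
        by (intro eventually_sequentiallyI[of n]) (auto simp: indicator_def)
    qed
    show "AE t in lborel. norm (indicator {0..zero N} t * ?h t) \<le> \<bar>?h t\<bar>" for N
    proof (rule AE_I2)
      fix t
      have "norm (indicator {0..zero N} t * x) \<le> \<bar>x\<bar>" for x :: real by (simp add: indicator_def)
      then show "norm (indicator {0..zero N} t * ?h t) \<le> \<bar>?h t\<bar>" .
    qed
    show "(\<lambda>t. indicator {0..} t * ?h t) \<in> borel_measurable lborel"
      by (rule borel_measurable_times[OF borel_measurable_indicator m']) simp
    show "(\<lambda>t. indicator {0..zero N} t * ?h t) \<in> borel_measurable lborel" for N
      by (rule borel_measurable_times[OF borel_measurable_indicator m']) simp
  qed
  moreover have "(LBINT t. indicator {0..} t * ?h t) = (LBINT t. ?h t) / 2"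
    by (rule integral_half_line_even[OF i even])
  ultimately show ?thesis by simp
qed

end

section \<open>The entire function whose zeros are the quantiles\<close>

context zero_density
begin

text \<open>The product omits the first \<open>M\<close> positive quantiles. Their factors stay
  explicit on the left-hand side, so the comparison with the integral still runs over the complete
  sequence, while dividing by them gains decay.\<close>

lemma entire_with_zeros:
  assumes even: "\<And>t. \<rho> (- t) = \<rho> t"
  obtains f where "f holomorphic_on UNIV" "f 0 \<noteq> 0" "\<And>z. f (cnj z) = cnj (f z)"
    "\<And>z. Im z > 0 \<Longrightarrow> integrable lborel (\<lambda>t. log_factor z t * \<rho> t) \<Longrightarrow>
      cmod (f (z\<^sup>2)) * (\<Prod>k=1..M. cmod ((of_real (zero k))\<^sup>2 - z\<^sup>2) / ((zero k)\<^sup>2 + 1))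
        \<le> exp ((LBINT t. log_factor z t * \<rho> t) / 2 + cell_error z)"
proof -
  define b where "b k = 1 / ((zero (Suc (k + M)))\<^sup>2 + 1)" for k
  have sb: "summable b" unfolding b_def using summable_ignore_initial_segment[OF summable_zero, of M] .
  have b: "0 \<le> b k" "b k < 1" for k
  proof -
    have "(zero (Suc (k + M)))\<^sup>2 > 0" using zero_pos[of "Suc (k + M)"] by simp
    then show "b k < 1" by (simp add: b_def divide_less_eq add_pos_pos)
  qed (simp add: b_def)
  obtain f where f: "f holomorphic_on UNIV" "f 0 \<noteq> 0" "\<And>z. f (cnj z) = cnj (f z)"
    "\<And>z. (\<lambda>N. \<Prod>k<N. 1 - (1 + z) * of_real (b k)) \<longlonglongrightarrow> f z"
    using entire_product[OF sb b] by metis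
  show thesis
  proof (rule that[OF f(1,2)])
    show "f (cnj z) = cnj (f z)" for z by (rule f)
    fix z assume z: "Im z > 0" and i: "integrable lborel (\<lambda>t. log_factor z t * \<rho> t)"
    let ?c = "\<lambda>k. cmod ((of_real (zero k))\<^sup>2 - z\<^sup>2) / ((zero k)\<^sup>2 + 1)"
    have cpos: "?c k > 0" for k
    proof -
      have "(of_real (zero k))\<^sup>2 - z\<^sup>2 = - ((z - zero k) * (z + zero k))" by (simp add: power2_eq_square algebra_simps)
      moreover have "z - zero k \<noteq> 0" "z + zero k \<noteq> 0" using z by (auto simp: complex_eq_iff)
      ultimately have "cmod ((of_real (zero k))\<^sup>2 - z\<^sup>2) > 0" by simp
      moreover have "(zero k)\<^sup>2 + 1 > 0" by (simp add: add_nonneg_pos)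
      ultimately show ?thesis by simp
    qed
    have prod: "cmod (\<Prod>k<N. 1 - (1 + z\<^sup>2) * of_real (b k)) * (\<Prod>k=1..M. ?c k)
      = exp (\<Sum>k=1..M + N. log_factor z (zero k))" for N
    proof -
      have "cmod (\<Prod>k<N. 1 - (1 + z\<^sup>2) * of_real (b k)) = (\<Prod>k<N. ?c (Suc (k + M)))"
        unfolding prod_norm[symmetric] b_def log_factor_alt by (simp add: mult.commute)
      moreover have "(\<Prod>k<N. c (Suc (k + M))) * (\<Prod>k=1..M. c k) = (\<Prod>k=1..M + N. c k)" for c :: "nat \<Rightarrow> real"
        by (induction N) (auto simp: mult_ac add_ac)
      ultimately have "cmod (\<Prod>k<N. 1 - (1 + z\<^sup>2) * of_real (b k)) * (\<Prod>k=1..M. ?c k) = (\<Prod>k=1..M + N. ?c k)"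
        by simp
      also have "\<dots> = exp (\<Sum>k=1..M + N. log_factor z (zero k))"
        unfolding exp_sum[OF finite_atLeastAtMost] log_factor_def using cpos by (simp add: exp_ln)
      finally show ?thesis .
    qed
    show "cmod (f (z\<^sup>2)) * (\<Prod>k=1..M. ?c k) \<le> exp ((LBINT t. log_factor z t * \<rho> t) / 2 + cell_error z)"
    proof (rule LIMSEQ_le)
      show "(\<lambda>N. cmod (\<Prod>k<N. 1 - (1 + z\<^sup>2) * of_real (b k)) * (\<Prod>k=1..M. ?c k))
        \<longlonglongrightarrow> cmod (f (z\<^sup>2)) * (\<Prod>k=1..M. ?c k)"
        by (rule tendsto_mult[OF tendsto_norm[OF f(4)] tendsto_const])
      have "(\<lambda>N. LBINT t. indicator {0..zero N} t * (log_factor z t * \<rho> t)) \<longlonglongrightarrow> (LBINT t. log_factor z t * \<rho> t) / 2"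
        by (rule tendsto_integral_zero[OF i]) (simp add: log_factor_even even)
      from LIMSEQ_ignore_initial_segment[OF this, of "Suc M"]
      have "(\<lambda>N. LBINT t. indicator {0..zero (Suc (M + N))} t * (log_factor z t * \<rho> t)) \<longlonglongrightarrow> (LBINT t. log_factor z t * \<rho> t) / 2"
        by (simp add: add.commute)
      from tendsto_exp[OF tendsto_add[OF this tendsto_const]]
      show "(\<lambda>N. exp ((LBINT t. indicator {0..zero (Suc (M + N))} t * (log_factor z t * \<rho> t)) + cell_error z))
        \<longlonglongrightarrow> exp ((LBINT t. log_factor z t * \<rho> t) / 2 + cell_error z)" .
      show "\<exists>N0. \<forall>N\<ge>N0. cmod (\<Prod>k<N. 1 - (1 + z\<^sup>2) * of_real (b k)) * (\<Prod>k=1..M. ?c k)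
        \<le> exp ((LBINT t. indicator {0..zero (Suc (M + N))} t * (log_factor z t * \<rho> t)) + cell_error z)"
        unfolding prod using sum_log_factor_zero_le[OF z i] by simp
    qed
  qed
qed

text \<open>The error is four times a logarithm of |z| up to constants, hence a polynomial factor of
  degree 4 after exponentiation; 81 is 3^4.\<close>

lemma exp_cell_error_le: "exp (cell_error z) \<le> 81 * exp (1 + 16 * K) * (1 + cmod z) ^ 4"
proof -
  let ?T = "2 * cmod z + 2"
  have T: "1 + ?T \<le> 3 * (1 + cmod z)" "?T \<ge> 0" by simp_all
  have "1 + ?T\<^sup>2 \<le> (1 + ?T)\<^sup>2" by (simp add: power2_eq_square algebra_simps)
  also have "\<dots> \<le> (3 * (1 + cmod z))\<^sup>2" using T by (intro power_mono) auto
  finally have 1: "1 + ?T\<^sup>2 \<le> (3 * (1 + cmod z))\<^sup>2" .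
  have 2: "(1 + ?T)\<^sup>2 \<le> (3 * (1 + cmod z))\<^sup>2" using T by (intro power_mono) auto
  have p: "1 + ?T\<^sup>2 > 0" by (simp add: add_pos_nonneg)
  have "exp (cell_error z) = exp ((1 + 16 * K) + ln (1 + ?T\<^sup>2) + (ln (1 + ?T) + ln (1 + ?T)))"
    unfolding cell_error_def by (simp add: algebra_simps)
  also have "\<dots> = exp (1 + 16 * K) * (1 + ?T\<^sup>2) * ((1 + ?T) * (1 + ?T))"
    unfolding exp_add[of "_ + _" "_ + _"] exp_add[of "1 + 16 * K"] exp_add[of "ln (1 + ?T)"]
    using p T by (simp only: exp_ln)
  also have "\<dots> \<le> exp (1 + 16 * K) * (3 * (1 + cmod z))\<^sup>2 * (3 * (1 + cmod z))\<^sup>2"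
    using 1 2 p unfolding power2_eq_square[of "1 + ?T", symmetric]
    by (intro mult_mono) auto
  also have "\<dots> = 81 * exp (1 + 16 * K) * (1 + cmod z) ^ 4"
  proof -
    have "e * (3 * a)\<^sup>2 * (3 * a)\<^sup>2 = 81 * e * a ^ 4" for e a :: real
      by (simp add: power2_eq_square power4_eq_xxxx)
    then show ?thesis .
  qed
  finally show ?thesis .
qed

text \<open>Each omitted factor is quadratic in z. For |z| > 2 Z the zeros lie below |z| / 2, so
  |z|^2 / 2 bounds each numerator from below, while Z^2 + 1 bounds all denominators.\<close>

lemma prod_zero_ge:
  obtains c R where "c > 0" "R \<ge> 1" "\<And>z. cmod z \<ge> R \<Longrightarrow>
    c * (1 + cmod z) ^ (2 * M) \<le> (\<Prod>k=1..M. cmod ((of_real (zero k))\<^sup>2 - z\<^sup>2) / ((zero k)\<^sup>2 + 1))"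
proof -
  define Z where "Z = zero M"
  define c0 where "c0 = 1 / (8 * (Z\<^sup>2 + 1))"
  have Zp: "Z\<^sup>2 + 1 > 0" by (simp add: add_nonneg_pos)
  have c0: "c0 > 0" using Zp by (simp add: c0_def)
  have le: "c0 * (1 + cmod z)\<^sup>2 \<le> cmod ((of_real (zero k))\<^sup>2 - z\<^sup>2) / ((zero k)\<^sup>2 + 1)"
    if R: "cmod z \<ge> 2 * Z + 1" and k: "k \<in> {1..M}" for z k
  proof -
    have zk: "0 \<le> zero k" "zero k \<le> Z" using zero_nonneg[of k] zero_mono[of k M] k by (auto simp: Z_def)
    then have zZ: "(zero k)\<^sup>2 \<le> Z\<^sup>2" by (intro power_mono)
    have "(zero k)\<^sup>2 \<le> (cmod z / 2)\<^sup>2" using zk R by (intro power_mono) auto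
    then have 1: "(zero k)\<^sup>2 \<le> (cmod z)\<^sup>2 / 4" by (simp add: power_divide)
    have "(cmod z)\<^sup>2 - (zero k)\<^sup>2 \<le> cmod ((of_real (zero k))\<^sup>2 - z\<^sup>2)"
      using norm_triangle_ineq2[of "z\<^sup>2" "(of_real (zero k))\<^sup>2"] by (simp add: norm_power norm_minus_commute)
    then have 2: "(cmod z)\<^sup>2 / 2 \<le> cmod ((of_real (zero k))\<^sup>2 - z\<^sup>2)" using 1 zero_le_power2[of "cmod z"] by linarith
    have "1 + cmod z \<le> 2 * cmod z" using R zk by auto
    then have "(1 + cmod z)\<^sup>2 \<le> (2 * cmod z)\<^sup>2" by (intro power_mono) auto
    then have 3: "(1 + cmod z)\<^sup>2 / 8 \<le> (cmod z)\<^sup>2 / 2" by (simp add: power_mult_distrib)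
    have "((1 + cmod z)\<^sup>2 / 8) / (Z\<^sup>2 + 1) \<le> cmod ((of_real (zero k))\<^sup>2 - z\<^sup>2) / ((zero k)\<^sup>2 + 1)"
      using 2 3 zZ by (intro frac_le) (auto simp: add_nonneg_pos)
    then show ?thesis by (simp add: c0_def)
  qed
  show thesis
  proof (rule that[of "c0 ^ M" "2 * Z + 1"])
    fix z assume R: "cmod z \<ge> 2 * Z + 1"
    have "(\<Prod>k=1..M. c0 * (1 + cmod z)\<^sup>2) \<le> (\<Prod>k=1..M. cmod ((of_real (zero k))\<^sup>2 - z\<^sup>2) / ((zero k)\<^sup>2 + 1))"
      using le[OF R] c0 by (intro prod_mono) auto
    then show "c0 ^ M * (1 + cmod z) ^ (2 * M) \<le> (\<Prod>k=1..M. cmod ((of_real (zero k))\<^sup>2 - z\<^sup>2) / ((zero k)\<^sup>2 + 1))"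
      by (simp add: power_mult_distrib power_mult)
  qed (use c0 zero_nonneg[of M] in \<open>auto simp: Z_def\<close>)
qed

end

text \<open>The logarithmic potentials are estimated only for Im z > 0. Both sides of the resulting
  inequalities are continuous, so they persist on the real axis.\<close>

lemma upper_half_plane_closure:
  fixes g h :: "complex \<Rightarrow> real"
  assumes le: "\<And>z. Im z > 0 \<Longrightarrow> Im z \<le> 1 \<Longrightarrow> Re z = x \<Longrightarrow> g z \<le> h z"
    and g: "isCont g (of_real x)" and h: "isCont h (of_real x)"
  shows "g (of_real x) \<le> h (of_real x)"
proof -
  define s where "s n = Complex x (1 / (real n + 1))" for n
  have s: "s \<longlonglongrightarrow> of_real x"
  proof -
    have "(\<lambda>n. 1 / (real n + 1)) \<longlonglongrightarrow> 0" by real_asymp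
    then have "(\<lambda>n. Complex x (1 / (real n + 1))) \<longlonglongrightarrow> Complex x 0"
      by (intro tendsto_Complex tendsto_const)
    then show ?thesis unfolding s_def[abs_def] by (simp add: complex_of_real_def)
  qed
  show ?thesis
  proof (rule LIMSEQ_le)
    show "(\<lambda>n. g (s n)) \<longlonglongrightarrow> g (of_real x)" by (rule isCont_tendsto_compose[OF g s])
    show "(\<lambda>n. h (s n)) \<longlonglongrightarrow> h (of_real x)" by (rule isCont_tendsto_compose[OF h s])
    show "\<exists>N. \<forall>n\<ge>N. g (s n) \<le> h (s n)"
      using le by (auto simp: s_def)
  qed
qed

text \<open>Both estimates come from the single bound \<open>upper\<close>: with d = 0 it gives the
  exponential type, and with d = W x - L near the real axis it gives the decay.\<close>

theorem multiplier_exists: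
  fixes W :: "real \<Rightarrow> real" and m :: nat
  assumes nn: "\<And>x. W x \<ge> 0" and even: "\<And>x. W (- x) = W x"
    and L: "L > 0" and lip: "\<And>x y. \<bar>W x - W y\<bar> \<le> L * \<bar>x - y\<bar>"
    and int: "integrable lborel (\<lambda>x. W x / (1 + x\<^sup>2))" and \<tau>: "\<tau> > 0"
  obtains f C where "f holomorphic_on UNIV" "f 0 \<noteq> 0" "\<And>z. f (cnj z) = cnj (f z)" "C > 0"
    "\<And>z. cmod (f (z\<^sup>2)) * (1 + cmod z) ^ m \<le> C * exp (\<tau> * \<bar>Im z\<bar>)"
    "\<And>x. cmod (f (of_real (x\<^sup>2))) * (1 + \<bar>x\<bar>) ^ m \<le> C * exp (- W x)"
proof -
  \<comment> \<open>The gap gains ln (3/2) times the majorant, and the product sees half of the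
    integral. A majorant of A W therefore yields exactly W.\<close>
  define A where "A = 2 / ln (3/2 :: real)"
  have A: "A > 0" by (simp add: A_def)
  \<comment> \<open>With this e the constant part of the density contributes \<tau> Im z - \<tau> to
    the integral, and the product sees half of that.\<close>
  define e where "e = \<tau> / (2 * pi)"
  have e: "e > 0" using \<tau> by (simp add: e_def)
  have intA: "integrable lborel (\<lambda>x. A * W x / (1 + x\<^sup>2))"
    using integrable_mult_right[OF int, of A] by simp
  have lipA: "\<bar>A * W x - A * W y\<bar> \<le> A * L * \<bar>x - y\<bar>" for x y
    using mult_left_mono[OF lip[of x y], of A] A by (simp add: right_diff_distrib[symmetric] abs_mult mult.assoc)
  have AL: "A * L > 0" using A L by simp
  have nnA: "A * W x \<ge> 0" for x using A nn by simp
  have evenA: "A * W (- x) = A * W x" for x using even by simp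
  have e2: "e / 2 > 0" using e by simp
  obtain \<Omega> X0 K where \<Omega>: "\<Omega> \<in> borel_measurable borel" "\<And>x. 0 \<le> \<Omega> x" "\<And>x. \<Omega> (- x) = \<Omega> x"
      "\<And>x. \<Omega> x \<le> K * \<bar>x\<bar>" "integrable lborel (\<lambda>x. \<Omega> x / (1 + x\<^sup>2))"
      "\<And>x. X0 \<le> \<bar>x\<bar> \<Longrightarrow> A * W x \<le> \<Omega> x" "\<And>x. poisson \<Omega> x - e / 2 \<le> \<Omega> x"
    by (rule global_majorant[where W="\<lambda>x. A * W x", OF nnA evenA AL lipA intA e2]) (rule that)
  have [measurable]: "\<Omega> \<in> borel_measurable borel" by (rule \<Omega>)
  define \<rho> where "\<rho> t = e + \<Omega> t - poisson \<Omega> t" for t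
  have P0: "0 \<le> poisson \<Omega> t" for t
    unfolding poisson_def using \<Omega>(2) by (intro integral_nonneg_AE AE_I2) (simp add: poisson_kernel_nonneg)
  define K1 where "K1 = e + \<bar>K\<bar>"
  interpret zero_density \<rho> "e / 2" K1
  proof
    show "\<rho> \<in> borel_measurable borel" unfolding \<rho>_def by measurable
    show "e / 2 > 0" using e by simp
    show "e / 2 \<le> \<rho> t" for t using \<Omega>(7)[of t] by (simp add: \<rho>_def)
    show "\<rho> t \<le> K1 * (1 + \<bar>t\<bar>)" for t
    proof -
      have "\<rho> t \<le> e + \<Omega> t" using P0[of t] by (simp add: \<rho>_def)
      also have "\<Omega> t \<le> K * \<bar>t\<bar>" by (rule \<Omega>)
      also have "K * \<bar>t\<bar> \<le> \<bar>K\<bar> * \<bar>t\<bar>" by (intro mult_right_mono) auto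
      also have "e + \<bar>K\<bar> * \<bar>t\<bar> \<le> K1 * (1 + \<bar>t\<bar>)" using e by (simp add: K1_def algebra_simps)
      finally show ?thesis by simp
    qed
    have "integrable lborel (\<lambda>t. 1 / (1 + t\<^sup>2) * poisson \<Omega> t)"
      by (rule integrable_weight_mult_poisson[where C=1, OF _ \<Omega>(1) _ \<Omega>(2,5)]) simp_all
    then have "integrable lborel (\<lambda>t. e / (1 + t\<^sup>2) + \<Omega> t / (1 + t\<^sup>2) - 1 / (1 + t\<^sup>2) * poisson \<Omega> t)"
      using integrable_weight[of e] \<Omega>(5) by (intro Bochner_Integration.integrable_add Bochner_Integration.integrable_diff)
    then show "integrable lborel (\<lambda>t. \<rho> t / (1 + t\<^sup>2))"
      by (simp add: \<rho>_def add_divide_distrib diff_divide_distrib)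
  qed
  have \<rho>even: "\<rho> (- t) = \<rho> t" for t by (simp add: \<rho>_def \<Omega>(3) poisson_even[of \<Omega>, OF \<Omega>(3)])
  \<comment> \<open>The omitted factors grow like the power 2 M >= m + 4: the exponent 4 pays for
    the cell error, and m is the decay asked for.\<close>
  define M where "M = m + 4"
  obtain f where f: "f holomorphic_on UNIV" "f 0 \<noteq> 0" "\<And>z. f (cnj z) = cnj (f z)"
    "\<And>z. Im z > 0 \<Longrightarrow> integrable lborel (\<lambda>t. log_factor z t * \<rho> t) \<Longrightarrow>
      cmod (f (z\<^sup>2)) * (\<Prod>k=1..M. cmod ((of_real (zero k))\<^sup>2 - z\<^sup>2) / ((zero k)\<^sup>2 + 1))
        \<le> exp ((LBINT t. log_factor z t * \<rho> t) / 2 + cell_error z)"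
    by (rule entire_with_zeros[OF \<rho>even, of M]) (rule that)
  obtain c R where c: "c > 0" "R \<ge> 1" "\<And>z. cmod z \<ge> R \<Longrightarrow>
    c * (1 + cmod z) ^ (2 * M) \<le> (\<Prod>k=1..M. cmod ((of_real (zero k))\<^sup>2 - z\<^sup>2) / ((zero k)\<^sup>2 + 1))"
    by (rule prod_zero_ge[of M]) (rule that)
  define I0 where "I0 = (LBINT x. \<Omega> x / (1 + x\<^sup>2))"
  define C1 where "C1 = 81 * exp (1 + 16 * K1) * exp (3 * I0 / 2) / c"
  have C1: "C1 > 0" using c by (simp add: C1_def)
  have upper: "cmod (f (z\<^sup>2)) * (1 + cmod z) ^ m \<le> C1 * exp (\<tau> * Im z - d)"
    if z: "Im z > 0" "cmod z \<ge> R" and d: "2 * d \<le> (LBINT u. \<Omega> u * log_gap z u)" for z d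
  proof -
    have i: "integrable lborel (\<lambda>t. log_factor z t * \<rho> t)"
      unfolding \<rho>_def by (rule integrable_log_factor_density[OF \<Omega>(1,2,5) z(1)])
    have "(LBINT t. log_factor z t * \<rho> t) \<le> 2 * pi * e * (Im z - 1) + 3 * I0 - 2 * d"
      using integral_log_factor_density_le[OF \<Omega>(1,2,5) z(1), of e] d unfolding \<rho>_def I0_def by linarith
    also have "2 * pi * e * (Im z - 1) = \<tau> * Im z - \<tau>" by (simp add: e_def right_diff_distrib)
    finally have "(LBINT t. log_factor z t * \<rho> t) / 2 \<le> \<tau> * Im z - d + 3 * I0 / 2"
      using \<tau> mult_pos_pos[OF \<tau> z(1)] by simp
    then have "exp ((LBINT t. log_factor z t * \<rho> t) / 2 + cell_error z)
      \<le> exp ((\<tau> * Im z - d + 3 * I0 / 2) + cell_error z)" by simp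
    also have "\<dots> = exp (\<tau> * Im z - d) * exp (3 * I0 / 2) * exp (cell_error z)" by (simp only: exp_add)
    also have "\<dots> \<le> exp (\<tau> * Im z - d) * exp (3 * I0 / 2) * (81 * exp (1 + 16 * K1) * (1 + cmod z) ^ 4)"
      by (intro mult_left_mono exp_cell_error_le) auto
    finally have ub: "cmod (f (z\<^sup>2)) * (\<Prod>k=1..M. cmod ((of_real (zero k))\<^sup>2 - z\<^sup>2) / ((zero k)\<^sup>2 + 1))
      \<le> exp (\<tau> * Im z - d) * exp (3 * I0 / 2) * (81 * exp (1 + 16 * K1) * (1 + cmod z) ^ 4)"
      using f(4)[OF z(1) i] by linarith
    have "cmod (f (z\<^sup>2)) * (c * (1 + cmod z) ^ (m + 4)) \<le> cmod (f (z\<^sup>2)) * (c * (1 + cmod z) ^ (2 * M))"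
      using c by (intro mult_left_mono power_increasing) (auto simp: M_def)
    also have "\<dots> \<le> exp (\<tau> * Im z - d) * exp (3 * I0 / 2) * (81 * exp (1 + 16 * K1) * (1 + cmod z) ^ 4)"
      using ub mult_left_mono[OF c(3)[OF z(2)], of "cmod (f (z\<^sup>2))"] by simp
    finally have "(cmod (f (z\<^sup>2)) * (1 + cmod z) ^ m * c) * (1 + cmod z) ^ 4
      \<le> (exp (\<tau> * Im z - d) * exp (3 * I0 / 2) * 81 * exp (1 + 16 * K1)) * (1 + cmod z) ^ 4"
      by (simp add: power_add mult_ac)
    moreover have "(1 + cmod z) ^ 4 > 0" by (rule zero_less_power) (simp add: add_pos_nonneg)
    ultimately have "cmod (f (z\<^sup>2)) * (1 + cmod z) ^ m * c \<le> exp (\<tau> * Im z - d) * exp (3 * I0 / 2) * 81 * exp (1 + 16 * K1)"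
      by (rule mult_right_le_imp_le)
    then have "cmod (f (z\<^sup>2)) * (1 + cmod z) ^ m \<le> exp (\<tau> * Im z - d) * exp (3 * I0 / 2) * 81 * exp (1 + 16 * K1) / c"
      using c(1) by (simp only: pos_le_divide_eq)
    then show ?thesis by (simp add: C1_def mult_ac)
  qed
  have contf: "continuous_on UNIV f" by (rule holomorphic_on_imp_continuous_on[OF f(1)])
  have cont: "continuous_on S (\<lambda>z. cmod (f (z\<^sup>2)) * (1 + cmod z) ^ m)" for S
    by (intro continuous_intros continuous_on_compose2[OF contf]) auto
  have isc: "isCont (\<lambda>z. cmod (f (z\<^sup>2)) * (1 + cmod z) ^ m) z" for z
    using cont[of UNIV] by (simp add: continuous_on_eq_continuous_at)
  \<comment> \<open>Beyond R1 the estimate of the omitted factors applies, and the summand 1 keeps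
    the unit window around Re z where the majorant is valid.\<close>
  define R1 where "R1 = R + \<bar>X0\<bar> + 1"
  have R1: "R1 \<ge> R" "R1 \<ge> X0 + 1" "R1 \<ge> 0" using c by (auto simp: R1_def)
  have "bounded ((\<lambda>z. cmod (f (z\<^sup>2)) * (1 + cmod z) ^ m) ` cball 0 R1)"
    by (intro compact_imp_bounded compact_continuous_image cont compact_cball)
  then obtain B where B: "B > 0" "\<And>z. cmod z \<le> R1 \<Longrightarrow> cmod (f (z\<^sup>2)) * (1 + cmod z) ^ m \<le> B"
  proof -
    assume *: "\<And>B. 0 < B \<Longrightarrow> (\<And>z. cmod z \<le> R1 \<Longrightarrow> cmod (f (z\<^sup>2)) * (1 + cmod z) ^ m \<le> B) \<Longrightarrow> thesis"
    assume "bounded ((\<lambda>z. cmod (f (z\<^sup>2)) * (1 + cmod z) ^ m) ` cball 0 R1)"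
    then obtain b where b: "b > 0" "\<forall>y\<in>(\<lambda>z. cmod (f (z\<^sup>2)) * (1 + cmod z) ^ m) ` cball 0 R1. norm y \<le> b"
      unfolding bounded_pos by blast
    show thesis
    proof (rule *[OF b(1)])
      fix z assume "cmod z \<le> R1"
      then have "norm (cmod (f (z\<^sup>2)) * (1 + cmod z) ^ m) \<le> b" using b(2) by simp
      then show "cmod (f (z\<^sup>2)) * (1 + cmod z) ^ m \<le> b" by (simp only: real_norm_def abs_le_iff)
    qed
  qed
  \<comment> \<open>The first summand serves large |z|, with exp L for the variation of W over a
    unit window. The second serves the compact disc, where W is at most W 0 + L R1.\<close>
  define C where "C = C1 * exp L + B * exp (W 0 + L * R1)"
  have CB: "B \<le> C * exp (- W x)" if "\<bar>x\<bar> \<le> R1" for x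
  proof -
    have "W x \<le> W 0 + L * \<bar>x\<bar>" using lip[of x 0] by simp
    also have "\<dots> \<le> W 0 + L * R1" using that L by simp
    finally have "1 \<le> exp (W 0 + L * R1) * exp (- W x)" by (simp add: exp_add[symmetric])
    then have "B * 1 \<le> B * (exp (W 0 + L * R1) * exp (- W x))" using B by (intro mult_left_mono) auto
    also have "\<dots> \<le> C * exp (- W x)" using C1 by (simp add: C_def distrib_right)
    finally show ?thesis by simp
  qed
  have C: "C > 0" using C1 B by (simp add: C_def add_pos_pos)
  have CC1: "C1 \<le> C" "C1 * exp L \<le> C" "B \<le> C"
  proof -
    have "C1 * 1 \<le> C1 * exp L" using C1 L by (intro mult_left_mono) auto
    moreover have "B * 1 \<le> B * exp (W 0 + L * R1)" using B nn[of 0] L R1 by (intro mult_left_mono) auto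
    ultimately show "C1 \<le> C" "C1 * exp L \<le> C" "B \<le> C" using B(1) C1 unfolding C_def by linarith+
  qed
  have pos: "cmod (f (z\<^sup>2)) * (1 + cmod z) ^ m \<le> C * exp (\<tau> * Im z)" if z: "Im z > 0" for z
  proof (cases "cmod z \<ge> R")
    case True
    have "0 \<le> (LBINT u. \<Omega> u * log_gap z u)"
      using \<Omega>(2) log_gap_nonneg[OF z] by (intro integral_nonneg_AE AE_I2) simp
    then have "cmod (f (z\<^sup>2)) * (1 + cmod z) ^ m \<le> C1 * exp (\<tau> * Im z)" using upper[OF z True, of 0] by simp
    also have "\<dots> \<le> C * exp (\<tau> * Im z)" by (intro mult_right_mono CC1) simp
    finally show ?thesis .
  next
    case False
    then have "cmod (f (z\<^sup>2)) * (1 + cmod z) ^ m \<le> B * 1" using B(2)[of z] R1 by simp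
    also have "\<dots> \<le> C * exp (\<tau> * Im z)" using CC1 B z \<tau> by (intro mult_mono) auto
    finally show ?thesis .
  qed
  show thesis
  proof (rule that[OF f(1-3) C])
    fix z
    show "cmod (f (z\<^sup>2)) * (1 + cmod z) ^ m \<le> C * exp (\<tau> * \<bar>Im z\<bar>)"
    proof -
      consider "Im z > 0" | "Im z = 0" | "Im z < 0" by linarith
      then show ?thesis
      proof cases
        case 2
        then have zr: "z = of_real (Re z)" by (simp add: complex_eq_iff)
        have "isCont (\<lambda>z. C * exp (\<tau> * Im z)) (of_real (Re z))"
          unfolding isCont_def by (intro tendsto_intros)
        from upper_half_plane_closure[OF pos isc this] show ?thesis using zr 2 by simp
      next
        case 3
        then have "Im (cnj z) > 0" by simp
        from pos[OF this] show ?thesis using 3 f(3)[of "z\<^sup>2"] by simp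
      qed (use pos[of z] in simp)
    qed
  next
    fix x :: real
    show "cmod (f (of_real (x\<^sup>2))) * (1 + \<bar>x\<bar>) ^ m \<le> C * exp (- W x)"
    proof (cases "\<bar>x\<bar> \<le> R1")
      case True
      then show ?thesis using B(2)[of "of_real x"] CB[OF True] by simp
    next
      case False
      have "cmod (f ((of_real x)\<^sup>2)) * (1 + cmod (of_real x)) ^ m \<le> C1 * exp (\<tau> * Im (of_real x) - (W x - L))"
      proof (rule upper_half_plane_closure[where g="\<lambda>z. cmod (f (z\<^sup>2)) * (1 + cmod z) ^ m"
            and h="\<lambda>z. C1 * exp (\<tau> * Im z - (W x - L))"])
        show "isCont (\<lambda>z. C1 * exp (\<tau> * Im z - (W x - L))) (complex_of_real x)"
          unfolding isCont_def by (intro tendsto_intros)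
        fix z assume z: "Im z > 0" "Im z \<le> 1" "Re z = x"
        have zR: "cmod z \<ge> R" using abs_Re_le_cmod[of z] z False R1 by simp
        \<comment> \<open>A lower bound for the majorant on the whole unit window around x, by the
          Lipschitz condition; the maximum makes it nonnegative.\<close>
        define q where "q = max 0 (A * W x - A * L)"
        have q: "q \<le> \<Omega> u" if u: "\<bar>u - Re z\<bar> \<le> 1" for u
        proof -
          have "X0 \<le> \<bar>u\<bar>" using u z False R1 by auto
          then have "A * W u \<le> \<Omega> u" by (rule \<Omega>)
          moreover have "A * L * \<bar>x - u\<bar> \<le> A * L * 1" using u z AL by (intro mult_left_mono) auto
          moreover have "A * W x - A * W u \<le> A * L * \<bar>x - u\<bar>" using lipA[of x u] by linarith
          ultimately have "A * W x - A * L \<le> \<Omega> u" by linarith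
          then show ?thesis using \<Omega>(2)[of u] by (simp add: q_def)
        qed
        have "q * ln (3/2) \<le> (LBINT u. \<Omega> u * log_gap z u)"
          by (rule integral_log_gap_ge[OF \<Omega>(1,2,5) z(1,2) _ q]) (simp add: q_def)
        moreover have "2 * (W x - L) \<le> q * ln (3/2)"
        proof -
          have "(A * W x - A * L) * ln (3/2) \<le> q * ln (3/2)" by (intro mult_right_mono) (auto simp: q_def)
          moreover have "(A * W x - A * L) * ln (3/2) = 2 * (W x - L)" by (simp add: A_def field_simps)
          ultimately show ?thesis by simp
        qed
        ultimately show "cmod (f (z\<^sup>2)) * (1 + cmod z) ^ m \<le> C1 * exp (\<tau> * Im z - (W x - L))"
          by (intro upper z(1) zR) simp
      qed (rule isc)
      also have "\<dots> = C1 * exp L * exp (- W x)" by (simp add: exp_diff exp_minus field_simps)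
      also have "\<dots> \<le> C * exp (- W x)" by (intro mult_right_mono CC1) simp
      finally show ?thesis by simp
    qed
  qed
qed

section \<open>Gaussian integrals\<close>

lemma
  fixes f :: "'a::euclidean_space \<Rightarrow> 'b::{banach, second_countable_topology}"
  assumes c: "c \<noteq> 0"
  shows lborel_integral_affine: "f \<in> borel_measurable borel \<Longrightarrow>
      integral\<^sup>L lborel f = (\<bar>c\<bar> ^ DIM('a)) *\<^sub>R (LINT x|lborel. f (t + c *\<^sub>R x))"
    and lborel_integrable_affine: "integrable lborel f \<Longrightarrow> integrable lborel (\<lambda>x. f (t + c *\<^sub>R x))"
proof -
  have eq: "lborel = density (distr lborel borel (\<lambda>x::'a. t + c *\<^sub>R x)) (\<lambda>_. (\<bar>c\<bar> ^ DIM('a)))"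
    by (rule lborel_affine[OF c])
  show "integral\<^sup>L lborel f = (\<bar>c\<bar> ^ DIM('a)) *\<^sub>R (LINT x|lborel. f (t + c *\<^sub>R x))"
    if [measurable]: "f \<in> borel_measurable borel"
    by (subst eq) (simp add: integral_density integral_distr)
  show "integrable lborel (\<lambda>x. f (t + c *\<^sub>R x))" if i: "integrable lborel f"
  proof -
    have [measurable]: "f \<in> borel_measurable borel" using i by simp
    have "integrable (density (distr lborel borel (\<lambda>x::'a. t + c *\<^sub>R x)) (\<lambda>_. (\<bar>c\<bar> ^ DIM('a)))) f"
      using i by (subst eq[symmetric])
    then have "integrable lborel (\<lambda>x. (\<bar>c\<bar> ^ DIM('a)) *\<^sub>R f (t + c *\<^sub>R x))"
      by (simp add: integrable_density integrable_distr_eq)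
    then have "integrable lborel (\<lambda>x. (1 / \<bar>c\<bar> ^ DIM('a)) *\<^sub>R ((\<bar>c\<bar> ^ DIM('a)) *\<^sub>R f (t + c *\<^sub>R x)))"
      by (rule integrable_scaleR_right)
    then show ?thesis using c by simp
  qed
qed

lemma
  fixes f :: "'a::euclidean_space \<Rightarrow> real \<Rightarrow> 'b::{real_normed_field, banach, second_countable_topology}"
  assumes i: "\<And>b. b \<in> Basis \<Longrightarrow> integrable lborel (f b)"
  shows integrable_prod_Basis: "integrable lborel (\<lambda>x. \<Prod>b\<in>Basis. f b (x \<bullet> b))"
    and integral_prod_Basis: "(LINT x|lborel. (\<Prod>b\<in>Basis. f b (x \<bullet> b))) = (\<Prod>b\<in>Basis. integral\<^sup>L lborel (f b))"
proof -
  interpret product_sigma_finite "\<lambda>b::'a. lborel :: real measure" ..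
  let ?M = "\<Pi>\<^sub>M b\<in>(Basis :: 'a set). (lborel :: real measure)"
  let ?T = "\<lambda>f. (\<Sum>b\<in>(Basis :: 'a set). f b *\<^sub>R b)"
  have [measurable]: "f b \<in> borel_measurable borel" if "b \<in> Basis" for b using i[OF that] by simp
  have T: "?T \<in> measurable ?M borel" by measurable
  have m: "(\<lambda>x. \<Prod>b\<in>Basis. f b (x \<bullet> b)) \<in> borel_measurable borel" by measurable
  have inner: "(?T y) \<bullet> b = y b" if "b \<in> Basis" for y :: "'a \<Rightarrow> real" and b
    using that by (simp add: inner_sum_left inner_Basis if_distrib cong: if_cong)
  have eq: "(\<Prod>b\<in>Basis. f b (?T y \<bullet> b)) = (\<Prod>b\<in>Basis. f b (y b))" for y
    by (intro prod.cong refl) (simp add: inner)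
  show "integrable lborel (\<lambda>x. \<Prod>b\<in>Basis. f b (x \<bullet> b))"
    unfolding lborel_eq[where 'a='a] integrable_distr_eq[OF T m] eq
    by (rule product_integrable_prod) (use i in auto)
  show "(LINT x|lborel. (\<Prod>b\<in>Basis. f b (x \<bullet> b))) = (\<Prod>b\<in>Basis. integral\<^sup>L lborel (f b))"
    unfolding lborel_eq[where 'a='a] integral_distr[OF T m] eq
    by (rule product_integral_prod) (use i in auto)
qed

lemma
  shows integrable_iexp_gauss_1: "integrable lborel (\<lambda>x. iexp (t * x) * of_real (exp (- x\<^sup>2 / 2)))"
    and integral_iexp_gauss_1: "(LBINT x. iexp (t * x) * of_real (exp (- x\<^sup>2 / 2)))
      = of_real (sqrt (2 * pi) * exp (- t\<^sup>2 / 2))"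
proof -
  have g: "integrable lborel (\<lambda>x. exp (- x\<^sup>2 / 2) :: real)"
  proof -
    have "integrable lborel (\<lambda>x. sqrt (2 * pi) * std_normal_density x)"
      by (intro integrable_mult_right integrable_normal_density) simp
    then show ?thesis by (simp add: std_normal_density_def)
  qed
  show i: "integrable lborel (\<lambda>x. iexp (t * x) * of_real (exp (- x\<^sup>2 / 2)))"
    by (rule Bochner_Integration.integrable_bound[OF g]) (auto simp: norm_mult)
  have "(LBINT x. of_real (std_normal_density x) * iexp (t * x)) = of_real (exp (- t\<^sup>2 / 2))"
    using char_std_normal_distribution
    by (simp add: char_def fun_eq_iff integral_density normal_density_nonneg scaleR_conv_of_real)
  then have "(LBINT x. of_real (1 / sqrt (2 * pi)) * (iexp (t * x) * of_real (exp (- x\<^sup>2 / 2)))) = of_real (exp (- t\<^sup>2 / 2))"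
    by (simp add: std_normal_density_def mult_ac)
  then have "of_real (1 / sqrt (2 * pi)) * (LBINT x. iexp (t * x) * of_real (exp (- x\<^sup>2 / 2))) = of_real (exp (- t\<^sup>2 / 2))"
    by (subst (asm) integral_mult_right_zero)
  then show "(LBINT x. iexp (t * x) * of_real (exp (- x\<^sup>2 / 2))) = of_real (sqrt (2 * pi) * exp (- t\<^sup>2 / 2))"
    by (simp add: field_simps)
qed

definition gauss :: "'a::euclidean_space \<Rightarrow> real" where
  "gauss x = exp (- (norm x)\<^sup>2 / 2)"

lemma gauss_pos: "gauss x > 0" and gauss_le_1: "gauss x \<le> 1"
  by (auto simp: gauss_def)

lemma measurable_gauss [measurable]: "gauss \<in> borel_measurable borel"
  unfolding gauss_def by measurable

lemma
  fixes a :: "'a::euclidean_space"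
  shows integrable_cos_gauss: "integrable lborel (\<lambda>x. cos (a \<bullet> x) * gauss x)"
    and integral_cos_gauss: "(LINT x|lborel. cos (a \<bullet> x) * gauss x) = sqrt (2 * pi) ^ DIM('a) * gauss a"
proof -
  let ?f = "\<lambda>(b::'a) (x::real). iexp ((a \<bullet> b) * x) * of_real (exp (- x\<^sup>2 / 2))"
  have n: "(norm x)\<^sup>2 = (\<Sum>b\<in>Basis. (x \<bullet> b)\<^sup>2)" for x :: 'a
    unfolding power2_norm_eq_inner euclidean_inner[of x x] by (simp add: power2_eq_square)
  have gp: "gauss x = (\<Prod>b\<in>Basis. exp (- (x \<bullet> b)\<^sup>2 / 2))" for x :: 'a
    unfolding gauss_def n exp_sum[OF finite_Basis, symmetric] by (simp add: sum_negf sum_divide_distrib)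
  have eq: "(\<Prod>b\<in>Basis. ?f b (x \<bullet> b)) = iexp (a \<bullet> x) * of_real (gauss x)" for x :: 'a
  proof -
    have "(\<Prod>b\<in>Basis. ?f b (x \<bullet> b)) = (\<Prod>b\<in>Basis. iexp ((a \<bullet> b) * (x \<bullet> b))) * of_real (gauss x)"
      unfolding gp of_real_prod by (rule prod.distrib)
    also have "(\<Prod>b\<in>Basis. iexp ((a \<bullet> b) * (x \<bullet> b))) = iexp (a \<bullet> x)"
      unfolding exp_sum[OF finite_Basis, symmetric] euclidean_inner[of a x]
      by (simp add: sum_distrib_left)
    finally show ?thesis .
  qed
  have i: "integrable lborel (\<lambda>x::'a. iexp (a \<bullet> x) * of_real (gauss x))"
    using integrable_prod_Basis[of ?f] integrable_iexp_gauss_1 unfolding eq by blast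
  have re: "Re (iexp (a \<bullet> x) * of_real (gauss x)) = cos (a \<bullet> x) * gauss x" for x :: 'a
    by (simp add: Re_exp)
  show "integrable lborel (\<lambda>x. cos (a \<bullet> x) * gauss x)"
    using integrable_Re[OF i] unfolding re .
  have "(LINT x|lborel. iexp (a \<bullet> x) * of_real (gauss x)) = (\<Prod>b\<in>Basis. of_real (sqrt (2 * pi) * exp (- (a \<bullet> b)\<^sup>2 / 2)))"
    using integral_prod_Basis[of ?f] integrable_iexp_gauss_1 unfolding eq integral_iexp_gauss_1 by blast
  also have "\<dots> = of_real (sqrt (2 * pi) ^ DIM('a) * gauss a)"
    unfolding gp of_real_prod[symmetric] prod.distrib by simp
  finally show "(LINT x|lborel. cos (a \<bullet> x) * gauss x) = sqrt (2 * pi) ^ DIM('a) * gauss a"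
    using integral_Re[OF i] unfolding re by simp
qed

lemma
  shows integrable_gauss: "integrable lborel (gauss :: 'a::euclidean_space \<Rightarrow> real)"
    and integral_gauss: "(LINT x|lborel. (gauss (x::'a))) = sqrt (2 * pi) ^ DIM('a)"
proof -
  have "gauss (0::'a) = 1" by (simp add: gauss_def)
  then show "integrable lborel (gauss :: 'a \<Rightarrow> real)" "(LINT x|lborel. (gauss (x::'a))) = sqrt (2 * pi) ^ DIM('a)"
    using integrable_cos_gauss[of "0::'a"] integral_cos_gauss[of "0::'a"] by simp_all
qed

lemma
  fixes a :: "'a::euclidean_space"
  assumes s: "s > 0"
  shows integrable_cos_gauss_scaled: "integrable lborel (\<lambda>x. cos (a \<bullet> x) * gauss (s *\<^sub>R x))"
    and integral_cos_gauss_scaled: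
      "(LINT x|lborel. cos (a \<bullet> x) * gauss (s *\<^sub>R x)) = (sqrt (2 * pi) / s) ^ DIM('a) * gauss ((1 / s) *\<^sub>R a)"
proof -
  let ?g = "\<lambda>x. cos (((1 / s) *\<^sub>R a) \<bullet> x) * gauss x"
  have eq: "?g (0 + s *\<^sub>R x) = cos (a \<bullet> x) * gauss (s *\<^sub>R x)" for x
    using s by simp
  show "integrable lborel (\<lambda>x. cos (a \<bullet> x) * gauss (s *\<^sub>R x))"
    using lborel_integrable_affine[of s ?g 0] integrable_cos_gauss[of "(1 / s) *\<^sub>R a"] s unfolding eq by simp
  have "(LINT x|lborel. ?g x) = s ^ DIM('a) * (LINT x|lborel. cos (a \<bullet> x) * gauss (s *\<^sub>R x))"
    using lborel_integral_affine[of s ?g 0] s unfolding eq by simp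
  then show "(LINT x|lborel. cos (a \<bullet> x) * gauss (s *\<^sub>R x)) = (sqrt (2 * pi) / s) ^ DIM('a) * gauss ((1 / s) *\<^sub>R a)"
    unfolding integral_cos_gauss using s by (simp add: field_simps)
qed

lemma gauss_approximate_identity:
  fixes f :: "'a::euclidean_space \<Rightarrow> real"
  assumes [measurable]: "f \<in> borel_measurable borel" and b: "\<And>x. \<bar>f x\<bar> \<le> B" and c: "isCont f a"
    and s: "\<And>n. s n > 0" "s \<longlonglongrightarrow> 0"
  shows "(\<lambda>n. (1 / s n) ^ DIM('a) * (LINT u|lborel. f u * gauss ((1 / s n) *\<^sub>R (a - u)))) \<longlonglongrightarrow> sqrt (2 * pi) ^ DIM('a) * f a"
proof -
  have eq: "(1 / s n) ^ DIM('a) * (LINT u|lborel. f u * gauss ((1 / s n) *\<^sub>R (a - u)))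
    = (LINT v|lborel. f (a + s n *\<^sub>R v) * gauss v)" for n
  proof -
    have "(LINT u|lborel. f u * gauss ((1 / s n) *\<^sub>R (a - u)))
      = s n ^ DIM('a) * (LINT v|lborel. f (a + s n *\<^sub>R v) * gauss ((1 / s n) *\<^sub>R (a - (a + s n *\<^sub>R v))))"
      using lborel_integral_affine[of "s n" "\<lambda>u. f u * gauss ((1 / s n) *\<^sub>R (a - u))" a] s(1)[of n] by simp
    also have "(\<lambda>v. gauss ((1 / s n) *\<^sub>R (a - (a + s n *\<^sub>R v)))) = gauss"
      using s(1)[of n] by (simp add: gauss_def fun_eq_iff)
    then have "(LINT v|lborel. f (a + s n *\<^sub>R v) * gauss ((1 / s n) *\<^sub>R (a - (a + s n *\<^sub>R v))))
       = (LINT v|lborel. f (a + s n *\<^sub>R v) * gauss v)" by metis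
    finally show ?thesis using s(1)[of n] by (simp add: power_divide)
  qed
  have "(\<lambda>n. LINT v|lborel. f (a + s n *\<^sub>R v) * gauss v) \<longlonglongrightarrow> (LINT v|lborel. f a * gauss (v::'a))"
  proof (rule integral_dominated_convergence)
    show "integrable lborel (\<lambda>v::'a. B * gauss v)" by (rule integrable_mult_right[OF integrable_gauss])
    show "AE v in lborel. (\<lambda>n. f (a + s n *\<^sub>R v) * gauss v) \<longlonglongrightarrow> f a * gauss v"
    proof (rule AE_I2)
      fix v :: 'a
      have "(\<lambda>n. a + s n *\<^sub>R v) \<longlonglongrightarrow> a + 0 *\<^sub>R v" by (intro tendsto_intros s)
      then have "(\<lambda>n. a + s n *\<^sub>R v) \<longlonglongrightarrow> a" by simp
      from isCont_tendsto_compose[OF c this]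
      show "(\<lambda>n. f (a + s n *\<^sub>R v) * gauss v) \<longlonglongrightarrow> f a * gauss v" by (intro tendsto_intros)
    qed
    show "AE v in lborel. norm (f (a + s n *\<^sub>R v) * gauss v) \<le> B * gauss v" for n
    proof (rule AE_I2)
      fix v :: 'a
      show "norm (f (a + s n *\<^sub>R v) * gauss v) \<le> B * gauss v"
        unfolding real_norm_def abs_mult abs_of_pos[OF gauss_pos]
        by (intro mult_right_mono b less_imp_le[OF gauss_pos])
    qed
  qed measurable
  then show ?thesis unfolding eq by (simp add: integral_gauss mult.commute)
qed

section \<open>Contour shifts and compact support\<close>

definition decay_weight :: "nat \<Rightarrow> 'a::euclidean_space \<Rightarrow> real" where
  "decay_weight m x = 1 / (1 + (norm x)\<^sup>2) ^ m"

lemma decay_weight_pos: "decay_weight m x > 0"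
  unfolding decay_weight_def by (intro divide_pos_pos zero_less_power) (auto simp: add_pos_nonneg)

lemma measurable_decay_weight [measurable]: "decay_weight m \<in> borel_measurable borel"
  unfolding decay_weight_def by measurable

text \<open>Every coordinate is at most the norm, so the power DIM of 1 + |x|^2 dominates the
  product of the one-dimensional weights, which is integrable by Fubini.\<close>

lemma integrable_decay_weight:
  assumes m: "m \<ge> DIM('a)"
  shows "integrable lborel (decay_weight m :: 'a::euclidean_space \<Rightarrow> real)"
proof (rule integrable_le_nonneg)
  have "integrable lborel (\<lambda>t::real. 1 / (1 + t\<^sup>2))" by (rule integrable_weight)
  then show "integrable lborel (\<lambda>x::'a. \<Prod>b\<in>Basis. 1 / (1 + (x \<bullet> b)\<^sup>2))"
    using integrable_prod_Basis[of "\<lambda>b t. 1 / (1 + t\<^sup>2)"] by simp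
  show "decay_weight m x \<ge> 0" for x :: 'a using decay_weight_pos[of m x] by simp
  fix x :: 'a
  have "(\<Prod>b\<in>(Basis::'a set). 1 + (x \<bullet> b)\<^sup>2) \<le> (\<Prod>b\<in>(Basis::'a set). 1 + (norm x)\<^sup>2)"
  proof (rule prod_mono)
    fix b :: 'a assume "b \<in> Basis"
    then have "\<bar>x \<bullet> b\<bar> \<le> norm x" by (rule Basis_le_norm)
    then have "(x \<bullet> b)\<^sup>2 \<le> (norm x)\<^sup>2" using power_mono[of "\<bar>x \<bullet> b\<bar>" "norm x" 2] by simp
    then show "0 \<le> 1 + (x \<bullet> b)\<^sup>2 \<and> 1 + (x \<bullet> b)\<^sup>2 \<le> 1 + (norm x)\<^sup>2" by simp
  qed
  also have "\<dots> = (1 + (norm x)\<^sup>2) ^ DIM('a)" by simp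
  also have "\<dots> \<le> (1 + (norm x)\<^sup>2) ^ m" using m by (intro power_increasing) auto
  finally have le: "(\<Prod>b\<in>(Basis::'a set). 1 + (x \<bullet> b)\<^sup>2) \<le> (1 + (norm x)\<^sup>2) ^ m" .
  have pos: "(\<Prod>b\<in>(Basis::'a set). 1 + (x \<bullet> b)\<^sup>2) > 0" by (intro prod_pos) (auto simp: add_pos_nonneg)
  have "decay_weight m x \<le> 1 / (\<Prod>b\<in>(Basis::'a set). 1 + (x \<bullet> b)\<^sup>2)"
    unfolding decay_weight_def using le pos by (intro divide_left_mono) (auto intro!: mult_pos_pos)
  then show "decay_weight m x \<le> (\<Prod>b\<in>Basis. 1 / (1 + (x \<bullet> b)\<^sup>2))"
    by (simp add: prod_dividef)
qed measurable

text \<open>Adding the real number q to the square leaves the product of real and imaginary part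
  unchanged. If |Im| grew, then comparing real parts |Re| would grow too, and the product could not
  be the same. With w = \<xi> . v + s this bounds the growth of \<open>f\<close> on the shifted
  contour by |Im s|.\<close>

lemma abs_Im_sqrt_le:
  fixes z w :: complex
  assumes eq: "z\<^sup>2 = w\<^sup>2 + of_real q" and q: "q \<ge> 0"
  shows "\<bar>Im z\<bar> \<le> \<bar>Im w\<bar>"
proof (rule ccontr)
  assume "\<not> ?thesis"
  then have y: "(Im w)\<^sup>2 < (Im z)\<^sup>2" by (simp add: abs_le_square_iff)
  have re: "(Re z)\<^sup>2 - (Im z)\<^sup>2 = (Re w)\<^sup>2 - (Im w)\<^sup>2 + q"
    using arg_cong[OF eq, of Re] by (simp add: power2_eq_square)
  have im: "Re z * Im z = Re w * Im w"
    using arg_cong[OF eq, of Im] by (simp add: power2_eq_square mult.commute)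
  have "(Re w)\<^sup>2 < (Re z)\<^sup>2" using re y q by linarith
  then have "(Re w)\<^sup>2 * (Im w)\<^sup>2 < (Re z)\<^sup>2 * (Im z)\<^sup>2" using y by (intro mult_strict_mono') auto
  then show False using im by (metis less_irrefl power_mult_distrib)
qed

lemma has_field_derivative_shifted:
  fixes f :: "complex \<Rightarrow> complex"
  assumes f: "f holomorphic_on UNIV"
  shows "((\<lambda>s. (f (a + 2 * s * p + s\<^sup>2))\<^sup>2 * exp (\<i> * (b + s * r))) has_field_derivative
      2 * f (a + 2 * s * p + s\<^sup>2) * deriv f (a + 2 * s * p + s\<^sup>2) * (2 * p + 2 * s) * exp (\<i> * (b + s * r))
       + (f (a + 2 * s * p + s\<^sup>2))\<^sup>2 * (\<i> * r * exp (\<i> * (b + s * r)))) (at s within U)"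
proof -
  have df: "(f has_field_derivative deriv f z) (at z)" for z
    using f holomorphic_derivI by blast
  show ?thesis
    by (rule derivative_eq_intros DERIV_chain2[OF df] refl | simp add: power2_eq_square algebra_simps)+
qed

locale paley_wiener_data =
  fixes f :: "complex \<Rightarrow> complex" and C \<tau> :: real and m :: nat and x :: "'a::euclidean_space"
  assumes hol: "f holomorphic_on UNIV"
    and f_bound: "\<And>z. cmod (f (z\<^sup>2)) * (1 + cmod z) ^ m \<le> C * exp (\<tau> * \<bar>Im z\<bar>)"
    and m_ge: "m \<ge> DIM('a)" and tau: "\<tau> \<ge> 0" and x_large: "norm x > 2 * \<tau>"
begin

abbreviation "r \<equiv> norm x"

definition v :: 'a where "v = (1 / r) *\<^sub>R x"

lemma r_pos: "r > 0" using tau x_large by linarith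

lemma v: "norm v = 1" "x = r *\<^sub>R v"
  using r_pos by (auto simp: v_def)

text \<open>The bilinear, not hermitian, square of \<xi> + s v, so that it is holomorphic in the
  shift s. At s = 0 it is the argument of \<open>f\<close> in the original integrand.\<close>

definition arg :: "'a \<Rightarrow> complex \<Rightarrow> complex" where
  "arg \<xi> s = of_real (\<xi> \<bullet> \<xi>) + 2 * s * of_real (\<xi> \<bullet> v) + s\<^sup>2"

definition \<Phi> :: "complex \<Rightarrow> 'a \<Rightarrow> complex" where
  "\<Phi> s \<xi> = (f (arg \<xi> s))\<^sup>2 * exp (\<i> * (of_real (x \<bullet> \<xi>) + s * of_real r))"

lemma continuous_f: "continuous_on A f"
  using holomorphic_on_imp_continuous_on[OF hol] continuous_on_subset by blast

lemma continuous_deriv_f: "continuous_on A (deriv f)"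
  using holomorphic_on_imp_continuous_on[OF holomorphic_deriv[OF hol open_UNIV]] continuous_on_subset by blast

lemma continuous_\<Phi>: "continuous_on A (\<Phi> s)"
  unfolding \<Phi>_def arg_def
  by (intro continuous_intros continuous_on_compose2[OF continuous_f[of UNIV]]) auto

lemma measurable_\<Phi> [measurable]: "\<Phi> s \<in> borel_measurable borel"
  by (intro borel_measurable_continuous_onI continuous_\<Phi>)

text \<open>The cross term 2 S |\<xi>| is absorbed into half of |\<xi>|^2. Decay of \<open>f\<close>
  in its argument thus becomes decay in \<xi>, uniformly for bounded shifts.\<close>

lemma weight_arg:
  assumes "cmod s \<le> S"
  shows "1 + (norm \<xi>)\<^sup>2 \<le> (2 + 6 * S\<^sup>2) * (1 + cmod (arg \<xi> s))"
proof -
  have S: "S \<ge> 0" using assms norm_ge_zero[of s] by linarith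
  have p: "\<bar>\<xi> \<bullet> v\<bar> \<le> norm \<xi>" using Cauchy_Schwarz_ineq2[of \<xi> v] v by simp
  have a: "cmod (of_real (\<xi> \<bullet> \<xi>)) = (norm \<xi>)\<^sup>2" unfolding power2_norm_eq_inner norm_of_real by simp
  have 1: "cmod (2 * s * of_real (\<xi> \<bullet> v)) \<le> 2 * S * norm \<xi>"
    unfolding norm_mult norm_of_real using assms p S by (intro mult_mono) auto
  have 2: "cmod (s\<^sup>2) \<le> S\<^sup>2" unfolding norm_power using assms by (intro power_mono) auto
  have "of_real (\<xi> \<bullet> \<xi>) = arg \<xi> s - (2 * s * of_real (\<xi> \<bullet> v) + s\<^sup>2)" by (simp add: arg_def)
  then have "(norm \<xi>)\<^sup>2 \<le> cmod (arg \<xi> s) + cmod (2 * s * of_real (\<xi> \<bullet> v) + s\<^sup>2)"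
    using norm_triangle_ineq4[of "arg \<xi> s" "2 * s * of_real (\<xi> \<bullet> v) + s\<^sup>2"] a by simp
  also have "cmod (2 * s * of_real (\<xi> \<bullet> v) + s\<^sup>2) \<le> 2 * S * norm \<xi> + S\<^sup>2"
    using norm_triangle_ineq[of "2 * s * of_real (\<xi> \<bullet> v)" "s\<^sup>2"] 1 2 by linarith
  finally have "(norm \<xi>)\<^sup>2 \<le> cmod (arg \<xi> s) + 2 * S * norm \<xi> + S\<^sup>2" by simp
  moreover have "0 \<le> (norm \<xi> - 2 * S)\<^sup>2" by simp
  then have "4 * S * norm \<xi> \<le> (norm \<xi>)\<^sup>2 + 4 * S\<^sup>2" by (simp add: power2_eq_square algebra_simps)
  ultimately have "(norm \<xi>)\<^sup>2 \<le> 2 * cmod (arg \<xi> s) + 6 * S\<^sup>2" by linarith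
  moreover have "0 \<le> 6 * S\<^sup>2 * cmod (arg \<xi> s)" by simp
  moreover have "(2 + 6 * S\<^sup>2) * (1 + cmod (arg \<xi> s)) = 2 + 2 * cmod (arg \<xi> s) + 6 * S\<^sup>2 + 6 * S\<^sup>2 * cmod (arg \<xi> s)"
    by (simp add: algebra_simps)
  ultimately show ?thesis by linarith
qed

text \<open>The growth bound on \<open>f\<close> is applied at a square root z of the argument. By
  \<open>abs_Im_sqrt_le\<close> its imaginary part is at most |Im s|; squaring \<open>f\<close>
  doubles the type, and the exponential contributes exp (- r Im s).\<close>

lemma \<Phi>_bound:
  assumes s: "cmod s \<le> S"
  shows "cmod (\<Phi> s \<xi>) \<le> C\<^sup>2 * (2 + 6 * S\<^sup>2) ^ m * exp (2 * \<tau> * \<bar>Im s\<bar> - r * Im s) * decay_weight m \<xi>"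
proof -
  define z where "z = csqrt (arg \<xi> s)"
  have z2: "z\<^sup>2 = arg \<xi> s" by (simp add: z_def)
  have im: "\<bar>Im z\<bar> \<le> \<bar>Im s\<bar>"
  proof -
    have "z\<^sup>2 = (of_real (\<xi> \<bullet> v) + s)\<^sup>2 + of_real (\<xi> \<bullet> \<xi> - (\<xi> \<bullet> v)\<^sup>2)"
      unfolding z2 arg_def by (simp add: power2_eq_square algebra_simps)
    moreover have "(\<xi> \<bullet> v)\<^sup>2 \<le> \<xi> \<bullet> \<xi>"
      using Cauchy_Schwarz_ineq[of \<xi> v] v(1) by (simp add: norm_eq_1)
    ultimately show ?thesis using abs_Im_sqrt_le[of z "of_real (\<xi> \<bullet> v) + s" "\<xi> \<bullet> \<xi> - (\<xi> \<bullet> v)\<^sup>2"] by simp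
  qed
  have C0: "C \<ge> 0" using f_bound[of 0] norm_ge_zero[of "f 0"] by (simp; linarith)
  have fz: "cmod (f (arg \<xi> s)) * (1 + cmod z) ^ m \<le> C * exp (\<tau> * \<bar>Im s\<bar>)"
  proof -
    have "cmod (f (arg \<xi> s)) * (1 + cmod z) ^ m \<le> C * exp (\<tau> * \<bar>Im z\<bar>)" using f_bound[of z] by (simp add: z2)
    also have "\<dots> \<le> C * exp (\<tau> * \<bar>Im s\<bar>)" using C0 tau im by (intro mult_left_mono) (auto intro: mult_left_mono)
    finally show ?thesis .
  qed
  have w: "1 + (norm \<xi>)\<^sup>2 \<le> (2 + 6 * S\<^sup>2) * (1 + cmod z)\<^sup>2"
  proof -
    have "1 + (norm \<xi>)\<^sup>2 \<le> (2 + 6 * S\<^sup>2) * (1 + cmod (arg \<xi> s))" by (rule weight_arg[OF s])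
    also have "\<dots> \<le> (2 + 6 * S\<^sup>2) * (1 + cmod z)\<^sup>2"
      unfolding z2[symmetric] norm_power by (intro mult_left_mono) (auto simp: power2_eq_square algebra_simps)
    finally show ?thesis .
  qed
  have e: "cmod (exp (\<i> * (of_real (x \<bullet> \<xi>) + s * of_real r))) = exp (- r * Im s)"
    by (simp add: norm_exp_eq_Re)
  have "(cmod (f (arg \<xi> s)))\<^sup>2 * (1 + (norm \<xi>)\<^sup>2) ^ m
     \<le> (cmod (f (arg \<xi> s)))\<^sup>2 * ((2 + 6 * S\<^sup>2) * (1 + cmod z)\<^sup>2) ^ m"
    using w by (intro mult_left_mono power_mono) auto
  also have "\<dots> = (2 + 6 * S\<^sup>2) ^ m * (cmod (f (arg \<xi> s)) * (1 + cmod z) ^ m)\<^sup>2"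
    by (simp add: power_mult_distrib power_mult[symmetric] mult.commute[of 2])
  also have "\<dots> \<le> (2 + 6 * S\<^sup>2) ^ m * (C * exp (\<tau> * \<bar>Im s\<bar>))\<^sup>2"
    using fz by (intro mult_left_mono power_mono) auto
  also have "\<dots> = C\<^sup>2 * (2 + 6 * S\<^sup>2) ^ m * exp (2 * \<tau> * \<bar>Im s\<bar>)"
    by (simp add: power_mult_distrib exp_double[symmetric] mult_ac)
  finally have 1: "(cmod (f (arg \<xi> s)))\<^sup>2 * (1 + (norm \<xi>)\<^sup>2) ^ m \<le> C\<^sup>2 * (2 + 6 * S\<^sup>2) ^ m * exp (2 * \<tau> * \<bar>Im s\<bar>)" .
  have pos: "(1 + (norm \<xi>)\<^sup>2) ^ m > 0" by (intro zero_less_power) (simp add: add_pos_nonneg)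
  have "(cmod (f (arg \<xi> s)))\<^sup>2 \<le> C\<^sup>2 * (2 + 6 * S\<^sup>2) ^ m * exp (2 * \<tau> * \<bar>Im s\<bar>) * decay_weight m \<xi>"
    unfolding decay_weight_def using 1 pos by (simp add: pos_le_divide_eq)
  then have "(cmod (f (arg \<xi> s)))\<^sup>2 * exp (- r * Im s)
    \<le> C\<^sup>2 * (2 + 6 * S\<^sup>2) ^ m * exp (2 * \<tau> * \<bar>Im s\<bar>) * decay_weight m \<xi> * exp (- r * Im s)"
    by (rule mult_right_mono) simp
  also have "\<dots> = C\<^sup>2 * (2 + 6 * S\<^sup>2) ^ m * exp (2 * \<tau> * \<bar>Im s\<bar> - r * Im s) * decay_weight m \<xi>"
    by (simp add: exp_diff exp_minus field_simps)
  finally show ?thesis unfolding \<Phi>_def norm_mult norm_power e .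
qed

lemma integrable_\<Phi>: "integrable lborel (\<Phi> s)"
proof (rule Bochner_Integration.integrable_bound)
  let ?K = "C\<^sup>2 * (2 + 6 * (cmod s)\<^sup>2) ^ m * exp (2 * \<tau> * \<bar>Im s\<bar> - r * Im s)"
  show "integrable lborel (\<lambda>\<xi>::'a. ?K * decay_weight m \<xi>)"
    by (rule integrable_mult_right[OF integrable_decay_weight[OF m_ge]])
  show "AE \<xi> in lborel. norm (\<Phi> s \<xi>) \<le> norm (?K * decay_weight m \<xi>)"
    by (rule AE_I2) (rule order_trans[OF \<Phi>_bound[OF order_refl]], simp)
qed measurable

definition A :: "complex \<Rightarrow> complex" where "A s = (LINT \<xi>|lborel. \<Phi> s \<xi>)"

lemma A_bound:
  assumes "cmod s \<le> S"
  shows "cmod (A s) \<le> C\<^sup>2 * (2 + 6 * S\<^sup>2) ^ m * exp (2 * \<tau> * \<bar>Im s\<bar> - r * Im s) * (LINT \<xi>|lborel. decay_weight m (\<xi>::'a))"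
proof -
  let ?K = "C\<^sup>2 * (2 + 6 * S\<^sup>2) ^ m * exp (2 * \<tau> * \<bar>Im s\<bar> - r * Im s)"
  have "cmod (A s) \<le> (LINT \<xi>|lborel. cmod (\<Phi> s \<xi>))"
    unfolding A_def by (rule integral_norm_bound)
  also have "\<dots> \<le> (LINT \<xi>|lborel. ?K * decay_weight m (\<xi>::'a))"
    by (rule integral_mono[OF integrable_norm[OF integrable_\<Phi>] integrable_mult_right[OF integrable_decay_weight[OF m_ge]] \<Phi>_bound[OF assms]])
  also have "\<dots> = ?K * (LINT \<xi>|lborel. decay_weight m (\<xi>::'a))" by (rule integral_mult_right_zero)
  finally show ?thesis .
qed

definition box :: "nat \<Rightarrow> 'a set" where "box n = cbox (- (real n *\<^sub>R One)) (real n *\<^sub>R One)"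

definition A_box :: "nat \<Rightarrow> complex \<Rightarrow> complex" where "A_box n s = integral (box n) (\<Phi> s)"

text \<open>Over a compact box one may differentiate under the integral. The full integral is then
  treated as the locally uniform limit of the box integrals, with tails controlled by the decay
  weight.\<close>

lemma A_box_holomorphic: "A_box n holomorphic_on UNIV"
proof -
  let ?e = "\<lambda>s \<xi>. exp (\<i> * (of_real (x \<bullet> \<xi>) + s * of_real r))"
  let ?fx = "\<lambda>s \<xi>. 2 * f (arg \<xi> s) * deriv f (arg \<xi> s) * (2 * of_real (\<xi> \<bullet> v) + 2 * s) * ?e s \<xi>
       + (f (arg \<xi> s))\<^sup>2 * (\<i> * of_real r * ?e s \<xi>)"
  have "(\<lambda>s. integral (cbox (- (real n *\<^sub>R One)) (real n *\<^sub>R One)) (\<Phi> s)) holomorphic_on UNIV"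
  proof (rule leibniz_rule_holomorphic)
    show "((\<lambda>s. \<Phi> s \<xi>) has_field_derivative ?fx s \<xi>) (at s within UNIV)" for s \<xi>
      unfolding \<Phi>_def arg_def by (rule has_field_derivative_shifted[OF hol])
    show "\<Phi> s integrable_on cbox (- (real n *\<^sub>R One)) (real n *\<^sub>R One)" for s
      by (rule integrable_continuous[OF continuous_\<Phi>])
    show "continuous_on (UNIV \<times> cbox (- (real n *\<^sub>R One)) (real n *\<^sub>R One)) (\<lambda>(s, \<xi>). ?fx s \<xi>)"
      unfolding split_beta arg_def
      by (intro continuous_intros continuous_on_compose2[OF continuous_f[of UNIV]]
          continuous_on_compose2[OF continuous_deriv_f[of UNIV]]) auto
  qed simp
  then show ?thesis by (simp add: A_box_def[abs_def] box_def)
qed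

lemma A_box_eq: "A_box n s = (LINT \<xi>|lborel. indicator (box n) \<xi> *\<^sub>R \<Phi> s \<xi>)"
proof -
  have "set_integrable lborel (box n) (\<Phi> s)"
    unfolding set_integrable_def box_def
    by (intro borel_integrable_compact continuous_\<Phi>) simp
  then show ?thesis
    unfolding A_box_def using set_borel_integral_eq_integral(2)[of "box n" "\<Phi> s"]
    by (simp add: set_lebesgue_integral_def)
qed

lemma tail_tendsto_0: "(\<lambda>n. LINT \<xi>|lborel. indicator (- box n) \<xi> * decay_weight m (\<xi>::'a)) \<longlonglongrightarrow> 0"
proof -
  have [measurable]: "box n \<in> sets borel" for n by (simp add: box_def)
  have "(\<lambda>n. LINT \<xi>|lborel. indicator (- box n) \<xi> * decay_weight m (\<xi>::'a)) \<longlonglongrightarrow> (LINT \<xi>|lborel. (0 * (decay_weight m (\<xi>::'a))))"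
  proof (rule integral_dominated_convergence[OF _ _ integrable_decay_weight[OF m_ge]])
    show "AE \<xi> in lborel. (\<lambda>n. indicator (- box n) \<xi> * decay_weight m (\<xi>::'a)) \<longlonglongrightarrow> 0 * decay_weight m \<xi>"
    proof (rule AE_I2, rule tendsto_eventually)
      fix \<xi> :: 'a
      obtain N :: nat where N: "norm \<xi> \<le> real N" using real_arch_simple by blast
      have "\<xi> \<in> box n" if "N \<le> n" for n
      proof -
        have "- real n \<le> \<xi> \<bullet> b \<and> \<xi> \<bullet> b \<le> real n" if "b \<in> Basis" for b
          using Basis_le_norm[OF that, of \<xi>] N \<open>N \<le> n\<close> unfolding abs_le_iff by linarith
        then show ?thesis by (simp add: box_def mem_box)
      qed
      then show "\<forall>\<^sub>F n in sequentially. indicator (- box n) \<xi> * decay_weight m \<xi> = 0 * decay_weight m \<xi>"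
        by (intro eventually_sequentiallyI[of N]) simp
    qed
    show "AE \<xi> in lborel. norm (indicator (- box n) \<xi> * decay_weight m (\<xi>::'a)) \<le> decay_weight m \<xi>" for n
    proof (rule AE_I2)
      fix \<xi> :: 'a
      show "norm (indicator (- box n) \<xi> * decay_weight m (\<xi>::'a)) \<le> decay_weight m \<xi>"
        using decay_weight_pos[of m \<xi>] by (simp add: indicator_def)
    qed
  qed measurable
  then show ?thesis by simp
qed

lemma A_holomorphic: "A holomorphic_on UNIV"
proof (rule holomorphic_uniform_sequence[OF open_UNIV A_box_holomorphic])
  fix s0 :: complex
  define S where "S = cmod s0 + 1"
  define K where "K = C\<^sup>2 * (2 + 6 * S\<^sup>2) ^ m * exp ((2 * \<tau> + r) * S)"
  let ?t = "\<lambda>n. LINT \<xi>|lborel. indicator (- box n) \<xi> * decay_weight m (\<xi>::'a)"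
  have [measurable]: "box n \<in> sets borel" for n by (simp add: box_def)
  have it: "integrable lborel (\<lambda>\<xi>. indicator (- box n) \<xi> * decay_weight m (\<xi>::'a))" for n
    using integrable_real_mult_indicator[OF _ integrable_decay_weight[OF m_ge], of "- box n"]
    by (simp add: mult.commute)
  have diff: "norm (A_box n s - A s) \<le> K * ?t n" if s: "s \<in> cball s0 1" for n s
  proof -
    have sS: "cmod s \<le> S"
      using s norm_triangle_ineq[of s0 "s - s0"] by (simp add: S_def dist_norm norm_minus_commute)
    have im: "\<bar>Im s\<bar> \<le> S" using abs_Im_le_cmod[of s] sS by linarith
    have "r * (- Im s) \<le> r * \<bar>Im s\<bar>" by (rule mult_left_mono) auto
    then have "2 * \<tau> * \<bar>Im s\<bar> - r * Im s \<le> (2 * \<tau> + r) * \<bar>Im s\<bar>"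
      by (simp add: algebra_simps)
    also have "\<dots> \<le> (2 * \<tau> + r) * S" using im tau r_pos by (intro mult_left_mono) auto
    finally have e: "exp (2 * \<tau> * \<bar>Im s\<bar> - r * Im s) \<le> exp ((2 * \<tau> + r) * S)" by simp
    have b: "cmod (\<Phi> s \<xi>) \<le> K * decay_weight m \<xi>" for \<xi>
    proof -
      have "cmod (\<Phi> s \<xi>) \<le> C\<^sup>2 * (2 + 6 * S\<^sup>2) ^ m * exp (2 * \<tau> * \<bar>Im s\<bar> - r * Im s) * decay_weight m \<xi>"
        by (rule \<Phi>_bound[OF sS])
      also have "\<dots> \<le> K * decay_weight m \<xi>"
        unfolding K_def using e decay_weight_pos[of m \<xi>] by (intro mult_right_mono mult_left_mono) auto
      finally show ?thesis .
    qed
    have ib: "integrable lborel (\<lambda>\<xi>. indicator (box n) \<xi> *\<^sub>R \<Phi> s \<xi>)"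
      by (rule integrable_mult_indicator[OF _ integrable_\<Phi>]) simp
    have "A_box n s - A s = (LINT \<xi>|lborel. indicator (box n) \<xi> *\<^sub>R \<Phi> s \<xi> - \<Phi> s \<xi>)"
      unfolding A_box_eq A_def by (rule Bochner_Integration.integral_diff[OF ib integrable_\<Phi>, symmetric])
    also have "norm \<dots> \<le> (LINT \<xi>|lborel. norm (indicator (box n) \<xi> *\<^sub>R \<Phi> s \<xi> - \<Phi> s \<xi>))"
      by (rule integral_norm_bound)
    also have "\<dots> \<le> (LINT \<xi>|lborel. K * (indicator (- box n) \<xi> * decay_weight m \<xi>))"
    proof (rule integral_mono)
      show "integrable lborel (\<lambda>\<xi>. norm (indicator (box n) \<xi> *\<^sub>R \<Phi> s \<xi> - \<Phi> s \<xi>))"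
        by (rule integrable_norm[OF Bochner_Integration.integrable_diff[OF ib integrable_\<Phi>]])
      show "integrable lborel (\<lambda>\<xi>. K * (indicator (- box n) \<xi> * decay_weight m \<xi>))"
        by (rule integrable_mult_right[OF it])
      show "norm (indicator (box n) \<xi> *\<^sub>R \<Phi> s \<xi> - \<Phi> s \<xi>) \<le> K * (indicator (- box n) \<xi> * decay_weight m \<xi>)" for \<xi>
        using b[of \<xi>] by (simp add: indicator_def)
    qed
    also have "\<dots> = K * ?t n" by (rule integral_mult_right_zero)
    finally show ?thesis .
  qed
  have Kt: "(\<lambda>n. K * ?t n) \<longlonglongrightarrow> 0" using tendsto_mult[OF tendsto_const tail_tendsto_0, of K] by simp
  have "uniform_limit (cball s0 1) A_box A sequentially"
  proof (rule uniform_limitI)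
    fix e :: real assume "e > 0"
    with Kt have "\<forall>\<^sub>F n in sequentially. K * ?t n < e" by (rule order_tendstoD)
    then show "\<forall>\<^sub>F n in sequentially. \<forall>s\<in>cball s0 1. dist (A_box n s) (A s) < e"
    proof eventually_elim
      case (elim n)
      show ?case
      proof
        fix s assume "s \<in> cball s0 1"
        from diff[OF this, of n] elim show "dist (A_box n s) (A s) < e" unfolding dist_norm by linarith
      qed
    qed
  qed
  then show "\<exists>d>0. cball s0 d \<subseteq> UNIV \<and> uniform_limit (cball s0 d) A_box A sequentially"
    using zero_less_one by blast
qed

text \<open>A real shift of the contour is a translation of the variable of integration.\<close>

lemma A_of_real: "A (of_real t) = A 0"
proof -
  have vv: "v \<bullet> v = 1" using v(1) by (simp add: norm_eq_1)
  have xv: "x \<bullet> v = r" using v(2) vv by (metis inner_scaleR_left mult.right_neutral)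
  have arg: "arg \<xi> (of_real t) = arg (\<xi> + t *\<^sub>R v) 0" for \<xi>
  proof -
    have "v \<bullet> \<xi> = \<xi> \<bullet> v" by (rule inner_commute)
    then have "(\<xi> + t *\<^sub>R v) \<bullet> (\<xi> + t *\<^sub>R v) = \<xi> \<bullet> \<xi> + 2 * t * (\<xi> \<bullet> v) + t\<^sup>2"
      unfolding inner_add_left inner_add_right inner_scaleR_left inner_scaleR_right
      by (simp add: vv power2_eq_square distrib_left)
    then show ?thesis by (simp add: arg_def)
  qed
  have "\<Phi> (of_real t) \<xi> = \<Phi> 0 (t *\<^sub>R v + 1 *\<^sub>R \<xi>)" for \<xi>
    unfolding \<Phi>_def arg by (simp add: inner_add_right xv add.commute)
  then have "A (of_real t) = (LINT \<xi>|lborel. \<Phi> 0 (t *\<^sub>R v + 1 *\<^sub>R \<xi>))" by (simp add: A_def)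
  also have "\<dots> = A 0"
    unfolding A_def using lborel_integral_affine[of 1 "\<Phi> 0" "t *\<^sub>R v"] by simp
  finally show ?thesis .
qed

text \<open>Constancy on the real axis extends to all complex shifts by the identity
  theorem.\<close>

lemma A_const: "A s = A 0"
proof -
  have "A s - A 0 = 0"
  proof (rule analytic_continuation[where S=UNIV and U="range complex_of_real" and \<xi>=0 and f="\<lambda>s. A s - A 0"])
    show "(\<lambda>s. A s - A 0) holomorphic_on UNIV" by (intro holomorphic_intros A_holomorphic)
    show "(0::complex) islimpt range complex_of_real"
      unfolding islimpt_approachable
    proof (intro allI impI)
      fix e :: real assume "e > 0"
      then show "\<exists>x'\<in>range complex_of_real. x' \<noteq> 0 \<and> dist x' 0 < e"
        by (intro bexI[OF _ rangeI[of complex_of_real "e / 2"]]) (simp add: norm_divide)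
    qed
  qed (auto simp: A_of_real)
  then show ?thesis by simp
qed

text \<open>For the shift s = i n the bound is a polynomial in n times exp (- (r - 2 \<tau>) n),
  which tends to 0 because r > 2 \<tau>. The integral does not depend on n, so it vanishes.\<close>

lemma A_0: "A 0 = 0"
proof -
  define G where "G = (LINT \<xi>|lborel. decay_weight m (\<xi>::'a))"
  have "(\<lambda>n. C\<^sup>2 * (2 + 6 * (real n)\<^sup>2) ^ m * exp (- ((r - 2 * \<tau>) * real n)) * G) \<longlonglongrightarrow> 0"
  proof -
    define a where "a = r - 2 * \<tau>"
    have "a > 0" using x_large by (simp add: a_def)
    have m0: "m > 0" using m_ge DIM_positive[where 'a='a] by linarith
    \<comment> \<open>Splitting the exponential rate into \<open>m\<close> equal parts turns the
      expression into the m-th power of (2 + 6 n^2) exp (- b n).\<close>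
    define b where "b = a / m"
    have b: "b > 0" using \<open>a > 0\<close> m0 by (simp add: b_def)
    have lin: "filterlim (\<lambda>n. b * real n) at_top sequentially"
      by (rule filterlim_tendsto_pos_mult_at_top[OF tendsto_const b filterlim_real_sequentially])
    have "(\<lambda>n. (b * real n) ^ k / exp (b * real n)) \<longlonglongrightarrow> 0" for k
      by (rule filterlim_compose[OF tendsto_power_div_exp_0 lin])
    from tendsto_add[OF tendsto_mult[OF tendsto_const[of 2] this[of 0]] tendsto_mult[OF tendsto_const[of "6 / b\<^sup>2"] this[of 2]]]
    have "(\<lambda>n. 2 * ((b * real n) ^ 0 / exp (b * real n)) + 6 / b\<^sup>2 * ((b * real n)\<^sup>2 / exp (b * real n))) \<longlonglongrightarrow> 0"
      by simp
    moreover have "2 * ((b * real n) ^ 0 / exp (b * real n)) + 6 / b\<^sup>2 * ((b * real n)\<^sup>2 / exp (b * real n))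
      = (2 + 6 * (real n)\<^sup>2) * exp (- (b * real n))" for n
      using b by (simp add: exp_minus divide_inverse power_mult_distrib distrib_right)
    ultimately have "(\<lambda>n. (2 + 6 * (real n)\<^sup>2) * exp (- (b * real n))) \<longlonglongrightarrow> 0" by simp
    from tendsto_power[OF this, of m]
    have "(\<lambda>n. ((2 + 6 * (real n)\<^sup>2) * exp (- (b * real n))) ^ m) \<longlonglongrightarrow> 0"
      using m0 by (simp only: zero_power)
    moreover have "exp (- (b * real n)) ^ m = exp (- (a * real n))" for n
      using m0 unfolding exp_of_nat_mult[symmetric] by (simp add: b_def)
    ultimately have "(\<lambda>n. (2 + 6 * (real n)\<^sup>2) ^ m * exp (- (a * real n))) \<longlonglongrightarrow> 0"
      by (simp only: power_mult_distrib)
    from tendsto_mult[OF tendsto_mult[OF tendsto_const[of "C\<^sup>2"] this] tendsto_const[of G]]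
    show ?thesis by (simp add: a_def mult.assoc)
  qed
  moreover have "cmod (A 0) \<le> C\<^sup>2 * (2 + 6 * (real n)\<^sup>2) ^ m * exp (- ((r - 2 * \<tau>) * real n)) * G" for n
  proof -
    have "cmod (A (\<i> * real n)) \<le> C\<^sup>2 * (2 + 6 * (real n)\<^sup>2) ^ m * exp (2 * \<tau> * \<bar>Im (\<i> * real n)\<bar> - r * Im (\<i> * real n)) * G"
      unfolding G_def by (rule A_bound) (simp add: norm_mult)
    moreover have "2 * \<tau> * \<bar>Im (\<i> * real n)\<bar> - r * Im (\<i> * real n) = - ((r - 2 * \<tau>) * real n)"
      by (simp add: left_diff_distrib)
    ultimately show ?thesis using A_const[of "\<i> * real n"] by metis
  qed
  ultimately have "cmod (A 0) \<le> 0"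
    using LIMSEQ_le_const by blast
  then show ?thesis by simp
qed

end

lemma paley_wiener:
  fixes f :: "complex \<Rightarrow> complex" and x :: "'a::euclidean_space"
  assumes "f holomorphic_on UNIV" "\<And>z. cmod (f (z\<^sup>2)) * (1 + cmod z) ^ m \<le> C * exp (\<tau> * \<bar>Im z\<bar>)"
    and "m \<ge> DIM('a)" "\<tau> \<ge> 0" "norm x > 2 * \<tau>"
  shows "(LINT \<xi>|lborel. (f (of_real (\<xi> \<bullet> \<xi>)))\<^sup>2 * iexp (x \<bullet> \<xi>)) = 0"
proof -
  interpret paley_wiener_data f C \<tau> m x by standard (use assms in auto)
  show ?thesis using A_0 by (simp add: A_def \<Phi>_def arg_def)
qed

section \<open>Membership in a reproducing kernel Hilbert space\<close>

context reproducing_kernel_Hilbert_space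
begin

lemma ip_add_right: "f \<in> H \<Longrightarrow> g \<in> H \<Longrightarrow> h \<in> H \<Longrightarrow> ip h (\<lambda>x. f x + g x) = ip h f + ip h g"
  using ip_add_left[of f g h] by (simp add: ip_commute[of h] add_mem)

lemma ip_scale_right: "f \<in> H \<Longrightarrow> g \<in> H \<Longrightarrow> ip g (\<lambda>x. a * f x) = a * ip g f"
  using ip_scale_left[of f g a] by (simp add: ip_commute[of g] scale_mem)

lemma diff_mem: "f \<in> H \<Longrightarrow> g \<in> H \<Longrightarrow> (\<lambda>x. f x - g x) \<in> H"
  using add_mem[OF _ scale_mem[of g "-1"]] by force

lemma ip_diff_left:
  assumes "f \<in> H" "g \<in> H" "h \<in> H"
  shows "ip (\<lambda>x. f x - g x) h = ip f h - ip g h"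
  using ip_add_left[OF assms(1) scale_mem[OF assms(2), of "-1"] assms(3)] ip_scale_left[OF assms(2,3), of "-1"]
  by simp

lemma ip_diff_right:
  assumes "f \<in> H" "g \<in> H" "h \<in> H"
  shows "ip h (\<lambda>x. f x - g x) = ip h f - ip h g"
  using ip_diff_left[OF assms] assms by (simp add: ip_commute[of h] diff_mem)

lemma ip_zero: "ip (\<lambda>_. 0) (\<lambda>_. 0) = 0"
  using ip_scale_left[OF zero_mem zero_mem, of 0] by simp

lemma ip_nonneg: "f \<in> H \<Longrightarrow> ip f f \<ge> 0"
  using ip_pos[of f] ip_zero by (cases "f = (\<lambda>_. 0)") auto

lemma ip_diff_self:
  assumes "f \<in> H" "g \<in> H"
  shows "ip (\<lambda>x. f x - g x) (\<lambda>x. f x - g x) = ip f f - 2 * ip f g + ip g g"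
  using assms by (simp add: ip_diff_left ip_diff_right diff_mem ip_commute[of g f])

lemma ip_add_self:
  assumes "f \<in> H" "g \<in> H"
  shows "ip (\<lambda>x. f x + g x) (\<lambda>x. f x + g x) = ip f f + 2 * ip f g + ip g g"
  using assms by (simp add: ip_add_left ip_add_right add_mem ip_commute[of g f])

lemma ip_scale_self: "f \<in> H \<Longrightarrow> ip (\<lambda>x. a * f x) (\<lambda>x. a * f x) = a\<^sup>2 * ip f f"
  by (simp add: ip_scale_left ip_scale_right scale_mem power2_eq_square)

lemma abs_ip_le:
  assumes f: "f \<in> H" and g: "g \<in> H"
  shows "\<bar>ip f g\<bar> \<le> sqrt (ip f f) * sqrt (ip g g)"
proof -
  have ng: "ip g g \<ge> 0" by (rule ip_nonneg[OF g])
  have "0 \<le> ip (\<lambda>x. ip g g * f x - ip f g * g x) (\<lambda>x. ip g g * f x - ip f g * g x)"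
    by (intro ip_nonneg diff_mem scale_mem f g)
  also have "\<dots> = ip g g * (ip g g * ip f f - (ip f g)\<^sup>2)"
    unfolding ip_diff_self[OF scale_mem[OF f] scale_mem[OF g]] ip_scale_self[OF f] ip_scale_self[OF g]
      ip_scale_left[OF f scale_mem[OF g]] ip_scale_right[OF g f]
    by (simp add: power2_eq_square algebra_simps)
  finally have *: "0 \<le> ip g g * (ip g g * ip f f - (ip f g)\<^sup>2)" .
  have "(ip f g)\<^sup>2 \<le> ip f f * ip g g"
  proof (cases "g = (\<lambda>_. 0)")
    case True
    have "ip f g = 0" using ip_scale_right[OF g f, of 0] True by simp
    then show ?thesis using ng ip_nonneg[OF f] by simp
  next
    case False
    then have "ip g g > 0" by (rule ip_pos[OF g])
    then show ?thesis using * by (simp add: zero_le_mult_iff mult.commute)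
  qed
  then have "sqrt ((ip f g)\<^sup>2) \<le> sqrt (ip f f * ip g g)" by (rule real_sqrt_le_mono)
  then show ?thesis by (simp add: real_sqrt_mult)
qed

text \<open>The bounded functional with graph \<open>P\<close> is represented by the limit of a maximising sequence of
  \<open>2 * l - ip g g\<close>; such a sequence is Cauchy by the parallelogram law.\<close>

lemma riesz_representation:
  assumes zero: "((\<lambda>_. 0), 0) \<in> P"
    and add: "\<And>g l g' l'. (g, l) \<in> P \<Longrightarrow> (g', l') \<in> P \<Longrightarrow> ((\<lambda>x. g x + g' x), l + l') \<in> P"
    and scale: "\<And>g l a. (g, l) \<in> P \<Longrightarrow> ((\<lambda>x. a * g x), a * l) \<in> P"
    and mem: "\<And>g l. (g, l) \<in> P \<Longrightarrow> g \<in> H" and B: "B > 0"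
    and bound: "\<And>g l. (g, l) \<in> P \<Longrightarrow> l\<^sup>2 \<le> B * ip g g"
  obtains h where "h \<in> H" "\<And>g l. (g, l) \<in> P \<Longrightarrow> ip h g = l"
proof -
  define Q where "Q p = 2 * snd p - ip (fst p) (fst p)" for p :: "('x \<Rightarrow> real) \<times> real"
  have QB: "Q p \<le> B" if "p \<in> P" for p
  proof -
    obtain g l where p: "p = (g, l)" by (cases p)
    have "l\<^sup>2 / B \<le> ip g g" using bound[of g l] that B by (simp add: p pos_divide_le_eq mult.commute)
    moreover have "2 * l - l\<^sup>2 / B \<le> B"
    proof -
      have "0 \<le> (l - B)\<^sup>2 / B" using B by simp
      also have "\<dots> = l\<^sup>2 / B - 2 * l + B" using B by (simp add: power2_eq_square field_simps)
      finally show ?thesis by simp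
    qed
    ultimately show ?thesis by (simp add: Q_def p)
  qed
  define M where "M = Sup (Q ` P)"
  have bdd: "bdd_above (Q ` P)" using QB by (intro bdd_aboveI2[of _ _ B])
  have QM: "Q p \<le> M" if "p \<in> P" for p unfolding M_def using that bdd by (intro cSup_upper) auto
  have "\<exists>p\<in>P. M - 1 / (real n + 1) < Q p" for n
  proof -
    have "M - 1 / (real n + 1) < Sup (Q ` P)" by (simp add: M_def)
    then show ?thesis using less_cSup_iff[OF _ bdd] zero by blast
  qed
  then obtain p where p: "\<And>n. p n \<in> P" "\<And>n. M - 1 / (real n + 1) < Q (p n)" by metis
  define g where "g n = fst (p n)" for n
  define l where "l n = snd (p n)" for n
  have gl: "(g n, l n) \<in> P" for n using p(1)[of n] by (simp add: g_def l_def)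
  have gH: "g n \<in> H" for n using gl mem by blast
  have Qn: "Q (g n, l n) > M - 1 / (real n + 1)" for n using p(2)[of n] by (simp add: g_def l_def)
  have par: "ip (\<lambda>x. g m x - g n x) (\<lambda>x. g m x - g n x) \<le> 2 * (1 / (real m + 1) + 1 / (real n + 1))" for m n
  proof -
    have eq: "2 * ((1/2) * (a + b)) - (1/2)\<^sup>2 * N = a + b - N / 4" for a b N :: real
      by (simp add: power2_eq_square field_simps)
    have "((\<lambda>x. (1/2) * (g m x + g n x)), (1/2) * (l m + l n)) \<in> P" by (intro scale add gl)
    from QM[OF this, unfolded Q_def fst_conv snd_conv ip_scale_self[OF add_mem[OF gH gH]] ip_add_self[OF gH gH]]
    have 1: "l m + l n - (ip (g m) (g m) + 2 * ip (g m) (g n) + ip (g n) (g n)) / 4 \<le> M"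
      unfolding eq .
    have *: "N1 - 2 * q + N2 \<le> 2 * (a + b)"
      if "l1 + l2 - (N1 + 2 * q + N2) / 4 \<le> M" "M - a < 2 * l1 - N1" "M - b < 2 * l2 - N2" "a \<ge> 0" "b \<ge> 0"
      for l1 l2 N1 N2 q a b
      using that by (simp add: field_simps)
    show ?thesis
      unfolding ip_diff_self[OF gH gH]
      by (rule *[OF 1 Qn[of m, unfolded Q_def fst_conv snd_conv] Qn[of n, unfolded Q_def fst_conv snd_conv]]) simp_all
  qed
  have "\<exists>h\<in>H. (\<lambda>n. sqrt (ip (\<lambda>x. g n x - h x) (\<lambda>x. g n x - h x))) \<longlonglongrightarrow> 0"
  proof (rule complete)
    fix e :: real assume e: "e > 0"
    obtain N :: nat where N: "4 / e\<^sup>2 < real N" using reals_Archimedean2 by blast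
    have "sqrt (ip (\<lambda>x. g m x - g n x) (\<lambda>x. g m x - g n x)) < e" if "m \<ge> N" "n \<ge> N" for m n
    proof -
      have e2: "e\<^sup>2 > 0" using e by simp
      have *: "1 / (real k + 1) < e\<^sup>2 / 4" if "k \<ge> N" for k
      proof -
        have "4 / e\<^sup>2 < real k + 1" using N that by linarith
        then have "4 < (real k + 1) * e\<^sup>2" using e2 by (simp add: pos_divide_less_eq)
        then show ?thesis by (simp add: divide_less_eq add_pos_nonneg mult.commute)
      qed
      have "ip (\<lambda>x. g m x - g n x) (\<lambda>x. g m x - g n x) < e\<^sup>2"
      proof (rule le_less_trans[OF par])
        have "2 * (a + b) < e\<^sup>2" if "a < e\<^sup>2 / 4" "b < e\<^sup>2 / 4" for a b using that by simp
        from this[OF *[OF that(1)] *[OF that(2)]]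
        show "2 * (1 / (real m + 1) + 1 / (real n + 1)) < e\<^sup>2" .
      qed
      then have "sqrt (ip (\<lambda>x. g m x - g n x) (\<lambda>x. g m x - g n x)) < sqrt (e\<^sup>2)" by (rule real_sqrt_less_mono)
      then show ?thesis using e by simp
    qed
    then show "\<exists>N. \<forall>m\<ge>N. \<forall>n\<ge>N. sqrt (ip (\<lambda>x. g m x - g n x) (\<lambda>x. g m x - g n x)) < e" by blast
  qed (rule gH)
  then obtain h where h: "h \<in> H" "(\<lambda>n. sqrt (ip (\<lambda>x. g n x - h x) (\<lambda>x. g n x - h x))) \<longlonglongrightarrow> 0" by blast
  show thesis
  proof (rule that[OF h(1)])
    fix u k assume uk: "(u, k) \<in> P"
    have uH: "u \<in> H" by (rule mem[OF uk])
    have lim: "(\<lambda>n. ip (g n) u) \<longlonglongrightarrow> ip h u"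
    proof -
      have "(\<lambda>n. ip (g n) u - ip h u) \<longlonglongrightarrow> 0"
      proof (rule Lim_null_comparison)
        show "\<forall>\<^sub>F n in sequentially. norm (ip (g n) u - ip h u)
            \<le> sqrt (ip (\<lambda>x. g n x - h x) (\<lambda>x. g n x - h x)) * sqrt (ip u u)"
          unfolding ip_diff_left[OF gH h(1) uH, symmetric] real_norm_def
          by (intro always_eventually allI abs_ip_le diff_mem gH h uH)
        show "(\<lambda>n. sqrt (ip (\<lambda>x. g n x - h x) (\<lambda>x. g n x - h x)) * sqrt (ip u u)) \<longlonglongrightarrow> 0"
          using tendsto_mult[OF h(2) tendsto_const[of "sqrt (ip u u)"]] by simp
      qed
      then show ?thesis by (simp add: LIM_zero_iff)
    qed
    \<comment> \<open>First variation: moving along \<open>t\<close> times \<open>(u, k)\<close>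
      cannot raise the functional above M, and the maximising sequence is within 1 / (n + 1) of
      M.\<close>
    have key: "2 * t * (k - ip h u) \<le> t\<^sup>2 * ip u u" for t
    proof -
      have "2 * t * (k - ip (g n) u) \<le> 1 / (real n + 1) + t\<^sup>2 * ip u u" for n
      proof -
        have "((\<lambda>x. g n x + t * u x), l n + t * k) \<in> P" by (intro add scale gl uk)
        from QM[OF this]
        have "2 * (l n + t * k) - (ip (g n) (g n) + 2 * (t * ip (g n) u) + t\<^sup>2 * ip u u) \<le> M"
          unfolding Q_def fst_conv snd_conv ip_add_self[OF gH scale_mem[OF uH]] ip_scale_self[OF uH]
            ip_scale_right[OF uH gH] .
        then show ?thesis using Qn[of n] by (simp add: Q_def right_diff_distrib)
      qed
      moreover have "(\<lambda>n. 2 * t * (k - ip (g n) u)) \<longlonglongrightarrow> 2 * t * (k - ip h u)" by (intro tendsto_intros lim)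
      moreover have "(\<lambda>n. 1 / (real n + 1) + t\<^sup>2 * ip u u) \<longlonglongrightarrow> 0 + t\<^sup>2 * ip u u"
      proof (rule tendsto_add[OF _ tendsto_const])
        show "(\<lambda>n. 1 / (real n + 1)) \<longlonglongrightarrow> 0" by real_asymp
      qed
      ultimately show ?thesis using LIMSEQ_le[where x="2 * t * (k - ip h u)" and y="0 + t\<^sup>2 * ip u u"] by fastforce
    qed
    define D where "D = k - ip h u"
    have "D = 0"
    proof (rule ccontr)
      assume D: "D \<noteq> 0"
      \<comment> \<open>The exact minimiser would be D divided by \<open>ip u u\<close>; adding 1
        keeps the denominator positive when u has norm zero.\<close>
      define s where "s = D / (ip u u + 1)"
      have n: "ip u u + 1 > 0" using ip_nonneg[OF uH] by simp
      have "2 * s * D \<le> s\<^sup>2 * ip u u" using key[of s] by (simp add: D_def)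
      also have "\<dots> \<le> s\<^sup>2 * (ip u u + 1)" by (intro mult_left_mono) auto
      also have "\<dots> = s * D" using n by (simp add: s_def power2_eq_square)
      finally have "2 * s * D \<le> s * D" .
      then have "s * D \<le> 0" by linarith
      moreover have "s * D = D\<^sup>2 / (ip u u + 1)" by (simp add: s_def power2_eq_square)
      moreover have "D\<^sup>2 / (ip u u + 1) > 0" using D n by simp
      ultimately show False by simp
    qed
    then show "ip h u = k" by (simp add: D_def)
  qed
qed

lemma sum_kernel_mem: "finite S \<Longrightarrow> (\<lambda>y. \<Sum>x\<in>S. c x * K y x) \<in> H"
proof (induction S rule: finite_induct)
  case (insert a S)
  show ?case unfolding sum.insert[OF insert.hyps]
    by (rule add_mem[OF scale_mem[OF kernel_mem] insert.IH])
qed (simp add: zero_mem)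

lemma ip_sum_kernel:
  assumes "finite S" "h \<in> H"
  shows "ip h (\<lambda>y. \<Sum>x\<in>S. c x * K y x) = (\<Sum>x\<in>S. c x * h x)"
  using assms(1)
proof (induction S rule: finite_induct)
  case empty
  then show ?case using ip_scale_right[OF zero_mem assms(2), of 0] by simp
next
  case (insert a S)
  then show ?case
    using assms(2) by (simp add: ip_add_right scale_mem kernel_mem sum_kernel_mem ip_scale_right reproducing)
qed

text \<open>The bound says that prescribing the values of \<open>f\<close> against kernel
  combinations defines a bounded functional. Its representer takes the value \<open>f x\<close>
  against each kernel section, so it is \<open>f\<close> by the reproducing property.\<close>

theorem mem_if_bounded:
  assumes B: "B > 0"
    and bound: "\<And>S c. finite S \<Longrightarrow> (\<Sum>x\<in>S. c x * f x)\<^sup>2 \<le> B * (\<Sum>x\<in>S. \<Sum>y\<in>S. c x * c y * K x y)"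
  shows "f \<in> H"
proof -
  \<comment> \<open>A relation instead of a function: different coefficients may give the same
    combination of kernels, and the bound alone forces the values to agree.\<close>
  define P where "P = {((\<lambda>y. \<Sum>x\<in>S. c x * K y x), (\<Sum>x\<in>S. c x * f x)) | S c. finite S}"
  have "\<exists>h\<in>H. \<forall>g l. (g, l) \<in> P \<longrightarrow> ip h g = l"
  proof (rule riesz_representation[OF _ _ _ _ B])
    show "((\<lambda>_. 0), 0) \<in> P" unfolding P_def by (auto intro!: exI[of _ "{}"])
    show "g \<in> H" if "(g, l) \<in> P" for g l using that sum_kernel_mem by (auto simp: P_def)
    show "((\<lambda>x. a * g x), a * l) \<in> P" if gl: "(g, l) \<in> P" for g l a
    proof -
      obtain S c where S: "finite S" "g = (\<lambda>y. \<Sum>x\<in>S. c x * K y x)" "l = (\<Sum>x\<in>S. c x * f x)"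
        using gl unfolding P_def by blast
      have "((\<lambda>x. a * g x), a * l) = ((\<lambda>y. \<Sum>x\<in>S. (a * c x) * K y x), (\<Sum>x\<in>S. (a * c x) * f x))"
        by (simp add: S sum_distrib_left mult.assoc)
      then show ?thesis
        unfolding P_def using S(1) by (intro CollectI exI[of _ S] exI[of _ "\<lambda>x. a * c x"] conjI)
    qed
    show "((\<lambda>x. g x + g' x), l + l') \<in> P" if gl: "(g, l) \<in> P" and gl': "(g', l') \<in> P" for g l g' l'
    proof -
      obtain S c where S: "finite S" "g = (\<lambda>y. \<Sum>x\<in>S. c x * K y x)" "l = (\<Sum>x\<in>S. c x * f x)"
        using gl unfolding P_def by blast
      obtain S' c' where S': "finite S'" "g' = (\<lambda>y. \<Sum>x\<in>S'. c' x * K y x)" "l' = (\<Sum>x\<in>S'. c' x * f x)"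
        using gl' unfolding P_def by blast
      define d where "d x = (if x \<in> S then c x else 0) + (if x \<in> S' then c' x else 0)" for x
      have ext: "(\<Sum>x\<in>T. e x * k x) = (\<Sum>x\<in>S \<union> S'. (if x \<in> T then e x else 0) * k x)" if "T \<subseteq> S \<union> S'" for T and e k :: "'x \<Rightarrow> real"
        using that S(1) S'(1) by (intro sum.mono_neutral_cong_left) auto
      have *: "(\<Sum>x\<in>S. c x * k x) + (\<Sum>x\<in>S'. c' x * k x) = (\<Sum>x\<in>S \<union> S'. d x * k x)" for k
        unfolding ext[of S, OF Un_upper1] ext[of S', OF Un_upper2] d_def distrib_right sum.distrib ..
      have "(\<lambda>x. g x + g' x) = (\<lambda>y. \<Sum>x\<in>S \<union> S'. d x * K y x)" "l + l' = (\<Sum>x\<in>S \<union> S'. d x * f x)"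
        by (simp_all add: S S' *)
      then show ?thesis unfolding P_def using S(1) S'(1) by blast
    qed
    show "l\<^sup>2 \<le> B * ip g g" if gl: "(g, l) \<in> P" for g l
    proof -
      obtain S c where S: "finite S" "g = (\<lambda>y. \<Sum>x\<in>S. c x * K y x)" "l = (\<Sum>x\<in>S. c x * f x)"
        using gl unfolding P_def by blast
      have "ip g g = (\<Sum>x\<in>S. c x * g x)"
        unfolding S(2) by (rule ip_sum_kernel[OF S(1) sum_kernel_mem[OF S(1)]])
      also have "\<dots> = (\<Sum>x\<in>S. \<Sum>y\<in>S. c x * c y * K x y)" by (simp add: S(2) sum_distrib_left mult.assoc)
      finally show ?thesis using bound[OF S(1), of c] S(3) by simp
    qed
    fix h assume "h \<in> H" "\<And>g l. (g, l) \<in> P \<Longrightarrow> ip h g = l"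
    then show "\<exists>h\<in>H. \<forall>g l. (g, l) \<in> P \<longrightarrow> ip h g = l" by blast
  qed
  then obtain h where h: "h \<in> H" "\<And>g l. (g, l) \<in> P \<Longrightarrow> ip h g = l" by blast
  have "h = f"
  proof
    fix x
    have "((\<lambda>y. K y x), f x) \<in> P" unfolding P_def by (auto intro!: exI[of _ "{x}"] exI[of _ "\<lambda>_. 1"])
    from h(2)[OF this] show "h x = f x" using reproducing[OF h(1)] by simp
  qed
  then show ?thesis using h(1) by simp
qed

end

section \<open>Cosine transforms and positive-definite functions\<close>

lemma positive_definite_even: "positive_definite \<Phi> \<Longrightarrow> \<Phi> (- x) = \<Phi> x"
  unfolding positive_definite_def by (metis diff_0 diff_zero)

text \<open>Two points 0 and x with coefficients 1 and plus or minus 1 give 2 \<Phi> 0 plus or minus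
  2 \<Phi> x > 0; the case x = 0 uses a single point.\<close>

lemma positive_definite_bounded:
  fixes \<Phi> :: "'a::ab_group_add \<Rightarrow> real"
  assumes pd: "positive_definite \<Phi>"
  shows "\<bar>\<Phi> x\<bar> \<le> \<Phi> 0"
proof -
  have P: "(\<Sum>i=1..n. \<Sum>j=1..n. c i * c j * \<Phi> (y i - y j)) > 0"
    if "inj_on y {1..n}" "\<exists>i\<in>{1..n}. c i \<noteq> 0" for n :: nat and y :: "nat \<Rightarrow> 'a" and c :: "nat \<Rightarrow> real"
    using pd that unfolding positive_definite_def by blast
  show ?thesis
  proof (cases "x = 0")
    case True
    have "\<Phi> 0 > 0" using P[of "\<lambda>_. 0" 1 "\<lambda>_. 1"] by simp
    then show ?thesis using True by simp
  next
    case False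
    define y where "y i = (if i = 1 then x else 0)" for i :: nat
    have n2: "{1..2} = {1, 2::nat}" by auto
    have ev: "\<Phi> (- x) = \<Phi> x" by (rule positive_definite_even[OF pd])
    have "inj_on y {1..2}" unfolding n2 using False by (simp add: y_def)
    then have "(\<Sum>i=1..2. \<Sum>j=1..2. (if i = 1 then 1 else s) * (if j = 1 then 1 else s) * \<Phi> (y i - y j)) > 0" for s :: real
      by (rule P) (rule bexI[of _ 1], simp_all)
    from this[of 1] this[of "- 1"] show ?thesis unfolding n2 by (simp add: y_def ev)
  qed
qed

definition cos_transform :: "('a::euclidean_space \<Rightarrow> real) \<Rightarrow> 'a \<Rightarrow> real" where
  "cos_transform h x = (LINT \<xi>|lborel. h \<xi> * cos (x \<bullet> \<xi>))"

lemma measurable_cos_transform [measurable (raw)]: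
  assumes [measurable]: "h \<in> borel_measurable borel"
  shows "cos_transform h \<in> borel_measurable borel"
  unfolding cos_transform_def by measurable

lemma integrable_mult_cos:
  fixes h :: "'a::euclidean_space \<Rightarrow> real"
  assumes h: "integrable lborel h"
  shows "integrable lborel (\<lambda>\<xi>. h \<xi> * cos (x \<bullet> \<xi>))"
proof (rule Bochner_Integration.integrable_bound[OF h])
  have [measurable]: "h \<in> borel_measurable borel" using h by simp
  show "(\<lambda>\<xi>. h \<xi> * cos (x \<bullet> \<xi>)) \<in> borel_measurable lborel" by measurable
  show "AE \<xi> in lborel. norm (h \<xi> * cos (x \<bullet> \<xi>)) \<le> norm (h \<xi>)"
    using mult_left_mono[OF abs_cos_le_one abs_ge_zero] by (intro AE_I2) (simp add: abs_mult)
qed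

lemma abs_cos_transform_le:
  assumes h: "integrable lborel h"
  shows "\<bar>cos_transform h x\<bar> \<le> (LINT \<xi>|lborel. \<bar>h \<xi>\<bar>)"
proof -
  have "\<bar>cos_transform h x\<bar> \<le> (LINT \<xi>|lborel. \<bar>h \<xi> * cos (x \<bullet> \<xi>)\<bar>)"
    unfolding cos_transform_def by (rule integral_abs_bound)
  also have "\<dots> \<le> (LINT \<xi>|lborel. \<bar>h \<xi>\<bar>)"
  proof (rule integral_mono[OF integrable_abs[OF integrable_mult_cos[OF h]] integrable_abs[OF h]])
    show "\<bar>h \<xi> * cos (x \<bullet> \<xi>)\<bar> \<le> \<bar>h \<xi>\<bar>" for \<xi>
      using mult_left_mono[OF abs_cos_le_one abs_ge_zero] by (simp add: abs_mult)
  qed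
  finally show ?thesis .
qed

text \<open>The multiplication formula: Fubini moves the transform to the Gaussian. The product of
  cosines splits into the two shifts a - u and a + u, which contribute equally because \<Phi> is
  even.\<close>

lemma
  fixes \<Phi> :: "'a::euclidean_space \<Rightarrow> real"
  assumes i: "integrable lborel \<Phi>" and even: "\<And>x. \<Phi> (- x) = \<Phi> x" and s: "s > 0"
  shows integrable_cos_transform_gauss:
      "integrable lborel (\<lambda>\<xi>. cos_transform \<Phi> \<xi> * (cos (a \<bullet> \<xi>) * gauss (s *\<^sub>R \<xi>)))"
    and integral_cos_transform_gauss:
      "(LINT \<xi>|lborel. cos_transform \<Phi> \<xi> * (cos (a \<bullet> \<xi>) * gauss (s *\<^sub>R \<xi>)))
        = (sqrt (2 * pi) / s) ^ DIM('a) * (LINT u|lborel. \<Phi> u * gauss ((1 / s) *\<^sub>R (a - u)))"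
proof -
  have [measurable]: "\<Phi> \<in> borel_measurable borel" using i by simp
  let ?F = "\<lambda>(u, \<xi>). \<Phi> u * (cos (u \<bullet> \<xi>) * (cos (a \<bullet> \<xi>) * gauss (s *\<^sub>R \<xi>)))"
  have ig: "integrable lborel (\<lambda>\<xi>::'a. gauss (s *\<^sub>R \<xi>))" using integrable_cos_gauss_scaled[OF s, of 0] by simp
  have iF: "integrable (lborel \<Otimes>\<^sub>M lborel) ?F"
  proof (rule Bochner_Integration.integrable_bound)
    show "integrable (lborel \<Otimes>\<^sub>M lborel) (\<lambda>(u, \<xi>). \<Phi> u * gauss (s *\<^sub>R (\<xi>::'a)))"
    proof (rule lborel_pair.Fubini_integrable)
      have "(\<lambda>u. LINT \<xi>|lborel. norm (case (u, \<xi>) of (u, \<xi>) \<Rightarrow> \<Phi> u * gauss (s *\<^sub>R (\<xi>::'a))))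
        = (\<lambda>u. \<bar>\<Phi> u\<bar> * (LINT \<xi>|lborel. gauss (s *\<^sub>R (\<xi>::'a))))"
        by (simp add: abs_mult gauss_pos less_imp_le)
      then show "integrable lborel (\<lambda>u. LINT \<xi>|lborel. norm (case (u, \<xi>) of (u, \<xi>) \<Rightarrow> \<Phi> u * gauss (s *\<^sub>R (\<xi>::'a))))"
        using i by simp
    qed (use ig in auto)
    show "AE p in lborel \<Otimes>\<^sub>M lborel. norm (?F p) \<le> norm (case p of (u, \<xi>) \<Rightarrow> \<Phi> u * gauss (s *\<^sub>R \<xi>))"
    proof (rule AE_I2)
      fix p :: "'a \<times> 'a"
      obtain u \<xi> where p: "p = (u, \<xi>)" by (cases p)
      have "\<bar>cos (u \<bullet> \<xi>)\<bar> * \<bar>cos (a \<bullet> \<xi>)\<bar> \<le> 1 * 1" by (intro mult_mono) auto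
      then have "\<bar>cos (u \<bullet> \<xi>)\<bar> * \<bar>cos (a \<bullet> \<xi>)\<bar> * (\<bar>\<Phi> u\<bar> * \<bar>gauss (s *\<^sub>R \<xi>)\<bar>) \<le> 1 * (\<bar>\<Phi> u\<bar> * \<bar>gauss (s *\<^sub>R \<xi>)\<bar>)"
        by (intro mult_right_mono) auto
      then show "norm (?F p) \<le> norm (case p of (u, \<xi>) \<Rightarrow> \<Phi> u * gauss (s *\<^sub>R \<xi>))"
        by (simp add: p abs_mult mult_ac)
    qed
  qed measurable
  have e1: "(LINT u|lborel. ?F (u, \<xi>)) = cos_transform \<Phi> \<xi> * (cos (a \<bullet> \<xi>) * gauss (s *\<^sub>R \<xi>))" for \<xi>
  proof -
    have "(LINT u|lborel. ?F (u, \<xi>)) = (LINT u|lborel. (\<Phi> u * cos (\<xi> \<bullet> u)) * (cos (a \<bullet> \<xi>) * gauss (s *\<^sub>R \<xi>)))"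
      by (simp add: inner_commute[of _ \<xi>] mult.assoc)
    also have "\<dots> = (LINT u|lborel. \<Phi> u * cos (\<xi> \<bullet> u)) * (cos (a \<bullet> \<xi>) * gauss (s *\<^sub>R \<xi>))"
      by (rule integral_mult_left_zero)
    finally show ?thesis by (simp add: cos_transform_def)
  qed
  let ?c = "(sqrt (2 * pi) / s) ^ DIM('a)"
  have e2: "(LINT \<xi>|lborel. ?F (u, \<xi>))
    = ?c / 2 * (\<Phi> u * gauss ((1 / s) *\<^sub>R (a - u)) + \<Phi> u * gauss ((1 / s) *\<^sub>R (a + u)))" for u
  proof -
    have "cos (u \<bullet> \<xi>) * (cos (a \<bullet> \<xi>) * gauss (s *\<^sub>R \<xi>))
      = 1 / 2 * (cos ((a - u) \<bullet> \<xi>) * gauss (s *\<^sub>R \<xi>) + cos ((a + u) \<bullet> \<xi>) * gauss (s *\<^sub>R \<xi>))" for \<xi>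
      by (simp add: inner_diff_left inner_add_left cos_add cos_diff algebra_simps)
    then have "(LINT \<xi>|lborel. ?F (u, \<xi>)) = \<Phi> u * (LINT \<xi>|lborel.
       1 / 2 * (cos ((a - u) \<bullet> \<xi>) * gauss (s *\<^sub>R \<xi>) + cos ((a + u) \<bullet> \<xi>) * gauss (s *\<^sub>R \<xi>)))"
      by (simp only: prod.case integral_mult_right_zero)
    also have "\<dots> = \<Phi> u * (1 / 2 * (?c * gauss ((1 / s) *\<^sub>R (a - u)) + ?c * gauss ((1 / s) *\<^sub>R (a + u))))"
      by (simp only: integral_mult_right_zero integral_cos_gauss_scaled[OF s]
          Bochner_Integration.integral_add[OF integrable_cos_gauss_scaled[OF s] integrable_cos_gauss_scaled[OF s]])
    finally show ?thesis by (simp add: algebra_simps)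
  qed
  show "integrable lborel (\<lambda>\<xi>. cos_transform \<Phi> \<xi> * (cos (a \<bullet> \<xi>) * gauss (s *\<^sub>R \<xi>)))"
    using lborel_pair.integrable_snd[OF iF] e1 by simp
  have ib: "integrable lborel (\<lambda>u. \<Phi> u * gauss ((1 / s) *\<^sub>R (a - u)))"
    by (rule Bochner_Integration.integrable_bound[OF i])
       (auto simp: abs_mult gauss_pos less_imp_le intro!: mult_left_le gauss_le_1)
  have iba: "integrable lborel (\<lambda>u. \<Phi> u * gauss ((1 / s) *\<^sub>R (a + u)))"
    by (rule Bochner_Integration.integrable_bound[OF i])
       (auto simp: abs_mult gauss_pos less_imp_le intro!: mult_left_le gauss_le_1)
  have refl: "(LINT u|lborel. \<Phi> u * gauss ((1 / s) *\<^sub>R (a + u))) = (LINT u|lborel. \<Phi> u * gauss ((1 / s) *\<^sub>R (a - u)))"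
    using lborel_integral_affine[of "-1" "\<lambda>u. \<Phi> u * gauss ((1 / s) *\<^sub>R (a + u))" 0] even by simp
  have "(LINT \<xi>|lborel. cos_transform \<Phi> \<xi> * (cos (a \<bullet> \<xi>) * gauss (s *\<^sub>R \<xi>))) = (LINT u|lborel. LINT \<xi>|lborel. ?F (u, \<xi>))"
    using lborel_pair.Fubini_integral[OF iF] e1 by simp
  also have "\<dots> = ?c / 2 * ((LINT u|lborel. \<Phi> u * gauss ((1 / s) *\<^sub>R (a - u))) + (LINT u|lborel. \<Phi> u * gauss ((1 / s) *\<^sub>R (a + u))))"
    unfolding e2 integral_mult_right_zero Bochner_Integration.integral_add[OF ib iba] ..
  also have "\<dots> = ?c * (LINT u|lborel. \<Phi> u * gauss ((1 / s) *\<^sub>R (a - u)))" unfolding refl by simp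
  finally show "(LINT \<xi>|lborel. cos_transform \<Phi> \<xi> * (cos (a \<bullet> \<xi>) * gauss (s *\<^sub>R \<xi>)))
        = ?c * (LINT u|lborel. \<Phi> u * gauss ((1 / s) *\<^sub>R (a - u)))" .
qed

section \<open>Fourier inversion by Gaussian summation\<close>

definition mesh :: "nat \<Rightarrow> real" where "mesh n = 1 / (real n + 1)"

lemma mesh_pos: "mesh n > 0" and mesh_tendsto: "mesh \<longlonglongrightarrow> 0"
proof -
  show "mesh n > 0" by (simp add: mesh_def add_nonneg_pos)
  show "mesh \<longlonglongrightarrow> 0" unfolding mesh_def[abs_def] by real_asymp
qed

lemma gauss_mesh_tendsto: "(\<lambda>n. gauss (mesh n *\<^sub>R (\<xi>::'a::euclidean_space))) \<longlonglongrightarrow> 1"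
proof -
  have "(\<lambda>n. exp (- (mesh n * norm \<xi>)\<^sup>2 / 2)) \<longlonglongrightarrow> exp (- (0 * norm \<xi>)\<^sup>2 / 2)"
    by (intro tendsto_intros mesh_tendsto) simp
  then show ?thesis by (simp add: gauss_def power_mult_distrib)
qed

text \<open>Integrability of the transform of \<Phi> is not assumed, so inversion takes the form of
  a limit of Gaussian-damped integrals; these always converge.\<close>

lemma fourier_inversion_gauss:
  fixes \<Phi> :: "'a::euclidean_space \<Rightarrow> real"
  assumes i: "integrable lborel \<Phi>" and even: "\<And>x. \<Phi> (- x) = \<Phi> x" and b: "\<And>x. \<bar>\<Phi> x\<bar> \<le> B" and c: "isCont \<Phi> a"
  shows "(\<lambda>n. LINT \<xi>|lborel. cos_transform \<Phi> \<xi> * (cos (a \<bullet> \<xi>) * gauss (mesh n *\<^sub>R \<xi>))) \<longlonglongrightarrow> (2 * pi) ^ DIM('a) * \<Phi> a"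
proof -
  have m: "\<Phi> \<in> borel_measurable borel" using i by simp
  have "(\<lambda>n. sqrt (2 * pi) ^ DIM('a) * ((1 / mesh n) ^ DIM('a) * (LINT u|lborel. \<Phi> u * gauss ((1 / mesh n) *\<^sub>R (a - u)))))
    \<longlonglongrightarrow> sqrt (2 * pi) ^ DIM('a) * (sqrt (2 * pi) ^ DIM('a) * \<Phi> a)"
    by (rule tendsto_mult[OF tendsto_const gauss_approximate_identity[OF m b c mesh_pos mesh_tendsto]])
  moreover have "sqrt (2 * pi) ^ DIM('a) * ((1 / mesh n) ^ DIM('a) * (LINT u|lborel. \<Phi> u * gauss ((1 / mesh n) *\<^sub>R (a - u))))
    = (LINT \<xi>|lborel. cos_transform \<Phi> \<xi> * (cos (a \<bullet> \<xi>) * gauss (mesh n *\<^sub>R \<xi>)))" for n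
    unfolding integral_cos_transform_gauss[OF i even mesh_pos] by (simp add: power_divide)
  moreover have "sqrt (2 * pi) ^ DIM('a) * (sqrt (2 * pi) ^ DIM('a) * \<Phi> a) = (2 * pi) ^ DIM('a) * \<Phi> a"
    unfolding mult.assoc[symmetric] power_mult_distrib[symmetric] by simp
  ultimately show ?thesis by simp
qed

lemma integral_cos_transform:
  fixes h :: "'a::euclidean_space \<Rightarrow> real"
  assumes i: "integrable lborel h" and even: "\<And>x. h (- x) = h x" and b: "\<And>x. \<bar>h x\<bar> \<le> B" and c: "isCont h 0"
    and it: "integrable lborel (cos_transform h)"
  shows "(LINT x|lborel. cos_transform h x) = (2 * pi) ^ DIM('a) * h 0"
proof (rule LIMSEQ_unique)
  show "(\<lambda>n. LINT \<xi>|lborel. cos_transform h \<xi> * (cos (0 \<bullet> \<xi>) * gauss (mesh n *\<^sub>R \<xi>))) \<longlonglongrightarrow> (2 * pi) ^ DIM('a) * h 0"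
    by (rule fourier_inversion_gauss[OF i even b c])
  have [measurable]: "h \<in> borel_measurable borel" using i by simp
  show "(\<lambda>n. LINT \<xi>|lborel. cos_transform h \<xi> * (cos (0 \<bullet> \<xi>) * gauss (mesh n *\<^sub>R \<xi>))) \<longlonglongrightarrow> (LINT x|lborel. cos_transform h x)"
  proof (rule integral_dominated_convergence)
    show "integrable lborel (\<lambda>\<xi>. \<bar>cos_transform h \<xi>\<bar>)" using it by simp
    show "AE \<xi> in lborel. (\<lambda>n. cos_transform h \<xi> * (cos (0 \<bullet> \<xi>) * gauss (mesh n *\<^sub>R \<xi>))) \<longlonglongrightarrow> cos_transform h \<xi>"
      using tendsto_mult[OF tendsto_const gauss_mesh_tendsto] by (intro AE_I2) fastforce
    show "AE \<xi> in lborel. norm (cos_transform h \<xi> * (cos (0 \<bullet> \<xi>) * gauss (mesh n *\<^sub>R \<xi>))) \<le> \<bar>cos_transform h \<xi>\<bar>" for n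
      by (intro AE_I2) (simp add: abs_mult gauss_pos less_imp_le mult_left_le gauss_le_1)
  qed measurable
qed

text \<open>The right-hand side is the squared modulus of the exponential sum of the c x. Shifting
  all points by x0 does not change it, and the left-hand side is the square of the real part after
  that shift.\<close>

lemma sum_cos_square_le:
  fixes x0 :: "'a::real_inner"
  assumes "finite S"
  shows "(\<Sum>x\<in>S. c x * cos ((x - x0) \<bullet> \<xi>))\<^sup>2 \<le> (\<Sum>x\<in>S. \<Sum>y\<in>S. c x * c y * cos ((x - y) \<bullet> \<xi>))"
proof -
  have "(\<Sum>x\<in>S. \<Sum>y\<in>S. c x * c y * cos ((x - y) \<bullet> \<xi>))
    = (\<Sum>x\<in>S. \<Sum>y\<in>S. (c x * cos ((x - x0) \<bullet> \<xi>)) * (c y * cos ((y - x0) \<bullet> \<xi>))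
        + (c x * sin ((x - x0) \<bullet> \<xi>)) * (c y * sin ((y - x0) \<bullet> \<xi>)))"
  proof (intro sum.cong refl)
    fix x y
    have "(x - y) \<bullet> \<xi> = (x - x0) \<bullet> \<xi> - (y - x0) \<bullet> \<xi>" by (simp add: inner_diff_left)
    then show "c x * c y * cos ((x - y) \<bullet> \<xi>) = (c x * cos ((x - x0) \<bullet> \<xi>)) * (c y * cos ((y - x0) \<bullet> \<xi>))
        + (c x * sin ((x - x0) \<bullet> \<xi>)) * (c y * sin ((y - x0) \<bullet> \<xi>))"
      by (simp only: cos_diff) (simp add: algebra_simps)
  qed
  also have "\<dots> = (\<Sum>x\<in>S. c x * cos ((x - x0) \<bullet> \<xi>))\<^sup>2 + (\<Sum>x\<in>S. c x * sin ((x - x0) \<bullet> \<xi>))\<^sup>2"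
    by (simp add: sum.distrib power2_eq_square sum_product)
  finally show ?thesis by simp
qed

text \<open>The choice t = |X| / D optimises the family. Cauchy-Schwarz is used in this linearised
  form because the bounds for fixed t pass to limits of damped integrals.\<close>

lemma square_le_of_scaled_bounds:
  fixes X D N :: real
  assumes D: "D > 0" and le: "\<And>t. t > 0 \<Longrightarrow> \<bar>X\<bar> \<le> (t * D + N / t) / 2" and N: "N \<ge> 0"
  shows "X\<^sup>2 \<le> D * N"
proof (cases "X = 0")
  case False
  then have "\<bar>X\<bar> \<le> (\<bar>X\<bar> / D * D + N / (\<bar>X\<bar> / D)) / 2" using D by (intro le) simp
  then have "\<bar>X\<bar> \<le> N * D / \<bar>X\<bar>" using D by simp
  then have "\<bar>X\<bar> * \<bar>X\<bar> \<le> N * D" using False by (simp add: pos_le_divide_eq)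
  then show ?thesis by (simp add: power2_eq_square mult.commute)
qed (use D N in simp)

text \<open>The left-hand side is the square of the integral of h against the trigonometric sum
  \<open>Cf\<close>. Pointwise |h Cf| <= (t h^2 / P + P Cf^2 / t) / 2 with P the transform of
  \<Phi>. After Gaussian damping, Cf^2 is replaced by the quadratic form \<open>T\<close>, whose
  integral against P tends to the kernel form by inversion. The added 1 keeps the constant
  positive.\<close>

lemma cos_transform_bound:
  fixes \<Phi> h :: "'a::euclidean_space \<Rightarrow> real"
  assumes i: "integrable lborel \<Phi>" and even: "\<And>x. \<Phi> (- x) = \<Phi> x" and b: "\<And>x. \<bar>\<Phi> x\<bar> \<le> B"
    and cont: "\<And>x. isCont \<Phi> x" and pos: "\<And>\<xi>. cos_transform \<Phi> \<xi> > 0"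
    and h: "integrable lborel h" and hw: "integrable lborel (\<lambda>\<xi>. (h \<xi>)\<^sup>2 / cos_transform \<Phi> \<xi>)"
    and S: "finite S"
  shows "(\<Sum>x\<in>S. c x * cos_transform h (x - x0))\<^sup>2
    \<le> ((LINT \<xi>|lborel. (h \<xi>)\<^sup>2 / cos_transform \<Phi> \<xi>) + 1) * ((2 * pi) ^ DIM('a) * (\<Sum>x\<in>S. \<Sum>y\<in>S. c x * c y * \<Phi> (x - y)))"
proof -
  have [measurable]: "\<Phi> \<in> borel_measurable borel" "h \<in> borel_measurable borel" using i h by auto
  define D where "D = (LINT \<xi>|lborel. (h \<xi>)\<^sup>2 / cos_transform \<Phi> \<xi>)"
  have D0: "D \<ge> 0" unfolding D_def using pos by (intro integral_nonneg_AE AE_I2) (simp add: less_imp_le)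
  define N where "N = (2 * pi) ^ DIM('a) * (\<Sum>x\<in>S. \<Sum>y\<in>S. c x * c y * \<Phi> (x - y))"
  define Cf where "Cf \<xi> = (\<Sum>x\<in>S. c x * cos ((x - x0) \<bullet> \<xi>))" for \<xi>
  define T where "T \<xi> = (\<Sum>x\<in>S. \<Sum>y\<in>S. c x * c y * cos ((x - y) \<bullet> \<xi>))" for \<xi>
  have [measurable]: "Cf \<in> borel_measurable borel" unfolding Cf_def by measurable
  have CT: "(Cf \<xi>)\<^sup>2 \<le> T \<xi>" for \<xi> unfolding Cf_def T_def by (rule sum_cos_square_le[OF S])
  let ?g = "\<lambda>n \<xi>::'a. gauss (mesh n *\<^sub>R \<xi>)"
  let ?P = "cos_transform \<Phi>"
  have X: "(\<Sum>x\<in>S. c x * cos_transform h (x - x0)) = (LINT \<xi>|lborel. h \<xi> * Cf \<xi>)"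
    unfolding cos_transform_def Cf_def sum_distrib_left
    using integrable_mult_cos[OF h]
    by (simp add: Bochner_Integration.integral_sum mult.left_commute)
  have iX: "integrable lborel (\<lambda>\<xi>. h \<xi> * Cf \<xi>)"
    unfolding Cf_def sum_distrib_left using integrable_mult_cos[OF h]
    by (intro Bochner_Integration.integrable_sum) (simp add: mult.left_commute)
  have Tg: "?P \<xi> * (T \<xi> * ?g n \<xi>) = (\<Sum>x\<in>S. \<Sum>y\<in>S. c x * c y * (?P \<xi> * (cos ((x - y) \<bullet> \<xi>) * ?g n \<xi>)))" for n \<xi>
    unfolding T_def by (simp add: sum_distrib_left sum_distrib_right mult_ac)
  have iT: "integrable lborel (\<lambda>\<xi>. ?P \<xi> * (T \<xi> * ?g n \<xi>))" for n
    unfolding Tg by (intro Bochner_Integration.integrable_sum integrable_mult_right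
        integrable_cos_transform_gauss[OF i even mesh_pos])
  have vT: "(LINT \<xi>|lborel. ?P \<xi> * (T \<xi> * ?g n \<xi>))
    = (\<Sum>x\<in>S. \<Sum>y\<in>S. c x * c y * (LINT \<xi>|lborel. ?P \<xi> * (cos ((x - y) \<bullet> \<xi>) * ?g n \<xi>)))" for n
    unfolding Tg using integrable_cos_transform_gauss[OF i even mesh_pos]
    by (simp add: Bochner_Integration.integral_sum)
  have limT: "(\<lambda>n. LINT \<xi>|lborel. ?P \<xi> * (T \<xi> * ?g n \<xi>)) \<longlonglongrightarrow> N"
  proof -
    have "(\<lambda>n. \<Sum>x\<in>S. \<Sum>y\<in>S. c x * c y * (LINT \<xi>|lborel. ?P \<xi> * (cos ((x - y) \<bullet> \<xi>) * ?g n \<xi>)))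
      \<longlonglongrightarrow> (\<Sum>x\<in>S. \<Sum>y\<in>S. c x * c y * ((2 * pi) ^ DIM('a) * \<Phi> (x - y)))"
      by (intro tendsto_sum tendsto_mult tendsto_const fourier_inversion_gauss[OF i even b cont])
    then show ?thesis unfolding vT N_def by (simp add: sum_distrib_left mult_ac)
  qed
  have limX: "(\<lambda>n. LINT \<xi>|lborel. h \<xi> * Cf \<xi> * ?g n \<xi>) \<longlonglongrightarrow> (LINT \<xi>|lborel. h \<xi> * Cf \<xi>)"
  proof (rule integral_dominated_convergence)
    show "integrable lborel (\<lambda>\<xi>. \<bar>h \<xi> * Cf \<xi>\<bar>)" using iX by simp
    show "AE \<xi> in lborel. (\<lambda>n. h \<xi> * Cf \<xi> * ?g n \<xi>) \<longlonglongrightarrow> h \<xi> * Cf \<xi>"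
      using tendsto_mult[OF tendsto_const gauss_mesh_tendsto] by (intro AE_I2) fastforce
    show "AE \<xi> in lborel. norm (h \<xi> * Cf \<xi> * ?g n \<xi>) \<le> \<bar>h \<xi> * Cf \<xi>\<bar>" for n
      by (intro AE_I2) (simp add: abs_mult gauss_pos less_imp_le mult_left_le gauss_le_1)
  qed measurable
  have N0: "N \<ge> 0"
  proof (rule LIMSEQ_le_const[OF limT])
    have "0 \<le> (LINT \<xi>|lborel. ?P \<xi> * (T \<xi> * ?g n \<xi>))" for n
    proof (rule integral_nonneg_AE, rule AE_I2)
      fix \<xi>
      have "T \<xi> \<ge> 0" using CT[of \<xi>] zero_le_power2[of "Cf \<xi>"] by linarith
      then show "0 \<le> ?P \<xi> * (T \<xi> * ?g n \<xi>)"
        using pos[of \<xi>] gauss_pos[of "mesh n *\<^sub>R \<xi>"] by (intro mult_nonneg_nonneg) auto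
    qed
    then show "\<exists>M. \<forall>n\<ge>M. 0 \<le> (LINT \<xi>|lborel. ?P \<xi> * (T \<xi> * ?g n \<xi>))" by blast
  qed
  have main: "\<bar>LINT \<xi>|lborel. h \<xi> * Cf \<xi>\<bar> \<le> (t * (D + 1) + N / t) / 2" if t: "t > 0" for t
  proof (rule LIMSEQ_le)
    show "(\<lambda>n. \<bar>LINT \<xi>|lborel. h \<xi> * Cf \<xi> * ?g n \<xi>\<bar>) \<longlonglongrightarrow> \<bar>LINT \<xi>|lborel. h \<xi> * Cf \<xi>\<bar>"
      by (rule tendsto_rabs[OF limX])
    show "(\<lambda>n. (t * (D + 1) + (LINT \<xi>|lborel. ?P \<xi> * (T \<xi> * ?g n \<xi>)) / t) / 2) \<longlonglongrightarrow> (t * (D + 1) + N / t) / 2"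
      by (intro tendsto_intros limT) (use t in auto)
    have "\<bar>LINT \<xi>|lborel. h \<xi> * Cf \<xi> * ?g n \<xi>\<bar> \<le> (t * (D + 1) + (LINT \<xi>|lborel. ?P \<xi> * (T \<xi> * ?g n \<xi>)) / t) / 2" for n
    proof -
      let ?G = "\<lambda>\<xi>. (t / 2) * ((h \<xi>)\<^sup>2 / ?P \<xi>) + (1 / (2 * t)) * (?P \<xi> * (T \<xi> * ?g n \<xi>))"
      have iG: "integrable lborel ?G" by (intro Bochner_Integration.integrable_add integrable_mult_right hw iT)
      have le: "\<bar>h \<xi> * Cf \<xi> * ?g n \<xi>\<bar> \<le> ?G \<xi>" for \<xi>
      proof -
        have gp: "?g n \<xi> > 0" "?g n \<xi> \<le> 1" by (rule gauss_pos gauss_le_1)+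
        note p = pos[of \<xi>]
        have "0 \<le> (t * \<bar>h \<xi>\<bar> - ?P \<xi> * \<bar>Cf \<xi>\<bar>)\<^sup>2 / (2 * t * ?P \<xi>)" using t p by simp
        also have "\<dots> = (t / 2) * ((h \<xi>)\<^sup>2 / ?P \<xi>) + (1 / (2 * t)) * (?P \<xi> * (Cf \<xi>)\<^sup>2) - \<bar>h \<xi> * Cf \<xi>\<bar>"
          using t p by (simp add: power2_diff abs_mult power_mult_distrib field_simps power2_eq_square)
        finally have "\<bar>h \<xi> * Cf \<xi>\<bar> \<le> (t / 2) * ((h \<xi>)\<^sup>2 / ?P \<xi>) + (1 / (2 * t)) * (?P \<xi> * (Cf \<xi>)\<^sup>2)" by simp
        then have "\<bar>h \<xi> * Cf \<xi>\<bar> * ?g n \<xi> \<le> ((t / 2) * ((h \<xi>)\<^sup>2 / ?P \<xi>) + (1 / (2 * t)) * (?P \<xi> * (Cf \<xi>)\<^sup>2)) * ?g n \<xi>"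
          using gp by (intro mult_right_mono) auto
        also have "\<dots> = (t / 2) * ((h \<xi>)\<^sup>2 / ?P \<xi>) * ?g n \<xi> + (1 / (2 * t)) * (?P \<xi> * ((Cf \<xi>)\<^sup>2 * ?g n \<xi>))"
          by (simp add: algebra_simps)
        also have "\<dots> \<le> (t / 2) * ((h \<xi>)\<^sup>2 / ?P \<xi>) * 1 + (1 / (2 * t)) * (?P \<xi> * (T \<xi> * ?g n \<xi>))"
          using t p gp CT[of \<xi>] by (intro add_mono mult_left_mono mult_right_mono) auto
        finally show ?thesis using gp by (simp add: abs_mult)
      qed
      have "\<bar>LINT \<xi>|lborel. h \<xi> * Cf \<xi> * ?g n \<xi>\<bar> \<le> (LINT \<xi>|lborel. \<bar>h \<xi> * Cf \<xi> * ?g n \<xi>\<bar>)"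
        by (rule integral_abs_bound)
      also have "\<dots> \<le> (LINT \<xi>|lborel. ?G \<xi>)"
      proof (rule integral_mono[OF _ iG le])
        show "integrable lborel (\<lambda>\<xi>. \<bar>h \<xi> * Cf \<xi> * ?g n \<xi>\<bar>)"
          by (rule integrable_le_nonneg[OF iG _ abs_ge_zero le]) measurable
      qed
      also have "\<dots> = (t / 2) * D + (1 / (2 * t)) * (LINT \<xi>|lborel. ?P \<xi> * (T \<xi> * ?g n \<xi>))"
        unfolding D_def
        by (simp only: Bochner_Integration.integral_add[OF integrable_mult_right[OF hw] integrable_mult_right[OF iT]] integral_mult_right_zero)
      also have "\<dots> \<le> (t * (D + 1) + (LINT \<xi>|lborel. ?P \<xi> * (T \<xi> * ?g n \<xi>)) / t) / 2"
        using t by (simp add: field_simps)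
      finally show ?thesis .
    qed
    then show "\<exists>M. \<forall>n\<ge>M. \<bar>LINT \<xi>|lborel. h \<xi> * Cf \<xi> * ?g n \<xi>\<bar>
      \<le> (t * (D + 1) + (LINT \<xi>|lborel. ?P \<xi> * (T \<xi> * ?g n \<xi>)) / t) / 2" by blast
  qed
  have "(LINT \<xi>|lborel. h \<xi> * Cf \<xi>)\<^sup>2 \<le> (D + 1) * N"
    by (rule square_le_of_scaled_bounds[OF _ main N0]) (use D0 in simp)
  then show ?thesis by (simp add: X D_def N_def)
qed

section \<open>Radial weights and the test function\<close>

text \<open>Averaging over the dilations of the annulus \<open>1 \<le> norm u \<le> 2\<close> and Fubini replace polar
  coordinates.\<close>

lemma integrable_along_some_ray:
  fixes F :: "'a::euclidean_space \<Rightarrow> real"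
  assumes F: "integrable lborel F" and nn: "\<And>x. F x \<ge> 0"
  obtains u where "1 \<le> norm u" "norm u \<le> 2"
    "integrable lborel (\<lambda>r. indicator {1..} r * (r ^ (DIM('a) - 1) * F (r *\<^sub>R u)))"
proof -
  have [measurable]: "F \<in> borel_measurable borel" using F by simp
  define G where "G u r = indicator {1..2} (norm u) * (indicator {1..} r * (r ^ (DIM('a) - 1) * F (r *\<^sub>R u)))" for u :: 'a and r :: real
  have [measurable]: "(\<lambda>(u, r). ennreal (G u r)) \<in> borel_measurable (lborel \<Otimes>\<^sub>M lborel)"
    unfolding G_def by measurable
  \<comment> \<open>Substituting \<xi> = r u turns the condition 1 <= |u| <= 2 into r <= |\<xi>| <=
    2 r. Of the Jacobian r^d, the power r^(d - 1) is already in \<open>G\<close>, which leaves 1 /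
    r.\<close>
  define k where "k \<xi> r = indicator {1..} r * (indicator {r..2 * r} (norm \<xi>) / r)" for \<xi> :: 'a and r :: real
  have k_nn: "k \<xi> r \<ge> 0" for \<xi> r unfolding k_def by (auto simp: indicator_def)
  have k_eq: "k \<xi> r = (if 1 \<le> r \<and> r \<le> norm \<xi> \<and> norm \<xi> \<le> 2 * r then 1 / r else 0)" for \<xi> r
    unfolding k_def by (auto simp: indicator_def)
  have [measurable]: "(\<lambda>(\<xi>, r). k \<xi> r) \<in> borel_measurable (lborel \<Otimes>\<^sub>M lborel)"
    unfolding k_eq by measurable
  have inner: "(\<integral>\<^sup>+u. ennreal (G u r) \<partial>lborel) = (\<integral>\<^sup>+\<xi>. ennreal (F \<xi> * k \<xi> r) \<partial>lborel)" for r
  proof (cases "r \<ge> 1")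
    case r: True
    have pw: "r ^ DIM('a) = r * r ^ (DIM('a) - 1)" using DIM_positive[where 'a='a] by (cases "DIM('a)") auto
    have "(\<integral>\<^sup>+\<xi>. ennreal (F \<xi> * k \<xi> r) \<partial>lborel)
      = ennreal (r ^ DIM('a)) * (\<integral>\<^sup>+u. ennreal (F (r *\<^sub>R u) * k (r *\<^sub>R u) r) \<partial>lborel)"
      using r by (subst lborel_affine[of r 0]) (simp_all add: nn_integral_density nn_integral_distr nn_integral_cmult)
    also have "\<dots> = (\<integral>\<^sup>+u. ennreal (r ^ DIM('a)) * ennreal (F (r *\<^sub>R u) * k (r *\<^sub>R u) r) \<partial>lborel)"
      by (subst nn_integral_cmult) simp_all
    also have "\<dots> = (\<integral>\<^sup>+u. ennreal (G u r) \<partial>lborel)"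
    proof (rule nn_integral_cong)
      fix u :: 'a
      have "r ^ DIM('a) * (F (r *\<^sub>R u) * k (r *\<^sub>R u) r) = G u r"
        using r unfolding G_def k_eq pw by (simp add: indicator_def)
      then show "ennreal (r ^ DIM('a)) * ennreal (F (r *\<^sub>R u) * k (r *\<^sub>R u) r) = ennreal (G u r)"
        using r nn k_nn by (subst ennreal_mult[symmetric]) simp_all
    qed
    finally show ?thesis by simp
  qed (simp add: G_def k_def)
  \<comment> \<open>The factor 1 / r is at most 2 / |\<xi>| and lives on an interval of length
    |\<xi>| / 2.\<close>
  have k_le: "(\<integral>\<^sup>+r. ennreal (k \<xi> r) \<partial>lborel) \<le> 1" for \<xi>
  proof (cases "\<xi> = 0")
    case True
    have "k \<xi> r = 0" for r unfolding k_eq True by simp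
    then show ?thesis by simp
  next
    case False
    let ?n = "norm \<xi>"
    have "(\<integral>\<^sup>+r. ennreal (k \<xi> r) \<partial>lborel) \<le> (\<integral>\<^sup>+r. ennreal (2 / ?n) * indicator {?n / 2..?n} r \<partial>lborel)"
    proof (rule nn_integral_mono)
      fix r :: real
      show "ennreal (k \<xi> r) \<le> ennreal (2 / ?n) * indicator {?n / 2..?n} r"
      proof (cases "1 \<le> r \<and> r \<le> ?n \<and> ?n \<le> 2 * r")
        case True
        then have "1 / r \<le> 2 / ?n" using False by (simp add: field_simps)
        moreover have "?n / 2 \<le> r" using True by simp
        ultimately show ?thesis using True unfolding k_eq by (simp add: ennreal_leI)
      next
        case False
        then show ?thesis unfolding k_eq by (simp only: if_False) simp
      qed
    qed
    also have "\<dots> = ennreal (2 / ?n) * ennreal (?n / 2)"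
      by (subst nn_integral_cmult_indicator) (simp_all add: field_simps)
    also have "\<dots> = 1" using False by (subst ennreal_mult[symmetric]) simp_all
    finally show ?thesis .
  qed
  have "(\<integral>\<^sup>+u. \<integral>\<^sup>+r. ennreal (G u r) \<partial>lborel \<partial>lborel) = (\<integral>\<^sup>+r. \<integral>\<^sup>+u. ennreal (G u r) \<partial>lborel \<partial>lborel)"
    using lborel_pair.Fubini'[of "\<lambda>u r. ennreal (G u r)"] by simp
  also have "\<dots> = (\<integral>\<^sup>+r. \<integral>\<^sup>+\<xi>. ennreal (F \<xi> * k \<xi> r) \<partial>lborel \<partial>lborel)" by (simp add: inner)
  also have "\<dots> = (\<integral>\<^sup>+\<xi>. \<integral>\<^sup>+r. ennreal (F \<xi> * k \<xi> r) \<partial>lborel \<partial>lborel)"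
    using lborel_pair.Fubini'[of "\<lambda>\<xi> r. ennreal (F \<xi> * k \<xi> r)"] by simp
  also have "\<dots> = (\<integral>\<^sup>+\<xi>. ennreal (F \<xi>) * (\<integral>\<^sup>+r. ennreal (k \<xi> r) \<partial>lborel) \<partial>lborel)"
    using nn k_nn by (simp add: ennreal_mult nn_integral_cmult)
  also have "\<dots> \<le> (\<integral>\<^sup>+\<xi>. ennreal (F \<xi>) * 1 \<partial>lborel)"
    by (intro nn_integral_mono mult_left_mono k_le) simp
  also have "\<dots> < \<infinity>" using F nn by (simp add: nn_integral_eq_integral)
  finally have "AE u in lborel. (\<integral>\<^sup>+r. ennreal (G u r) \<partial>lborel) \<noteq> \<infinity>"
    by (intro nn_integral_PInf_AE) simp_all
  \<comment> \<open>The open annulus is not a null set, so one of the almost all good directions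
    lies in it.\<close>
  moreover have "\<not> (AE u::'a in lborel. \<not> (1 < norm u \<and> norm u < 2))"
  proof
    let ?A = "{u::'a. 1 < norm u \<and> norm u < 2}"
    assume "AE u::'a in lborel. \<not> (1 < norm u \<and> norm u < 2)"
    then have "emeasure lborel ?A = 0"
      by (subst (asm) AE_iff_measurable[of ?A]) simp_all
    then have "negligible ?A"
      by (simp add: negligible_iff_null_sets null_sets_completion_iff null_sets_def)
    moreover have "open ?A" by (intro open_Collect_conj open_Collect_less continuous_intros)
    moreover obtain b :: 'a where "b \<in> Basis" using nonempty_Basis by blast
    then have "(3/2) *\<^sub>R b \<in> ?A" by simp
    ultimately show False using open_not_negligible by blast
  qed
  ultimately obtain u where u: "1 < norm u" "norm u < 2" and fin: "(\<integral>\<^sup>+r. ennreal (G u r) \<partial>lborel) \<noteq> \<infinity>"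
    by (smt (verit) eventually_mono)
  show ?thesis
  proof (rule that)
    show "1 \<le> norm u" "norm u \<le> 2" using u by auto
    have eq: "indicator {1..} r * (r ^ (DIM('a) - 1) * F (r *\<^sub>R u)) = G u r" for r :: real
      using u unfolding G_def by simp
    have G_nn: "G u r \<ge> 0" for r unfolding G_def using nn by (simp add: indicator_def)
    show "integrable lborel (\<lambda>r. indicator {1..} r * (r ^ (DIM('a) - 1) * F (r *\<^sub>R u)))"
      unfolding eq using fin G_nn
      by (intro integrableI_nonneg) (simp_all add: less_top G_def[abs_def])
  qed
qed

text \<open>Along a good ray the power r^(d - 1) cancels all but one power of 1 + r^2 in the weight.
  The remaining part, within distance at most 2 of the origin, is bounded through the Lipschitz
  condition.\<close>

lemma integrable_radial_profile:
  fixes W :: "real \<Rightarrow> real"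
  assumes nn: "\<And>x. W x \<ge> 0" and even: "\<And>x. W (- x) = W x"
    and lip: "\<And>x y. \<bar>W x - W y\<bar> \<le> L * \<bar>x - y\<bar>" and L: "L > 0"
    and int: "integrable lborel (\<lambda>\<xi>::'a::euclidean_space. W (norm \<xi>) / (1 + (norm \<xi>)\<^sup>2) powr ((real DIM('a) + 1) / 2))"
  shows "integrable lborel (\<lambda>x. W x / (1 + x\<^sup>2))"
proof -
  have cont: "continuous_on UNIV W"
  proof (rule lipschitz_on_continuous_on)
    show "L-lipschitz_on UNIV W" using L lip by (intro lipschitz_onI) (auto simp: dist_real_def)
  qed
  have [measurable]: "W \<in> borel_measurable borel" by (rule borel_measurable_continuous_onI[OF cont])
  let ?d = "real DIM('a)"
  let ?F = "\<lambda>\<xi>::'a. W (norm \<xi>) / (1 + (norm \<xi>)\<^sup>2) powr ((?d + 1) / 2)"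
  obtain u :: 'a where u: "1 \<le> norm u" "norm u \<le> 2"
    and iu: "integrable lborel (\<lambda>r. indicator {1..} r * (r ^ (DIM('a) - 1) * ?F (r *\<^sub>R u)))"
    by (rule integrable_along_some_ray[OF int]) (simp_all add: nn)
  define \<rho> where "\<rho> = norm u"
  have \<rho>: "1 \<le> \<rho>" "\<rho> \<le> 2" using u by (simp_all add: \<rho>_def)
  define g where "g s = indicator {\<rho>..} s * (W s / (1 + s\<^sup>2))" for s :: real
  have g_nn: "g s \<ge> 0" for s unfolding g_def using nn by (simp add: indicator_def)
  have [measurable]: "g \<in> borel_measurable borel" unfolding g_def by measurable
  \<comment> \<open>For s = \<rho> r with \<rho> <= 2 and r >= 1, 1 + s^2 <= 8 r^2, and the constant
    is the power (d - 1) / 2 of this 8.\<close>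
  let ?K = "8 powr ((?d - 1) / 2)"
  have le: "g (0 + \<rho> *\<^sub>R r) \<le> ?K * (indicator {1..} r * (r ^ (DIM('a) - 1) * ?F (r *\<^sub>R u)))" for r :: real
  proof (cases "r \<ge> 1")
    case r: True
    define s where "s = \<rho> * r"
    have s: "s \<ge> 1" "s \<le> 2 * r" "norm (r *\<^sub>R u) = s"
      using r \<rho> mult_mono[of 1 \<rho> 1 r] by (auto simp: s_def \<rho>_def)
    have "s\<^sup>2 \<le> (2 * r)\<^sup>2" using s by (intro power_mono) auto
    moreover have "1\<^sup>2 \<le> r\<^sup>2" using r by (intro power_mono) auto
    ultimately have s8: "1 + s\<^sup>2 \<le> 8 * r\<^sup>2" by (simp add: power_mult_distrib)
    have p: "1 + s\<^sup>2 > 0" by (simp add: add_pos_nonneg)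
    have d: "?d \<ge> 1" using DIM_positive[where 'a='a] by linarith
    have "(1 + s\<^sup>2) powr ((?d - 1) / 2) \<le> (8 * r\<^sup>2) powr ((?d - 1) / 2)"
      using s8 p d by (intro powr_mono2) auto
    also have "\<dots> = ?K * (r\<^sup>2) powr ((?d - 1) / 2)" using r by (simp add: powr_mult)
    also have "(r\<^sup>2) powr ((?d - 1) / 2) = r powr real (DIM('a) - 1)"
      using r d by (simp add: powr_powr diff_divide_distrib of_nat_diff flip: powr_numeral)
    also have "\<dots> = r ^ (DIM('a) - 1)" using r by (intro powr_realpow) simp
    finally have key: "(1 + s\<^sup>2) powr ((?d - 1) / 2) \<le> ?K * r ^ (DIM('a) - 1)" .
    have "(1 + s\<^sup>2) powr ((?d + 1) / 2) = (1 + s\<^sup>2) powr (1 + (?d - 1) / 2)" by (simp add: field_simps)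
    also have "\<dots> = (1 + s\<^sup>2) * (1 + s\<^sup>2) powr ((?d - 1) / 2)" using p by (simp add: powr_add)
    also have "\<dots> \<le> (1 + s\<^sup>2) * (?K * r ^ (DIM('a) - 1))" using key p by (intro mult_left_mono) auto
    finally have "W s * (1 + s\<^sup>2) powr ((?d + 1) / 2) \<le> W s * ((1 + s\<^sup>2) * (?K * r ^ (DIM('a) - 1)))"
      using nn by (rule mult_left_mono)
    then have "W s / (1 + s\<^sup>2) \<le> ?K * (r ^ (DIM('a) - 1) * (W s / (1 + s\<^sup>2) powr ((?d + 1) / 2)))"
      using p by (simp add: field_simps)
    moreover have "g (0 + \<rho> *\<^sub>R r) = W s / (1 + s\<^sup>2)"
      using r \<rho> by (simp add: g_def s_def)
    ultimately show ?thesis using r unfolding s(3) by simp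
  next
    case False
    then have "\<rho> * r < \<rho>" using \<rho> by simp
    then show ?thesis using False by (simp add: g_def)
  qed
  have "integrable lborel (\<lambda>r. g (0 + \<rho> *\<^sub>R r))"
  proof (rule integrable_le_nonneg[OF _ _ g_nn le])
    show "integrable lborel (\<lambda>r. ?K * (indicator {1..} r * (r ^ (DIM('a) - 1) * ?F (r *\<^sub>R u))))"
      by (rule integrable_mult_right[OF iu])
  qed measurable
  then have "integrable lborel (\<lambda>s. g (0 + \<rho> *\<^sub>R (0 + (1 / \<rho>) *\<^sub>R s)))"
    using \<rho> by (intro lborel_integrable_affine[where f = "\<lambda>r. g (0 + \<rho> *\<^sub>R r)"]) simp_all
  then have ig: "integrable lborel g" using \<rho> by simp
  have ig': "integrable lborel (\<lambda>s. g (- s))"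
    using lborel_integrable_affine[of "-1" g 0] ig by simp
  show ?thesis
  proof (rule integrable_le_nonneg)
    show "integrable lborel (\<lambda>s. (W 0 + 2 * L) * (1 / (1 + s\<^sup>2)) + (g s + g (- s)))"
      by (intro Bochner_Integration.integrable_add integrable_mult_right integrable_weight ig ig')
    show "W s / (1 + s\<^sup>2) \<ge> 0" for s using nn by (simp add: add_nonneg_nonneg)
    show "W s / (1 + s\<^sup>2) \<le> (W 0 + 2 * L) * (1 / (1 + s\<^sup>2)) + (g s + g (- s))" for s
    proof (cases "\<bar>s\<bar> < \<rho>")
      case True
      have "W s \<le> W 0 + L * \<bar>s\<bar>" using lip[of s 0] by simp
      also have "\<dots> \<le> W 0 + L * 2" using True \<rho> L by simp
      finally have "W s / (1 + s\<^sup>2) \<le> (W 0 + 2 * L) / (1 + s\<^sup>2)"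
        by (intro divide_right_mono) (auto simp: add_nonneg_nonneg)
      then show ?thesis using g_nn[of s] g_nn[of "- s"] by simp
    next
      case False
      then have "W s / (1 + s\<^sup>2) \<le> g s + g (- s)"
        using g_nn[of s] g_nn[of "- s"] by (cases "s \<ge> \<rho>") (auto simp: g_def even indicator_def)
      moreover have "(W 0 + 2 * L) * (1 / (1 + s\<^sup>2)) \<ge> 0" using nn[of 0] L by (simp add: add_nonneg_nonneg)
      ultimately show ?thesis by linarith
    qed
  qed measurable
qed

lemma spectral_density_eq_cos_transform:
  fixes \<Phi> :: "real ^ 'n \<Rightarrow> real"
  assumes \<Phi>: "integrable lborel \<Phi>"
  shows "spectral_density \<Phi> \<xi> = (2 * pi) powr (- real CARD('n) / 2) * cos_transform \<Phi> \<xi>"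
proof -
  have [measurable]: "\<Phi> \<in> borel_measurable borel" using \<Phi> by simp
  let ?g = "\<lambda>x. complex_of_real (\<Phi> x) * exp (- \<i> * complex_of_real (x \<bullet> \<xi>))"
  have n: "norm (exp (- \<i> * complex_of_real t)) = 1" for t by (simp add: norm_exp_eq_Re)
  have i: "integrable lborel ?g"
    by (rule Bochner_Integration.integrable_bound[OF \<Phi>]) (simp_all add: norm_mult n)
  have "Re (exp (- \<i> * complex_of_real t)) = cos t" for t by (simp add: Re_exp)
  then have "Re (?g x) = \<Phi> x * cos (\<xi> \<bullet> x)" for x by (simp add: inner_commute)
  then have "Re (LINT x|lborel. ?g x) = cos_transform \<Phi> \<xi>"
    unfolding cos_transform_def by (subst integral_Re[OF i, symmetric]) presburger
  then show ?thesis unfolding spectral_density_def fourier_def by simp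
qed

text \<open>Squaring the real multiplier makes h nonnegative, so its transform is positive at 0. It
  also gives decay like exp (- 2 W), of which the condition on h^2 exp W uses only a part.\<close>

lemma compactly_supported_cos_transform:
  fixes W :: "real \<Rightarrow> real"
  assumes nn: "\<And>x. W x \<ge> 0" and even: "\<And>x. W (- x) = W x"
    and lip: "\<And>x y. \<bar>W x - W y\<bar> \<le> L * \<bar>x - y\<bar>" and L: "L > 0"
    and int: "integrable lborel (\<lambda>x. W x / (1 + x\<^sup>2))" and \<epsilon>: "\<epsilon> > 0"
  obtains h :: "'a::euclidean_space \<Rightarrow> real" and C where
    "integrable lborel h" "\<And>\<xi>. h (- \<xi>) = h \<xi>" "\<And>\<xi>. 0 \<le> h \<xi>" "continuous_on UNIV h" "h 0 > 0"
    "\<And>\<xi>. h \<xi> \<le> C" "\<And>\<xi>. (h \<xi>)\<^sup>2 * exp (W (norm \<xi>)) \<le> C * decay_weight DIM('a) \<xi>"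
    "\<And>x. norm x > \<epsilon> \<Longrightarrow> cos_transform h x = 0"
proof -
  let ?m = "DIM('a)"
  \<comment> \<open>Half of the radius, because squaring the multiplier doubles its type.\<close>
  have \<tau>: "\<epsilon> / 2 > 0" using \<epsilon> by simp
  obtain f C where f: "f holomorphic_on UNIV" and f0: "f 0 \<noteq> 0" and f_cnj: "\<And>z. f (cnj z) = cnj (f z)" and C: "C > 0"
    and growth: "\<And>z. cmod (f (z\<^sup>2)) * (1 + cmod z) ^ ?m \<le> C * exp (\<epsilon> / 2 * \<bar>Im z\<bar>)"
    and decay: "\<And>x. cmod (f (of_real (x\<^sup>2))) * (1 + \<bar>x\<bar>) ^ ?m \<le> C * exp (- W x)"
    by (rule multiplier_exists[OF nn even L lip int \<tau>, of ?m]) (rule that)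
  define q where "q x = Re (f (of_real x))" for x :: real
  have f_q: "f (of_real x) = of_real (q x)" for x :: real
  proof -
    have "cnj (f (of_real x)) = f (of_real x)" using f_cnj[of "of_real x"] by simp
    then show ?thesis unfolding q_def using Reals_cnj_iff of_real_Re by metis
  qed
  define h where "h \<xi> = (q (\<xi> \<bullet> \<xi>))\<^sup>2" for \<xi> :: 'a
  have cont: "continuous_on UNIV h"
  proof -
    have cf: "continuous_on UNIV f" by (rule holomorphic_on_imp_continuous_on[OF f])
    show ?thesis unfolding h_def q_def
      by (intro continuous_intros continuous_on_compose2[OF cf]) simp_all
  qed
  have [measurable]: "h \<in> borel_measurable borel" by (rule borel_measurable_continuous_onI[OF cont])
  have q_le: "\<bar>q (\<xi> \<bullet> \<xi>)\<bar> \<le> C * exp (- W (norm \<xi>)) / (1 + norm \<xi>) ^ ?m" for \<xi> :: 'a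
  proof -
    have "\<bar>q (\<xi> \<bullet> \<xi>)\<bar> = cmod (f (of_real ((norm \<xi>)\<^sup>2)))" unfolding power2_norm_eq_inner f_q by simp
    then show ?thesis using decay[of "norm \<xi>"] by (simp add: pos_le_divide_eq add_pos_nonneg)
  qed
  have dw: "(1 / (1 + norm \<xi>) ^ ?m)\<^sup>2 \<le> decay_weight ?m \<xi>" for \<xi> :: 'a
  proof -
    have "1 + (norm \<xi>)\<^sup>2 \<le> (1 + norm \<xi>)\<^sup>2" by (simp add: power2_eq_square algebra_simps)
    then have "(1 + (norm \<xi>)\<^sup>2) ^ ?m \<le> ((1 + norm \<xi>)\<^sup>2) ^ ?m" by (intro power_mono) auto
    then have "1 / ((1 + norm \<xi>)\<^sup>2) ^ ?m \<le> 1 / (1 + (norm \<xi>)\<^sup>2) ^ ?m"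
      by (intro divide_left_mono) (auto intro!: mult_pos_pos zero_less_power simp: add_pos_nonneg)
    then show ?thesis unfolding decay_weight_def by (simp add: power_divide power_mult[symmetric] mult.commute)
  qed
  have dw1: "decay_weight ?m \<xi> \<le> 1" for \<xi> :: 'a
    unfolding decay_weight_def by (subst divide_le_eq_1) (simp add: one_le_power add_pos_nonneg)
  have h_le: "h \<xi> \<le> C\<^sup>2 * (exp (- W (norm \<xi>)))\<^sup>2 * decay_weight ?m \<xi>" for \<xi>
  proof -
    have "h \<xi> = \<bar>q (\<xi> \<bullet> \<xi>)\<bar>\<^sup>2" by (simp add: h_def)
    also have "\<dots> \<le> (C * exp (- W (norm \<xi>)) / (1 + norm \<xi>) ^ ?m)\<^sup>2" by (rule power_mono[OF q_le]) simp
    also have "\<dots> = C\<^sup>2 * (exp (- W (norm \<xi>)))\<^sup>2 * (1 / (1 + norm \<xi>) ^ ?m)\<^sup>2" by (simp add: power_mult_distrib power_divide)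
    also have "\<dots> \<le> C\<^sup>2 * (exp (- W (norm \<xi>)))\<^sup>2 * decay_weight ?m \<xi>" by (intro mult_left_mono dw) simp
    finally show ?thesis .
  qed
  have e1: "exp (- W x) \<le> 1" for x using nn[of x] by simp
  have h_nn: "0 \<le> h \<xi>" for \<xi> by (simp add: h_def)
  have h_dw: "h \<xi> \<le> C\<^sup>2 * decay_weight ?m \<xi>" for \<xi>
  proof -
    have "C\<^sup>2 * (exp (- W (norm \<xi>)))\<^sup>2 * decay_weight ?m \<xi> \<le> C\<^sup>2 * 1 * decay_weight ?m \<xi>"
      using e1 decay_weight_pos[of ?m \<xi>] by (intro mult_right_mono mult_left_mono power_le_one) auto
    then show ?thesis using h_le[of \<xi>] by simp
  qed
  have h_b: "h \<xi> \<le> C\<^sup>2" for \<xi>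
  proof -
    have "C\<^sup>2 * decay_weight ?m \<xi> \<le> C\<^sup>2 * 1" by (intro mult_left_mono dw1) simp
    then show ?thesis using h_dw[of \<xi>] by simp
  qed
  have i: "integrable lborel h"
    by (rule integrable_le_nonneg[OF _ _ h_nn h_dw]) (simp_all add: integrable_decay_weight)
  \<comment> \<open>One factor h absorbs exp W; the other supplies the integrable weight.\<close>
  have h2: "(h \<xi>)\<^sup>2 * exp (W (norm \<xi>)) \<le> C ^ 4 * decay_weight ?m \<xi>" for \<xi>
  proof -
    let ?e = "exp (- W (norm \<xi>))" and ?d = "decay_weight ?m \<xi>"
    have d: "?d > 0" by (rule decay_weight_pos)
    have "?e\<^sup>2 \<le> ?e" using e1[of "norm \<xi>"] by (simp add: power2_eq_square)
    then have "C\<^sup>2 * ?e\<^sup>2 * ?d \<le> C\<^sup>2 * ?e * 1"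
      using dw1[of \<xi>] d by (intro mult_mono) auto
    then have a: "h \<xi> * exp (W (norm \<xi>)) \<le> C\<^sup>2 * ?e * exp (W (norm \<xi>))"
      using h_le[of \<xi>] by (intro mult_right_mono) auto
    have "(h \<xi>)\<^sup>2 * exp (W (norm \<xi>)) = h \<xi> * (h \<xi> * exp (W (norm \<xi>)))" by (simp add: power2_eq_square)
    also have "\<dots> \<le> h \<xi> * C\<^sup>2" using a h_nn by (intro mult_left_mono) (simp_all add: mult.assoc flip: exp_add)
    also have "\<dots> \<le> (C\<^sup>2 * ?d) * C\<^sup>2" by (intro mult_right_mono h_dw) simp
    finally show ?thesis by (simp add: mult_ac flip: power_add)
  qed
  have supp: "cos_transform h x = 0" if x: "norm x > \<epsilon>" for x
  proof -
    let ?G = "\<lambda>\<xi>. (f (of_real (\<xi> \<bullet> \<xi>)))\<^sup>2 * iexp (x \<bullet> \<xi>)"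
    have G: "?G \<xi> = of_real (h \<xi>) * iexp (x \<bullet> \<xi>)" for \<xi> unfolding f_q h_def by simp
    have iG: "integrable lborel ?G" unfolding G
      by (rule Bochner_Integration.integrable_bound[OF i]) (simp_all add: norm_mult)
    have "Re (?G \<xi>) = h \<xi> * cos (x \<bullet> \<xi>)" for \<xi> unfolding G by (simp add: Re_exp)
    then have "cos_transform h x = Re (LINT \<xi>|lborel. ?G \<xi>)"
      unfolding cos_transform_def by (subst integral_Re[OF iG, symmetric]) presburger
    also have "(LINT \<xi>|lborel. ?G \<xi>) = 0"
      by (rule paley_wiener[OF f growth]) (use x \<epsilon> in simp_all)
    finally show ?thesis by simp
  qed
  show ?thesis
  proof (rule that[of h "C\<^sup>2 + C ^ 4"])
    show "h 0 > 0" using f0 f_q[of 0] by (auto simp: h_def)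
    show "h \<xi> \<le> C\<^sup>2 + C ^ 4" for \<xi> using h_b[of \<xi>] C by (simp add: add_increasing2)
    show "(h \<xi>)\<^sup>2 * exp (W (norm \<xi>)) \<le> (C\<^sup>2 + C ^ 4) * decay_weight ?m \<xi>" for \<xi>
    proof -
      have "C ^ 4 * decay_weight ?m \<xi> \<le> (C\<^sup>2 + C ^ 4) * decay_weight ?m \<xi>"
        using decay_weight_pos[of ?m \<xi>] by (intro mult_right_mono) auto
      then show ?thesis using h2[of \<xi>] by linarith
    qed
    show "h (- \<xi>) = h \<xi>" for \<xi> by (simp add: h_def)
  qed (rule i h_nn cont supp; assumption?)+
qed

theorem theorem2p3:
  fixes \<Phi> :: "real ^ 'n \<Rightarrow> real"
    and H :: "(real ^ 'n \<Rightarrow> real) set"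
    and ip :: "(real ^ 'n \<Rightarrow> real) \<Rightarrow> (real ^ 'n \<Rightarrow> real) \<Rightarrow> real"
    and \<omega> :: "real ^ 'n \<Rightarrow> real"
    and c :: real
  assumes "continuous_on UNIV \<Phi>"
    and "integrable lborel \<Phi>"
    and "positive_definite \<Phi>"
    and "reproducing_kernel_Hilbert_space (\<lambda>x y. \<Phi> (x - y)) H ip"
    and "\<And>\<xi>. \<omega> \<xi> \<ge> 0"
    and "radial \<omega>"
    and "\<exists>L. L-lipschitz_on UNIV \<omega>"
    and "c > 0"
    and "\<And>\<xi>. exp (- \<omega> \<xi>) \<le> c * spectral_density \<Phi> \<xi>"
    and "integrable lborel
           (\<lambda>\<xi>. \<omega> \<xi> / (1 + (norm \<xi>)\<^sup>2) powr ((real CARD('n) + 1) / 2))"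
  shows "\<forall>x. \<forall>\<epsilon>>0. \<exists>\<psi>\<in>H. supp \<psi> \<subseteq> cball x \<epsilon> \<and> \<psi> x = 1 \<and> (LINT y|lborel. \<psi> y) \<noteq> 0"
proof (intro allI impI)
  fix x0 :: "real ^ 'n" and \<epsilon> :: real
  assume \<epsilon>: "\<epsilon> > 0"
  interpret reproducing_kernel_Hilbert_space "\<lambda>x y. \<Phi> (x - y)" H ip by (rule assms(4))
  have [measurable]: "\<Phi> \<in> borel_measurable borel" using assms(2) by simp
  obtain L where L: "L-lipschitz_on UNIV \<omega>" using assms(7) by blast
  obtain e :: "real ^ 'n" where e: "norm e = 1" using vector_choose_size[of 1] by auto
  \<comment> \<open>The profile along one line through the origin. Radiality makes it even and
    identifies W (norm \<xi>) with \<omega> \<xi>.\<close>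
  define W where "W r = \<omega> (r *\<^sub>R e)" for r
  have W_even: "W (- r) = W r" for r
    using assms(6) unfolding radial_def W_def by (metis norm_minus_cancel scaleR_minus_left)
  have W_norm: "W (norm \<xi>) = \<omega> \<xi>" for \<xi>
  proof -
    have "norm (norm \<xi> *\<^sub>R e) = norm \<xi>" by (simp add: e)
    then show ?thesis using assms(6) unfolding radial_def W_def by blast
  qed
  have L0: "L \<ge> 0" using L by (rule lipschitz_on_nonneg)
  \<comment> \<open>The constant \<open>L + 1\<close> is positive also when
    \<open>L = 0\<close>.\<close>
  have W_lip: "\<bar>W r - W s\<bar> \<le> (L + 1) * \<bar>r - s\<bar>" for r s
  proof -
    have "\<bar>W r - W s\<bar> \<le> L * norm ((r - s) *\<^sub>R e)"
      using lipschitz_onD[OF L, of "r *\<^sub>R e" "s *\<^sub>R e"] by (simp add: W_def dist_norm scaleR_left_diff_distrib)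
    also have "\<dots> \<le> (L + 1) * \<bar>r - s\<bar>" using e by (simp add: mult_right_mono)
    finally show ?thesis .
  qed
  have W_nn: "W r \<ge> 0" for r unfolding W_def by (rule assms(5))
  have W_int: "integrable lborel (\<lambda>r. W r / (1 + r\<^sup>2))"
    using assms(10) L0
    by (intro integrable_radial_profile[where 'a="real ^ 'n", OF W_nn W_even W_lip]) (simp_all add: W_norm)
  have L1: "L + 1 > 0" using L0 by simp
  obtain h :: "real ^ 'n \<Rightarrow> real" and C where h: "integrable lborel h" and h_even: "\<And>\<xi>. h (- \<xi>) = h \<xi>"
    and h_nn: "\<And>\<xi>. 0 \<le> h \<xi>" and h_cont: "continuous_on UNIV h" and h_0: "h 0 > 0" and h_le: "\<And>\<xi>. h \<xi> \<le> C"
    and h_sq: "\<And>\<xi>. (h \<xi>)\<^sup>2 * exp (W (norm \<xi>)) \<le> C * decay_weight DIM(real ^ 'n) \<xi>"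
    and h_supp: "\<And>x. norm x > \<epsilon> \<Longrightarrow> cos_transform h x = 0"
    by (rule compactly_supported_cos_transform[OF W_nn W_even W_lip L1 W_int \<epsilon>]) (rule that)
  have [measurable]: "h \<in> borel_measurable borel" using h by simp
  define \<kappa> where "\<kappa> = c * (2 * pi) powr (- real CARD('n) / 2)"
  have \<kappa>: "\<kappa> > 0" using assms(8) by (simp add: \<kappa>_def)
  have low: "exp (- \<omega> \<xi>) \<le> \<kappa> * cos_transform \<Phi> \<xi>" for \<xi>
    using assms(9)[of \<xi>] unfolding spectral_density_eq_cos_transform[OF assms(2)] by (simp add: \<kappa>_def mult.assoc)
  have pos: "cos_transform \<Phi> \<xi> > 0" for \<xi>
    using less_le_trans[OF exp_gt_zero low[of \<xi>]] \<kappa> by (simp add: zero_less_mult_iff)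
  \<comment> \<open>The lower bound on the spectral density turns division by it into multiplication
    by exp \<omega>, which the decay of h absorbs.\<close>
  have hw: "integrable lborel (\<lambda>\<xi>. (h \<xi>)\<^sup>2 / cos_transform \<Phi> \<xi>)"
  proof (rule integrable_le_nonneg)
    show "integrable lborel (\<lambda>\<xi>::real ^ 'n. \<kappa> * (C * decay_weight DIM(real ^ 'n) \<xi>))"
      by (intro integrable_mult_right integrable_decay_weight order_refl)
    show "0 \<le> (h \<xi>)\<^sup>2 / cos_transform \<Phi> \<xi>" for \<xi> using pos[of \<xi>] by simp
    show "(h \<xi>)\<^sup>2 / cos_transform \<Phi> \<xi> \<le> \<kappa> * (C * decay_weight DIM(real ^ 'n) \<xi>)" for \<xi>
    proof -
      have "1 \<le> exp (\<omega> \<xi>) * (\<kappa> * cos_transform \<Phi> \<xi>)"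
        using mult_left_mono[OF low[of \<xi>], of "exp (\<omega> \<xi>)"] by (simp flip: exp_add)
      then have "1 / cos_transform \<Phi> \<xi> \<le> \<kappa> * exp (\<omega> \<xi>)"
        using pos[of \<xi>] by (simp add: pos_divide_le_eq mult_ac)
      then have "(h \<xi>)\<^sup>2 * (1 / cos_transform \<Phi> \<xi>) \<le> (h \<xi>)\<^sup>2 * (\<kappa> * exp (\<omega> \<xi>))"
        by (rule mult_left_mono) simp
      also have "\<dots> = \<kappa> * ((h \<xi>)\<^sup>2 * exp (W (norm \<xi>)))" by (simp add: W_norm)
      also have "\<dots> \<le> \<kappa> * (C * decay_weight DIM(real ^ 'n) \<xi>)" using h_sq \<kappa> by (intro mult_left_mono) auto
      finally show ?thesis by simp
    qed
  qed measurable
  let ?\<psi> = "cos_transform h"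
  \<comment> \<open>A bounded function vanishing off a ball; its integrability is what recovering
    the value h 0 by inversion requires.\<close>
  have \<psi>_int: "integrable lborel ?\<psi>"
  proof (rule Bochner_Integration.integrable_bound)
    show "integrable lborel (\<lambda>x. indicator (cball 0 \<epsilon>) x * (LINT \<xi>|lborel. \<bar>h \<xi>\<bar>) :: real)"
      by (intro integrable_mult_left integrable_real_indicator) (simp_all add: emeasure_lborel_cball_finite[unfolded infinity_ennreal_def])
    show "AE x in lborel. norm (?\<psi> x) \<le> norm (indicator (cball 0 \<epsilon>) x * (LINT \<xi>|lborel. \<bar>h \<xi>\<bar>) :: real)"
    proof (rule AE_I2)
      fix x
      show "norm (?\<psi> x) \<le> norm (indicator (cball 0 \<epsilon>) x * (LINT \<xi>|lborel. \<bar>h \<xi>\<bar>) :: real)"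
        using abs_cos_transform_le[OF h, of x] h_supp[of x] by (cases "norm x \<le> \<epsilon>") simp_all
    qed
  qed measurable
  have \<psi>_0: "?\<psi> 0 > 0"
  proof -
    have eq: "?\<psi> 0 = (LINT \<xi>|lborel. h \<xi>)" by (simp add: cos_transform_def)
    have "(LINT \<xi>|lborel. h \<xi>) \<noteq> 0"
    proof
      assume "(LINT \<xi>|lborel. h \<xi>) = 0"
      then have "AE \<xi> in lborel. h \<xi> = 0" using integral_nonneg_eq_0_iff_AE[OF h] h_nn by simp
      then have "AE \<xi> in lebesgue. \<xi> \<notin> {\<xi>. h \<xi> \<noteq> 0}" by (intro AE_completion) simp
      then have "negligible {\<xi>. h \<xi> \<noteq> 0}" by (simp add: negligible_iff_null_sets AE_iff_null_sets)
      moreover have "open {\<xi>. h \<xi> \<noteq> 0}" by (intro open_Collect_neq h_cont continuous_intros)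
      ultimately show False using h_0 open_not_negligible[of "{\<xi>. h \<xi> \<noteq> 0}"] by force
    qed
    moreover have "(LINT \<xi>|lborel. h \<xi>) \<ge> 0" using h_nn by simp
    ultimately show ?thesis unfolding eq by simp
  qed
  have \<psi>_integral: "(LINT x|lborel. ?\<psi> x) > 0"
  proof -
    have "\<bar>h \<xi>\<bar> \<le> C" for \<xi> using h_nn[of \<xi>] h_le[of \<xi>] by simp
    moreover have "isCont h 0" using h_cont by (simp add: continuous_on_eq_continuous_at)
    ultimately have "(LINT x|lborel. ?\<psi> x) = (2 * pi) ^ DIM(real ^ 'n) * h 0"
      using integral_cos_transform[OF h h_even _ _ \<psi>_int] by blast
    then show ?thesis using h_0 by simp
  qed
  define \<psi> where "\<psi> x = 1 / ?\<psi> 0 * ?\<psi> (x - x0)" for x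
  define D where "D = (LINT \<xi>|lborel. (h \<xi>)\<^sup>2 / cos_transform \<Phi> \<xi>) + 1"
  have D: "D > 0"
  proof -
    have "(LINT \<xi>|lborel. (h \<xi>)\<^sup>2 / cos_transform \<Phi> \<xi>) \<ge> 0"
      using pos by (intro integral_nonneg_AE AE_I2) (simp add: less_imp_le)
    then show ?thesis by (simp add: D_def)
  qed
  have "(\<lambda>x. ?\<psi> (x - x0)) \<in> H"
  proof (rule mem_if_bounded)
    show "D * (2 * pi) ^ DIM(real ^ 'n) > 0" using D by simp
    fix S :: "(real ^ 'n) set" and a :: "real ^ 'n \<Rightarrow> real" assume S: "finite S"
    have cont: "isCont \<Phi> x" for x using assms(1) by (simp add: continuous_on_eq_continuous_at)
    show "(\<Sum>x\<in>S. a x * ?\<psi> (x - x0))\<^sup>2 \<le> D * (2 * pi) ^ DIM(real ^ 'n) * (\<Sum>x\<in>S. \<Sum>y\<in>S. a x * a y * \<Phi> (x - y))"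
      using cos_transform_bound[OF assms(2) positive_definite_even[OF assms(3)]
          positive_definite_bounded[OF assms(3)] cont pos h hw S, of a x0]
      unfolding D_def mult.assoc .
  qed
  then have "\<psi> \<in> H" unfolding \<psi>_def by (rule scale_mem)
  moreover have "supp \<psi> \<subseteq> cball x0 \<epsilon>" unfolding supp_def
  proof (rule closure_minimal)
    show "{x. \<psi> x \<noteq> 0} \<subseteq> cball x0 \<epsilon>"
    proof
      fix x assume "x \<in> {x. \<psi> x \<noteq> 0}"
      then have "\<not> norm (x - x0) > \<epsilon>" using h_supp[of "x - x0"] by (auto simp: \<psi>_def)
      then show "x \<in> cball x0 \<epsilon>" by (simp add: dist_norm norm_minus_commute)
    qed
  qed simp
  moreover have "\<psi> x0 = 1" using \<psi>_0 by (simp add: \<psi>_def)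
  moreover have "(LINT y|lborel. \<psi> y) \<noteq> 0"
  proof -
    have "(LINT y|lborel. ?\<psi> y) = (LINT y|lborel. ?\<psi> (y - x0))"
      using lborel_integral_affine[of 1 ?\<psi> "- x0"] by simp
    then show ?thesis using \<psi>_integral \<psi>_0 unfolding \<psi>_def by simp
  qed
  ultimately show "\<exists>\<psi>\<in>H. supp \<psi> \<subseteq> cball x0 \<epsilon> \<and> \<psi> x0 = 1 \<and> (LINT y|lborel. \<psi> y) \<noteq> 0" by blast
qed

end
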